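(* Let $\rho_0:\Gamma\to\mathrm{GL}_2(\mathbb{C})$ be irreducible with generating weights $k_1\le k_2$ in $\{0,\ldots,11\}$. Let $\rho:\Gamma\to\mathrm{GL}_3(\mathbb{C})$ be an indecomposable representation with $\rho(T)$ diagonalizable, fitting in an exact sequence $0\to\rho_0\to\rho\to\chi^{2a}\to0$ with $a\in\{0,\ldots,5\}$. (i) If $(k_1,k_2)\neq(8,10)$, or if $(k_1,k_2)=(8,10)$ and $a=3$, then $\rho$ is $M$-split. (ii) If $(k_1,k_2)=(8,10)$ and $a=0$, then $\rho$ is not $M$-split and its generating weights are $(4,6,8)$.
   Context: $\Gamma=\mathrm{PSL}_2(\mathbb{Z})$; representations of $\Gamma$ are viewed as representations of $\mathrm{SL}_2(\mathbb{Z})$ trivial on $-I$. $T$ is the image of $\begin{pmatrix}1&1\\0&1\end{pmatrix}$. For $m\in\{0,\ldots,11\}$, $\chi^m$ is the character with $\chi^m(T)=e^{2\pi im/12}$. For a finite-dimensional representation $\rho$ on $V$, let $L$ be the unique endomorphism with $e^{2\pi iL}=\rho(T)$ whose eigenvalues have real parts in $[0,1)$; a holomorphic vector-valued modular form of weight $k$ for $\rho$ is a holomorphic $F:\mathbb{H}\to V$ with $F(\gamma\tau)=(c\tau+d)^k\rho(\gamma)F(\tau)$ for all $\gamma\in\mathrm{SL}_2(\mathbb{Z})$ and $e^{-2\pi i\tau L}F(\tau)$ holomorphic at $q=e^{2\pi i\tau}=0$. $M(\rho)=\bigoplus_kM_k(\rho)$ is free of rank $\dim\rho$ over $R=\mathbb{C}[E_4,E_6]$,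 and the generating weights are the weights of a homogeneous $R$-basis. For an exact sequence $0\to\rho_0\to\rho\to\rho_1\to0$, $\rho$ is $M$-split if the induced map $M(\rho)\to M(\rho_1)$ is surjective. *)

theory Defs
  imports "HOL-Analysis.Analysis"
begin

abbreviation upper_half_plane :: "complex set" ("\<H>") where
  "\<H> \<equiv> {\<tau>. Im \<tau> > 0}"

definition SL2Z :: "(int^2^2) set" where
  "SL2Z = {g. det g = 1}"

definition T_mat :: "int^2^2" where
  "T_mat = vector [vector [1, 1], vector [0, 1]]"

definition aut_factor :: "int^2^2 \<Rightarrow> complex \<Rightarrow> complex" where
  "aut_factor g \<tau> = of_int (g$2$1) * \<tau> + of_int (g$2$2)"

definition moebius_act :: "int^2^2 \<Rightarrow> complex \<Rightarrow> complex" where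
  "moebius_act g \<tau> = (of_int (g$1$1) * \<tau> + of_int (g$1$2)) / aut_factor g \<tau>"


subsection \<open>Representations\<close>

text \<open>A representation on the column space \<open>complex^'n\<close> is a matrix-valued function of which
  only the values on \<open>SL2Z\<close> matter. Those values are automatically invertible.\<close>

definition sl2_rep :: "(int^2^2 \<Rightarrow> complex^'n^'n) \<Rightarrow> bool" where
  "sl2_rep \<rho> \<longleftrightarrow> \<rho> (mat 1) = mat 1 \<and> (\<forall>g\<in>SL2Z. \<forall>h\<in>SL2Z. \<rho> (g ** h) = \<rho> g ** \<rho> h)"

definition psl2_rep :: "(int^2^2 \<Rightarrow> complex^'n^'n) \<Rightarrow> bool" where
  "psl2_rep \<rho> \<longleftrightarrow> sl2_rep \<rho> \<and> \<rho> (- mat 1) = mat 1"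

text \<open>Since \<open>T_mat\<close> generates the abelianization of \<open>SL2Z\<close>, which is cyclic of order 12,
  the following predicate determines \<open>\<rho>\<close> on \<open>SL2Z\<close>.\<close>

definition is_chi_power :: "nat \<Rightarrow> (int^2^2 \<Rightarrow> complex^1^1) \<Rightarrow> bool" where
  "is_chi_power m \<rho> \<longleftrightarrow>
     sl2_rep \<rho> \<and> \<rho> T_mat = mat (exp (2 * of_real pi * \<i> * of_nat m / 12))"

text \<open>\<open>vec.subspace\<close> is the notion of complex subspace; the plain \<open>subspace\<close> would be a real one.\<close>

definition subrep :: "(int^2^2 \<Rightarrow> complex^'n^'n) \<Rightarrow> (complex^'n) set \<Rightarrow> bool" where
  "subrep \<rho> W \<longleftrightarrow> vec.subspace W \<and> (\<forall>g\<in>SL2Z. \<forall>v\<in>W. \<rho> g *v v \<in> W)"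

definition irreducible_rep :: "(int^2^2 \<Rightarrow> complex^'n^'n) \<Rightarrow> bool" where
  "irreducible_rep \<rho> \<longleftrightarrow> (\<forall>W. subrep \<rho> W \<longrightarrow> W = {0} \<or> W = UNIV)"

definition indecomposable_rep :: "(int^2^2 \<Rightarrow> complex^'n^'n) \<Rightarrow> bool" where
  "indecomposable_rep \<rho> \<longleftrightarrow>
     \<not> (\<exists>U W. subrep \<rho> U \<and> subrep \<rho> W \<and> U \<noteq> {0} \<and> W \<noteq> {0} \<and>
            U \<inter> W = {0} \<and> {u + w | u w. u \<in> U \<and> w \<in> W} = UNIV)"

definition diagonalizable_matrix :: "complex^'n^'n \<Rightarrow> bool" where
  "diagonalizable_matrix A \<longleftrightarrow>
     (\<exists>P D :: complex^'n^'n. invertible P \<and> (\<forall>i j. i \<noteq> j \<longrightarrow> D$i$j = 0) \<and> A = P ** D ** matrix_inv P)"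

definition intertwines ::
    "complex^'n^'m \<Rightarrow> (int^2^2 \<Rightarrow> complex^'n^'n) \<Rightarrow> (int^2^2 \<Rightarrow> complex^'m^'m) \<Rightarrow> bool" where
  "intertwines f \<rho> \<sigma> \<longleftrightarrow> (\<forall>g\<in>SL2Z. f ** \<rho> g = \<sigma> g ** f)"

definition short_exact_reps ::
    "(int^2^2 \<Rightarrow> complex^'l^'l) \<Rightarrow> complex^'l^'n \<Rightarrow> (int^2^2 \<Rightarrow> complex^'n^'n) \<Rightarrow>
     complex^'n^'m \<Rightarrow> (int^2^2 \<Rightarrow> complex^'m^'m) \<Rightarrow> bool" where
  "short_exact_reps \<rho>\<^sub>0 \<iota> \<rho> p \<rho>\<^sub>1 \<longleftrightarrow>
     intertwines \<iota> \<rho>\<^sub>0 \<rho> \<and> intertwines p \<rho> \<rho>\<^sub>1 \<and>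
     inj ((*v) \<iota>) \<and> range ((*v) \<iota>) = {v. p *v v = 0} \<and> surj ((*v) p)"


subsection \<open>Exponents\<close>

text \<open>The class-based \<open>exp\<close> does not apply to matrices: the type \<open>complex^'n^'n\<close> carries the
  componentwise product. Below, \<open>mat c ** A\<close> is the scalar multiple of \<open>A\<close> by \<open>c\<close>.\<close>

definition matrix_exp :: "complex^'n^'n \<Rightarrow> complex^'n^'n" where
  "matrix_exp A = (\<Sum>n. (((**) A) ^^ n) (mat 1) /\<^sub>R fact n)"

definition is_exponent_matrix ::
    "(int^2^2 \<Rightarrow> complex^'n^'n) \<Rightarrow> complex^'n^'n \<Rightarrow> bool" where
  "is_exponent_matrix \<rho> L \<longleftrightarrow>
     matrix_exp (mat (2 * of_real pi * \<i>) ** L) = \<rho> T_mat \<and>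
     (\<forall>c v. v \<noteq> 0 \<and> L *v v = c *s v \<longrightarrow> 0 \<le> Re c \<and> Re c < 1)"

definition exponent_matrix :: "(int^2^2 \<Rightarrow> complex^'n^'n) \<Rightarrow> complex^'n^'n" where
  "exponent_matrix \<rho> = (THE L. is_exponent_matrix \<rho> L)"


subsection \<open>Vector-valued modular forms\<close>

text \<open>Functions on the upper half plane are represented by functions on \<open>complex\<close> vanishing
  outside it, so that equality of forms is equality of functions. In the last clause \<open>G\<close> is
  the function of \<open>q = exp (2\<pi>\<i>\<tau>)\<close> through which the periodic function on the left factors;
  its value at 0 is not constrained by the equation.\<close>

definition modular_forms ::
    "(int^2^2 \<Rightarrow> complex^'n^'n) \<Rightarrow> int \<Rightarrow> (complex \<Rightarrow> complex^'n) set" where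
  "modular_forms \<rho> k = {F.
     (\<forall>\<tau>. \<tau> \<notin> \<H> \<longrightarrow> F \<tau> = 0) \<and>
     (\<forall>j. (\<lambda>\<tau>. F \<tau> $ j) holomorphic_on \<H>) \<and>
     (\<forall>g\<in>SL2Z. \<forall>\<tau>\<in>\<H>. F (moebius_act g \<tau>) = (aut_factor g \<tau> powi k) *s (\<rho> g *v F \<tau>)) \<and>
     (\<exists>G. (\<forall>j. (\<lambda>q. G q $ j) analytic_on {0}) \<and>
          (\<forall>\<tau>\<in>\<H>. matrix_exp (mat (- 2 * of_real pi * \<i> * \<tau>) ** exponent_matrix \<rho>) *v F \<tau>
                  = G (exp (2 * of_real pi * \<i> * \<tau>))))}"

text \<open>The sum of all \<open>modular_forms \<rho> k\<close> inside the space of functions. It is a direct sum,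
  because nonzero forms of pairwise distinct weights are linearly independent.\<close>

definition modular_form_module ::
    "(int^2^2 \<Rightarrow> complex^'n^'n) \<Rightarrow> (complex \<Rightarrow> complex^'n) set" where
  "modular_form_module \<rho> =
     {\<lambda>\<tau>. \<Sum>k\<in>K. F k \<tau> | K F. finite K \<and> (\<forall>k\<in>K. F k \<in> modular_forms \<rho> k)}"

text \<open>The normalized Eisenstein series with constant term 1, for even \<open>k \<ge> 4\<close>.\<close>

definition eisenstein :: "nat \<Rightarrow> complex \<Rightarrow> complex" where
  "eisenstein k \<tau> =
     (if \<tau> \<in> \<H>
      then (\<Sum>\<^sub>\<infinity>(c, d) \<in> {(c, d). coprime c d}. 1 / (of_int c * \<tau> + of_int d) ^ k) / 2
      else 0)"

text \<open>The ring generated over the constants by \<open>eisenstein 4\<close> and \<open>eisenstein 6\<close>.\<close>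

inductive_set eisenstein_ring :: "(complex \<Rightarrow> complex) set" where
  const: "(\<lambda>\<tau>. if \<tau> \<in> \<H> then c else 0) \<in> eisenstein_ring"
| E4: "eisenstein 4 \<in> eisenstein_ring"
| E6: "eisenstein 6 \<in> eisenstein_ring"
| add: "f \<in> eisenstein_ring \<Longrightarrow> g \<in> eisenstein_ring \<Longrightarrow> (\<lambda>\<tau>. f \<tau> + g \<tau>) \<in> eisenstein_ring"
| mult: "f \<in> eisenstein_ring \<Longrightarrow> g \<in> eisenstein_ring \<Longrightarrow> (\<lambda>\<tau>. f \<tau> * g \<tau>) \<in> eisenstein_ring"

text \<open>\<open>has_generating_weights \<rho> ks\<close>: the module has a basis \<open>B 0, B 1, \<dots>\<close> over
  \<open>eisenstein_ring\<close> with \<open>B i\<close> homogeneous of weight \<open>ks ! i\<close>. The order of the list is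
  immaterial.\<close>

definition has_generating_weights :: "(int^2^2 \<Rightarrow> complex^'n^'n) \<Rightarrow> int list \<Rightarrow> bool" where
  "has_generating_weights \<rho> ks \<longleftrightarrow>
     (\<exists>B. (\<forall>i<length ks. B i \<in> modular_forms \<rho> (ks ! i)) \<and>
          (\<forall>F\<in>modular_form_module \<rho>.
             \<exists>!f. f \<in> {..<length ks} \<rightarrow>\<^sub>E eisenstein_ring \<and>
                  F = (\<lambda>\<tau>. \<Sum>i<length ks. f i \<tau> *s B i \<tau>)))"

text \<open>\<open>M\<close>-splitness of an extension of \<open>\<rho>\<^sub>1\<close> with total space \<open>\<rho>\<close> and projection \<open>p\<close>.\<close>

definition M_split ::
    "(int^2^2 \<Rightarrow> complex^'n^'n) \<Rightarrow> complex^'n^'m \<Rightarrow> (int^2^2 \<Rightarrow> complex^'m^'m) \<Rightarrow> bool" where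
  "M_split \<rho> p \<rho>\<^sub>1 \<longleftrightarrow>
     (\<lambda>F \<tau>. p *v F \<tau>) ` modular_form_module \<rho> = modular_form_module \<rho>\<^sub>1"

end

theory Submission
  imports Defs "HOL-Complex_Analysis.Complex_Analysis"
begin

text \<open>Write \<open>\<eta>\<^sup>4\<close> for the fourth power of Dedekind's function, a form of weight 2 for \<open>\<chi>\<^sup>2\<close>; forms
  for \<open>\<chi>\<^sup>2\<^sup>a\<close> are the multiples of \<open>\<eta>\<^sup>4\<^sup>a\<close> by scalar forms, so the extension is \<open>M\<close>-split as soon as
  \<open>\<eta>\<^sup>4\<^sup>a\<close> lifts. Serre's derivative of a form is again a form, and this forces the weights of \<open>\<rho>\<^sub>0\<close> to be
  \<open>(2m, 2m + 2)\<close>; the Wronskian of the generators and the cocycle of the extension both compute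
  \<open>det (\<rho>\<^sub>0 T)\<close>, so \<open>m = a + 1 + 3n\<close> for an integer \<open>n\<close>. A form \<open>H\<close> of weight \<open>2N + 2\<close> for \<open>\<rho>\<^sub>0\<close>, with \<open>N\<close>
  congruent to \<open>a\<close> modulo 6, has an Eichler integral, the primitive of \<open>H / \<eta>\<^sup>4\<^sup>N\<close>, whose period cocycle
  is a multiple of the cocycle of the extension, as the first cohomology has dimension at most 1.
  Unless \<open>H\<close> is a Serre derivative the multiple is nonzero, and the integral yields a lift of \<open>\<eta>\<^sup>4\<^sup>N\<close>.
  For \<open>n = 0, -1, -2\<close> a suitable \<open>H\<close> of weight \<open>2a + 2\<close> exists; \<open>n = 1\<close> is the exceptional case \<open>(8, 10)\<close>, \<open>a = 0\<close>.
  There the constant 1 does not lift, but the discriminant does, and dividing combinations of its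
  lift with the forms of \<open>\<rho>\<^sub>0\<close> by the discriminant yields the generators of weights 4 and 6.\<close>

text \<open>Nothing about modular forms is presupposed, so a discriminant without zeros has to be
  produced: \<open>eta4\<close> is the exponential of a primitive of the weight 2 Eisenstein series,
  whose inversion law must be extracted from a conditionally convergent sum. In place of a valence
  formula, dimension counts use that forms of weight 0 are constant, that forms of weight 2 vanish,
  and that a form vanishing at the cusp is divisible by the discriminant. The absence of forms of
  weight 2 recurs: it yields the weights (2m, 2m + 2), it restricts Serre primitives, and for (8,
  10) it prevents cancelling the lift of the discriminant at the cusp in weight 12. The cusp
  condition is weakened to linear growth in a strip, since a power of \<open>eta4\<close> times an
  Eichler integral is only seen to be O(1 + Im \<tau>); exponents with real part below 1 let the
  removable singularity theorem absorb this factor. Twisting by the inverse character turns the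
  extension into a class in the cohomology of the free product of groups of orders 2 and 3, where
  linear algebra on a plane decides.\<close>

lemmas mv_add = matrix_vector_right_distrib
lemmas mv_diff = matrix_vector_mult_diff_distrib
lemmas mv_assoc = matrix_vector_mul_assoc

abbreviation q_exp :: "complex \<Rightarrow> complex" where
  "q_exp \<tau> \<equiv> exp (2 * of_real pi * \<i> * \<tau>)"

abbreviation q_pow :: "complex \<Rightarrow> complex \<Rightarrow> complex" where
  "q_pow l \<tau> \<equiv> exp (2 * of_real pi * \<i> * l * \<tau>)"

subsection \<open>Lattice sums\<close>

text \<open>The imaginary part of m \<tau> + n bounds m, and then the real part bounds n. The
  constant depends only on the half strip, as locally uniform convergence of lattice sums
  requires.\<close>

lemma norm_lattice_lower_bound:
  fixes m n :: int and \<tau> :: complex and B \<epsilon> :: real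
  assumes "\<bar>Re \<tau>\<bar> \<le> B" "\<epsilon> \<le> Im \<tau>" "0 < \<epsilon>"
  shows "of_int (m^2 + n^2) \<le> (2 + (2 * B^2 + 1) / \<epsilon>^2) * (norm (of_int m * \<tau> + of_int n))^2"
proof -
  define s where "s = (norm (of_int m * \<tau> + of_int n))^2"
  let ?x = "Re \<tau>" and ?y = "Im \<tau>"
  define M N where "M = real_of_int m" and "N = real_of_int n"
  have s: "s = (M * ?x + N)^2 + (M * ?y)^2"
    by (simp add: s_def cmod_power2 M_def N_def)
  have y: "\<epsilon>^2 \<le> ?y^2" using assms by (intro power_mono) auto
  have x: "?x^2 \<le> B^2" using assms by (metis abs_ge_zero power2_abs power_mono)
  have "M^2 * \<epsilon>^2 \<le> (M * ?y)^2"
    using y by (simp add: power_mult_distrib mult_left_mono)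
  also have "\<dots> \<le> s" unfolding s by simp
  finally have M: "M^2 \<le> s / \<epsilon>^2" using assms by (simp add: field_simps)
  \<comment> \<open>The difference of the two sides is the square (2 M x + N)^2.\<close>
  have "N^2 \<le> 2 * (M * ?x + N)^2 + 2 * (M * ?x)^2"
    using sum_squares_ge_zero[of "2 * M * ?x + N" 0] by (simp add: power2_eq_square algebra_simps)
  also have "(M * ?x)^2 \<le> M^2 * B^2" using x by (simp add: power_mult_distrib mult_left_mono)
  also have "M^2 * B^2 \<le> s / \<epsilon>^2 * B^2" using M by (intro mult_right_mono) auto
  also have "(M * ?x + N)^2 \<le> s" unfolding s by simp
  finally have "N^2 \<le> 2 * s + 2 * (s / \<epsilon>^2 * B^2)" by simp
  with M have "M^2 + N^2 \<le> s / \<epsilon>^2 + (2 * s + 2 * (s / \<epsilon>^2 * B^2))" by simp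
  also have "\<dots> = (2 + (2 * B^2 + 1) / \<epsilon>^2) * s" by (simp add: field_simps add_divide_distrib)
  finally show ?thesis by (simp add: s_def M_def N_def)
qed

lemma sum_int_square_ge_1:
  fixes m n :: int assumes "(m, n) \<noteq> (0, 0)" shows "1 \<le> m^2 + n^2"
  using assms by (metis add_nonneg_eq_0_iff int_one_le_iff_zero_less linorder_not_le
      order_antisym_conv prod.inject sum_power2_ge_zero sum_power2_le_zero_iff)

lemma sum_real_int_square_ge_1:
  fixes m n :: int assumes "(m, n) \<noteq> (0, 0)"
  shows "1 \<le> (real_of_int m)^2 + (real_of_int n)^2"
proof -
  have "real_of_int 1 \<le> real_of_int (m^2 + n^2)"
    using sum_int_square_ge_1[OF assms] by (simp only: of_int_le_iff)
  thus ?thesis by simp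
qed

text \<open>Terms of cubic decay are at most a multiple of (m^2 + n^2) powr (-3/2). Splitting the
  exponent evenly over the two indices gives a product of two series with terms of order |n| powr
  (-3/2), each convergent.\<close>

definition majorant :: "int \<times> int \<Rightarrow> real" where
  "majorant = (\<lambda>(m, n). (1 + of_int (m^2)) powr (-3/4) * (1 + of_int (n^2)) powr (-3/4))"

lemma summable_on_int_from_nat:
  fixes f :: "int \<Rightarrow> real"
  assumes "\<And>n. f (-n) = f n" "\<And>n. 0 \<le> f n" "summable (\<lambda>n. f (int n))"
  shows "f summable_on UNIV"
proof -
  have nat: "(\<lambda>n. f (int n)) summable_on UNIV"
    using assms by (subst summable_on_UNIV_nonneg_real_iff) auto
  have 1: "f summable_on range int"
    using nat by (subst summable_on_reindex) (auto simp: o_def)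
  have 2: "f summable_on range (\<lambda>n. - int n)"
    using nat assms(1) by (subst summable_on_reindex) (auto simp: o_def inj_on_def)
  have "f summable_on (range int \<union> range (\<lambda>n. - int n))"
    using 1 2 by (rule summable_on_union)
  also have "range int \<union> range (\<lambda>n. - int n) = UNIV"
    by (metis (no_types, lifting) UNIV_eq_I UnCI int_cases2 rangeI)
  finally show ?thesis .
qed

lemma summable_on_majorant: "majorant summable_on UNIV"
proof -
  define f where "f = (\<lambda>n::int. (1 + real_of_int (n^2)) powr (-3/4))"
  have "summable (\<lambda>n. f (int n))"
  proof (rule summable_comparison_test')
    show "summable (\<lambda>n. real n powr (-3/2))" by (subst summable_real_powr_iff) auto
    show "norm (f (int n)) \<le> real n powr (-3/2)" if "1 \<le> n" for n
    proof -
      have "norm (f (int n)) = (1 + (real n)^2) powr (-3/4)" by (simp add: f_def)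
      also have "\<dots> \<le> ((real n)^2) powr (-3/4)" using that by (intro powr_mono2') auto
      also have "\<dots> = real n powr (-3/2)"
        using that by (simp add: powr_powr flip: powr_numeral)
      finally show ?thesis .
    qed
  qed
  hence f: "f summable_on UNIV"
    by (intro summable_on_int_from_nat) (auto simp: f_def)
  have eq: "majorant = (\<lambda>(m,n). f m * f n)"
    by (simp add: majorant_def f_def fun_eq_iff)
  have "(\<lambda>(m,n). f m * f n) summable_on (UNIV \<times> UNIV)"
  proof (rule summable_on_SigmaI[where g = "\<lambda>m. f m * infsum f UNIV"])
    show "((\<lambda>y. case (x, y) of (m, n) \<Rightarrow> f m * f n) has_sum f x * infsum f UNIV) UNIV" for x
      using f by (auto intro!: has_sum_cmult_right)
    show "(\<lambda>m. f m * infsum f UNIV) summable_on UNIV"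
      using f by (rule summable_on_cmult_left)
  qed (auto simp: f_def)
  thus ?thesis by (simp add: eq)
qed

lemma majorant_bound:
  assumes "(m, n) \<noteq> (0, 0)" "0 < K" "K * of_int (m^2 + n^2) \<le> s"
  shows "s powr (-3/2) \<le> (4/9 * K^2) powr (-3/4) * majorant (m, n)"
proof -
  define M N where "M = real_of_int (m^2)" and "N = real_of_int (n^2)"
  have MN: "0 \<le> M" "0 \<le> N" "1 \<le> M + N"
    using sum_int_square_ge_1[OF assms(1)] unfolding M_def N_def
    by (auto simp del: of_int_power simp flip: of_int_add)
  \<comment> \<open>With t = M + N \<ge> 1 the product is 1 + t + M N, and 1 \<le> t^2, t \<le> t^2,
    M N \<le> t^2 / 4.\<close>
  have "(1 + M) * (1 + N) \<le> 9/4 * (M + N)^2"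
  proof -
    have "(M + N) * 1 \<le> (M + N) * (M + N)" using MN by (intro mult_left_mono) auto
    moreover have "1 * 1 \<le> (M + N) * (M + N)" using MN by (intro mult_mono) auto
    moreover have "4 * (M * N) \<le> (M + N) * (M + N)"
      using sum_squares_ge_zero[of "M - N" 0] by (simp add: algebra_simps)
    ultimately show ?thesis by (simp add: power2_eq_square algebra_simps)
  qed
  hence "4/9 * K^2 * ((1 + M) * (1 + N)) \<le> 4/9 * K^2 * (9/4 * (M + N)^2)"
    using assms by (intro mult_left_mono) auto
  also have "\<dots> = (K * (M + N))^2" by (simp add: power2_eq_square algebra_simps)
  also have "\<dots> \<le> s^2" using assms MN by (intro power_mono) (auto simp: M_def N_def)
  finally have le: "4/9 * K^2 * ((1 + M) * (1 + N)) \<le> s^2" .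
  have "0 < K * (M + N)" using MN assms by simp
  hence s: "0 < s" using assms by (simp add: M_def N_def)
  have "s powr (-3/2) = (s^2) powr (-3/4)" using s by (simp add: powr_powr flip: powr_numeral)
  also have "\<dots> \<le> (4/9 * K^2 * ((1 + M) * (1 + N))) powr (-3/4)"
    using le assms MN by (intro powr_mono2') auto
  also have "\<dots> = (4/9 * K^2) powr (-3/4) * majorant (m, n)"
  proof -
    have "majorant (m, n) = (1 + M) powr (-3/4) * (1 + N) powr (-3/4)"
      by (simp add: majorant_def M_def N_def)
    thus ?thesis using MN assms by (simp only: powr_mult)
  qed
  finally show ?thesis .
qed

text \<open>The summand of the weight 2 Eisenstein series, with the telescoping correction that makes
  the double series absolutely convergent. The junk value \<open>1 / 0 = 0\<close> takes care of the indices
  \<open>(0, 0)\<close> and \<open>(0, 1)\<close>.\<close>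

definition G2_term :: "complex \<Rightarrow> int \<times> int \<Rightarrow> complex" where
  "G2_term \<tau> = (\<lambda>(m, n). 1 / (of_int m * \<tau> + of_int n)^2 -
     (1 / (of_int m * \<tau> + of_int (n - 1)) - 1 / (of_int m * \<tau> + of_int n)))"

definition G2 :: "complex \<Rightarrow> complex" where
  "G2 \<tau> = (\<Sum>\<^sub>\<infinity>x\<in>UNIV. G2_term \<tau> x)"

lemma lattice_nonzero:
  assumes "0 < Im \<tau>" "(m, n) \<noteq> (0, 0)"
  shows "of_int m * \<tau> + of_int n \<noteq> 0"
  using assms by (auto simp: complex_eq_iff)

text \<open>With z = m \<tau> + n the corrected term is -1 / (z^2 (z - 1)), which decays cubically.
  The two excluded indices are those where z or z - 1 is zero.\<close>

lemma norm_G2_term_le: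
  assumes "\<And>m n. K * of_int (m^2 + n^2) \<le> (norm (of_int m * \<tau> + of_int n :: complex))^2"
    and K: "0 < K" and \<tau>: "0 < Im \<tau>" and mn: "(m, n) \<noteq> (0, 0)" "(m, n) \<noteq> (0, 1)"
  shows "norm (G2_term \<tau> (m, n)) \<le> 2 * (4/9 * K^2) powr (-3/4) * majorant (m, n)"
proof -
  let ?z = "of_int m * \<tau> + of_int n :: complex"
  let ?w = "of_int m * \<tau> + of_int (n - 1) :: complex"
  define M N where "M = real_of_int (m^2)" and "N = real_of_int (n^2)"
  have z: "?z \<noteq> 0" using lattice_nonzero[OF \<tau> mn(1)] .
  have w: "?w \<noteq> 0" using lattice_nonzero[OF \<tau>, of m "n - 1"] mn by auto
  \<comment> \<open>This lets a single quantity \<open>s\<close> bound both |z|^2 and 4 |z - 1|^2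
    from below.\<close>
  have *: "m^2 + n^2 \<le> 4 * (m^2 + (n - 1)^2)"
  proof -
    define k where "k = (n - 1)^2"
    have "1 \<le> m^2 + k" using sum_int_square_ge_1[of m "n - 1"] mn by (auto simp: k_def)
    moreover have "n^2 \<le> 2 * k + 2"
      using sum_squares_ge_zero[of "n - 2" 0] by (simp add: power2_eq_square algebra_simps k_def)
    moreover have "0 \<le> m^2" by simp
    moreover have "a + b \<le> 4 * (a + c)" if "1 \<le> a + c" "b \<le> 2 * c + 2" "0 \<le> a" for a b c :: int
      using that by presburger
    ultimately show ?thesis unfolding k_def by blast
  qed
  define s where "s = K * of_int (m^2 + n^2)"
  have s: "0 < s" using K sum_real_int_square_ge_1[OF mn(1)] unfolding s_def
    by (intro mult_pos_pos) auto
  have "s \<le> (norm ?z)^2" using assms(1)[of m n] by (simp add: s_def)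
  hence 1: "s powr (1/2) \<le> norm ?z"
    using s real_le_lsqrt by (simp add: powr_half_sqrt)
  have "s \<le> 4 * (K * of_int (m^2 + (n - 1)^2))"
  proof -
    have "real_of_int (m^2 + n^2) \<le> real_of_int (4 * (m^2 + (n - 1)^2))"
      using * by (simp only: of_int_le_iff)
    from mult_left_mono[OF this, of K] show ?thesis using K by (simp add: s_def algebra_simps)
  qed
  also have "\<dots> \<le> 4 * (norm ?w)^2" using assms(1)[of m "n - 1"] by simp
  also have "\<dots> = (2 * norm ?w)^2" by (simp add: power_mult_distrib)
  finally have 2: "s powr (1/2) \<le> 2 * norm ?w"
    using s real_le_lsqrt by (simp add: powr_half_sqrt)
  have "G2_term \<tau> (m, n) = - 1 / (?z^2 * ?w)"
  proof -
    have "?w = ?z - 1" by simp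
    thus ?thesis using z w unfolding G2_term_def by (simp add: divide_simps power2_eq_square)
  qed
  hence "norm (G2_term \<tau> (m, n)) = 2 / (norm ?z * norm ?z * (2 * norm ?w))"
    by (simp add: norm_divide norm_mult power2_eq_square)
  also have "\<dots> \<le> 2 / (s powr (1/2) * s powr (1/2) * s powr (1/2))"
    using s 1 2 z w by (intro divide_left_mono mult_mono mult_pos_pos) auto
  also have "\<dots> = 2 * s powr (-3/2)"
  proof -
    have "s powr (1/2) * s powr (1/2) * s powr (1/2) = s powr (1/2 + 1/2 + 1/2)"
      by (simp only: powr_add)
    moreover have "s powr (-3/2) = 1 / s powr (3/2)" using powr_minus_divide[of s "3/2"] by simp
    ultimately show ?thesis by simp
  qed
  also have "\<dots> \<le> 2 * ((4/9 * K^2) powr (-3/4) * majorant (m, n))"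
    using majorant_bound[OF mn(1) K, of s] by (simp add: s_def)
  finally show ?thesis by simp
qed

lemma G2_term_exceptional [simp]: "G2_term \<tau> (0, 0) = 1" "G2_term \<tau> (0, 1) = 2"
  by (simp_all add: G2_term_def)

lemma lattice_lower_bound_obtain:
  assumes "0 < \<epsilon>"
  obtains K where "0 < K"
    "\<And>m n \<tau>. \<bar>Re \<tau>\<bar> \<le> B \<Longrightarrow> \<epsilon> \<le> Im \<tau> \<Longrightarrow>
       K * of_int (m^2 + n^2) \<le> (norm (of_int m * \<tau> + of_int n :: complex))^2"
proof
  define K where "K = 1 / (2 + (2 * B^2 + 1) / \<epsilon>^2)"
  have *: "2 + (2 * B^2 + 1) / \<epsilon>^2 > 0" using assms by (intro add_pos_nonneg) auto
  show "0 < K" using * by (simp add: K_def)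
  show "K * of_int (m^2 + n^2) \<le> (norm (of_int m * \<tau> + of_int n :: complex))^2"
    if "\<bar>Re \<tau>\<bar> \<le> B" "\<epsilon> \<le> Im \<tau>" for m n \<tau>
    using norm_lattice_lower_bound[OF that assms, of m n] * by (simp add: K_def field_simps)
qed

lemma majorant_pos: "0 < majorant x"
proof -
  have "0 < 1 + (real_of_int n)^2" for n by (intro add_pos_nonneg) auto
  hence "1 + (real_of_int n)^2 \<noteq> 0" for n by (metis less_irrefl)
  thus ?thesis by (auto simp: majorant_def split: prod.splits)
qed

lemma G2_term_majorant:
  assumes "0 < \<epsilon>"
  obtains C where "0 < C"
    "\<And>x \<tau>. \<bar>Re \<tau>\<bar> \<le> B \<Longrightarrow> \<epsilon> \<le> Im \<tau> \<Longrightarrow> norm (G2_term \<tau> x) \<le> C * majorant x"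
proof -
  obtain K where K: "0 < K"
    "\<And>m n \<tau>. \<bar>Re \<tau>\<bar> \<le> B \<Longrightarrow> \<epsilon> \<le> Im \<tau> \<Longrightarrow>
       K * of_int (m^2 + n^2) \<le> (norm (of_int m * \<tau> + of_int n :: complex))^2"
    using lattice_lower_bound_obtain[OF assms] by metis
  \<comment> \<open>The last two summands absorb the values 1 and 2 of the exceptional terms at (0,
    0) and (0, 1).\<close>
  define C where "C = 2 * (4/9 * K^2) powr (-3/4) + 1 / majorant (0,0) + 2 / majorant (0,1)"
  have pos: "0 < 2 * (4/9 * K^2) powr (-3/4)" "0 < 1 / majorant (0,0)" "0 < 2 / majorant (0,1)"
    using K majorant_pos by auto
  show thesis
  proof (rule that[of C])
    show "0 < C" unfolding C_def using pos by (intro add_pos_pos)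
    show "norm (G2_term \<tau> x) \<le> C * majorant x" if "\<bar>Re \<tau>\<bar> \<le> B" "\<epsilon> \<le> Im \<tau>" for x \<tau>
    proof -
      obtain m n where x: "x = (m, n)" by force
      consider "x = (0,0)" | "x = (0,1)" | "x \<noteq> (0,0)" "x \<noteq> (0,1)" by blast
      thus ?thesis
      proof cases
        case 1
        have "1 = 1 / majorant x * majorant x"
          using majorant_pos[of x] by simp
        also have "\<dots> \<le> C * majorant x"
          using majorant_pos[of x] pos 1 by (intro mult_right_mono) (auto simp: C_def)
        finally show ?thesis using 1 by simp
      next
        case 2
        have "2 = 2 / majorant x * majorant x"
          using majorant_pos[of x] by simp
        also have "\<dots> \<le> C * majorant x"
          using majorant_pos[of x] pos 2 by (intro mult_right_mono) (auto simp: C_def)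
        finally show ?thesis using 2 by simp
      next
        case 3
        have "norm (G2_term \<tau> x) \<le> 2 * (4/9 * K^2) powr (-3/4) * majorant x"
          unfolding x using K that 3 assms x by (intro norm_G2_term_le) auto
        also have "\<dots> \<le> C * majorant x"
          using majorant_pos[of x] pos by (intro mult_right_mono) (auto simp: C_def)
        finally show ?thesis .
      qed
    qed
  qed
qed

lemma has_sum_diff_complex:
  fixes f g :: "'a \<Rightarrow> complex"
  assumes "(f has_sum a) A" "(g has_sum b) A"
  shows "((\<lambda>x. f x - g x) has_sum (a - b)) A"
  using has_sum_add[OF assms(1) has_sum_uminusI[OF assms(2)]] by simp

lemma summable_on_G2_term:
  assumes "0 < Im \<tau>"
  shows "G2_term \<tau> summable_on UNIV"
proof -
  obtain C where C: "\<And>x. norm (G2_term \<tau> x) \<le> C * majorant x"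
    using G2_term_majorant[of "Im \<tau>" "\<bar>Re \<tau>\<bar>"] assms by (metis order_refl)
  have "(\<lambda>x. norm (G2_term \<tau> x)) summable_on UNIV"
    by (rule Infinite_Sum.abs_summable_on_comparison_test'[where g = "\<lambda>x. C * majorant x"])
       (use C in \<open>auto intro!: summable_on_cmult_right summable_on_majorant\<close>)
  thus ?thesis by (rule abs_summable_summable)
qed

section \<open>Rows and columns of the weight 2 series\<close>

lemma summable_on_int_inverse_square:
  fixes f :: "int \<Rightarrow> complex"
  assumes "\<And>n. n \<noteq> 0 \<Longrightarrow> norm (f n) \<le> C / of_int (n^2)"
  shows "f summable_on UNIV"
proof -
  define g where "g = (\<lambda>n::int. if n = 0 then norm (f 0) else \<bar>C\<bar> / of_int (n^2))"
  have "summable (\<lambda>n. g (int n))"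
  proof (rule summable_comparison_test')
    show "summable (\<lambda>n. \<bar>C\<bar> * (1 / real n ^ 2))"
      by (intro summable_mult) (simp add: inverse_power_summable inverse_eq_divide[symmetric])
    show "norm (g (int n)) \<le> \<bar>C\<bar> * (1 / real n ^ 2)" if "1 \<le> n" for n
      using that by (simp add: g_def)
  qed
  hence g: "g summable_on UNIV"
    by (intro summable_on_int_from_nat) (auto simp: g_def)
  have "norm (f n) \<le> g n" for n
  proof (cases "n = 0")
    case False
    have "C / of_int (n^2) \<le> \<bar>C\<bar> / of_int (n^2)" by (intro divide_right_mono) auto
    with assms[OF False] False show ?thesis unfolding g_def by simp
  qed (auto simp: g_def)
  hence "(\<lambda>x. norm (f x)) summable_on UNIV"
    by (intro Infinite_Sum.abs_summable_on_comparison_test'[OF g]) auto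
  thus ?thesis by (rule abs_summable_summable)
qed

text \<open>Unordered sums over the integers are evaluated as limits over the intervals [-N, N], on
  which telescoping is possible.\<close>

lemma filterlim_symmetric_int_intervals:
  "filterlim (\<lambda>N. {-int N..int N}) (finite_subsets_at_top UNIV) sequentially"
  unfolding filterlim_finite_subsets_at_top
proof (intro allI impI)
  fix X :: "int set" assume X: "finite X \<and> X \<subseteq> UNIV"
  define B where "B = nat (\<Sum>x\<in>X. \<bar>x\<bar>)"
  have "\<bar>x\<bar> \<le> int B" if "x \<in> X" for x
  proof -
    have "\<bar>x\<bar> \<le> (\<Sum>x\<in>X. \<bar>x\<bar>)" using X that by (intro member_le_sum) auto
    thus ?thesis by (simp add: B_def)
  qed
  thus "\<forall>\<^sub>F N in sequentially. finite {-int N..int N} \<and> X \<subseteq> {-int N..int N} \<and> {-int N..int N} \<subseteq> UNIV"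
    by (intro eventually_sequentiallyI[of B]) (fastforce simp: abs_le_iff)
qed

lemma has_sum_int_symmetric:
  fixes f :: "int \<Rightarrow> 'a::{comm_monoid_add, topological_space}"
  assumes "(f has_sum S) UNIV"
  shows "(\<lambda>N. \<Sum>n\<in>{-int N..int N}. f n) \<longlonglongrightarrow> S"
  using filterlim_compose[OF assms[unfolded has_sum_def] filterlim_symmetric_int_intervals] .

lemma sum_int_telescope:
  fixes f :: "int \<Rightarrow> 'a::ab_group_add"
  shows "(\<Sum>n\<in>{-int N..int N}. f (n - 1) - f n) = f (-int N - 1) - f (int N)"
proof (induction N)
  case (Suc N)
  have "{-int (Suc N)..int (Suc N)} = insert (-int (Suc N)) (insert (int (Suc N)) {-int N..int N})"
    by auto
  moreover have "f (-int N - 1) = f (- 1 - int N)" by (rule arg_cong[of _ _ f]) simp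
  ultimately show ?case using Suc by (simp add: algebra_simps)
qed auto

lemma tendsto_inverse_affine_int:
  fixes z :: complex and g :: "nat \<Rightarrow> int"
  assumes "filterlim (\<lambda>N. real_of_int \<bar>g N\<bar>) at_top sequentially"
  shows "(\<lambda>N. 1 / (z + of_int (g N))) \<longlonglongrightarrow> 0"
proof -
  have "filterlim (\<lambda>N. norm (of_int (g N) :: complex)) at_top sequentially"
    using assms by simp
  hence "filterlim (\<lambda>N. of_int (g N) :: complex) at_infinity sequentially"
    by (rule filterlim_norm_at_top_imp_at_infinity)
  hence "filterlim (\<lambda>N. z + of_int (g N) :: complex) at_infinity sequentially"
    by (intro tendsto_add_filterlim_at_infinity[OF tendsto_const])
  thus ?thesis by (intro tendsto_divide_0[OF tendsto_const])
qed

text \<open>The partial sum over [-N, N] telescopes to 1 / (z - N - 1) - 1 / (z + N), which tends to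
  0.\<close>

lemma has_sum_telescope_zero:
  fixes z :: complex
  assumes "(\<lambda>n. 1 / (z + of_int (n - 1)) - 1 / (z + of_int n)) summable_on UNIV"
  shows "((\<lambda>n::int. 1 / (z + of_int (n - 1)) - 1 / (z + of_int n)) has_sum 0) UNIV"
proof -
  let ?f = "\<lambda>n::int. 1 / (z + of_int n)"
  obtain S where S: "((\<lambda>n. ?f (n - 1) - ?f n) has_sum S) UNIV"
    using assms by (auto simp: summable_on_def)
  have lim: "(\<lambda>N. ?f (-int N - 1) - ?f (int N)) \<longlonglongrightarrow> S"
    using has_sum_int_symmetric[OF S] unfolding sum_int_telescope[of ?f] .
  have "(\<lambda>N. ?f (-int N - 1) - ?f (int N)) \<longlonglongrightarrow> 0 - 0"
  proof (intro tendsto_diff tendsto_inverse_affine_int)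
    have "(\<lambda>N. real_of_int \<bar>- int N - 1\<bar>) = (\<lambda>N. real (Suc N))" by (simp add: fun_eq_iff)
    thus "filterlim (\<lambda>N. real_of_int \<bar>- int N - 1\<bar>) at_top sequentially"
      using filterlim_compose[OF filterlim_real_sequentially filterlim_Suc] by simp
    show "filterlim (\<lambda>N. real_of_int \<bar>int N\<bar>) at_top sequentially"
      using filterlim_real_sequentially by simp
  qed
  with lim have "S = 0" using LIMSEQ_unique by fastforce
  with S show ?thesis by simp
qed

text \<open>Since the correction sums to zero on every row, \<open>G2\<close> is Eisenstein's
  iterated sum of 1 / (m \<tau> + n)^2, rows first; in row 0 the value 1 / 0 = 0 drops the
  origin.\<close>

definition G2_row :: "complex \<Rightarrow> int \<Rightarrow> complex" where
  "G2_row \<tau> m = (\<Sum>\<^sub>\<infinity>n. 1 / (of_int m * \<tau> + of_int n)^2)"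

lemma norm_lattice_inverse_square:
  assumes "0 < Im \<tau>"
  obtains C where "0 < C" "\<And>m n. (m, n) \<noteq> (0, 0) \<Longrightarrow>
    norm (1 / (of_int m * \<tau> + of_int n :: complex)^2) \<le> C / of_int (m^2 + n^2)"
proof -
  obtain K where K: "0 < K"
    "\<And>m n. K * of_int (m^2 + n^2) \<le> (norm (of_int m * \<tau> + of_int n :: complex))^2"
    using lattice_lower_bound_obtain[OF assms, of "\<bar>Re \<tau>\<bar>"] by (metis order_refl)
  show thesis
  proof (rule that[of "1 / K"])
    show "norm (1 / (of_int m * \<tau> + of_int n :: complex)^2) \<le> 1 / K / of_int (m^2 + n^2)"
      if mn: "(m, n) \<noteq> (0, 0)" for m n
    proof -
      have "0 < K * of_int (m^2 + n^2)" using K sum_real_int_square_ge_1[OF mn] by (intro mult_pos_pos) auto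
      hence "1 / (norm (of_int m * \<tau> + of_int n :: complex))^2 \<le> 1 / (K * of_int (m^2 + n^2))"
        using K(2)[of m n] by (intro frac_le) auto
      thus ?thesis by (simp add: norm_divide norm_power)
    qed
  qed (use K in auto)
qed

lemma summable_on_inverse_square_row:
  assumes "0 < Im \<tau>"
  shows "(\<lambda>n. 1 / (of_int m * \<tau> + of_int n)^2) summable_on UNIV"
    and "(\<lambda>m. 1 / (of_int m * \<tau> + of_int n)^2) summable_on UNIV"
proof -
  obtain C where C: "0 < C" "\<And>m n. (m, n) \<noteq> (0, 0) \<Longrightarrow>
    norm (1 / (of_int m * \<tau> + of_int n :: complex)^2) \<le> C / of_int (m^2 + n^2)"
    using norm_lattice_inverse_square[OF assms] by metis
  have le: "C / of_int (m^2 + n^2) \<le> C / of_int (n^2)" if "n \<noteq> 0" for m n :: int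
    using C that by (intro divide_left_mono) (auto intro!: mult_pos_pos add_nonneg_pos)
  show "(\<lambda>n. 1 / (of_int m * \<tau> + of_int n)^2) summable_on UNIV"
  proof (rule summable_on_int_inverse_square[where C = C])
    fix n :: int assume n: "n \<noteq> 0"
    hence "(m, n) \<noteq> (0, 0)" by simp
    from order_trans[OF C(2)[OF this] le[OF n]]
    show "norm (1 / (of_int m * \<tau> + of_int n)^2) \<le> C / of_int (n^2)" .
  qed
  show "(\<lambda>m. 1 / (of_int m * \<tau> + of_int n)^2) summable_on UNIV"
  proof (rule summable_on_int_inverse_square[where C = C])
    fix m :: int assume m: "m \<noteq> 0"
    hence "(m, n) \<noteq> (0, 0)" by simp
    from order_trans[OF C(2)[OF this] le[OF m, of n, unfolded add.commute[of "n^2" "m^2"]]]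
    show "norm (1 / (of_int m * \<tau> + of_int n)^2) \<le> C / of_int (m^2)" .
  qed
qed

lemma G2_term_has_sum_row:
  assumes "0 < Im \<tau>"
  shows "((\<lambda>n. G2_term \<tau> (m, n)) has_sum G2_row \<tau> m) UNIV"
proof -
    have sum: "G2_term \<tau> summable_on (UNIV \<times> UNIV)"
      using summable_on_G2_term[OF assms] by simp
    have sq: "((\<lambda>n. 1 / (of_int m * \<tau> + of_int n)^2) has_sum G2_row \<tau> m) UNIV"
      unfolding G2_row_def using summable_on_inverse_square_row[OF assms] by simp
    have "(\<lambda>n. G2_term \<tau> (m, n)) summable_on UNIV"
      using summable_on_SigmaD1[of "\<lambda>m n. G2_term \<tau> (m, n)" UNIV "\<lambda>_. UNIV" m] sum
      by auto
    from has_sum_imp_summable[OF has_sum_diff_complex[OF sq has_sum_infsum[OF this]]]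
    have "(\<lambda>n. 1 / (of_int m * \<tau> + of_int (n - 1)) - 1 / (of_int m * \<tau> + of_int n)) summable_on UNIV"
      by (simp add: G2_term_def)
    from has_sum_diff_complex[OF sq has_sum_telescope_zero[OF this]]
    show ?thesis by (simp add: G2_term_def)
qed

lemma G2_has_sum_rows:
  assumes "0 < Im \<tau>"
  shows "(G2_row \<tau> has_sum G2 \<tau>) UNIV"
proof -
  have "(G2_term \<tau> has_sum G2 \<tau>) (UNIV \<times> UNIV)"
    unfolding G2_def using summable_on_G2_term[OF assms] by simp
  from has_sum_SigmaD[OF this G2_term_has_sum_row[OF assms]] show ?thesis by simp
qed

text \<open>First-order Taylor estimate: Ln w - w / z has derivative 1 / w - 1 / z, of size at most
  2 |\<tau>| / |z|^2 on the segment from z to z + \<tau>, because |w| \<ge> |z| / 2 there.\<close>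

lemma Ln_affine_step:
  fixes \<tau> :: complex and m :: int and N :: nat
  assumes "0 < Im \<tau>" "0 < N" and big: "2 * norm \<tau> \<le> norm (of_int m * \<tau> + of_nat N)"
  shows "norm (Ln (of_int (m + 1) * \<tau> + of_nat N) - Ln (of_int m * \<tau> + of_nat N)
            - \<tau> / (of_int m * \<tau> + of_nat N))
         \<le> 2 * (norm \<tau>)^2 * norm (1 / (of_int m * \<tau> + of_nat N)^2)"
proof -
  define z where "z = of_int m * \<tau> + of_nat N"
  have \<tau>: "\<tau> \<noteq> 0" using assms by auto
  hence z: "0 < norm z" using big unfolding z_def[symmetric] by (smt (verit) zero_less_norm_iff)
  define S where "S = closed_segment z (z + \<tau>)"
  define f where "f = (\<lambda>w. Ln w - w / z)"
  have S: "w \<notin> \<real>\<^sub>\<le>\<^sub>0 \<and> norm z / 2 \<le> norm w \<and> norm (z - w) \<le> norm \<tau>" if "w \<in> S" for w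
  proof -
    obtain u where u: "0 \<le> u" "u \<le> 1" "w = (1 - u) *\<^sub>R z + u *\<^sub>R (z + \<tau>)"
      using \<open>w \<in> S\<close> by (auto simp: S_def in_segment)
    hence w: "w = z + of_real u * \<tau>" by (simp add: algebra_simps scaleR_conv_of_real)
    have "Im w = (of_int m + u) * Im \<tau>" "Re w = (of_int m + u) * Re \<tau> + N"
      by (simp_all add: w z_def algebra_simps)
    \<comment> \<open>If Im w = 0 then m + u = 0 and w = N > 0, so the segment avoids the branch
      cut.\<close>
    hence "w \<notin> \<real>\<^sub>\<le>\<^sub>0" using assms by (auto simp: complex_nonpos_Reals_iff)
    moreover have n: "norm (of_real u * \<tau>) \<le> norm \<tau>"
      using u by (simp add: norm_mult mult_left_le_one_le)
    moreover have "norm z \<le> norm w + norm (of_real u * \<tau>)"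
      using norm_triangle_ineq4[of w "of_real u * \<tau>"] by (simp add: w)
    ultimately show ?thesis using big unfolding z_def[symmetric] by (simp add: w)
  qed
  have "norm (f z - f (z + \<tau>)) \<le> 2 * norm \<tau> / (norm z)^2 * norm (z - (z + \<tau>))"
  proof (rule field_differentiable_bound[of S f "\<lambda>w. 1 / w - 1 / z"])
    show "convex S" "z \<in> S" "z + \<tau> \<in> S" by (auto simp: S_def)
    fix w assume w: "w \<in> S"
    have w0: "w \<noteq> 0" using S[OF w] by auto
    show "(f has_field_derivative 1 / w - 1 / z) (at w within S)"
      unfolding f_def using S[OF w] z
      by (auto intro!: derivative_eq_intros simp: field_simps)
    have "norm (1 / w - 1 / z) = norm (z - w) / (norm w * norm z)"
      using w0 z by (simp add: field_simps norm_divide[symmetric] norm_mult[symmetric])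
    also have "\<dots> \<le> norm \<tau> / (norm z / 2 * norm z)"
      using S[OF w] z w0 by (intro frac_le mult_right_mono) auto
    finally show "norm (1 / w - 1 / z) \<le> 2 * norm \<tau> / (norm z)^2" by (simp add: power2_eq_square mult.commute)
  qed
  moreover have "f z - f (z + \<tau>) = - (Ln (z + \<tau>) - Ln z - \<tau> / z)"
    using z by (simp add: f_def add_divide_distrib)
  ultimately have "norm (Ln (z + \<tau>) - Ln z - \<tau> / z) \<le> 2 * norm \<tau> / (norm z)^2 * norm \<tau>"
    by (simp only: norm_minus_cancel) simp
  moreover have "z + \<tau> = of_int (m + 1) * \<tau> + of_nat N" by (simp add: z_def algebra_simps)
  moreover have "2 * norm \<tau> / (norm z)^2 * norm \<tau> = 2 * (norm \<tau>)^2 * norm (1 / z^2)"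
    by (simp add: norm_divide norm_mult power2_eq_square)
  ultimately show ?thesis by (simp only: z_def)
qed

text \<open>Dividing both arguments by the positive number M leaves the difference of logarithms
  unchanged. The quotients tend to \<tau> and -\<tau>, whose logarithms differ by \<i> pi.\<close>

lemma Ln_affine_limit:
  assumes "0 < Im \<tau>" "0 < N"
  shows "(\<lambda>M. Ln (of_int (int M + 1) * \<tau> + of_nat N) - Ln (of_int (- int M) * \<tau> + of_nat N))
    \<longlonglongrightarrow> \<i> * of_real pi"
proof -
  have \<tau>: "\<tau> \<notin> \<real>\<^sub>\<le>\<^sub>0" "- \<tau> \<notin> \<real>\<^sub>\<le>\<^sub>0" "\<tau> \<noteq> 0"
    using assms by (auto simp: complex_nonpos_Reals_iff)
  have "(\<lambda>M. \<tau> + (\<tau> + of_nat N) / of_nat M) \<longlonglongrightarrow> \<tau> + 0"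
    by (intro tendsto_add tendsto_const lim_const_over_n)
  hence 1: "(\<lambda>M. Ln (\<tau> + (\<tau> + of_nat N) / of_nat M)) \<longlonglongrightarrow> Ln \<tau>"
    using \<tau> by (intro tendsto_Ln) auto
  have "(\<lambda>M. - \<tau> + of_nat N / of_nat M) \<longlonglongrightarrow> - \<tau> + 0"
    by (intro tendsto_add tendsto_const lim_const_over_n)
  hence 2: "(\<lambda>M. Ln (- \<tau> + of_nat N / of_nat M)) \<longlonglongrightarrow> Ln (- \<tau>)"
    using \<tau> by (intro tendsto_Ln) auto
  have "Ln \<tau> - Ln (- \<tau>) = \<i> * of_real pi"
    using \<tau> assms Ln_minus[of \<tau>] by (auto simp: not_less)
  with tendsto_diff[OF 1 2] have
    lim: "(\<lambda>M. Ln (\<tau> + (\<tau> + of_nat N) / of_nat M) - Ln (- \<tau> + of_nat N / of_nat M))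
      \<longlonglongrightarrow> \<i> * of_real pi" by simp
  show ?thesis
  proof (rule Lim_transform_eventually[OF lim])
    show "\<forall>\<^sub>F M in sequentially. Ln (\<tau> + (\<tau> + of_nat N) / of_nat M) - Ln (- \<tau> + of_nat N / of_nat M)
        = Ln (of_int (int M + 1) * \<tau> + of_nat N) - Ln (of_int (- int M) * \<tau> + of_nat N)"
    proof (rule eventually_sequentiallyI[of 1])
      fix M :: nat assume M: "1 \<le> M"
      have a: "of_int (int M + 1) * \<tau> + of_nat N = of_real (real M) * (\<tau> + (\<tau> + of_nat N) / of_nat M)"
        and b: "of_int (- int M) * \<tau> + of_nat N = of_real (real M) * (- \<tau> + of_nat N / of_nat M)"
        using M by (simp_all add: field_simps)
      have "Im (of_int (int M + 1) * \<tau> + of_nat N) \<noteq> 0" "Im (of_int (- int M) * \<tau> + of_nat N) \<noteq> 0"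
        using assms M by (auto simp: add_pos_pos)
      hence nz: "\<tau> + (\<tau> + of_nat N) / of_nat M \<noteq> 0" "- \<tau> + of_nat N / of_nat M \<noteq> 0"
        unfolding a b by (metis mult_zero_right zero_complex.simps(2))+
      show "Ln (\<tau> + (\<tau> + of_nat N) / of_nat M) - Ln (- \<tau> + of_nat N / of_nat M)
        = Ln (of_int (int M + 1) * \<tau> + of_nat N) - Ln (of_int (- int M) * \<tau> + of_nat N)"
        unfolding a b using M nz by (simp add: Ln_times_of_real del: of_real_of_nat_eq of_real_mult)
    qed
  qed
qed

text \<open>The point is decay in N together with uniformity in M: of the power 1 / s with s = m^2 +
  N^2, one quarter is spent on N and three quarters remain for the summation over m.\<close>

lemma sum_inverse_square_affine_le:
  assumes "0 < Im \<tau>"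
  obtains D where "0 \<le> D" "\<And>M N::nat. 1 \<le> N \<Longrightarrow>
    (\<Sum>m\<in>{-int M..int M}. norm (1 / (of_int m * \<tau> + of_nat N)^2)) \<le> D * real N powr (-1/2)"
proof -
  obtain C where C: "0 < C" "\<And>m n. (m, n) \<noteq> (0, 0) \<Longrightarrow>
    norm (1 / (of_int m * \<tau> + of_int n :: complex)^2) \<le> C / of_int (m^2 + n^2)"
    using norm_lattice_inverse_square[OF assms] by metis
  define S where "S = infsum majorant UNIV"
  have fin: "(\<Sum>m\<in>A. majorant (m, 0)) \<le> S" if "finite A" for A
  proof -
    have "(\<Sum>m\<in>A. majorant (m, 0)) = sum majorant ((\<lambda>m. (m, 0)) ` A)"
      by (subst sum.reindex) (auto simp: inj_on_def)
    also have "\<dots> \<le> S" unfolding S_def using that majorant_pos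
      by (intro finite_sum_le_infsum summable_on_majorant) (auto intro: less_imp_le)
    finally show ?thesis .
  qed
  show thesis
  proof (rule that[of "C * S"])
    show "0 \<le> C * S" using C fin[of "{}"] by simp
    fix M N :: nat assume N: "1 \<le> N"
    have "norm (1 / (of_int m * \<tau> + of_nat N)^2) \<le> C * real N powr (-1/2) * majorant (m, 0)" for m
    proof -
      define s where "s = (real_of_int m)^2 + (real N)^2"
      have "(real N)^2 \<ge> 1" using N by simp
      hence s: "1 + (real_of_int m)^2 \<le> s" "(real N)^2 \<le> s" by (auto simp: s_def)
      with \<open>(real N)^2 \<ge> 1\<close> have s0: "0 < s" by linarith
      note s = s s0
      have "norm (1 / (of_int m * \<tau> + of_nat N)^2) \<le> C / s"
        using C(2)[of m "int N"] N by (simp add: s_def)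
      also have "C / s = C * (s powr (-1/4) * s powr (-3/4))"
        using s by (simp add: powr_minus_divide flip: powr_add)
      also have "\<dots> \<le> C * (((real N)^2) powr (-1/4) * (1 + (real_of_int m)^2) powr (-3/4))"
        using s C N by (intro mult_left_mono mult_mono powr_mono2') (auto simp: add_pos_nonneg)
      also have "((real N)^2) powr (-1/4) = real N powr (-1/2)"
        using N by (simp add: powr_powr flip: powr_numeral)
      finally show ?thesis by (simp add: majorant_def mult_ac)
    qed
    hence "(\<Sum>m\<in>{-int M..int M}. norm (1 / (of_int m * \<tau> + of_nat N)^2))
       \<le> (\<Sum>m\<in>{-int M..int M}. C * real N powr (-1/2) * majorant (m, 0))"
      by (rule sum_mono)
    also have "\<dots> = C * real N powr (-1/2) * (\<Sum>m\<in>{-int M..int M}. majorant (m, 0))"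
      by (simp add: sum_distrib_left)
    also have "\<dots> \<le> C * real N powr (-1/2) * S"
      using C by (intro mult_left_mono fin) auto
    finally show "(\<Sum>m\<in>{-int M..int M}. norm (1 / (of_int m * \<tau> + of_nat N)^2)) \<le> C * S * real N powr (-1/2)"
      by (simp add: mult_ac)
  qed
qed

text \<open>The sum over m of \<tau> / (m \<tau> + N) is a Riemann sum for the increment of Ln. The
  errors of the single steps add up to O(N powr (-1/2)), uniformly in M.\<close>

lemma sum_inverse_affine_approx:
  assumes "0 < Im \<tau>"
  obtains D N\<^sub>0 where "\<And>M N::nat. N\<^sub>0 \<le> N \<Longrightarrow>
    norm (\<tau> * (\<Sum>m\<in>{-int M..int M}. 1 / (of_int m * \<tau> + of_nat N))
      - (Ln (of_int (int M + 1) * \<tau> + of_nat N) - Ln (of_int (- int M) * \<tau> + of_nat N)))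
     \<le> D * real N powr (-1/2)"
proof -
  obtain D where D: "0 \<le> D" "\<And>M N::nat. 1 \<le> N \<Longrightarrow>
    (\<Sum>m\<in>{-int M..int M}. norm (1 / (of_int m * \<tau> + of_nat N)^2)) \<le> D * real N powr (-1/2)"
    using sum_inverse_square_affine_le[OF assms] by metis
  obtain K where K: "0 < K"
    "\<And>m n. K * of_int (m^2 + n^2) \<le> (norm (of_int m * \<tau> + of_int n :: complex))^2"
    using lattice_lower_bound_obtain[OF assms, of "\<bar>Re \<tau>\<bar>"] by (metis order_refl)
  define N\<^sub>0 where "N\<^sub>0 = max 1 (nat \<lceil>2 * norm \<tau> / sqrt K\<rceil>)"
  show thesis
  proof (rule that[of N\<^sub>0 "2 * (norm \<tau>)^2 * D"])
    fix M N :: nat assume N: "N\<^sub>0 \<le> N"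
    hence N1: "1 \<le> N" by (simp add: N\<^sub>0_def)
    define g where "g = (\<lambda>m::int. Ln (of_int m * \<tau> + of_nat N))"
    have big: "2 * norm \<tau> \<le> norm (of_int m * \<tau> + of_nat N)" for m
    proof -
      have "2 * norm \<tau> / sqrt K \<le> real N" using N unfolding N\<^sub>0_def by linarith
      hence "2 * norm \<tau> \<le> sqrt K * real N" using K by (simp add: field_simps)
      also have "\<dots> = sqrt (K * (real N)^2)" by (simp add: real_sqrt_mult)
      also have "\<dots> \<le> sqrt (K * of_int (m^2 + (int N)^2))"
        using K by (intro real_sqrt_le_mono mult_left_mono) auto
      also have "\<dots> \<le> norm (of_int m * \<tau> + of_nat N)"
        using K(2)[of m "int N"] by (intro real_le_lsqrt) auto
      finally show ?thesis .
    qed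
    have tel: "g (int M + 1) - g (- int M) = (\<Sum>m\<in>{-int M..int M}. g (m + 1) - g m)"
    proof (induction M)
      case (Suc M)
      have "{-int (Suc M)..int (Suc M)} = insert (-int (Suc M)) (insert (int (Suc M)) {-int M..int M})"
        by auto
      thus ?case using Suc by (simp add: algebra_simps)
    qed auto
    have "norm (\<tau> * (\<Sum>m\<in>{-int M..int M}. 1 / (of_int m * \<tau> + of_nat N)) - (g (int M + 1) - g (- int M)))
        = norm (\<Sum>m\<in>{-int M..int M}. g (m + 1) - g m - \<tau> / (of_int m * \<tau> + of_nat N))"
      unfolding tel by (subst norm_minus_commute) (simp add: sum_subtractf sum_distrib_left)
    also have "\<dots> \<le> (\<Sum>m\<in>{-int M..int M}. 2 * (norm \<tau>)^2 * norm (1 / (of_int m * \<tau> + of_nat N)^2))"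
      unfolding g_def using Ln_affine_step[OF assms _ big] N1 by (intro sum_norm_le) auto
    also have "\<dots> \<le> 2 * (norm \<tau>)^2 * (D * real N powr (-1/2))"
      unfolding sum_distrib_left[symmetric] using D(2)[OF N1] by (intro mult_left_mono) auto
    finally show "norm (\<tau> * (\<Sum>m\<in>{-int M..int M}. 1 / (of_int m * \<tau> + of_nat N))
      - (Ln (of_int (int M + 1) * \<tau> + of_nat N) - Ln (of_int (- int M) * \<tau> + of_nat N)))
     \<le> 2 * (norm \<tau>)^2 * D * real N powr (-1/2)"
      by (simp add: g_def mult_ac)
  qed
qed

lemma has_sum_finite_sum:
  fixes f :: "'b \<Rightarrow> 'a \<Rightarrow> complex"
  assumes "finite A" "\<And>n. n \<in> A \<Longrightarrow> (f n has_sum h n) B"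
  shows "((\<lambda>m. \<Sum>n\<in>A. f n m) has_sum (\<Sum>n\<in>A. h n)) B"
  using assms by (induction A) (auto intro!: has_sum_add has_sum_0)

text \<open>The two orders of summation of the absolutely convergent double series are compared. The
  correction terms telescope to zero along rows, while along columns they add up to
  \<open>- 2 * lim N. sum m. 1 / (m * \<tau> + N)\<close>, which is an increment of the logarithm.\<close>

theorem G2_inversion:
  assumes "0 < Im \<tau>"
  shows "G2 (- 1 / \<tau>) = \<tau>^2 * G2 \<tau> - 2 * \<i> * of_real pi * \<tau>"
proof -
  have \<tau>0: "\<tau> \<noteq> 0" using assms by auto
  have im: "0 < Im (- 1 / \<tau>)"
    using assms \<tau>0 by (simp add: Im_divide complex_neq_0 field_simps)
  have sum: "(G2_term \<tau> has_sum G2 \<tau>) (UNIV \<times> UNIV)"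
    unfolding G2_def using summable_on_G2_term[OF assms] by simp
  define t where "t n = (\<Sum>\<^sub>\<infinity>m. 1 / (of_int m * \<tau> + of_int n)^2)" for n :: int
  define b where "b m n = 1 / (of_int m * \<tau> + of_int (n - 1)) - 1 / (of_int m * \<tau> + of_int n)" for m n :: int
  define h where "h n = (\<Sum>\<^sub>\<infinity>m. b m n)" for n
  have t: "((\<lambda>m. 1 / (of_int m * \<tau> + of_int n)^2) has_sum t n) UNIV" for n
    unfolding t_def using summable_on_inverse_square_row[OF assms] by simp
  have sum': "((\<lambda>(n, m). G2_term \<tau> (m, n)) has_sum G2 \<tau>) (UNIV \<times> UNIV)"
    using sum by (subst (asm) has_sum_swap)
  have h: "((\<lambda>m. b m n) has_sum h n) UNIV" for n
  proof -
    have "(\<lambda>m. G2_term \<tau> (m, n)) summable_on UNIV"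
      using summable_on_SigmaD1[of "\<lambda>n m. G2_term \<tau> (m, n)" UNIV "\<lambda>_. UNIV" n] sum'
      by (auto simp: has_sum_imp_summable)
    from has_sum_imp_summable[OF has_sum_diff_complex[OF t[of n] has_sum_infsum[OF this]]]
    have "(\<lambda>m. b m n) summable_on UNIV" by (simp add: G2_term_def b_def)
    thus ?thesis unfolding h_def by simp
  qed
  have "((\<lambda>n. t n - h n) has_sum G2 \<tau>) UNIV"
    using has_sum_SigmaD[OF sum', of "\<lambda>n. t n - h n"] has_sum_diff_complex[OF t h]
    by (simp add: G2_term_def b_def)
  \<comment> \<open>The columns of the lattice of \<tau> are, up to the factor \<tau>^2, the rows of
    the lattice of -1 / \<tau>. So the uncorrected columns give \<open>G2 (- 1 / \<tau>)\<close>,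
    and the column sums \<open>h\<close> of the correction account for the whole defect.\<close>
  moreover have "(t has_sum (G2 (- 1 / \<tau>) / \<tau>^2)) UNIV"
  proof -
    have "t n = G2_row (- 1 / \<tau>) n / \<tau>^2" for n
    proof -
      have "G2_row (- 1 / \<tau>) n = (\<Sum>\<^sub>\<infinity>m. \<tau>^2 * (1 / (of_int m * \<tau> + of_int n)^2))"
        unfolding G2_row_def
      proof (rule infsum_reindex_bij_witness[of _ uminus uminus])
        show "\<tau>^2 * (1 / (of_int (- m) * \<tau> + of_int n)^2) = 1 / (of_int n * (- 1 / \<tau>) + of_int m)^2" for m
        proof -
          have "(of_int (- m) * \<tau> + of_int n) = - \<tau> * (of_int n * (- 1 / \<tau>) + of_int m)"
            using \<tau>0 by (simp add: field_simps)
          thus ?thesis using \<tau>0 by (simp add: power_mult_distrib)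
        qed
      qed auto
      also have "\<dots> = \<tau>^2 * t n"
        unfolding t_def by (intro infsum_cmult_right) (use t has_sum_imp_summable in blast)
      finally show ?thesis using \<tau>0 by simp
    qed
    hence "t = (\<lambda>n. G2_row (- 1 / \<tau>) n * (1 / \<tau>^2))" by (simp add: fun_eq_iff)
    with has_sum_cmult_left[OF G2_has_sum_rows[OF im], of "1 / \<tau>^2"]
    have "(t has_sum (G2 (- 1 / \<tau>) * (1 / \<tau>^2))) UNIV" by (simp only:)
    thus ?thesis by (simp only: mult_1_right times_divide_eq_right)
  qed
  ultimately have "((\<lambda>n. t n - (t n - h n)) has_sum (G2 (- 1 / \<tau>) / \<tau>^2 - G2 \<tau>)) UNIV"
    using has_sum_diff_complex by blast
  hence H: "(h has_sum (G2 (- 1 / \<tau>) / \<tau>^2 - G2 \<tau>)) UNIV" (is "(h has_sum ?H) _") by simp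
  obtain D N\<^sub>0 where D: "\<And>M N::nat. N\<^sub>0 \<le> N \<Longrightarrow>
    norm (\<tau> * (\<Sum>m\<in>{-int M..int M}. 1 / (of_int m * \<tau> + of_nat N))
      - (Ln (of_int (int M + 1) * \<tau> + of_nat N) - Ln (of_int (- int M) * \<tau> + of_nat N)))
     \<le> D * real N powr (-1/2)"
    using sum_inverse_affine_approx[OF assms] by metis
  define U where "U M N = (\<Sum>m\<in>{-int M..int M}. 1 / (of_int m * \<tau> + of_nat N))" for M N :: nat
  \<comment> \<open>For fixed N the sum over m is taken first, as a limit in M. Telescoping in n
    leaves two columns, N and, after reflection, N + 1; each contributes one logarithmic increment
    \<i> pi.\<close>
  have bound: "norm (\<tau> * (\<Sum>n\<in>{-int N..int N}. h n) + 2 * (\<i> * of_real pi))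
      \<le> D * real (Suc N) powr (-1/2) + D * real N powr (-1/2)" if N: "N\<^sub>0 \<le> N" "0 < N" for N
  proof -
    have "((\<lambda>m. \<Sum>n\<in>{-int N..int N}. b m n) has_sum (\<Sum>n\<in>{-int N..int N}. h n)) UNIV"
      using h by (intro has_sum_finite_sum) auto
    also have "(\<lambda>m. \<Sum>n\<in>{-int N..int N}. b m n) =
        (\<lambda>m. 1 / (of_int m * \<tau> + of_int (- int N - 1)) - 1 / (of_int m * \<tau> + of_int (int N)))"
    proof
      fix m
      show "(\<Sum>n\<in>{-int N..int N}. b m n) =
        1 / (of_int m * \<tau> + of_int (- int N - 1)) - 1 / (of_int m * \<tau> + of_int (int N))"
        unfolding b_def by (rule sum_int_telescope[of "\<lambda>n. 1 / (of_int m * \<tau> + of_int n)" N])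
    qed
    finally have "(\<lambda>M. \<Sum>m\<in>{-int M..int M}. 1 / (of_int m * \<tau> + of_int (- int N - 1)) -
        1 / (of_int m * \<tau> + of_int (int N))) \<longlonglongrightarrow> (\<Sum>n\<in>{-int N..int N}. h n)"
      by (rule has_sum_int_symmetric)
    also have "(\<lambda>M. \<Sum>m\<in>{-int M..int M}. 1 / (of_int m * \<tau> + of_int (- int N - 1)) -
        1 / (of_int m * \<tau> + of_int (int N))) = (\<lambda>M. - U M (Suc N) - U M N)"
    proof
      fix M
      have "(\<Sum>m\<in>{-int M..int M}. 1 / (of_int m * \<tau> + of_int (- int N - 1)))
          = (\<Sum>m\<in>{-int M..int M}. - (1 / (of_int m * \<tau> + of_nat (Suc N))))"
      \<comment> \<open>The reflection of m turns the column -N - 1 into minus the column N +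
        1.\<close>
      proof (rule sum.reindex_bij_witness[of _ uminus uminus])
        fix m :: int
        have "of_int (- m) * \<tau> + of_nat (Suc N) = - (of_int m * \<tau> + of_int (- int N - 1))" by simp
        thus "- (1 / (of_int (- m) * \<tau> + of_nat (Suc N))) = 1 / (of_int m * \<tau> + of_int (- int N - 1))"
          by (simp only: divide_minus_right minus_minus)
      qed auto
      thus "(\<Sum>m\<in>{-int M..int M}. 1 / (of_int m * \<tau> + of_int (- int N - 1)) -
        1 / (of_int m * \<tau> + of_int (int N))) = - U M (Suc N) - U M N"
        by (simp add: sum_subtractf sum_negf U_def)
    qed
    finally have lim: "(\<lambda>M. - U M (Suc N) - U M N) \<longlonglongrightarrow> (\<Sum>n\<in>{-int N..int N}. h n)" .
    define E where "E M N = Ln (of_int (int M + 1) * \<tau> + of_nat N) - Ln (of_int (- int M) * \<tau> + of_nat N)" for M N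
    have E: "(\<lambda>M. E M N) \<longlonglongrightarrow> \<i> * of_real pi" if "0 < N" for N
      unfolding E_def using Ln_affine_limit[OF assms that] .
    have "(\<lambda>M. norm (\<tau> * (- U M (Suc N) - U M N) + (E M (Suc N) + E M N)))
       \<longlonglongrightarrow> norm (\<tau> * (\<Sum>n\<in>{-int N..int N}. h n) + (\<i> * of_real pi + \<i> * of_real pi))"
      by (intro tendsto_intros lim E) (use N in auto)
    moreover have "norm (\<tau> * (- U M (Suc N) - U M N) + (E M (Suc N) + E M N)) \<le>
       D * real (Suc N) powr (-1/2) + D * real N powr (-1/2)" for M
    proof -
      have "norm (\<tau> * U M (Suc N) - E M (Suc N)) \<le> D * real (Suc N) powr (-1/2)"
        unfolding U_def E_def using D[of "Suc N" M] N by simp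
      moreover have "norm (\<tau> * U M N - E M N) \<le> D * real N powr (-1/2)"
        unfolding U_def E_def using D[of N M] N by simp
      moreover have "\<tau> * (- U M (Suc N) - U M N) + (E M (Suc N) + E M N)
         = - (\<tau> * U M (Suc N) - E M (Suc N)) - (\<tau> * U M N - E M N)"
        by (simp add: algebra_simps)
      ultimately show ?thesis
        using norm_triangle_ineq4[of "- (\<tau> * U M (Suc N) - E M (Suc N))" "\<tau> * U M N - E M N"]
        by (simp only: norm_minus_cancel)
    qed
    ultimately show ?thesis
      by (intro tendsto_upperbound) (auto intro!: always_eventually)
  qed
  have "(\<lambda>N. norm (\<tau> * (\<Sum>n\<in>{-int N..int N}. h n) + 2 * (\<i> * of_real pi)))
      \<longlonglongrightarrow> norm (\<tau> * ?H + 2 * (\<i> * of_real pi))"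
    by (intro tendsto_intros has_sum_int_symmetric H)
  moreover have "(\<lambda>N. D * real (Suc N) powr (-1/2) + D * real N powr (-1/2)) \<longlonglongrightarrow> 0"
    by real_asymp
  ultimately have "norm (\<tau> * ?H + 2 * (\<i> * of_real pi)) \<le> 0"
  proof (rule LIMSEQ_le)
    show "\<exists>K. \<forall>N\<ge>K. norm (\<tau> * (\<Sum>n\<in>{-int N..int N}. h n) + 2 * (\<i> * of_real pi))
      \<le> D * real (Suc N) powr (-1/2) + D * real N powr (-1/2)"
      using bound by (intro exI[of _ "max 1 N\<^sub>0"] allI impI) auto
  qed
  hence "\<tau> * ?H + 2 * (\<i> * of_real pi) = 0" by simp
  hence "\<tau> * (\<tau> * ?H + 2 * (\<i> * of_real pi)) = 0" by simp
  thus ?thesis using \<tau>0 by (simp add: algebra_simps power2_eq_square)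
qed

section \<open>Translation, holomorphy and cusp value of the weight 2 series\<close>

lemma G2_translation:
  assumes "0 < Im \<tau>"
  shows "G2 (\<tau> + 1) = G2 \<tau>"
  unfolding G2_def
proof (rule infsum_reindex_bij_witness[of _ "\<lambda>(m, n). (m, n - m)" "\<lambda>(m, n). (m, n + m)"])
  show "G2_term \<tau> (case x of (m, n) \<Rightarrow> (m, n + m)) = G2_term (\<tau> + 1) x" for x
    by (cases x) (simp add: G2_term_def algebra_simps)
qed auto

lemma open_uhp: "open \<H>" and convex_uhp: "convex \<H>"
  by (auto simp: open_halfspace_Im_gt convex_halfspace_Im_gt)

text \<open>Weierstrass M-test on closed discs, each of which lies in a half strip where one
  multiple of \<open>majorant\<close> dominates.\<close>

lemma holomorphic_on_lattice_infsum:
  fixes f :: "complex \<Rightarrow> int \<times> int \<Rightarrow> complex"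
  assumes hol: "\<And>x. x \<in> X \<Longrightarrow> (\<lambda>\<tau>. f \<tau> x) holomorphic_on \<H>"
    and bound: "\<And>B \<epsilon>. 0 < \<epsilon> \<Longrightarrow> \<exists>C. \<forall>\<tau> x. \<bar>Re \<tau>\<bar> \<le> B \<and> \<epsilon> \<le> Im \<tau> \<and> x \<in> X \<longrightarrow> norm (f \<tau> x) \<le> C * majorant x"
  shows "(\<lambda>\<tau>. \<Sum>\<^sub>\<infinity>x\<in>X. f \<tau> x) holomorphic_on \<H>"
proof -
  have "\<exists>r>0. (\<lambda>\<tau>. \<Sum>\<^sub>\<infinity>x\<in>X. f \<tau> x) holomorphic_on ball z r" if z: "z \<in> \<H>" for z
  proof -
    define r where "r = Im z / 2"
    have r: "0 < r" using z by (simp add: r_def)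
    obtain C where C: "\<And>\<tau> x. \<bar>Re \<tau>\<bar> \<le> \<bar>Re z\<bar> + r \<Longrightarrow> r \<le> Im \<tau> \<Longrightarrow> x \<in> X \<Longrightarrow> norm (f \<tau> x) \<le> C * majorant x"
      using bound[OF r, of "\<bar>Re z\<bar> + r"] by blast
    have ball: "\<bar>Re \<tau>\<bar> \<le> \<bar>Re z\<bar> + r \<and> r \<le> Im \<tau>" if "\<tau> \<in> cball z r" for \<tau>
    proof -
      have "\<bar>Re (z - \<tau>)\<bar> \<le> r" "\<bar>Im (z - \<tau>)\<bar> \<le> r"
        using that abs_Re_le_cmod[of "z - \<tau>"] abs_Im_le_cmod[of "z - \<tau>"] by (auto simp: dist_norm)
      thus ?thesis unfolding r_def minus_complex.sel by linarith
    qed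
    have sub: "cball z r \<subseteq> \<H>" using ball r by force
    have "(\<lambda>x. C * majorant x) summable_on X"
      by (intro summable_on_cmult_right summable_on_subset_banach[OF summable_on_majorant]) auto
    hence ul: "uniform_limit (cball z r) (\<lambda>A \<tau>. \<Sum>x\<in>A. f \<tau> x) (\<lambda>\<tau>. \<Sum>\<^sub>\<infinity>x\<in>X. f \<tau> x) (finite_subsets_at_top X)"
      using C ball by (intro Weierstrass_m_test_general) auto
    have ev: "\<forall>\<^sub>F A in finite_subsets_at_top X. continuous_on (cball z r) (\<lambda>\<tau>. \<Sum>x\<in>A. f \<tau> x) \<and>
        (\<lambda>\<tau>. \<Sum>x\<in>A. f \<tau> x) holomorphic_on ball z r"
    proof (rule eventually_finite_subsets_at_top_weakI)
      fix A assume "finite A" "A \<subseteq> X"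
      hence "(\<lambda>\<tau>. \<Sum>x\<in>A. f \<tau> x) holomorphic_on \<H>" using hol by (intro holomorphic_on_sum) auto
      hence "(\<lambda>\<tau>. \<Sum>x\<in>A. f \<tau> x) holomorphic_on cball z r" using sub by (rule holomorphic_on_subset)
      thus "continuous_on (cball z r) (\<lambda>\<tau>. \<Sum>x\<in>A. f \<tau> x) \<and> (\<lambda>\<tau>. \<Sum>x\<in>A. f \<tau> x) holomorphic_on ball z r"
        using ball_subset_cball holomorphic_on_subset holomorphic_on_imp_continuous_on by blast
    qed
    show ?thesis
      by (rule holomorphic_uniform_limit[OF ev ul]) (use r in \<open>auto intro: exI[of _ r]\<close>)
  qed
  thus ?thesis
    by (subst holomorphic_on_open[OF open_uhp])
       (metis centre_in_ball holomorphic_on_open open_ball)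
qed

lemma G2_holomorphic: "G2 holomorphic_on \<H>"
  unfolding G2_def
proof (rule holomorphic_on_lattice_infsum)
  fix x :: "int \<times> int"
  obtain m n where x: "x = (m, n)" by force
  have "(\<lambda>\<tau>. 1 / (of_int m * \<tau> + of_int n)) holomorphic_on \<H>" for m n
  proof (cases "(m, n) = (0, 0)")
    case False
    thus ?thesis using lattice_nonzero[of _ m n] by (auto intro!: holomorphic_intros)
  qed auto
  hence 1: "(\<lambda>\<tau>. 1 / (of_int m * \<tau> + of_int n) ^ k) holomorphic_on \<H>" for m n k
    using holomorphic_on_power[of "\<lambda>\<tau>. 1 / (of_int m * \<tau> + of_int n)" \<H> k] by (simp add: power_one_over)
  show "(\<lambda>\<tau>. G2_term \<tau> x) holomorphic_on \<H>"
    unfolding G2_term_def x prod.case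
    using 1[of m n 2] 1[of m n 1] 1[of m "n - 1" 1] unfolding power_one_right
    by (intro holomorphic_on_diff)
next
  fix B \<epsilon> :: real assume "0 < \<epsilon>"
  then obtain C where C: "0 < C" "\<And>x \<tau>. \<bar>Re \<tau>\<bar> \<le> B \<Longrightarrow> \<epsilon> \<le> Im \<tau> \<Longrightarrow> norm (G2_term \<tau> x) \<le> C * majorant x"
    using G2_term_majorant[of \<epsilon> B] by metis
  thus "\<exists>C. \<forall>\<tau> x. \<bar>Re \<tau>\<bar> \<le> B \<and> \<epsilon> \<le> Im \<tau> \<and> x \<in> UNIV \<longrightarrow> norm (G2_term \<tau> x) \<le> C * majorant x"
    by blast
qed

lemma norm_lattice_infsum_le:
  fixes f :: "int \<times> int \<Rightarrow> complex"
  assumes "\<And>x. x \<in> X \<Longrightarrow> norm (f x) \<le> C * majorant x"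
  shows "f summable_on X" "0 \<le> C \<Longrightarrow> norm (\<Sum>\<^sub>\<infinity>x\<in>X. f x) \<le> C * infsum majorant UNIV"
proof -
  have M: "majorant summable_on X"
    by (rule summable_on_subset_banach[OF summable_on_majorant]) auto
  hence CM: "(\<lambda>x. C * majorant x) summable_on X" by (rule summable_on_cmult_right)
  have abs: "(\<lambda>x. norm (f x)) summable_on X"
    using CM assms by (rule Infinite_Sum.abs_summable_on_comparison_test')
  thus "f summable_on X" by (rule abs_summable_summable)
  assume C: "0 \<le> C"
  have "norm (\<Sum>\<^sub>\<infinity>x\<in>X. f x) \<le> (\<Sum>\<^sub>\<infinity>x\<in>X. norm (f x))"
    using abs by (rule norm_infsum_bound)
  also have "\<dots> \<le> (\<Sum>\<^sub>\<infinity>x\<in>X. C * majorant x)"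
    using abs CM assms by (rule infsum_mono)
  also have "\<dots> = C * (\<Sum>\<^sub>\<infinity>x\<in>X. majorant x)"
    by (rule infsum_cmult_right) (use M in auto)
  also have "\<dots> \<le> C * infsum majorant UNIV"
    using M summable_on_majorant C majorant_pos
    by (intro mult_left_mono infsum_mono_neutral) (auto intro: less_imp_le)
  finally show "norm (\<Sum>\<^sub>\<infinity>x\<in>X. f x) \<le> C * infsum majorant UNIV" .
qed

text \<open>For m \<noteq> 0 the term gains a factor of order y powr (-3/2) over
  \<open>majorant\<close>, so high up on the imaginary axis only the row m = 0 survives.\<close>

lemma majorant_bound_imag_axis:
  assumes "m \<noteq> 0" "1 \<le> y"
  shows "(of_int (m^2) * y^2 + of_int (n^2)) powr (-3/2) \<le> (y^2 / 2) powr (-3/4) * majorant (m, n)"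
proof -
  define M N where "M = real_of_int (m^2)" and "N = real_of_int (n^2)"
  have "1 \<le> m^2" using assms by (metis one_le_power abs_ge_zero int_one_le_iff_zero_less power2_abs zero_less_abs_iff)
  hence M: "1 \<le> M" unfolding M_def by (simp only: of_int_1_le_iff)
  have N: "0 \<le> N" by (simp add: N_def)
  have y: "1 \<le> y^2" using assms by simp
  define s where "s = M * y^2 + N"
  have s: "M + N \<le> s" "M * y^2 \<le> s"
    using M N y mult_left_mono[OF y, of M] by (auto simp: s_def)
  hence "0 < s" using M N by linarith
  note s = s this
  have "y^2 / 2 * ((1 + M) * (1 + N)) \<le> y^2 / 2 * ((2 * M) * (M + N))"
    using M N by (intro mult_left_mono mult_mono) auto
  also have "\<dots> = (M * y^2) * (M + N)" by simp
  also have "\<dots> \<le> s * s" using s M N by (intro mult_mono) auto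
  finally have le: "y^2 / 2 * ((1 + M) * (1 + N)) \<le> s^2" by (simp add: power2_eq_square)
  have "s powr (-3/2) = (s^2) powr (-3/4)" using s by (simp add: powr_powr flip: powr_numeral)
  also have "\<dots> \<le> (y^2 / 2 * ((1 + M) * (1 + N))) powr (-3/4)"
    using le M N y by (intro powr_mono2' mult_pos_pos) auto
  also have "\<dots> = (y^2 / 2) powr (-3/4) * majorant (m, n)"
  proof -
    have "majorant (m, n) = (1 + M) powr (-3/4) * (1 + N) powr (-3/4)"
      by (simp add: majorant_def M_def N_def)
    thus ?thesis using M N by (simp only: powr_mult)
  qed
  finally show ?thesis by (simp only: s_def M_def N_def)
qed

lemma norm_G2_term_imag_axis:
  assumes "m \<noteq> 0" "1 \<le> y"
  shows "norm (G2_term (\<i> * of_real y) (m, n)) \<le> 2 * (y^2 / 2) powr (-3/4) * majorant (m, n)"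
proof -
  define M N where "M = real_of_int m" and "N = real_of_int n"
  define s where "s = M^2 * y^2 + N^2"
  define z where "z = Complex N (M * y)"
  have M1: "1 \<le> M^2" using assms unfolding M_def
    by (metis of_int_1_le_iff of_int_power one_le_power abs_ge_zero int_one_le_iff_zero_less power2_abs zero_less_abs_iff)
  have My: "1 \<le> M^2 * y^2" using mult_mono[OF M1, of 1 "y^2"] assms by simp
  have s: "1 \<le> s" using My by (simp add: s_def add_increasing2)
  have z: "of_int m * (\<i> * of_real y) + of_int n = z" by (simp add: z_def M_def N_def complex_eq_iff)
  have w: "of_int m * (\<i> * of_real y) + of_int (n - 1) = z - 1"
    by (simp add: z_def M_def N_def complex_eq_iff)
  have nz: "(norm z)^2 = s" by (simp add: z_def s_def cmod_power2 power_mult_distrib)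
  have "N^2 \<le> 2 * (N - 1)^2 + 2"
    using sum_squares_ge_zero[of "N - 2" 0] by (simp add: power2_eq_square algebra_simps)
  moreover have "(2 * norm (z - 1))^2 = 4 * ((N - 1)^2 + M^2 * y^2)"
    by (simp add: z_def cmod_power2 power_mult_distrib)
  moreover have "0 \<le> (N - 1)^2" by simp
  moreover have "u + v \<le> w" if "v \<le> 2 * k + 2" "w = 4 * (k + u)" "0 \<le> k" "1 \<le> u" for u v w k :: real
    using that by argo
  ultimately have "s \<le> (2 * norm (z - 1))^2" using My unfolding s_def by blast
  hence 2: "s powr (1/2) \<le> 2 * norm (z - 1)"
    using s real_le_lsqrt by (simp add: powr_half_sqrt)
  have 1: "norm z = s powr (1/2)" using nz s
    by (metis norm_ge_zero powr_half_sqrt real_sqrt_unique zero_le_one order_trans)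
  have pos: "0 < s powr (1/2)" using s by simp
  have nz: "z \<noteq> 0" "z - 1 \<noteq> 0" using 1 2 pos by auto
  have "G2_term (\<i> * of_real y) (m, n) = - 1 / (z^2 * (z - 1))"
    unfolding G2_term_def prod.case z w using nz by (simp add: divide_simps power2_eq_square)
  hence "norm (G2_term (\<i> * of_real y) (m, n)) = 2 / (norm z * norm z * (2 * norm (z - 1)))"
    by (simp add: norm_divide norm_mult power2_eq_square)
  also have "\<dots> \<le> 2 / (s powr (1/2) * s powr (1/2) * s powr (1/2))"
    unfolding 1 using pos 2 by (intro divide_left_mono mult_left_mono mult_pos_pos) auto
  also have "\<dots> = 2 * s powr (-3/2)"
  proof -
    have "s powr (1/2) * s powr (1/2) * s powr (1/2) = s powr (1/2 + 1/2 + 1/2)"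
      by (simp only: powr_add)
    moreover have "s powr (-3/2) = 1 / s powr (3/2)" using powr_minus_divide[of s "3/2"] by simp
    ultimately show ?thesis by simp
  qed
  also have "\<dots> \<le> 2 * ((y^2 / 2) powr (-3/4) * majorant (m, n))"
    using majorant_bound_imag_axis[OF assms, of n] by (simp add: s_def M_def N_def)
  finally show ?thesis by simp
qed

text \<open>Twice Euler's sum pi^2 / 6, from the positive and the negative n.\<close>

lemma G2_row_0: "G2_row \<tau> 0 = of_real pi ^ 2 / 3"
proof -
  have "((\<lambda>n::int. 1 / (of_int n :: complex)^2) has_sum G2_row \<tau> 0) UNIV"
    unfolding G2_row_def
    using summable_on_inverse_square_row(1)[of \<i> 0] by simp
  hence "(\<lambda>N. \<Sum>n\<in>{-int N..int N}. 1 / (of_int n :: complex)^2) \<longlonglongrightarrow> G2_row \<tau> 0"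
    by (rule has_sum_int_symmetric)
  also have "(\<lambda>N. \<Sum>n\<in>{-int N..int N}. 1 / (of_int n :: complex)^2) =
     (\<lambda>N. of_real (2 * (\<Sum>n<N. 1 / (real n + 1)^2)))"
  proof
    fix N show "(\<Sum>n\<in>{-int N..int N}. 1 / (of_int n :: complex)^2) = of_real (2 * (\<Sum>n<N. 1 / (real n + 1)^2))"
    proof (induction N)
      case (Suc N)
      have "{-int (Suc N)..int (Suc N)} = insert (-int (Suc N)) (insert (int (Suc N)) {-int N..int N})"
        by auto
      hence "(\<Sum>n\<in>{-int (Suc N)..int (Suc N)}. 1 / (of_int n :: complex)^2) =
        1 / (of_int (-int (Suc N)) :: complex)^2 + (1 / (of_int (int (Suc N)) :: complex)^2 + (\<Sum>n\<in>{-int N..int N}. 1 / (of_int n :: complex)^2))"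
        by simp
      also have "\<dots> = 2 * (1 / (of_nat N + 1)^2) + (\<Sum>n\<in>{-int N..int N}. 1 / (of_int n :: complex)^2)"
      proof -
        have "(of_int (-int (Suc N)) :: complex)^2 = (of_nat N + 1)^2" "(of_int (int (Suc N)) :: complex)^2 = (of_nat N + 1)^2"
          by (simp_all add: power2_eq_square algebra_simps)
        thus ?thesis by (simp only:) simp
      qed
      finally show ?case using Suc by (simp add: algebra_simps)
    qed auto
  qed
  finally have "(\<lambda>N. complex_of_real (2 * (\<Sum>n<N. 1 / (real n + 1)^2))) \<longlonglongrightarrow> G2_row \<tau> 0" .
  moreover have "(\<lambda>N. complex_of_real (2 * (\<Sum>n<N. 1 / (real n + 1)^2))) \<longlonglongrightarrow> of_real (2 * (pi^2 / 6))"
  proof -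
    have "(\<lambda>n. 1 / real ((n + 1)\<^sup>2)) = (\<lambda>n. 1 / (real n + 1)^2)"
      by (simp add: fun_eq_iff add.commute)
    with inverse_squares_sums have "(\<lambda>N. \<Sum>n<N. 1 / (real n + 1)^2) \<longlonglongrightarrow> pi^2 / 6"
      unfolding sums_def by metis
    thus ?thesis by (intro tendsto_intros)
  qed
  ultimately have "G2_row \<tau> 0 = of_real (2 * (pi^2 / 6))" by (rule LIMSEQ_unique)
  thus ?thesis by simp
qed

lemma G2_imag_axis_limit: "((\<lambda>y. G2 (\<i> * of_real y)) \<longlongrightarrow> of_real pi ^ 2 / 3) at_top"
proof -
  define S where "S = infsum majorant UNIV"
  have bound: "norm (G2 (\<i> * of_real y) - of_real pi ^ 2 / 3) \<le> 2 * (y^2 / 2) powr (-3/4) * S" if y: "1 \<le> y" for y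
  proof -
    define \<tau> where "\<tau> = \<i> * of_real y"
    have im: "0 < Im \<tau>" using y by (simp add: \<tau>_def)
    let ?X = "{x::int \<times> int. fst x \<noteq> 0}"
    have b: "norm (G2_term \<tau> x) \<le> 2 * (y^2 / 2) powr (-3/4) * majorant x" if "x \<in> ?X" for x
      using norm_G2_term_imag_axis[of "fst x" y "snd x"] that y by (simp add: \<tau>_def)
    have "((\<lambda>n. G2_term \<tau> (0, n)) has_sum of_real pi ^ 2 / 3) UNIV"
      using G2_term_has_sum_row[OF im, of 0] by (simp add: G2_row_0)
    hence "(G2_term \<tau> has_sum of_real pi ^ 2 / 3) (range (\<lambda>n. (0, n)))"
      by (subst has_sum_reindex) (auto simp: inj_on_def o_def)
    moreover have "(G2_term \<tau> has_sum infsum (G2_term \<tau>) ?X) ?X"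
      using norm_lattice_infsum_le(1)[of ?X "G2_term \<tau>", OF b] by simp
    ultimately have "(G2_term \<tau> has_sum (of_real pi ^ 2 / 3 + infsum (G2_term \<tau>) ?X)) (range (\<lambda>n. (0, n)) \<union> ?X)"
      by (rule has_sum_Un_disjoint) auto
    also have "range (\<lambda>n. (0, n)) \<union> ?X = UNIV" by (auto simp: image_iff)
    finally have "G2 \<tau> = of_real pi ^ 2 / 3 + infsum (G2_term \<tau>) ?X"
      unfolding G2_def by (rule infsumI)
    thus ?thesis using norm_lattice_infsum_le(2)[of ?X "G2_term \<tau>", OF b] by (simp add: \<tau>_def S_def)
  qed
  have lim: "((\<lambda>y. 2 * (y^2 / 2) powr (-3/4) * S) \<longlongrightarrow> 0) at_top" by real_asymp
  have "((\<lambda>y. G2 (\<i> * of_real y) - of_real pi ^ 2 / 3) \<longlongrightarrow> 0) at_top"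
    by (rule Lim_null_comparison[OF _ lim])
       (use bound in \<open>auto intro!: eventually_mono[OF eventually_ge_at_top[of 1]]\<close>)
  thus ?thesis by (simp add: LIM_zero_iff)
qed

lemma G2_bounded_strip: "\<exists>C. \<forall>\<tau>. \<bar>Re \<tau>\<bar> \<le> 1 \<and> 1 \<le> Im \<tau> \<longrightarrow> norm (G2 \<tau>) \<le> C"
proof -
  obtain C where C: "0 < C" "\<And>x \<tau>. \<bar>Re \<tau>\<bar> \<le> 1 \<Longrightarrow> 1 \<le> Im \<tau> \<Longrightarrow> norm (G2_term \<tau> x) \<le> C * majorant x"
    using G2_term_majorant[of 1 1] by (metis zero_less_one)
  show ?thesis
    proof (intro exI allI impI)
    fix \<tau> :: complex assume "\<bar>Re \<tau>\<bar> \<le> 1 \<and> 1 \<le> Im \<tau>"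
    thus "norm (G2 \<tau>) \<le> C * infsum majorant UNIV"
      unfolding G2_def using C by (intro norm_lattice_infsum_le(2)) auto
  qed
qed

lemma uhp_translate_int:
  assumes "\<And>\<tau>. \<tau> \<in> \<H> \<Longrightarrow> f (\<tau> + 1) = f \<tau>" "\<tau> \<in> \<H>"
  shows "f (\<tau> + of_int n) = f (\<tau> :: complex)"
proof (induction n rule: int_induct[of _ 0])
  case (step1 i)
  have "f (\<tau> + of_int i + 1) = f (\<tau> + of_int i)" using assms by simp
  thus ?case using step1 by (simp add: add_ac)
next
  case (step2 i)
  have "f (\<tau> + of_int (i - 1) + 1) = f (\<tau> + of_int (i - 1))" using assms(2) by (intro assms(1)) simp
  moreover have "\<tau> + of_int (i - 1) + 1 = \<tau> + of_int i" by simp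
  ultimately show ?case using step2 by (simp only:)
qed simp

subsection \<open>Expansions at the cusp and the fourth power of the eta function\<close>

text \<open>A periodic function on the upper half plane whose growth at the cusp is strictly slower than
  \<open>1 / \<bar>q\<bar>\<close> is a holomorphic function of \<open>q\<close>, by Riemann's removable singularity theorem.\<close>

theorem q_expansion:
  fixes f :: "complex \<Rightarrow> complex"
  assumes hol: "f holomorphic_on \<H>" and per: "\<And>\<tau>. \<tau> \<in> \<H> \<Longrightarrow> f (\<tau> + 1) = f \<tau>"
    and \<theta>: "\<theta> < 1"
    and growth: "\<And>\<tau>. \<bar>Re \<tau>\<bar> \<le> 1 \<Longrightarrow> 1 \<le> Im \<tau> \<Longrightarrow> norm (f \<tau>) \<le> C * (1 + Im \<tau>) * exp (2 * pi * \<theta> * Im \<tau>)"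
  obtains g where "g holomorphic_on ball 0 1"
    "\<And>\<tau>. \<tau> \<in> \<H> \<Longrightarrow> f \<tau> = g (q_exp \<tau>)"
proof -
  define c where "c = 2 * of_real pi * \<i>"
  have c: "c \<noteq> 0" by (simp add: c_def)
  have Im_c: "Im (z / c) = - Re z / (2 * pi)" "Re (z / c) = Im z / (2 * pi)" for z
    by (simp_all add: c_def Im_divide Re_divide field_simps power2_eq_square)
  define h where "h q = f (Ln q / c)" for q
  have h_exp: "h (exp (c * \<tau>)) = f \<tau>" if "\<tau> \<in> \<H>" for \<tau>
  proof -
    have "exp (Ln (exp (c * \<tau>))) = exp (c * \<tau>)" by simp
    then obtain n where "Ln (exp (c * \<tau>)) = c * \<tau> + of_real (of_int (2 * n) * pi) * \<i>"
      unfolding exp_eq by blast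
    hence "Ln (exp (c * \<tau>)) / c = \<tau> + of_int n" by (simp add: c_def field_simps)
    thus ?thesis using uhp_translate_int[of f, OF per that] by (simp add: h_def)
  qed
  have in_H: "Ln q / c \<in> \<H>" if "q \<in> ball 0 1 - {0}" for q
  proof -
    have "Re (Ln q) < 0" using that by simp
    thus ?thesis using pi_gt_zero by (simp add: Im_c divide_neg_pos)
  qed
  have hol_h: "h holomorphic_on (ball 0 1 - {0})"
  proof -
    let ?A = "ball 0 1 - \<real>\<^sub>\<le>\<^sub>0 :: complex set" and ?B = "ball 0 1 - \<real>\<^sub>\<ge>\<^sub>0 :: complex set"
    have "?A \<subseteq> ball 0 1 - {0}" by auto
    hence "(\<lambda>q. Ln q / c) ` ?A \<subseteq> \<H>" using in_H by blast
    moreover have "(\<lambda>q. Ln q / c) holomorphic_on ?A" using c by (intro holomorphic_intros) auto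
    ultimately have "(f \<circ> (\<lambda>q. Ln q / c)) holomorphic_on ?A"
      by (intro holomorphic_on_compose_gen[OF _ hol])
    hence A: "h holomorphic_on ?A" by (simp add: h_def[abs_def] o_def)
    \<comment> \<open>Ln jumps across the negative axis. There the branch Ln (-q) + \<i> pi is used,
      which is the shift by 1/2 in \<tau>; periodicity of f makes both branches define the same
      \<open>h\<close>.\<close>
    have "(f \<circ> (\<lambda>q. Ln (- q) / c + 1 / 2)) holomorphic_on ?B"
    proof (rule holomorphic_on_compose_gen[OF _ hol])
      show "(\<lambda>q. Ln (- q) / c + 1 / 2) holomorphic_on ?B"
        using c by (intro holomorphic_intros)
           (auto simp: complex_nonpos_Reals_iff complex_nonneg_Reals_iff)
      show "(\<lambda>q. Ln (- q) / c + 1 / 2) ` ?B \<subseteq> \<H>"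
        using in_H[of "- _"] by force
    qed
    also have "?this \<longleftrightarrow> h holomorphic_on ?B"
    proof (rule holomorphic_cong)
      fix q assume q: "q \<in> ?B"
      hence q0: "q \<noteq> 0" "- q \<in> ball 0 1 - {0}" by auto
      let ?\<tau> = "Ln (- q) / c + 1 / 2"
      have "c * ?\<tau> = Ln (- q) + c / 2" using c by (simp add: distrib_left)
      hence "exp (c * ?\<tau>) = exp (Ln (- q) + of_real pi * \<i>)" by (simp add: c_def)
      also have "\<dots> = q" using q0 by (simp add: exp_add)
      finally have "h q = f ?\<tau>" using h_exp[of ?\<tau>] in_H[OF q0(2)] by simp
      thus "(f \<circ> (\<lambda>q. Ln (- q) / c + 1 / 2)) q = h q" by simp
    qed auto
    finally have B: "h holomorphic_on ?B" .
    have "h holomorphic_on (?A \<union> ?B)"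
      using A B by (intro holomorphic_on_Un) (auto intro!: open_Diff)
    also have "?A \<union> ?B = ball 0 1 - {0}"
      by (auto simp: complex_nonpos_Reals_iff complex_nonneg_Reals_iff complex_eq_iff)
    finally show ?thesis .
  qed
  have "((\<lambda>q. q * h q) \<longlongrightarrow> 0) (at 0)"
  proof (rule Lim_null_comparison)
    let ?Y = "\<lambda>q::complex. - ln (norm q) / (2 * pi)"
    \<comment> \<open>With y = -ln |q| / (2 pi), the factor |q| = exp (-2 pi y) beats the growth exp
      (2 pi \<theta> y) and leaves the decay rate a > 0.\<close>
    define a where "a = 2 * pi * (1 - \<theta>)"
    have a: "a > 0" using \<theta> by (simp add: a_def)
    have "filterlim (\<lambda>q::complex. norm q) (at_right 0) (at 0)"
      unfolding filterlim_at using tendsto_norm_zero[OF tendsto_ident_at]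
      by (auto simp: eventually_at_filter)
    hence "filterlim (\<lambda>q::complex. ln (norm q)) at_bot (at 0)"
      by (rule filterlim_compose[OF ln_at_0])
    hence Y: "filterlim ?Y at_top (at 0)"
    proof -
      have "filterlim (\<lambda>x::real. - x / (2 * pi)) at_top at_bot" by real_asymp
      from filterlim_compose[OF this \<open>filterlim (\<lambda>q::complex. ln (norm q)) at_bot (at 0)\<close>] show ?thesis .
    qed
    have "((\<lambda>y. C * (1 + y) * exp (- a * y)) \<longlongrightarrow> 0) at_top" using a by real_asymp
    from filterlim_compose[OF this Y]
    show "((\<lambda>q. C * (1 + ?Y q) * exp (- a * ?Y q)) \<longlongrightarrow> 0) (at (0::complex))" .
    have "norm (q * h q) \<le> C * (1 + ?Y q) * exp (- a * ?Y q)" if q: "q \<noteq> 0" "norm q < exp (- 2 * pi)" for q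
    proof -
      let ?\<tau> = "Ln q / c"
      have y: "Im ?\<tau> = ?Y q" "Re ?\<tau> = Im (Ln q) / (2 * pi)" using q by (simp_all add: Im_c)
      have "ln (norm q) < - 2 * pi" using q by (metis exp_less_cancel_iff exp_ln zero_less_norm_iff)
      hence 1: "1 \<le> Im ?\<tau>" unfolding y using pi_gt_zero by (simp add: field_simps)
      have "\<bar>Im (Ln q)\<bar> \<le> pi" using q mpi_less_Im_Ln[of q] Im_Ln_le_pi[of q] by linarith
      hence 2: "\<bar>Re ?\<tau>\<bar> \<le> 1" unfolding y by (simp add: field_simps)
      define u where "u = ?Y q"
      have nq: "norm q = exp (- 2 * pi * u)" using q by (simp add: u_def)
      have "norm (q * h q) = exp (- 2 * pi * u) * norm (f ?\<tau>)" by (simp add: norm_mult h_def nq)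
      also have "\<dots> \<le> exp (- 2 * pi * u) * (C * (1 + u) * exp (2 * pi * \<theta> * u))"
        using growth[OF 2 1] unfolding y u_def[symmetric] by (intro mult_left_mono) auto
      also have "\<dots> = C * (1 + u) * (exp (- 2 * pi * u) * exp (2 * pi * \<theta> * u))" by (simp only: mult_ac)
      also have "exp (- 2 * pi * u) * exp (2 * pi * \<theta> * u) = exp (- a * u)"
      proof -
        have "- 2 * pi * u + 2 * pi * \<theta> * u = - a * u" by (simp add: a_def algebra_simps)
        thus ?thesis by (simp only: exp_add[symmetric])
      qed
      also note u_def
      finally show ?thesis .
    qed
    thus "\<forall>\<^sub>F q in at 0. norm (q * h q) \<le> C * (1 + ?Y q) * exp (- a * ?Y q)"
      unfolding eventually_at by (intro exI[of _ "exp (- 2 * pi)"]) auto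
  qed
  hence "\<exists>g. g holomorphic_on ball 0 1 \<and> (\<forall>z\<in>ball 0 1 - {0}. g z = h z)"
    using hol_h by (subst holomorphic_on_extend_lim) auto
  then obtain g where g: "g holomorphic_on ball 0 1" "\<And>z. z \<in> ball 0 1 - {0} \<Longrightarrow> g z = h z" by blast
  show thesis
  proof (rule that[OF g(1)])
    fix \<tau> assume \<tau>: "\<tau> \<in> \<H>"
    hence "exp (c * \<tau>) \<in> ball 0 1 - {0}" by (simp add: c_def)
    from g(2)[OF this] h_exp[OF \<tau>] show "f \<tau> = g (q_exp \<tau>)"
      by (simp add: c_def)
  qed
qed

lemma norm_exp_2pi_i: "norm (q_pow \<l> \<tau>) = exp (- 2 * pi * (Re \<l> * Im \<tau> + Im \<l> * Re \<tau>))"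
  by (simp add: algebra_simps)

lemma bounded_on_cusp_strip_exp:
  assumes "g holomorphic_on ball 0 1"
  obtains C where "\<And>\<tau>. 1 \<le> Im \<tau> \<Longrightarrow> norm (g (q_exp \<tau>)) \<le> C"
proof -
  let ?K = "cball 0 (exp (- 2 * pi)) :: complex set"
  have "exp (- 2 * pi) < 1" by simp
  hence "?K \<subseteq> ball 0 1" by (auto simp del: exp_less_one_iff)
  hence "continuous_on ?K g"
    using assms holomorphic_on_imp_continuous_on holomorphic_on_subset by blast
  hence "compact (g ` ?K)" by (intro compact_continuous_image) auto
  then obtain C where C: "\<And>z. z \<in> g ` ?K \<Longrightarrow> norm z \<le> C"
    using compact_imp_bounded bounded_iff by metis
  show thesis
  proof (rule that[of C])
    fix \<tau> :: complex assume "1 \<le> Im \<tau>"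
    hence "q_exp \<tau> \<in> ?K" using pi_gt_zero by (auto simp: algebra_simps)
    thus "norm (g (q_exp \<tau>)) \<le> C" using C by blast
  qed
qed

lemma tendsto_exp_imag_axis:
  "((\<lambda>y. q_exp (\<i> * of_real y)) \<longlongrightarrow> (0::complex)) at_top"
proof -
  have "((\<lambda>y::real. exp (- 2 * pi * y)) \<longlongrightarrow> 0) at_top" by real_asymp
  hence "((\<lambda>y::real. complex_of_real (exp (- 2 * pi * y))) \<longlongrightarrow> of_real 0) at_top"
    by (intro tendsto_of_real)
  thus ?thesis by (simp add: exp_of_real[symmetric] algebra_simps)
qed

lemma q_expansion_imag_axis:
  assumes "g holomorphic_on ball 0 1"
  shows "((\<lambda>y. g (q_exp (\<i> * of_real y))) \<longlongrightarrow> g 0) at_top"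
proof -
  have "isCont g 0"
    using assms holomorphic_on_imp_continuous_on continuous_on_interior
    by (metis centre_in_ball interior_ball zero_less_one)
  from isCont_tendsto_compose[OF this tendsto_exp_imag_axis] show ?thesis .
qed

section \<open>Primitives, and the logarithm of the fourth eta power\<close>

lemma uhp_primitive:
  assumes "f holomorphic_on \<H>"
  obtains g where "\<And>\<tau>. \<tau> \<in> \<H> \<Longrightarrow> (g has_field_derivative f \<tau>) (at \<tau>)"
  using holomorphic_convex_primitive'[OF convex_uhp open_uhp assms]
  by (metis at_within_open open_uhp)

lemma uhp_constant:
  assumes "\<And>\<tau>. \<tau> \<in> \<H> \<Longrightarrow> (f has_field_derivative 0) (at \<tau>)"
  shows "\<exists>c. \<forall>\<tau>\<in>\<H>. f \<tau> = c"
  using has_field_derivative_zero_constant[OF convex_uhp, of f] assms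
  by (metis has_field_derivative_at_within)

lemma neg_inverse_in_uhp: "0 < Im \<tau> \<Longrightarrow> 0 < Im (- 1 / \<tau>)"
  by (auto simp: Im_divide add_nonneg_pos zero_less_divide_iff)

text \<open>For the classical eta function, eta' / eta is pi \<i> / 12 times E_2, and
  \<open>G2\<close> is pi^2 / 3 times E_2; the constant gives 4 eta' / eta. It makes the defect
  under inversion exactly 2 \<tau>.\<close>

definition eta4_logderiv :: "complex \<Rightarrow> complex" where
  "eta4_logderiv \<tau> = \<i> / of_real pi * G2 \<tau>"

lemma eta4_logderiv_holomorphic: "eta4_logderiv holomorphic_on \<H>"
  unfolding eta4_logderiv_def[abs_def] using G2_holomorphic by (intro holomorphic_intros)

lemma eta4_logderiv_translation: "0 < Im \<tau> \<Longrightarrow> eta4_logderiv (\<tau> + 1) = eta4_logderiv \<tau>"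
  by (simp add: eta4_logderiv_def G2_translation)

lemma eta4_logderiv_inversion:
  "0 < Im \<tau> \<Longrightarrow> eta4_logderiv (- 1 / \<tau>) = \<tau>^2 * eta4_logderiv \<tau> + 2 * \<tau>"
proof -
  assume "0 < Im \<tau>"
  hence "eta4_logderiv (- 1 / \<tau>) = \<tau>^2 * (\<i> / of_real pi * G2 \<tau>) - \<i> / of_real pi * (2 * \<i> * of_real pi * \<tau>)"
    unfolding eta4_logderiv_def by (subst G2_inversion) (auto simp: right_diff_distrib mult_ac)
  also have "\<i> / of_real pi * (2 * \<i> * of_real pi * \<tau>) = - (2 * \<tau>)" by simp
  finally show ?thesis by (simp add: eta4_logderiv_def)
qed

lemma eta4_logderiv_bounded: "\<exists>C. \<forall>\<tau>. \<bar>Re \<tau>\<bar> \<le> 1 \<and> 1 \<le> Im \<tau> \<longrightarrow> norm (eta4_logderiv \<tau>) \<le> C"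
proof -
  obtain C where "\<forall>\<tau>. \<bar>Re \<tau>\<bar> \<le> 1 \<and> 1 \<le> Im \<tau> \<longrightarrow> norm (G2 \<tau>) \<le> C" using G2_bounded_strip by blast
  thus ?thesis
    by (intro exI[of _ "C / pi"]) (auto simp: eta4_logderiv_def norm_mult norm_divide divide_right_mono)
qed

definition eta4_log :: "complex \<Rightarrow> complex" where
  "eta4_log = (SOME g. \<forall>\<tau>\<in>\<H>. (g has_field_derivative eta4_logderiv \<tau>) (at \<tau>))"

text \<open>The fourth power of Dedekind's eta function, up to a constant factor.\<close>

definition eta4 :: "complex \<Rightarrow> complex" where
  "eta4 \<tau> = (if \<tau> \<in> \<H> then exp (eta4_log \<tau>) else 0)"

lemma eta4_log_deriv: "\<tau> \<in> \<H> \<Longrightarrow> (eta4_log has_field_derivative eta4_logderiv \<tau>) (at \<tau>)"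
proof -
  have "\<exists>g. \<forall>\<tau>\<in>\<H>. (g has_field_derivative eta4_logderiv \<tau>) (at \<tau>)"
    using uhp_primitive[OF eta4_logderiv_holomorphic] by metis
  from someI_ex[OF this] show "\<tau> \<in> \<H> \<Longrightarrow> ?thesis" unfolding eta4_log_def by blast
qed

text \<open>The constant term pi \<i> / 3 of the logarithmic derivative integrates to the linear
  part, which makes \<open>eta4\<close> behave like q to the power 1/6. The remaining terms have a
  primitive in q.\<close>

lemma eta4_log_q_expansion:
  obtains P where "P holomorphic_on ball 0 1"
    "\<And>\<tau>. \<tau> \<in> \<H> \<Longrightarrow> eta4_log \<tau> = \<i> * of_real pi / 3 * \<tau> + P (q_exp \<tau>)"
proof -
  obtain C where C: "\<And>\<tau>. \<bar>Re \<tau>\<bar> \<le> 1 \<Longrightarrow> 1 \<le> Im \<tau> \<Longrightarrow> norm (eta4_logderiv \<tau>) \<le> C"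
    using eta4_logderiv_bounded by blast
  have "norm (eta4_logderiv \<tau>) \<le> \<bar>C\<bar> * (1 + Im \<tau>) * exp (2 * pi * 0 * Im \<tau>)"
    if "\<bar>Re \<tau>\<bar> \<le> 1" "1 \<le> Im \<tau>" for \<tau>
  proof -
    have "norm (eta4_logderiv \<tau>) \<le> \<bar>C\<bar> * 1" using C[OF that] by simp
    also have "\<dots> \<le> \<bar>C\<bar> * (1 + Im \<tau>)" using that by (intro mult_left_mono) auto
    finally show ?thesis by simp
  qed
  from q_expansion[OF eta4_logderiv_holomorphic _ zero_less_one this] eta4_logderiv_translation
  obtain g where g: "g holomorphic_on ball 0 1"
    "\<And>\<tau>. \<tau> \<in> \<H> \<Longrightarrow> eta4_logderiv \<tau> = g (q_exp \<tau>)"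
    by (metis mem_Collect_eq)
  have "((\<lambda>y. eta4_logderiv (\<i> * of_real y)) \<longlongrightarrow> \<i> / of_real pi * (of_real pi ^ 2 / 3)) at_top"
    unfolding eta4_logderiv_def by (intro tendsto_intros G2_imag_axis_limit)
  moreover have "((\<lambda>y. eta4_logderiv (\<i> * of_real y)) \<longlongrightarrow> g 0) at_top"
    by (rule Lim_transform_eventually[OF q_expansion_imag_axis[OF g(1)]])
       (use g(2) in \<open>auto intro!: eventually_mono[OF eventually_gt_at_top[of 0]]\<close>)
  ultimately have "\<i> / of_real pi * (of_real pi ^ 2 / 3) = g 0"
    by (intro tendsto_unique[OF _ _ _]) auto
  hence g0: "g 0 = \<i> * of_real pi / 3" by (simp add: power2_eq_square)
  \<comment> \<open>Since d\<tau> equals dq / (c q) with c = 2 pi \<i>, integrating g(q) - g(0) in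
    \<tau> means integrating its quotient by q, up to the factor 1 / c.\<close>
  define k where "k q = (if q = 0 then deriv g 0 else (g q - g 0) / (q - 0))" for q
  have "k holomorphic_on ball 0 1" unfolding k_def by (rule pole_lemma) (use g in auto)
  then obtain Q where Q: "\<And>q. q \<in> ball 0 1 \<Longrightarrow> (Q has_field_derivative k q) (at q within ball 0 1)"
    using holomorphic_convex_primitive'[of "ball 0 1" k] by auto
  define c where "c = 2 * of_real pi * \<i>"
  have c: "c \<noteq> 0" by (simp add: c_def)
  have "((\<lambda>\<tau>. eta4_log \<tau> - \<i> * of_real pi / 3 * \<tau> - Q (exp (c * \<tau>)) / c) has_field_derivative 0) (at \<tau>)"
    if \<tau>: "\<tau> \<in> \<H>" for \<tau>
  proof -
    let ?q = "exp (c * \<tau>)"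
    have q: "?q \<in> ball 0 1" "?q \<noteq> 0" using \<tau> by (simp_all add: c_def)
    have dQ: "(Q has_field_derivative k ?q) (at ?q)"
      using Q[OF q(1)] at_within_open[OF q(1)] by simp
    have "((\<lambda>\<tau>. eta4_log \<tau> - \<i> * of_real pi / 3 * \<tau> - Q (exp (c * \<tau>)) / c) has_field_derivative
        eta4_logderiv \<tau> - g 0 - k ?q * (c * exp (c * \<tau>)) / c) (at \<tau>)"
    proof -
      have 1: "((\<lambda>\<tau>. exp (c * \<tau>)) has_field_derivative c * exp (c * \<tau>)) (at \<tau>)"
        by (auto intro!: derivative_eq_intros)
      have 2: "((\<lambda>\<tau>. Q (exp (c * \<tau>))) has_field_derivative k ?q * (c * exp (c * \<tau>))) (at \<tau>)"
        using dQ 1 by (rule DERIV_chain2[where f = Q and g = "\<lambda>\<tau>. exp (c * \<tau>)"])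
      show ?thesis unfolding g0
        by (rule DERIV_diff[OF DERIV_diff[OF eta4_log_deriv[OF \<tau>] DERIV_cmult_Id] DERIV_cdivide[OF 2]])
    qed
    also have "eta4_logderiv \<tau> - g 0 - k ?q * (c * exp (c * \<tau>)) / c = 0"
      using c q g(2)[OF \<tau>] by (simp add: k_def c_def)
    finally show ?thesis .
  qed
  from uhp_constant[OF this]
  obtain b where b: "\<And>\<tau>. \<tau> \<in> \<H> \<Longrightarrow> eta4_log \<tau> - \<i> * of_real pi / 3 * \<tau> - Q (exp (c * \<tau>)) / c = b"
    by blast
  have "Q holomorphic_on ball 0 1" unfolding holomorphic_on_def field_differentiable_def using Q by blast
  hence "(\<lambda>q. Q q / c + b) holomorphic_on ball 0 1" using c by (intro holomorphic_intros) auto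
  moreover have "eta4_log \<tau> = \<i> * of_real pi / 3 * \<tau> + (Q (q_exp \<tau>) / c + b)"
    if "\<tau> \<in> \<H>" for \<tau>
    using b[OF that] unfolding c_def[symmetric] by (simp add: algebra_simps)
  ultimately show thesis using that by blast
qed

lemma eta4_nonzero: "\<tau> \<in> \<H> \<Longrightarrow> eta4 \<tau> \<noteq> 0"
  by (simp add: eta4_def)

lemma eta4_has_deriv: "\<tau> \<in> \<H> \<Longrightarrow> (eta4 has_field_derivative eta4_logderiv \<tau> * eta4 \<tau>) (at \<tau>)"
proof -
  assume \<tau>: "\<tau> \<in> \<H>"
  have "((\<lambda>\<tau>. exp (eta4_log \<tau>)) has_field_derivative eta4_logderiv \<tau> * eta4 \<tau>) (at \<tau>)"
    using \<tau> by (auto intro!: derivative_eq_intros eta4_log_deriv simp: eta4_def)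
  thus ?thesis
    by (rule has_field_derivative_transform_within_open[OF _ open_uhp \<tau>]) (simp add: eta4_def)
qed

lemma eta4_holomorphic: "eta4 holomorphic_on \<H>"
  using eta4_has_deriv unfolding holomorphic_on_open[OF open_uhp] by blast

lemma eta4_translation: "\<tau> \<in> \<H> \<Longrightarrow> eta4 (\<tau> + 1) = exp (\<i> * of_real pi / 3) * eta4 \<tau>"
proof -
  assume \<tau>: "\<tau> \<in> \<H>"
  obtain P where P: "\<And>\<tau>. \<tau> \<in> \<H> \<Longrightarrow> eta4_log \<tau> = \<i> * of_real pi / 3 * \<tau> + P (q_exp \<tau>)"
    using eta4_log_q_expansion by metis
  have "q_exp (\<tau> + 1) = q_exp \<tau>"
    by (simp add: ring_distribs exp_add mult_ac)
  hence "eta4_log (\<tau> + 1) = \<i> * of_real pi / 3 + eta4_log \<tau>"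
    using P[of \<tau>] P[of "\<tau> + 1"] \<tau> by (simp add: algebra_simps)
  thus ?thesis using \<tau> by (simp add: eta4_def exp_add)
qed

lemma eta4_inversion: "\<tau> \<in> \<H> \<Longrightarrow> eta4 (- 1 / \<tau>) = - (\<tau>^2) * eta4 \<tau>"
proof -
  assume \<tau>: "\<tau> \<in> \<H>"
  have "((\<lambda>\<tau>. eta4_log (- 1 / \<tau>) - eta4_log \<tau> - 2 * Ln \<tau>) has_field_derivative 0) (at \<tau>)" if \<tau>: "\<tau> \<in> \<H>" for \<tau>
  proof -
    have \<tau>': "- 1 / \<tau> \<in> \<H>" using neg_inverse_in_uhp \<tau> by simp
    have nz: "\<tau> \<noteq> 0" "\<tau> \<notin> \<real>\<^sub>\<le>\<^sub>0" using \<tau> by (auto simp: complex_nonpos_Reals_iff)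
    have i: "((\<lambda>\<tau>. - 1 / \<tau>) has_field_derivative 1 / \<tau>^2) (at \<tau>)"
      using nz by (auto intro!: derivative_eq_intros simp: power2_eq_square)
    have "((\<lambda>\<tau>. eta4_log (- 1 / \<tau>) - eta4_log \<tau> - 2 * Ln \<tau>) has_field_derivative
        eta4_logderiv (- 1 / \<tau>) * (1 / \<tau>^2) - eta4_logderiv \<tau> - 2 * inverse \<tau>) (at \<tau>)"
    proof -
      have "((\<lambda>\<tau>. eta4_log (- 1 / \<tau>)) has_field_derivative eta4_logderiv (- 1 / \<tau>) * (1 / \<tau>^2)) (at \<tau>)"
        using eta4_log_deriv[OF \<tau>'] i by (rule DERIV_chain2[where f = eta4_log and g = "\<lambda>\<tau>. - 1 / \<tau>"])
      thus ?thesis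
        by (rule DERIV_diff[OF DERIV_diff[OF _ eta4_log_deriv[OF \<tau>]] DERIV_cmult[OF has_field_derivative_Ln[OF nz(2)]]])
    qed
    also have "eta4_logderiv (- 1 / \<tau>) * (1 / \<tau>^2) - eta4_logderiv \<tau> - 2 * inverse \<tau> = 0"
    proof -
      have "eta4_logderiv (- 1 / \<tau>) = \<tau>^2 * eta4_logderiv \<tau> + 2 * \<tau>"
        using eta4_logderiv_inversion \<tau> by simp
      thus ?thesis using nz(1) by (simp only:) (simp add: power2_eq_square field_simps)
    qed
    finally show ?thesis .
  qed
  from uhp_constant[OF this]
  obtain c where c: "\<And>\<tau>. \<tau> \<in> \<H> \<Longrightarrow> eta4_log (- 1 / \<tau>) - eta4_log \<tau> - 2 * Ln \<tau> = c"
    by blast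
  \<comment> \<open>At the fixed point \<i> the two values of the logarithm cancel, and c = -2 Ln
    \<i> = -\<i> pi. This is the origin of the minus sign.\<close>
  have "- 1 / \<i> = \<i>" by (simp add: complex_eq_iff)
  with c[of \<i>] have "c = - (\<i> * of_real pi)" by simp
  hence "eta4_log (- 1 / \<tau>) = eta4_log \<tau> + 2 * Ln \<tau> - \<i> * of_real pi" using c[OF \<tau>] by (simp add: algebra_simps)
  moreover have "\<tau> \<noteq> 0" using \<tau> by auto
  moreover have "- 1 / \<tau> \<in> \<H>" using neg_inverse_in_uhp \<tau> by simp
  ultimately show ?thesis
    using \<tau> by (simp add: eta4_def exp_add exp_diff exp_double mult.commute[of \<i>])
qed

text \<open>The upper bound controls products with powers of \<open>eta4\<close>, the lower one
  quotients by them. The rate pi / 3 corresponds to |q| to the power 1/6.\<close>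

lemma eta4_bounds:
  obtains a b where "0 < a"
    "\<And>\<tau>. 1 \<le> Im \<tau> \<Longrightarrow> a * exp (- pi / 3 * Im \<tau>) \<le> norm (eta4 \<tau>)"
    "\<And>\<tau>. 1 \<le> Im \<tau> \<Longrightarrow> norm (eta4 \<tau>) \<le> b * exp (- pi / 3 * Im \<tau>)"
proof -
  obtain P where P: "P holomorphic_on ball 0 1"
    "\<And>\<tau>. \<tau> \<in> \<H> \<Longrightarrow> eta4_log \<tau> = \<i> * of_real pi / 3 * \<tau> + P (q_exp \<tau>)"
    using eta4_log_q_expansion by metis
  obtain C where C: "\<And>\<tau>. 1 \<le> Im \<tau> \<Longrightarrow> norm (P (q_exp \<tau>)) \<le> C"
    using bounded_on_cusp_strip_exp[OF P(1)] by metis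
  have n: "norm (eta4 \<tau>) = exp (Re (P (q_exp \<tau>))) * exp (- pi / 3 * Im \<tau>)" if "1 \<le> Im \<tau>" for \<tau>
  proof -
    have "norm (eta4 \<tau>) = exp (Re (\<i> * of_real pi / 3 * \<tau> + P (q_exp \<tau>)))"
      using that P(2)[of \<tau>] by (simp add: eta4_def)
    also have "\<dots> = exp (Re (P (q_exp \<tau>)) + (- pi / 3 * Im \<tau>))"
      by simp
    finally show ?thesis by (simp only: exp_add)
  qed
  have re: "\<bar>Re (P (q_exp \<tau>))\<bar> \<le> C" if "1 \<le> Im \<tau>" for \<tau>
    using abs_Re_le_cmod C[OF that] order_trans by blast
  show thesis
  proof (rule that[of "exp (- C)" "exp C"])
    fix \<tau> :: complex assume \<tau>: "1 \<le> Im \<tau>"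
    show "exp (- C) * exp (- pi / 3 * Im \<tau>) \<le> norm (eta4 \<tau>)" "norm (eta4 \<tau>) \<le> exp C * exp (- pi / 3 * Im \<tau>)"
      unfolding n[OF \<tau>] using re[OF \<tau>] by (auto intro!: mult_right_mono)
  qed auto
qed

subsection \<open>Eisenstein series of higher weight\<close>

definition coprime_pairs :: "(int \<times> int) set" where
  "coprime_pairs = {(c, d). coprime c d}"

definition eis_term :: "nat \<Rightarrow> complex \<Rightarrow> int \<times> int \<Rightarrow> complex" where
  "eis_term k \<tau> = (\<lambda>(c, d). 1 / (of_int c * \<tau> + of_int d) ^ k)"

lemma eisenstein_altdef:
  "eisenstein k \<tau> = (if \<tau> \<in> \<H> then infsum (eis_term k \<tau>) coprime_pairs / 2 else 0)"
  by (simp add: eisenstein_def eis_term_def coprime_pairs_def)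

lemma coprime_pairs_nonzero: "(c, d) \<in> coprime_pairs \<Longrightarrow> (c, d) \<noteq> (0, 0)"
  by (auto simp: coprime_pairs_def)

lemma power_inverse_le_powr:
  fixes s :: real
  assumes "1 \<le> s" "2 \<le> j"
  shows "1 / s ^ j \<le> s powr (-3/2)"
proof -
  have "1 / s ^ j = s powr (- real j)"
    using assms by (simp add: powr_minus_divide powr_realpow)
  also have "\<dots> \<le> s powr (-3/2)" using assms by (intro powr_mono) auto
  finally show ?thesis .
qed

lemma eis_term_majorant:
  assumes "0 < \<epsilon>" "2 \<le> j"
  obtains C where "0 < C" "\<And>x \<tau>. \<bar>Re \<tau>\<bar> \<le> B \<Longrightarrow> \<epsilon> \<le> Im \<tau> \<Longrightarrow> x \<noteq> (0, 0) \<Longrightarrow>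
    norm (eis_term (2 * j) \<tau> x) \<le> C * majorant x"
proof -
  obtain K where K: "0 < K"
    "\<And>m n \<tau>. \<bar>Re \<tau>\<bar> \<le> B \<Longrightarrow> \<epsilon> \<le> Im \<tau> \<Longrightarrow>
       K * of_int (m^2 + n^2) \<le> (norm (of_int m * \<tau> + of_int n :: complex))^2"
    using lattice_lower_bound_obtain[OF assms(1)] by metis
  show thesis
  proof (rule that[of "1 / K ^ j * (4/9) powr (-3/4)"])
    show "0 < 1 / K ^ j * (4/9) powr (-3/4)" using K by simp
    fix x :: "int \<times> int" and \<tau> assume \<tau>: "\<bar>Re \<tau>\<bar> \<le> B" "\<epsilon> \<le> Im \<tau>" and x: "x \<noteq> (0, 0)"
    obtain m n where mn: "x = (m, n)" by force
    define s where "s = real_of_int (m^2 + n^2)"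
    have s: "1 \<le> s" using sum_real_int_square_ge_1[of m n] x mn by (simp add: s_def)
    have "norm (eis_term (2 * j) \<tau> x) = 1 / ((norm (of_int m * \<tau> + of_int n))^2) ^ j"
      by (simp add: eis_term_def mn norm_divide norm_power power_mult)
    also have "\<dots> \<le> 1 / (K * s) ^ j"
    proof -
      have "0 < K * s" using K s by simp
      moreover have "K * s \<le> (norm (of_int m * \<tau> + of_int n))^2" using K(2)[OF \<tau>] unfolding s_def .
      ultimately show ?thesis by (intro frac_le power_mono) auto
    qed
    also have "\<dots> = 1 / K ^ j * (1 / s ^ j)" by (simp add: power_mult_distrib)
    also have "\<dots> \<le> 1 / K ^ j * (s powr (-3/2))"
      using K power_inverse_le_powr[OF s assms(2)] by (intro mult_left_mono) auto
    also have "\<dots> \<le> 1 / K ^ j * ((4/9) powr (-3/4) * majorant x)"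
      using K majorant_bound[of m n 1 s] x by (intro mult_left_mono) (auto simp: s_def mn)
    finally show "norm (eis_term (2 * j) \<tau> x) \<le> 1 / K ^ j * (4/9) powr (-3/4) * majorant x"
      by (simp add: mult.assoc)
  qed
qed

lemma eisenstein_holomorphic:
  assumes "2 \<le> j" shows "eisenstein (2 * j) holomorphic_on \<H>"
proof -
  have "(\<lambda>\<tau>. infsum (eis_term (2 * j) \<tau>) coprime_pairs) holomorphic_on \<H>"
  proof (rule holomorphic_on_lattice_infsum)
    fix x assume x: "x \<in> coprime_pairs"
    obtain m n where mn: "x = (m, n)" by force
    have "of_int m * \<tau> + of_int n \<noteq> 0" if "\<tau> \<in> \<H>" for \<tau>
      using lattice_nonzero[of \<tau> m n] coprime_pairs_nonzero[of m n] x mn that by simp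
    thus "(\<lambda>\<tau>. eis_term (2 * j) \<tau> x) holomorphic_on \<H>"
      unfolding eis_term_def mn prod.case by (auto intro!: holomorphic_intros)
  next
    fix B \<epsilon> :: real assume "0 < \<epsilon>"
    then obtain C where C: "\<And>x \<tau>. \<bar>Re \<tau>\<bar> \<le> B \<Longrightarrow> \<epsilon> \<le> Im \<tau> \<Longrightarrow> x \<noteq> (0, 0) \<Longrightarrow>
        norm (eis_term (2 * j) \<tau> x) \<le> C * majorant x"
      using eis_term_majorant[OF _ assms, of \<epsilon> B] by metis
    show "\<exists>C. \<forall>\<tau> x. \<bar>Re \<tau>\<bar> \<le> B \<and> \<epsilon> \<le> Im \<tau> \<and> x \<in> coprime_pairs \<longrightarrow>
        norm (eis_term (2 * j) \<tau> x) \<le> C * majorant x"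
    proof (intro exI allI impI)
      fix \<tau> x assume *: "\<bar>Re \<tau>\<bar> \<le> B \<and> \<epsilon> \<le> Im \<tau> \<and> x \<in> coprime_pairs"
      hence "x \<noteq> (0, 0)" using coprime_pairs_nonzero by (cases x) auto
      with * C show "norm (eis_term (2 * j) \<tau> x) \<le> C * majorant x" by blast
    qed
  qed
  hence "(\<lambda>\<tau>. infsum (eis_term (2 * j) \<tau>) coprime_pairs / 2) holomorphic_on \<H>"
    by (intro holomorphic_intros) auto
  thus ?thesis by (rule holomorphic_transform) (simp add: eisenstein_altdef)
qed

lemma eisenstein_bounded:
  assumes "2 \<le> j"
  shows "\<exists>C. \<forall>\<tau>. \<bar>Re \<tau>\<bar> \<le> 1 \<and> 1 \<le> Im \<tau> \<longrightarrow> norm (eisenstein (2 * j) \<tau>) \<le> C"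
proof -
  obtain C where C: "0 < C" "\<And>x \<tau>. \<bar>Re \<tau>\<bar> \<le> 1 \<Longrightarrow> 1 \<le> Im \<tau> \<Longrightarrow> x \<noteq> (0, 0) \<Longrightarrow>
        norm (eis_term (2 * j) \<tau> x) \<le> C * majorant x"
    using eis_term_majorant[OF zero_less_one assms, of 1] by metis
  show ?thesis
  proof (intro exI allI impI)
    fix \<tau> :: complex assume *: "\<bar>Re \<tau>\<bar> \<le> 1 \<and> 1 \<le> Im \<tau>"
    have "norm (eis_term (2 * j) \<tau> x) \<le> C * majorant x" if "x \<in> coprime_pairs" for x
      using C(2)[of \<tau> x] * that coprime_pairs_nonzero by (cases x) auto
    from norm_lattice_infsum_le(2)[OF this, of coprime_pairs] C(1)
    show "norm (eisenstein (2 * j) \<tau>) \<le> C * infsum majorant UNIV / 2"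
      using * by (simp add: eisenstein_altdef norm_divide)
  qed
qed

lemma eisenstein_translation:
  assumes "\<tau> \<in> \<H>" shows "eisenstein k (\<tau> + 1) = eisenstein k \<tau>"
proof -
  have "infsum (eis_term k (\<tau> + 1)) coprime_pairs = infsum (eis_term k \<tau>) coprime_pairs"
  proof (rule infsum_reindex_bij_witness[of _ "\<lambda>(m, n). (m, n - m)" "\<lambda>(m, n). (m, n + m)"])
    show "eis_term k \<tau> (case x of (m, n) \<Rightarrow> (m, n + m)) = eis_term k (\<tau> + 1) x" for x
      by (cases x) (simp add: eis_term_def algebra_simps)
  next
    have *: "coprime m (n + m) \<longleftrightarrow> coprime m n" for m n :: int
      by (metis add.commute coprime_iff_gcd_eq_1 gcd_add2)
    show "(case x of (m, n) \<Rightarrow> (m, n + m)) \<in> coprime_pairs" if "x \<in> coprime_pairs" for x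
      using that * by (cases x) (simp add: coprime_pairs_def)
    show "(case x of (m, n) \<Rightarrow> (m, n - m)) \<in> coprime_pairs" if "x \<in> coprime_pairs" for x
      using that *[of "fst x" "snd x - fst x"] by (cases x) (simp add: coprime_pairs_def)
  qed auto
  thus ?thesis using assms by (simp add: eisenstein_altdef)
qed

lemma eisenstein_inversion:
  assumes "\<tau> \<in> \<H>" shows "eisenstein k (- 1 / \<tau>) = \<tau> ^ k * eisenstein k \<tau>"
proof -
  have \<tau>: "\<tau> \<noteq> 0" using assms by auto
  have "infsum (eis_term k (- 1 / \<tau>)) coprime_pairs = (\<Sum>\<^sub>\<infinity>x\<in>coprime_pairs. \<tau> ^ k * eis_term k \<tau> x)"
  proof (rule infsum_reindex_bij_witness[of _ "\<lambda>(m, n). (- n, m)" "\<lambda>(m, n). (n, - m)"])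
    show "\<tau> ^ k * eis_term k \<tau> (case x of (m, n) \<Rightarrow> (n, - m)) = eis_term k (- 1 / \<tau>) x" for x
    proof -
      obtain m n where x: "x = (m, n)" by force
      have "of_int n * \<tau> + of_int (- m) = \<tau> * (of_int m * (- 1 / \<tau>) + of_int n)"
        using \<tau> by (simp add: field_simps)
      thus ?thesis using \<tau> by (simp add: eis_term_def x power_mult_distrib)
    qed
  qed (auto simp: coprime_pairs_def coprime_commute)
  also have "\<dots> = \<tau> ^ k * infsum (eis_term k \<tau>) coprime_pairs"
    using \<tau> by (simp add: infsum_cmult_right')
  finally have "infsum (eis_term k (- 1 / \<tau>)) coprime_pairs = \<tau> ^ k * infsum (eis_term k \<tau>) coprime_pairs" .
  thus ?thesis
    using assms neg_inverse_in_uhp[of \<tau>] unfolding eisenstein_altdef by simp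
qed

text \<open>Coprimality leaves only (0, 1) and (0, -1) in the row c = 0. They contribute 2, which
  the normalisation halves to 1.\<close>

lemma eisenstein_imag_axis_limit:
  assumes "2 \<le> j"
  shows "((\<lambda>y. eisenstein (2 * j) (\<i> * of_real y)) \<longlongrightarrow> 1) at_top"
proof -
  define S where "S = infsum majorant UNIV"
  let ?X = "{x \<in> coprime_pairs. fst x \<noteq> 0}"
  have bound: "norm (eisenstein (2 * j) (\<i> * of_real y) - 1) \<le> (y^2 / 2) powr (-3/4) * S / 2" if y: "1 \<le> y" for y
  proof -
    define \<tau> where "\<tau> = \<i> * of_real y"
    have b: "norm (eis_term (2 * j) \<tau> x) \<le> (y^2 / 2) powr (-3/4) * majorant x" if "x \<in> ?X" for x
    proof -
      obtain m n where x: "x = (m, n)" by force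
      hence m: "m \<noteq> 0" using that by simp
      define s where "s = real_of_int (m^2) * y^2 + of_int (n^2)"
      have "1 \<le> (real_of_int m)^2" using sum_real_int_square_ge_1[of m 0] m by simp
      from mult_mono[OF this, of 1 "y^2"] y have s: "1 \<le> s" by (simp add: s_def add_increasing2)
      have "(norm (of_int m * \<tau> + of_int n))^2 = s"
        by (simp add: \<tau>_def s_def cmod_power2 power_mult_distrib)
      hence "norm (eis_term (2 * j) \<tau> x) = 1 / s ^ j"
        by (simp add: eis_term_def x norm_divide norm_power power_mult)
      also have "\<dots> \<le> s powr (-3/2)" by (rule power_inverse_le_powr[OF s assms])
      also have "\<dots> \<le> (y^2 / 2) powr (-3/4) * majorant (m, n)"
        unfolding s_def by (rule majorant_bound_imag_axis[OF m y])
      finally show ?thesis by (simp only: x)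
    qed
    have "(eis_term (2 * j) \<tau> has_sum (\<Sum>x\<in>{(0, 1), (0, -1)}. eis_term (2 * j) \<tau> x)) {(0, 1), (0, -1)}"
      by (rule has_sum_finite) auto
    hence "(eis_term (2 * j) \<tau> has_sum 2) {(0, 1), (0, -1)}"
      by (simp add: eis_term_def)
    moreover have "(eis_term (2 * j) \<tau> has_sum infsum (eis_term (2 * j) \<tau>) ?X) ?X"
      using norm_lattice_infsum_le(1)[of ?X "eis_term (2 * j) \<tau>", OF b] by simp
    ultimately have "(eis_term (2 * j) \<tau> has_sum (2 + infsum (eis_term (2 * j) \<tau>) ?X)) ({(0, 1), (0, -1)} \<union> ?X)"
      by (rule has_sum_Un_disjoint) auto
    also have "{(0, 1), (0, -1)} \<union> ?X = coprime_pairs"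
      by (auto simp: coprime_pairs_def abs_if split: if_splits)
    finally have "infsum (eis_term (2 * j) \<tau>) coprime_pairs = 2 + infsum (eis_term (2 * j) \<tau>) ?X"
      by (rule infsumI)
    hence "eisenstein (2 * j) \<tau> - 1 = infsum (eis_term (2 * j) \<tau>) ?X / 2"
      using y by (simp add: eisenstein_altdef \<tau>_def add_divide_distrib)
    hence "norm (eisenstein (2 * j) \<tau> - 1) = norm (infsum (eis_term (2 * j) \<tau>) ?X) / 2"
      by (simp only: norm_divide) simp
    thus ?thesis
      using norm_lattice_infsum_le(2)[of ?X "eis_term (2 * j) \<tau>", OF b] unfolding \<tau>_def S_def by simp
  qed
  have lim: "((\<lambda>y. (y^2 / 2) powr (-3/4) * S / 2) \<longlongrightarrow> 0) at_top" by real_asymp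
  have "((\<lambda>y. eisenstein (2 * j) (\<i> * of_real y) - 1) \<longlongrightarrow> 0) at_top"
    by (rule Lim_null_comparison[OF _ lim])
       (use bound in \<open>auto intro!: eventually_mono[OF eventually_ge_at_top[of 1]]\<close>)
  thus ?thesis by (simp add: LIM_zero_iff)
qed

subsection \<open>Generators of the modular group\<close>

no_notation fps_nth (infixl "$" 75)

lemma matrix_mult_2_2:
  fixes A B :: "'a::semiring_1^2^2"
  shows "(A ** B) $ i $ j = A $ i $ 1 * B $ 1 $ j + A $ i $ 2 * B $ 2 $ j"
  by (simp add: matrix_matrix_mult_def sum_2)

lemma matrix_eq_2_2:
  fixes A B :: "'a^2^2"
  shows "A = B \<longleftrightarrow> A $ 1 $ 1 = B $ 1 $ 1 \<and> A $ 1 $ 2 = B $ 1 $ 2 \<and> A $ 2 $ 1 = B $ 2 $ 1 \<and> A $ 2 $ 2 = B $ 2 $ 2"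
  by (auto simp: vec_eq_iff forall_2)

lemma mat_2_2 [simp]:
  "(mat c :: 'a::zero^2^2) $ 1 $ 1 = c" "(mat c :: 'a::zero^2^2) $ 1 $ 2 = 0"
  "(mat c :: 'a::zero^2^2) $ 2 $ 1 = 0" "(mat c :: 'a::zero^2^2) $ 2 $ 2 = c"
  by (simp_all add: mat_def)

definition S_mat :: "int^2^2" where
  "S_mat = vector [vector [0, -1], vector [1, 0]]"

definition T_power :: "int \<Rightarrow> int^2^2" where
  "T_power n = vector [vector [1, n], vector [0, 1]]"

lemma S_mat_entries [simp]: "S_mat $ 1 $ 1 = 0" "S_mat $ 1 $ 2 = -1" "S_mat $ 2 $ 1 = 1" "S_mat $ 2 $ 2 = 0"
  by (simp_all add: S_mat_def)

lemma T_power_entries [simp]: "T_power n $ 1 $ 1 = 1" "T_power n $ 1 $ 2 = n" "T_power n $ 2 $ 1 = 0" "T_power n $ 2 $ 2 = 1"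
  by (simp_all add: T_power_def)

lemma T_power_1: "T_power 1 = T_mat"
  by (simp add: T_power_def T_mat_def)

lemma T_power_add: "T_power (m + n) = T_power m ** T_power n"
  by (simp add: matrix_eq_2_2 matrix_mult_2_2)

lemma T_power_0: "T_power 0 = mat 1"
  by (simp add: matrix_eq_2_2)

lemma SL2Z_iff: "g \<in> SL2Z \<longleftrightarrow> g $ 1 $ 1 * g $ 2 $ 2 - g $ 1 $ 2 * g $ 2 $ 1 = 1"
  by (simp add: SL2Z_def det_2)

lemma S_mat_in_SL2Z [simp]: "S_mat \<in> SL2Z" and T_power_in_SL2Z [simp]: "T_power n \<in> SL2Z"
  and mat_1_in_SL2Z [simp]: "mat 1 \<in> SL2Z" and minus_mat_1_in_SL2Z [simp]: "- mat 1 \<in> SL2Z"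
  by (simp_all add: SL2Z_iff)

lemma T_mat_in_SL2Z [simp]: "T_mat \<in> SL2Z"
  using T_power_in_SL2Z[of 1] by (simp only: T_power_1)

lemma SL2Z_mult [simp]: "g \<in> SL2Z \<Longrightarrow> h \<in> SL2Z \<Longrightarrow> g ** h \<in> SL2Z"
  by (simp add: SL2Z_def det_mul)

lemma S_mat_squared: "S_mat ** S_mat = - mat 1"
  by (simp add: matrix_eq_2_2 matrix_mult_2_2)

text \<open>In the induction below this undoes a factor S by multiplying with S three more
  times.\<close>

lemma S_mat_fourth:
  fixes g :: "int^2^2"
  shows "S_mat ** (S_mat ** (S_mat ** (S_mat ** g))) = g"
  by (simp add: matrix_eq_2_2 matrix_mult_2_2)

text \<open>Euclid's algorithm on the first column: a power of T reduces the upper left entry modulo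
  the lower left one, and S moves the remainder to the lower left, whose absolute value is the
  induction measure.\<close>

lemma SL2Z_induct [consumes 1, case_names one S T Tinv]:
  assumes g: "g \<in> SL2Z" and one: "P (mat 1)"
    and S: "\<And>g. g \<in> SL2Z \<Longrightarrow> P g \<Longrightarrow> P (S_mat ** g)"
    and T: "\<And>g. g \<in> SL2Z \<Longrightarrow> P g \<Longrightarrow> P (T_mat ** g)"
    and Tinv: "\<And>g. g \<in> SL2Z \<Longrightarrow> P g \<Longrightarrow> P (T_power (-1) ** g)"
  shows "P g"
proof -
  have T_power: "P (T_power n ** g)" if "g \<in> SL2Z" "P g" for g n
  proof (induction n rule: int_induct[of _ 0])
    case base
    thus ?case using that by (simp add: T_power_0)
  next
    case (step1 i)
    have "P (T_mat ** (T_power i ** g))" using step1 that by (intro T) auto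
    thus ?case using T_power_add[of 1 i] by (simp add: T_power_1 matrix_mul_assoc add.commute)
  next
    case (step2 i)
    have "P (T_power (-1) ** (T_power i ** g))" using step2 that by (intro Tinv) auto
    thus ?case using T_power_add[of "-1" i] by (simp add: matrix_mul_assoc)
  qed
  show ?thesis using g
  proof (induction "nat \<bar>g $ 2 $ 1\<bar>" arbitrary: g rule: less_induct)
    case less
    define a b c d where "a = g $ 1 $ 1" and "b = g $ 1 $ 2" and "c = g $ 2 $ 1" and "d = g $ 2 $ 2"
    note defs = a_def b_def c_def d_def
    have det: "a * d - b * c = 1" using less.prems by (simp add: SL2Z_iff defs)
    show ?case
    proof (cases "c = 0")
      case True
      hence "a * d = 1" using det by simp
      hence "a = 1 \<and> d = 1 \<or> a = -1 \<and> d = -1" using zmult_eq_1_iff by blast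
      thus ?thesis
      proof
        assume "a = 1 \<and> d = 1"
        hence "g = T_power b ** mat 1" using True by (simp add: matrix_eq_2_2 flip: defs)
        thus ?thesis using T_power[OF mat_1_in_SL2Z one] by metis
      next
        assume "a = -1 \<and> d = -1"
        hence "g = S_mat ** (S_mat ** (T_power (- b) ** mat 1))"
          using True by (simp add: matrix_eq_2_2 matrix_mult_2_2 flip: defs)
        moreover have "P (S_mat ** (S_mat ** (T_power (- b) ** mat 1)))"
          by (intro S T_power one) auto
        ultimately show ?thesis by metis
      qed
    next
      case False
      define q where "q = a div c"
      define h where "h = T_power (- q) ** g"
      have h: "h \<in> SL2Z" using less.prems by (simp add: h_def)
      have "(S_mat ** h) $ 2 $ 1 = a mod c"
        by (simp add: h_def matrix_mult_2_2 q_def minus_div_mult_eq_mod flip: defs)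
      moreover have "\<bar>a mod c\<bar> < \<bar>c\<bar>" using False by (rule abs_mod_less)
      ultimately have "P (S_mat ** h)" using h by (intro less.hyps) (auto simp: c_def)
      hence "P (S_mat ** (S_mat ** (S_mat ** (S_mat ** h))))"
        using h by (metis S S_mat_in_SL2Z SL2Z_mult)
      hence "P h" by (simp only: S_mat_fourth)
      hence "P (T_power q ** h)" using h by (intro T_power)
      moreover have "T_power q ** h = g"
      proof -
        have "T_power q ** h = (T_power q ** T_power (- q)) ** g" by (simp only: h_def matrix_mul_assoc)
        also have "T_power q ** T_power (- q) = mat 1" using T_power_add[of q "- q"] by (simp add: T_power_0)
        finally show ?thesis by simp
      qed
      ultimately show ?thesis by simp
    qed
  qed
qed

lemma aut_factor_nonzero:
  assumes "g \<in> SL2Z" "\<tau> \<in> \<H>" shows "aut_factor g \<tau> \<noteq> 0"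
proof
  assume "aut_factor g \<tau> = 0"
  hence "g $ 2 $ 1 = 0" "g $ 2 $ 2 = 0" using assms(2) by (auto simp: aut_factor_def complex_eq_iff)
  thus False using assms(1) by (simp add: SL2Z_iff)
qed

lemma Im_moebius_act:
  assumes "g \<in> SL2Z" "\<tau> \<in> \<H>"
  shows "Im (moebius_act g \<tau>) = Im \<tau> / (norm (aut_factor g \<tau>))^2"
proof -
  let ?a = "real_of_int (g $ 1 $ 1)" and ?b = "real_of_int (g $ 1 $ 2)" and ?c = "real_of_int (g $ 2 $ 1)" and ?d = "real_of_int (g $ 2 $ 2)"
  have "real_of_int (g $ 1 $ 1 * g $ 2 $ 2 - g $ 1 $ 2 * g $ 2 $ 1) = 1"
    using assms(1) by (simp only: SL2Z_iff)
  hence det: "?a * ?d - ?b * ?c = 1" by simp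
  have "?a * Im \<tau> * (?c * Re \<tau> + ?d) - (?a * Re \<tau> + ?b) * (?c * Im \<tau>) = (?a * ?d - ?b * ?c) * Im \<tau>"
    by (simp add: algebra_simps)
  thus ?thesis unfolding det
    by (simp add: moebius_act_def aut_factor_def Im_divide cmod_power2)
qed

lemma moebius_act_in_uhp:
  assumes "g \<in> SL2Z" "\<tau> \<in> \<H>" shows "moebius_act g \<tau> \<in> \<H>"
  using Im_moebius_act[OF assms] aut_factor_nonzero[OF assms] assms by simp

lemma aut_factor_mult:
  assumes "h \<in> SL2Z" "\<tau> \<in> \<H>"
  shows "aut_factor (g ** h) \<tau> = aut_factor g (moebius_act h \<tau>) * aut_factor h \<tau>"
proof -
  have "aut_factor h \<tau> \<noteq> 0" using aut_factor_nonzero[OF assms] .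
  hence "moebius_act h \<tau> * aut_factor h \<tau> = of_int (h$1$1) * \<tau> + of_int (h$1$2)"
    by (simp add: moebius_act_def)
  moreover have "aut_factor g (moebius_act h \<tau>) * aut_factor h \<tau> =
     of_int (g$2$1) * (moebius_act h \<tau> * aut_factor h \<tau>) + of_int (g$2$2) * aut_factor h \<tau>"
    by (simp add: aut_factor_def[of g] algebra_simps)
  ultimately show ?thesis by (simp add: aut_factor_def matrix_mult_2_2 algebra_simps)
qed

lemma moebius_act_mult:
  assumes "g \<in> SL2Z" "h \<in> SL2Z" "\<tau> \<in> \<H>"
  shows "moebius_act (g ** h) \<tau> = moebius_act g (moebius_act h \<tau>)"
proof -
  have nz: "aut_factor h \<tau> \<noteq> 0" "aut_factor g (moebius_act h \<tau>) \<noteq> 0"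
    using assms aut_factor_nonzero moebius_act_in_uhp by blast+
  hence m: "moebius_act h \<tau> * aut_factor h \<tau> = of_int (h$1$1) * \<tau> + of_int (h$1$2)"
    by (simp add: moebius_act_def)
  have "moebius_act g (moebius_act h \<tau>) * aut_factor (g ** h) \<tau> =
     (of_int (g$1$1) * moebius_act h \<tau> + of_int (g$1$2)) * aut_factor h \<tau>"
    using nz by (simp add: aut_factor_mult[OF assms(2,3)] moebius_act_def[of g])
  also have "\<dots> = of_int (g$1$1) * (moebius_act h \<tau> * aut_factor h \<tau>) + of_int (g$1$2) * aut_factor h \<tau>"
    by (simp add: algebra_simps)
  also have "\<dots> = of_int ((g ** h)$1$1) * \<tau> + of_int ((g ** h)$1$2)"
    unfolding m by (simp add: aut_factor_def matrix_mult_2_2 algebra_simps)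
  finally show ?thesis
    using aut_factor_nonzero[of "g ** h" \<tau>] assms by (simp add: moebius_act_def[of "g ** h"] field_simps)
qed

lemma moebius_act_S [simp]: "moebius_act S_mat \<tau> = - 1 / \<tau>" and aut_factor_S [simp]: "aut_factor S_mat \<tau> = \<tau>"
  and moebius_act_T_power [simp]: "moebius_act (T_power n) \<tau> = \<tau> + of_int n" and aut_factor_T_power [simp]: "aut_factor (T_power n) \<tau> = 1"
  and moebius_act_one [simp]: "moebius_act (mat 1) \<tau> = \<tau>" and aut_factor_one [simp]: "aut_factor (mat 1) \<tau> = 1"
  and moebius_act_minus_one [simp]: "moebius_act (- mat 1) \<tau> = \<tau>" and aut_factor_minus_one [simp]: "aut_factor (- mat 1) \<tau> = - 1"
  by (simp_all add: moebius_act_def aut_factor_def)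

lemma moebius_act_T [simp]: "moebius_act T_mat \<tau> = \<tau> + 1" and aut_factor_T [simp]: "aut_factor T_mat \<tau> = 1"
  using moebius_act_T_power[of 1 \<tau>] aut_factor_T_power[of 1 \<tau>] by (simp_all add: T_power_1 del: moebius_act_T_power aut_factor_T_power)

lemma sl2_rep_mult: "sl2_rep \<rho> \<Longrightarrow> g \<in> SL2Z \<Longrightarrow> h \<in> SL2Z \<Longrightarrow> \<rho> (g ** h) = \<rho> g ** \<rho> h"
  and sl2_rep_one: "sl2_rep \<rho> \<Longrightarrow> \<rho> (mat 1) = mat 1"
  by (auto simp: sl2_rep_def)

lemma T_power_minus_T: "T_power (-1) ** T_mat = mat 1" "T_mat ** T_power (-1) = mat 1"
  using T_power_add[of "-1" 1] T_power_add[of 1 "-1"] by (simp_all add: T_power_1 T_power_0)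

lemma mv_smult: "A *v (c *s v) = c *s (A *v (v :: 'a::comm_semiring_1 ^ 'n))"
  by (simp add: matrix_vector_mult_def vector_scalar_mult_def vec_eq_iff sum_distrib_left mult_ac)

text \<open>The law propagates by the cocycle property of the automorphy factor. For the inverse of
  T, the law for T is applied at the point translated back by 1.\<close>

lemma transformation_from_generators:
  fixes F :: "complex \<Rightarrow> complex^'n"
  assumes \<rho>: "sl2_rep \<rho>"
    and T: "\<And>\<tau>. \<tau> \<in> \<H> \<Longrightarrow> F (\<tau> + 1) = \<rho> T_mat *v F \<tau>"
    and S: "\<And>\<tau>. \<tau> \<in> \<H> \<Longrightarrow> F (- 1 / \<tau>) = (\<tau> powi k) *s (\<rho> S_mat *v F \<tau>)"
    and g: "g \<in> SL2Z" and \<tau>: "\<tau> \<in> \<H>"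
  shows "F (moebius_act g \<tau>) = (aut_factor g \<tau> powi k) *s (\<rho> g *v F \<tau>)"
  using g
proof (induction rule: SL2Z_induct)
  case one
  show ?case by (simp add: sl2_rep_one[OF \<rho>])
next
  case (S g)
  have H: "moebius_act g \<tau> \<in> \<H>" using moebius_act_in_uhp[OF S(1) \<tau>] .
  have "F (moebius_act (S_mat ** g) \<tau>) = F (- 1 / moebius_act g \<tau>)"
    using S(1) \<tau> by (simp add: moebius_act_mult)
  also have "\<dots> = (moebius_act g \<tau> powi k) *s (\<rho> S_mat *v ((aut_factor g \<tau> powi k) *s (\<rho> g *v F \<tau>)))"
    using assms(3)[OF H] S(2) by simp
  also have "\<dots> = (aut_factor (S_mat ** g) \<tau> powi k) *s (\<rho> (S_mat ** g) *v F \<tau>)"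
    using S(1) \<tau> by (simp add: mv_smult aut_factor_mult power_int_mult_distrib sl2_rep_mult[OF \<rho>]
        mv_assoc vector_smult_assoc)
  finally show ?case .
next
  case (T g)
  have H: "moebius_act g \<tau> \<in> \<H>" using moebius_act_in_uhp[OF T(1) \<tau>] .
  have "F (moebius_act (T_mat ** g) \<tau>) = F (moebius_act g \<tau> + 1)"
    using T(1) \<tau> by (simp add: moebius_act_mult)
  also have "\<dots> = \<rho> T_mat *v ((aut_factor g \<tau> powi k) *s (\<rho> g *v F \<tau>))"
    using assms(2)[OF H] T(2) by simp
  also have "\<dots> = (aut_factor (T_mat ** g) \<tau> powi k) *s (\<rho> (T_mat ** g) *v F \<tau>)"
    using T(1) \<tau> by (simp add: mv_smult aut_factor_mult sl2_rep_mult[OF \<rho>] mv_assoc)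
  finally show ?case .
next
  case (Tinv g)
  have H: "moebius_act g \<tau> \<in> \<H>" using moebius_act_in_uhp[OF Tinv(1) \<tau>] .
  hence H': "moebius_act g \<tau> - 1 \<in> \<H>" by simp
  have inv: "\<rho> (T_power (-1)) ** \<rho> T_mat = mat 1"
    by (simp add: sl2_rep_mult[OF \<rho>, symmetric] T_power_minus_T sl2_rep_one[OF \<rho>])
  have "F (moebius_act (T_power (-1) ** g) \<tau>) = F (moebius_act g \<tau> - 1)"
    using Tinv(1) \<tau> by (simp add: moebius_act_mult)
  also have "\<dots> = \<rho> (T_power (-1)) *v (\<rho> T_mat *v F (moebius_act g \<tau> - 1))"
    by (simp add: mv_assoc inv)
  also have "\<rho> T_mat *v F (moebius_act g \<tau> - 1) = F (moebius_act g \<tau>)"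
    using assms(2)[OF H'] by simp
  also have "\<rho> (T_power (-1)) *v F (moebius_act g \<tau>) = (aut_factor (T_power (-1) ** g) \<tau> powi k) *s (\<rho> (T_power (-1) ** g) *v F \<tau>)"
    using Tinv \<tau> by (simp add: mv_smult aut_factor_mult sl2_rep_mult[OF \<rho>] mv_assoc)
  finally show ?case .
qed

subsection \<open>The matrix exponential\<close>

abbreviation matpow :: "complex^'n^'n \<Rightarrow> nat \<Rightarrow> complex^'n^'n" where
  "matpow A n \<equiv> (((**) A) ^^ n) (mat 1)"

lemma norm_matpow_entry_le:
  "norm (matpow A n $ i $ j) \<le> (\<Sum>i\<in>UNIV. \<Sum>j\<in>UNIV. norm (A $ i $ j)) ^ n" (is "_ \<le> ?M ^ n")
proof (induction n arbitrary: i j)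
  case (Suc n)
  have M: "0 \<le> ?M" by (intro sum_nonneg) auto
  have "norm (matpow A (Suc n) $ i $ j) = norm (\<Sum>k\<in>UNIV. A $ i $ k * matpow A n $ k $ j)"
    by (simp add: matrix_matrix_mult_def)
  also have "\<dots> \<le> (\<Sum>k\<in>UNIV. norm (A $ i $ k) * ?M ^ n)"
    using Suc.IH by (intro sum_norm_le) (auto simp: norm_mult intro!: mult_left_mono)
  also have "\<dots> = (\<Sum>k\<in>UNIV. norm (A $ i $ k)) * ?M ^ n" by (simp add: sum_distrib_right)
  also have "\<dots> \<le> ?M * ?M ^ n"
    using M by (intro mult_right_mono member_le_sum sum_nonneg) auto
  finally show ?case by simp
qed (auto simp: mat_def)

lemma norm_matrix_le_sum: "norm (A :: complex^'n^'n) \<le> (\<Sum>i\<in>UNIV. \<Sum>j\<in>UNIV. norm (A $ i $ j))"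
proof -
  have "norm A \<le> (\<Sum>i\<in>UNIV. norm (A $ i))" unfolding norm_vec_def[of A] by (intro L2_set_le_sum) auto
  also have "\<dots> \<le> (\<Sum>i\<in>UNIV. \<Sum>j\<in>UNIV. norm (A $ i $ j))"
    unfolding norm_vec_def[of "A $ _"] by (intro sum_mono L2_set_le_sum) auto
  finally show ?thesis .
qed

lemma summable_matrix_exp: "summable (\<lambda>n. matpow A n /\<^sub>R fact n)" for A :: "complex^'n^'n"
proof (rule summable_comparison_test')
  let ?M = "\<Sum>i\<in>UNIV. \<Sum>j\<in>UNIV. norm (A $ i $ j)"
  show "summable (\<lambda>n. real CARD('n) * real CARD('n) * (inverse (fact n) * ?M ^ n))"
    by (intro summable_mult summable_exp)
  show "norm (matpow A n /\<^sub>R fact n) \<le> real CARD('n) * real CARD('n) * (inverse (fact n) * ?M ^ n)" if "0 \<le> n" for n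
  proof -
    have "norm (matpow A n) \<le> (\<Sum>i\<in>(UNIV::'n set). \<Sum>j\<in>(UNIV::'n set). ?M ^ n)"
      using norm_matrix_le_sum norm_matpow_entry_le by (rule order_trans[OF _ sum_mono[OF sum_mono]])
    hence "inverse (fact n) * norm (matpow A n) \<le> inverse (fact n) * (real CARD('n) * (real CARD('n) * ?M ^ n))"
      by (intro mult_left_mono) auto
    thus ?thesis by (simp add: mult_ac)
  qed
qed

lemma bounded_linear_matrix_apply: "bounded_linear (\<lambda>A. A *v (v :: complex^'n))"
  unfolding linear_conv_bounded_linear[symmetric]
  by (intro linearI) (simp_all add: matrix_vector_mult_def vec_eq_iff algebra_simps sum.distrib
        scaleR_sum_right scaleR_conv_of_real[where 'a=complex] sum_distrib_left)

lemma matrix_exp_apply_sums: "(\<lambda>n. (matpow A n *v v) /\<^sub>R fact n) sums (matrix_exp A *v v)"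
proof -
  have "(\<lambda>n. matpow A n /\<^sub>R fact n) sums matrix_exp A"
    unfolding matrix_exp_def by (rule summable_sums[OF summable_matrix_exp])
  from bounded_linear.sums[OF bounded_linear_matrix_apply this]
  show ?thesis by (simp add: linear_scale[OF bounded_linear.linear[OF bounded_linear_matrix_apply]])
qed

lemma sums_vec_smult:
  assumes "f sums (s :: complex)" shows "(\<lambda>n. f n *s (v :: complex^'n)) sums (s *s v)"
proof -
  have "bounded_linear (\<lambda>c::complex. c *s v)"
    unfolding linear_conv_bounded_linear[symmetric]
    by (intro linearI) (auto simp: vec_eq_iff algebra_simps)
  from bounded_linear.sums[OF this assms] show ?thesis .
qed

lemma matpow_jordan_block:
  assumes "A *v w = c *s w" "A *v u = c *s u + w"
  shows "matpow A n *v u = c ^ n *s u + (of_nat n * c ^ (n - 1)) *s w"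
proof (induction n)
  case (Suc n)
  have "matpow A (Suc n) *v u = A *v (c ^ n *s u + (of_nat n * c ^ (n - 1)) *s w)"
    using Suc by (simp add: mv_assoc[symmetric])
  also have "\<dots> = c ^ n *s (c *s u + w) + (of_nat n * c ^ (n - 1)) *s (c *s w)"
    by (simp add: mv_add mv_smult assms)
  also have "\<dots> = c ^ Suc n *s u + (of_nat (Suc n) * c ^ (Suc n - 1)) *s w"
    by (cases n) (simp_all add: vec_eq_iff algebra_simps)
  finally show ?case .
qed simp

text \<open>On u the n-th power contributes c^n times u and n c^(n - 1) times w. The second
  coefficient series is the derivative of the exponential series, hence again exp c.\<close>

lemma matrix_exp_jordan_block:
  assumes "A *v w = c *s w" "A *v u = c *s u + w"
  shows "matrix_exp A *v u = exp c *s (u + w)"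
proof -
  have e: "(\<lambda>n. c ^ n /\<^sub>R fact n) sums exp c" unfolding exp_def by (rule summable_sums[OF summable_exp_generic])
  have e': "(\<lambda>n. (of_nat n * c ^ (n - 1)) /\<^sub>R fact n) sums exp c"
  proof -
    have "(\<lambda>n. (of_nat (Suc n) * c ^ (Suc n - 1)) /\<^sub>R fact (Suc n)) = (\<lambda>n. c ^ n /\<^sub>R fact n)"
    proof
      fix n
      have "(of_nat (Suc n) :: complex) \<noteq> 0" by (simp del: of_nat_Suc)
      thus "(of_nat (Suc n) * c ^ (Suc n - 1)) /\<^sub>R fact (Suc n) = c ^ n /\<^sub>R fact n"
        by (simp add: scaleR_conv_of_real[where 'a=complex] field_simps del: of_nat_Suc)
    qed
    thus ?thesis using e sums_Suc_iff[of "\<lambda>n. (of_nat n * c ^ (n - 1)) /\<^sub>R fact n" "exp c"] by simp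
  qed
  have "(\<lambda>n. (c ^ n /\<^sub>R fact n) *s u + ((of_nat n * c ^ (n - 1)) /\<^sub>R fact n) *s w) sums (exp c *s u + exp c *s w)"
    by (intro sums_add sums_vec_smult e e')
  also have "(\<lambda>n. (c ^ n /\<^sub>R fact n) *s u + ((of_nat n * c ^ (n - 1)) /\<^sub>R fact n) *s w) = (\<lambda>n. (matpow A n *v u) /\<^sub>R fact n)"
    by (simp add: matpow_jordan_block[OF assms] fun_eq_iff vec_eq_iff scaleR_conv_of_real[where 'a=complex] algebra_simps)
  finally have "matrix_exp A *v u = exp c *s u + exp c *s w"
    using matrix_exp_apply_sums sums_unique2 by blast
  thus ?thesis by (simp add: vec_eq_iff algebra_simps)
qed

lemma matrix_exp_eigenvector:
  assumes "A *v u = c *s u" shows "matrix_exp A *v u = exp c *s u"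
  using matrix_exp_jordan_block[of A 0 c u] assms by simp

lemma matrix_exp_commute:
  assumes "A ** B = B ** A" shows "matrix_exp A ** B = B ** matrix_exp A"
proof -
  have pow: "matpow A n ** B = B ** matpow A n" for n
  proof (induction n)
    case (Suc n)
    have "matpow A (Suc n) ** B = A ** (B ** matpow A n)" by (simp add: matrix_mul_assoc[symmetric] Suc)
    also have "\<dots> = B ** matpow A (Suc n)" by (simp add: matrix_mul_assoc assms)
    finally show ?case .
  qed simp
  have "(matrix_exp A ** B) *v v = (B ** matrix_exp A) *v v" for v
  proof -
    have l: "bounded_linear ((*v) B)"
      unfolding linear_conv_bounded_linear[symmetric] by (rule matrix_vector_mul_linear)
    have "(\<lambda>n. B *v ((matpow A n *v v) /\<^sub>R fact n)) sums (B *v (matrix_exp A *v v))"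
      by (intro bounded_linear.sums[OF l] matrix_exp_apply_sums)
    also have "(\<lambda>n. B *v ((matpow A n *v v) /\<^sub>R fact n)) = (\<lambda>n. (matpow A n *v (B *v v)) /\<^sub>R fact n)"
      by (simp add: linear_scale[OF bounded_linear.linear[OF l]] mv_assoc pow)
    finally have "matrix_exp A *v (B *v v) = B *v (matrix_exp A *v v)"
      using matrix_exp_apply_sums sums_unique2 by blast
    thus ?thesis by (simp add: mv_assoc)
  qed
  thus ?thesis by (simp add: matrix_eq)
qed

section \<open>Polynomials in a matrix and uniqueness of logarithms\<close>

lemma mat_vector_mult: "mat c *v x = c *s (x :: complex^'n)"
  by (simp add: matrix_vector_mult_def mat_def vec_eq_iff if_distrib[of "\<lambda>x. x * _"] cong: if_cong)

text \<open>The vector p(A) v, computed by Horner's scheme on vectors instead of forming the matrix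
  p(A).\<close>

definition poly_apply :: "complex^'n^'n \<Rightarrow> complex poly \<Rightarrow> complex^'n \<Rightarrow> complex^'n" where
  "poly_apply A p v = fold_coeffs (\<lambda>a w. a *s v + A *v w) p 0"

lemma poly_apply_0 [simp]: "poly_apply A 0 v = 0"
  by (simp add: poly_apply_def)

lemma poly_apply_pCons [simp]: "poly_apply A (pCons a p) v = a *s v + A *v poly_apply A p v"
  by (cases "p = 0 \<and> a = 0") (auto simp: poly_apply_def)

lemma poly_apply_add: "poly_apply A (p + q) v = poly_apply A p v + poly_apply A q v"
  by (induction p q rule: poly_induct2) (simp_all add: mv_add vector_sadd_rdistrib add_ac)

lemma poly_apply_smult: "poly_apply A (smult c p) v = c *s poly_apply A p v"
  by (induction p) (simp_all add: mv_smult vector_add_ldistrib vector_smult_assoc)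

lemma poly_apply_linear_factor: "poly_apply A ([:- r, 1:] * s) v = A *v poly_apply A s v - r *s poly_apply A s v"
proof -
  have "[:- r, 1:] * s = smult (- r) s + pCons 0 s" by simp
  thus ?thesis by (simp only: poly_apply_add poly_apply_smult poly_apply_pCons) (simp add: vec_eq_iff)
qed

lemma poly_apply_eigenvector:
  assumes "A ** B = B ** A" "B *v v = \<mu> *s v"
  shows "B *v poly_apply A p v = \<mu> *s poly_apply A p v"
proof (induction p)
  case (pCons a p)
  have "B *v (A *v poly_apply A p v) = A *v (B *v poly_apply A p v)"
    by (simp add: mv_assoc assms)
  thus ?case using pCons assms(2)
    by (simp add: mv_add mv_smult vector_add_ldistrib vector_smult_assoc mult.commute)
qed simp

lemma poly_apply_monom: "poly_apply A (monom c n) v = c *s (matpow A n *v v)"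
proof (induction n)
  case (Suc n)
  thus ?case by (simp add: monom_Suc mv_smult mv_assoc)
qed (simp add: monom_0)

lemma poly_apply_sum: "poly_apply A (sum f S) v = (\<Sum>i\<in>S. poly_apply A (f i) v)"
  by (induction S rule: infinite_finite_induct) (auto simp: poly_apply_add)

text \<open>The n + 1 vectors A^i v cannot be independent. A repetition among them is treated
  separately, since the set of their values does not record it.\<close>

lemma annihilating_poly_exists: "\<exists>p. p \<noteq> 0 \<and> poly_apply A p v = 0" for v :: "complex^'n"
proof -
  define I where "I = {..CARD('n)}"
  define f where "f i = matpow A i *v v" for i
  show ?thesis
  proof (cases "inj_on f I")
    case False
    then obtain i j where ij: "i \<noteq> j" "f i = f j" by (auto simp: inj_on_def)
    define p where "p = monom (1::complex) i + monom (-1) j"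
    have "coeff p i = 1" using ij by (simp add: p_def)
    hence "p \<noteq> 0" by auto
    moreover have "poly_apply A p v = 0"
      using ij by (simp add: p_def poly_apply_add poly_apply_monom f_def vec_eq_iff)
    ultimately show ?thesis by blast
  next
    case True
    have "card (f ` I) = CARD('n) + 1" using True by (simp add: card_image I_def)
    hence "vec.dependent (f ` I)"
    proof (rule contrapos_pp)
      assume "vec.independent (f ` I)"
      from vec.independent_card_le_dim[OF subset_UNIV this]
      show "card (f ` I) \<noteq> CARD('n) + 1" unfolding vec_dim_card by simp
    qed
    then obtain u x where u: "(\<Sum>x\<in>f ` I. u x *s x) = 0" "x \<in> f ` I" "u x \<noteq> 0"
      using vec.dependent_finite[of "f ` I"] by (auto simp: I_def)
    then obtain k where k: "k \<in> I" "u (f k) \<noteq> 0" by blast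
    define p where "p = (\<Sum>i\<in>I. monom (u (f i)) i)"
    have "coeff p k = (\<Sum>i\<in>I. if i = k then u (f i) else 0)" by (simp add: p_def coeff_sum)
    also have "\<dots> = u (f k)" using k by (simp add: I_def)
    finally have "p \<noteq> 0" using k by auto
    moreover have "poly_apply A p v = (\<Sum>i\<in>I. u (f i) *s f i)"
      by (simp add: p_def poly_apply_sum poly_apply_monom f_def)
    hence "poly_apply A p v = 0" using u(1) True by (simp add: sum.reindex)
    ultimately show ?thesis by blast
  qed
qed

lemma poly_root_exists:
  fixes p :: "complex poly"
  assumes "degree p \<noteq> 0"
  shows "\<exists>z. poly p z = 0"
proof -
  have "coeff p (degree p) \<noteq> 0" "degree p \<in> {1..degree p}" using assms by auto
  hence "coeff p 0 = 0 \<or> (\<exists>i\<in>{1..degree p}. coeff p i \<noteq> 0)" by blast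
  then obtain z where "(\<Sum>i\<le>degree p. coeff p i * z ^ i) = 0"
    by (rule fundamental_theorem_of_algebra)
  thus ?thesis by (auto simp: poly_altdef)
qed

lemma exp_2pi_i_inj:
  assumes "q_exp r = q_exp s"
    "0 \<le> Re r" "Re r < 1" "0 \<le> Re s" "Re s < 1"
  shows "r = s"
proof -
  obtain n where "2 * of_real pi * \<i> * r = 2 * of_real pi * \<i> * s + of_real (of_int (2 * n) * pi) * \<i>"
    using assms(1) unfolding exp_eq by blast
  hence "2 * of_real pi * \<i> * (r - s - of_int n) = 0" by (simp add: algebra_simps)
  hence rs: "r - s = of_int n" by simp
  hence "Re r - Re s = of_int n" by (metis Re_complex_of_real minus_complex.sel(1) of_real_of_int_eq)
  hence "\<bar>real_of_int n\<bar> < 1" using assms by linarith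
  hence "n = 0" by linarith
  thus ?thesis using rs by simp
qed

text \<open>A logarithm with eigenvalues in a fundamental strip acts as a scalar on each eigenspace:
  a Jordan block of the logarithm would exponentiate to a Jordan block.\<close>

lemma logarithm_eigenvector:
  fixes L :: "complex^'n^'n"
  assumes B: "matrix_exp (mat (2 * of_real pi * \<i>) ** L) = B"
    and strip: "\<And>c v. v \<noteq> 0 \<Longrightarrow> L *v v = c *s v \<Longrightarrow> 0 \<le> Re c \<and> Re c < 1"
    and v: "B *v v = q_exp l *s v" and l: "0 \<le> Re l" "Re l < 1"
  shows "L *v v = l *s v"
proof (cases "v = 0")
  case False
  define c where "c = 2 * of_real pi * \<i>"
  have c: "c \<noteq> 0" by (simp add: c_def)
  define \<mu> where "\<mu> = exp (c * l)"
  have scal: "(mat c ** L) *v x = c *s (L *v x)" for x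
    by (simp only: mv_assoc[symmetric] mat_vector_mult)
  have comm: "L ** B = B ** L"
  proof -
    have "((mat c ** L) ** L) *v x = (L ** (mat c ** L)) *v x" for x
      by (simp only: mv_assoc[symmetric] mat_vector_mult mv_smult)
    hence "(mat c ** L) ** L = L ** (mat c ** L)" by (subst matrix_eq) blast
    from matrix_exp_commute[OF this] show ?thesis using B by (simp add: c_def)
  qed
  obtain p0 where "p0 \<noteq> 0 \<and> poly_apply L p0 v = 0" using annihilating_poly_exists by blast
  \<comment> \<open>p is a minimal polynomial of v under L, so splitting off a linear factor leaves
    a polynomial that does not annihilate v.\<close>
  from ex_has_least_nat[of "\<lambda>p. p \<noteq> 0 \<and> poly_apply L p v = 0", OF this, of degree]
  obtain p where p: "p \<noteq> 0" "poly_apply L p v = 0"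
    and min: "\<And>q. q \<noteq> 0 \<Longrightarrow> poly_apply L q v = 0 \<Longrightarrow> degree p \<le> degree q" by blast
  have least: "poly_apply L q v \<noteq> 0" if "q \<noteq> 0" "degree q < degree p" for q
    using min[of q] that by auto
  have eig: "B *v poly_apply L q v = \<mu> *s poly_apply L q v" for q
    using poly_apply_eigenvector[OF comm] v by (simp add: \<mu>_def c_def)
  \<comment> \<open>A root r gives an eigenvector of L inside the eigenspace of B. So r and l have
    the same exponential, and the strip makes them equal.\<close>
  have root: "r = l" if "poly p r = 0" for r
  proof -
    obtain s where s: "p = [:- r, 1:] * s" using \<open>poly p r = 0\<close> by (auto simp: poly_eq_0_iff_dvd)
    have s0: "s \<noteq> 0" using s p by auto
    hence "degree p = Suc (degree s)" unfolding s by (subst degree_mult_eq) auto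
    hence u: "poly_apply L s v \<noteq> 0" using least[OF s0] p by simp
    have Lu: "L *v poly_apply L s v = r *s poly_apply L s v"
      using p(2) unfolding s poly_apply_linear_factor by simp
    have "exp (c * r) *s poly_apply L s v = B *v poly_apply L s v"
      unfolding B[symmetric] c_def[symmetric]
      by (rule matrix_exp_eigenvector[symmetric]) (simp add: scal Lu vector_smult_assoc)
    also have "\<dots> = \<mu> *s poly_apply L s v" by (rule eig)
    finally have "exp (c * r) = \<mu>" using u by (metis vector_mul_rcancel)
    hence e: "q_exp r = q_exp l" unfolding \<mu>_def c_def .
    show "r = l" by (rule exp_2pi_i_inj[OF e]) (use strip[OF u Lu] l in blast)+
  qed
  have "degree p \<noteq> 0"
  proof
    assume "degree p = 0"
    then obtain a where "p = [:a:]" by (metis degree_eq_zeroE)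
    thus False using p False by (auto simp: vec_eq_iff)
  qed
  then obtain r where r: "poly p r = 0"
    using poly_root_exists[of p] by blast
  then obtain s where s: "p = [:- l, 1:] * s" using root by (auto simp: poly_eq_0_iff_dvd)
  have s0: "s \<noteq> 0" using s p by auto
  have ds: "degree p = Suc (degree s)" unfolding s using s0 by (subst degree_mult_eq) auto
  \<comment> \<open>A second root, again l, would give a Jordan pair w, u of L. Then B w = exp (c l)
    (w + c u), although w is an eigenvector of B.\<close>
  have "degree s = 0"
  proof (rule ccontr)
    assume "degree s \<noteq> 0"
    then obtain r' where "poly s r' = 0"
      using poly_root_exists[of s] by blast
    moreover from this have "r' = l" using root[of r'] s by simp
    ultimately obtain t where t: "s = [:- l, 1:] * t" by (auto simp: poly_eq_0_iff_dvd)
    define u w where "u = poly_apply L s v" and "w = poly_apply L t v"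
    have u: "u \<noteq> 0" using least[OF s0] ds p by (simp add: u_def)
    have Lu: "L *v u = l *s u" using p(2) unfolding s poly_apply_linear_factor u_def by simp
    have Lw: "L *v w = l *s w + u" unfolding u_def w_def t poly_apply_linear_factor by simp
    have "B *v w = exp (c * l) *s (w + c *s u)"
      unfolding B[symmetric] c_def[symmetric]
      by (rule matrix_exp_jordan_block) (simp_all add: scal Lu Lw vec_eq_iff mv_smult algebra_simps)
    moreover have "B *v w = \<mu> *s w" unfolding w_def by (rule eig)
    ultimately have "\<mu> *s (w + c *s u) = \<mu> *s w" by (simp add: \<mu>_def)
    hence "c *s u = 0" by (simp add: \<mu>_def)
    thus False using c u by simp
  qed
  then obtain a where a: "s = [:a:]" by (metis degree_eq_zeroE)
  hence "a \<noteq> 0" using s0 by auto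
  have "a *s (L *v v) = a *s (l *s v)"
    using p(2) unfolding s poly_apply_linear_factor a by (simp add: mv_smult vector_smult_assoc mult.commute)
  thus ?thesis using \<open>a \<noteq> 0\<close> vector_mul_lcancel by blast
qed auto

subsection \<open>Vector-valued forms and their growth at the cusp\<close>

definition diag_mat :: "('n \<Rightarrow> complex) \<Rightarrow> complex^'n^'n" where
  "diag_mat d = (\<chi> i j. if i = j then d i else 0)"

lemma diag_mat_apply [simp]: "(diag_mat d *v x) $ i = d i * x $ i"
  by (simp add: diag_mat_def matrix_vector_mult_def if_distrib[of "\<lambda>x. x * _"] cong: if_cong)

lemma diag_mat_axis: "diag_mat d *v axis j 1 = d j *s axis j 1"
  by (auto simp: vec_eq_iff axis_def)

lemma matrix_eq_on_axes:
  fixes A B :: "complex^'n^'n"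
  assumes "\<And>j. A *v axis j 1 = B *v axis j 1" shows "A = B"
proof -
  have *: "(X *v axis j 1) $ i = X $ i $ j" for X :: "complex^'n^'n" and i j
    by (simp add: matrix_vector_mult_def axis_def if_distrib[of "\<lambda>x. _ * x"] cong: if_cong)
  have "A $ i $ j = B $ i $ j" for i j using *[of A j i] *[of B j i] assms[of j] by simp
  thus ?thesis by (simp add: vec_eq_iff)
qed

text \<open>The columns of P are eigenvectors of \<open>\<rho> T_mat\<close> with exponents l in the
  strip, and Q is the inverse of P; the coordinates of Q F are the functions to be expanded in
  q.\<close>

definition T_eigenbasis ::
    "(int^2^2 \<Rightarrow> complex^'n^'n) \<Rightarrow> complex^'n^'n \<Rightarrow> complex^'n^'n \<Rightarrow> ('n \<Rightarrow> complex) \<Rightarrow> bool" where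
  "T_eigenbasis \<rho> P Q l \<longleftrightarrow> P ** Q = mat 1 \<and> Q ** P = mat 1 \<and>
     \<rho> T_mat = P ** diag_mat (\<lambda>j. q_exp (l j)) ** Q \<and>
     (\<forall>j. 0 \<le> Re (l j) \<and> Re (l j) < 1)"

lemma logarithm_in_strip_exists:
  assumes "d \<noteq> 0"
  shows "\<exists>l. q_exp l = d \<and> 0 \<le> Re l \<and> Re l < 1"
proof -
  define c where "c = 2 * of_real pi * \<i>"
  define z where "z = Ln d / c"
  define n where "n = \<lfloor>Re z\<rfloor>"
  have "exp (c * (z - of_int n)) = exp (c * z) / exp (c * of_int n)"
    by (simp add: right_diff_distrib exp_diff)
  also have "exp (c * of_int n) = 1"
    unfolding exp_eq_1 by (simp add: c_def)
  also have "exp (c * z) = d" using assms by (simp add: z_def c_def)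
  finally have "exp (c * (z - of_int n)) = d" by simp
  moreover have "0 \<le> Re (z - of_int n)" "Re (z - of_int n) < 1" unfolding n_def minus_complex.sel complex_Re_of_int by linarith+
  ultimately show ?thesis unfolding c_def by blast
qed

lemma sl2_rep_invertible:
  assumes "sl2_rep \<rho>" shows "\<rho> (T_power (-1)) ** \<rho> T_mat = mat 1" "\<rho> T_mat ** \<rho> (T_power (-1)) = mat 1"
  by (simp_all add: sl2_rep_mult[OF assms, symmetric] T_power_minus_T sl2_rep_one[OF assms])

lemma T_eigenbasis_exists:
  fixes \<rho> :: "int^2^2 \<Rightarrow> complex^'n^'n"
  assumes \<rho>: "sl2_rep \<rho>" and diag: "diagonalizable_matrix (\<rho> T_mat)"
  obtains P Q l where "T_eigenbasis \<rho> P Q l"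
proof -
  obtain P D :: "complex^'n^'n" where "invertible P \<and> (\<forall>i j. i \<noteq> j \<longrightarrow> D $ i $ j = 0) \<and> \<rho> T_mat = P ** D ** matrix_inv P"
    using diag unfolding diagonalizable_matrix_def by (elim exE)
  hence PD: "invertible P" "\<And>i j. i \<noteq> j \<Longrightarrow> D $ i $ j = 0" "\<rho> T_mat = P ** D ** matrix_inv P"
    by simp_all
  define Q where "Q = matrix_inv P"
  have PQ: "P ** Q = mat 1" "Q ** P = mat 1"
    unfolding Q_def matrix_inv_def using someI_ex[OF PD(1)[unfolded invertible_def]] by simp_all
  define d where "d j = D $ j $ j" for j
  have D: "D = diag_mat d" using PD(2) by (auto simp: diag_mat_def d_def vec_eq_iff)
  have "d j \<noteq> 0" for j
  proof
    assume "d j = 0"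
    have "\<rho> T_mat *v (P *v axis j 1) = P *v (D *v ((Q ** P) *v axis j 1))"
      by (simp add: PD(3) Q_def mv_assoc matrix_mul_assoc)
    also have "\<dots> = 0" by (simp add: PQ D diag_mat_axis \<open>d j = 0\<close> matrix_vector_mult_0_right)
    finally have "\<rho> (T_power (-1)) *v (\<rho> T_mat *v (P *v axis j 1)) = 0" by simp
    hence "P *v axis j 1 = 0" by (simp add: mv_assoc sl2_rep_invertible[OF \<rho>] matrix_mul_assoc)
    hence "Q *v (P *v axis j 1) = 0" by simp
    hence "axis j (1::complex) = 0" by (simp add: mv_assoc PQ)
    thus False by (simp add: axis_eq_0_iff)
  qed
  hence "\<forall>j. \<exists>l. q_exp l = d j \<and> 0 \<le> Re l \<and> Re l < 1"
    using logarithm_in_strip_exists by blast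
  then obtain l where l: "\<And>j. q_exp (l j) = d j \<and> 0 \<le> Re (l j) \<and> Re (l j) < 1" by metis
  have "T_eigenbasis \<rho> P Q l"
    unfolding T_eigenbasis_def using PQ PD(3) l by (simp add: D Q_def)
  thus thesis by (rule that)
qed

lemma conjugate_diag_eigenvector:
  fixes P Q :: "complex^'n^'n"
  assumes "Q ** P = mat 1"
  shows "(P ** diag_mat d ** Q) *v (P *v axis j 1) = d j *s (P *v axis j 1)"
proof -
  have "(P ** diag_mat d ** Q) *v (P *v axis j 1) = P *v (diag_mat d *v ((Q ** P) *v axis j 1))"
    by (simp only: mv_assoc matrix_mul_assoc)
  thus ?thesis by (simp add: assms diag_mat_axis mv_smult)
qed

lemma matrix_eq_on_basis:
  fixes A B P Q :: "complex^'n^'n"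
  assumes "P ** Q = mat 1" and eq: "\<And>j. A *v (P *v axis j 1) = B *v (P *v axis j 1)"
  shows "A = B"
proof -
  have "A ** P = B ** P" using eq by (intro matrix_eq_on_axes) (simp add: mv_assoc)
  hence "A ** P ** Q = B ** P ** Q" by simp
  thus ?thesis by (simp add: matrix_mul_assoc[symmetric] assms(1))
qed

lemma matrix_exp_diagonalizable:
  fixes P Q :: "complex^'n^'n"
  assumes "P ** Q = mat 1" "Q ** P = mat 1"
  shows "matrix_exp (mat c ** (P ** diag_mat l ** Q)) = P ** diag_mat (\<lambda>j. exp (c * l j)) ** Q"
proof (rule matrix_eq_on_basis[OF assms(1)])
  fix j
  have "(mat c ** (P ** diag_mat l ** Q)) *v (P *v axis j 1) = (c * l j) *s (P *v axis j 1)"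
    by (simp only: mv_assoc[of "mat c", symmetric] conjugate_diag_eigenvector[OF assms(2)]
        mat_vector_mult vector_smult_assoc)
  from matrix_exp_eigenvector[OF this]
  show "matrix_exp (mat c ** (P ** diag_mat l ** Q)) *v (P *v axis j 1) =
      (P ** diag_mat (\<lambda>j. exp (c * l j)) ** Q) *v (P *v axis j 1)"
    by (simp only: conjugate_diag_eigenvector[OF assms(2)])
qed

text \<open>Turns the definite description into an explicit matrix: any admissible logarithm acts on
  the eigenbasis by the same scalars.\<close>

lemma exponent_matrix_eq:
  fixes \<rho> :: "int^2^2 \<Rightarrow> complex^'n^'n"
  assumes "T_eigenbasis \<rho> P Q l"
  shows "exponent_matrix \<rho> = P ** diag_mat l ** Q"
proof -
  have PQ: "P ** Q = mat 1" "Q ** P = mat 1"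
    and T: "\<rho> T_mat = P ** diag_mat (\<lambda>j. q_exp (l j)) ** Q"
    and l: "\<And>j. 0 \<le> Re (l j) \<and> Re (l j) < 1"
    using assms by (auto simp: T_eigenbasis_def)
  define L where "L = P ** diag_mat l ** Q"
  have ev: "0 \<le> Re c \<and> Re c < 1" if "v \<noteq> 0" "L *v v = c *s v" for c v
  proof -
    have "Q *v v \<noteq> 0"
    proof
      assume "Q *v v = 0"
      hence "P *v (Q *v v) = 0" by simp
      thus False using \<open>v \<noteq> 0\<close> by (simp add: mv_assoc PQ)
    qed
    then obtain j where j: "(Q *v v) $ j \<noteq> 0" by (auto simp: vec_eq_iff)
    have "Q *v (L *v v) = diag_mat l *v (Q *v v)"
      by (simp add: L_def mv_assoc matrix_mul_assoc PQ)
    hence "diag_mat l *v (Q *v v) = c *s (Q *v v)" using that(2) by (simp add: mv_smult)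
    hence "(diag_mat l *v (Q *v v)) $ j = (c *s (Q *v v)) $ j" by simp
    hence "l j = c" using j by simp
    thus ?thesis using l by blast
  qed
  have "is_exponent_matrix \<rho> L"
    unfolding is_exponent_matrix_def using ev matrix_exp_diagonalizable[OF PQ, of "2 * of_real pi * \<i>" l] T
    by (auto simp: L_def)
  moreover have "L' = L" if L': "is_exponent_matrix \<rho> L'" for L'
  proof (rule matrix_eq_on_basis[OF PQ(1)])
    fix j
    have "\<rho> T_mat *v (P *v axis j 1) = q_exp (l j) *s (P *v axis j 1)"
      unfolding T by (rule conjugate_diag_eigenvector[OF PQ(2)])
    note v = this
    have "matrix_exp (mat (2 * of_real pi * \<i>) ** L') = \<rho> T_mat"
      and "\<And>c v. v \<noteq> 0 \<Longrightarrow> L' *v v = c *s v \<Longrightarrow> 0 \<le> Re c \<and> Re c < 1"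
      using L' unfolding is_exponent_matrix_def by blast+
    from logarithm_eigenvector[OF this v] l
    have "L' *v (P *v axis j 1) = l j *s (P *v axis j 1)" by simp
    thus "L' *v (P *v axis j 1) = L *v (P *v axis j 1)"
      unfolding L_def by (simp only: conjugate_diag_eigenvector[OF PQ(2)])
  qed
  ultimately show ?thesis unfolding exponent_matrix_def L_def by (rule the_equality)
qed

section \<open>Expansions and growth in a vertical strip\<close>

definition cusp_strip :: "complex set" where
  "cusp_strip = {\<tau>. \<bar>Re \<tau>\<bar> \<le> 1 \<and> 1 \<le> Im \<tau>}"

lemma cusp_strip_subset: "\<tau> \<in> cusp_strip \<Longrightarrow> \<tau> \<in> \<H>"
  by (auto simp: cusp_strip_def)

lemma norm_exp_2pi_i_bounds:
  assumes "\<bar>Re \<tau>\<bar> \<le> 1"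
  shows "norm (q_pow l \<tau>) \<le> exp (2 * pi * \<bar>Im l\<bar>) * exp (- 2 * pi * Re l * Im \<tau>)"
proof -
  have "- (Im l * Re \<tau>) \<le> \<bar>Im l\<bar> * \<bar>Re \<tau>\<bar>" by (metis abs_ge_minus_self abs_mult)
  also have "\<dots> \<le> \<bar>Im l\<bar> * 1" using assms by (intro mult_left_mono) auto
  finally have "2 * pi * (- (Im l * Re \<tau>)) \<le> 2 * pi * \<bar>Im l\<bar>" by (intro mult_left_mono) auto
  hence "exp (- 2 * pi * (Re l * Im \<tau> + Im l * Re \<tau>)) \<le> exp (2 * pi * \<bar>Im l\<bar> + - 2 * pi * Re l * Im \<tau>)"
    by (simp add: algebra_simps)
  thus ?thesis unfolding norm_exp_2pi_i exp_add .
qed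

lemma matrix_vector_norm_bound:
  fixes A :: "complex^'n^'m"
  obtains K where "0 \<le> K" "\<And>v. norm (A *v v) \<le> K * norm v"
proof -
  have "bounded_linear ((*v) A)"
    unfolding linear_conv_bounded_linear[symmetric] by (rule matrix_vector_mul_linear)
  then obtain K where "0 < K" "\<And>v. norm (A *v v) \<le> norm v * K"
    using bounded_linear.pos_bounded by blast
  thus thesis using that[of K] by (simp add: mult.commute less_imp_le)
qed

lemma norm_vec_le_sum: "norm (v :: complex^'n) \<le> (\<Sum>j\<in>UNIV. norm (v $ j))"
  unfolding norm_vec_def by (rule L2_set_le_sum) auto

lemma holomorphic_on_matrix_vector:
  fixes A :: "complex^'n^'m"
  assumes "\<And>j. (\<lambda>\<tau>. F \<tau> $ j) holomorphic_on S"
  shows "(\<lambda>\<tau>. (A *v F \<tau>) $ i) holomorphic_on S"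
  unfolding matrix_vector_mult_def using assms by (auto intro!: holomorphic_intros)

lemma q_expansion_ex:
  fixes f :: "complex \<Rightarrow> complex"
  assumes "f holomorphic_on \<H>" "\<And>\<tau>. \<tau> \<in> \<H> \<Longrightarrow> f (\<tau> + 1) = f \<tau>" "\<theta> < 1"
    "\<And>\<tau>. \<bar>Re \<tau>\<bar> \<le> 1 \<Longrightarrow> 1 \<le> Im \<tau> \<Longrightarrow> norm (f \<tau>) \<le> C * (1 + Im \<tau>) * exp (2 * pi * \<theta> * Im \<tau>)"
  shows "\<exists>g. g holomorphic_on ball 0 1 \<and> (\<forall>\<tau>\<in>\<H>. f \<tau> = g (q_exp \<tau>))"
  by (rule q_expansion[OF assms]) auto

text \<open>Translation multiplies component j by exp (2 pi \<i> l_j). Dividing by q to the power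
  l_j makes it periodic, with growth rate Re l_j < 1 as the removable singularity requires.\<close>

theorem T_component_expansion:
  fixes F :: "complex \<Rightarrow> complex^'n"
  assumes basis: "T_eigenbasis \<rho> P Q l"
    and hol: "\<And>j. (\<lambda>\<tau>. F \<tau> $ j) holomorphic_on \<H>"
    and T: "\<And>\<tau>. \<tau> \<in> \<H> \<Longrightarrow> F (\<tau> + 1) = \<rho> T_mat *v F \<tau>"
    and growth: "\<And>\<tau>. \<tau> \<in> cusp_strip \<Longrightarrow> norm (F \<tau>) \<le> C * (1 + Im \<tau>)"
  shows "\<exists>g. (\<forall>j. g j holomorphic_on ball 0 1) \<and>
    (\<forall>j. \<forall>\<tau>\<in>\<H>. (Q *v F \<tau>) $ j = q_pow (l j) \<tau> * g j (q_exp \<tau>))"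
proof -
  have PQ: "P ** Q = mat 1" "Q ** P = mat 1"
    and \<rho>T: "\<rho> T_mat = P ** diag_mat (\<lambda>j. q_exp (l j)) ** Q"
    and l: "\<And>j. 0 \<le> Re (l j)" "\<And>j. Re (l j) < 1"
    using basis by (auto simp: T_eigenbasis_def)
  have "\<exists>g. g holomorphic_on ball 0 1 \<and> (\<forall>\<tau>\<in>\<H>. (Q *v F \<tau>) $ j = q_pow (l j) \<tau> * g (q_exp \<tau>))" for j
  proof -
    define f where "f \<tau> = q_pow (- l j) \<tau> * (Q *v F \<tau>) $ j" for \<tau>
    obtain K where K: "0 \<le> K" "\<And>v. norm (Q *v v) \<le> K * norm v" using matrix_vector_norm_bound[of Q] by metis
    have hf: "f holomorphic_on \<H>"
      unfolding f_def by (intro holomorphic_intros holomorphic_on_matrix_vector hol)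
    have per: "f (\<tau> + 1) = f \<tau>" if \<tau>: "\<tau> \<in> \<H>" for \<tau>
    proof -
      have "Q *v F (\<tau> + 1) = diag_mat (\<lambda>j. q_exp (l j)) *v (Q *v F \<tau>)"
        unfolding T[OF \<tau>] \<rho>T by (simp add: mv_assoc matrix_mul_assoc PQ)
      hence "(Q *v F (\<tau> + 1)) $ j = q_exp (l j) * (Q *v F \<tau>) $ j" by simp
      moreover have "q_pow (- l j) (\<tau> + 1) * q_exp (l j) =
          q_pow (- l j) \<tau>"
        unfolding exp_add[symmetric] by (rule arg_cong[of _ _ exp]) (simp add: algebra_simps)
      ultimately show ?thesis by (simp only: f_def mult.assoc[symmetric])
    qed
    have gr: "norm (f \<tau>) \<le> exp (2 * pi * \<bar>Im (l j)\<bar>) * (K * \<bar>C\<bar>) * (1 + Im \<tau>) * exp (2 * pi * Re (l j) * Im \<tau>)"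
      if \<tau>: "\<bar>Re \<tau>\<bar> \<le> 1" "1 \<le> Im \<tau>" for \<tau>
    proof -
      have "norm ((Q *v F \<tau>) $ j) \<le> norm (Q *v F \<tau>)" by (rule Finite_Cartesian_Product.norm_nth_le)
      also note K(2)
      also have "norm (F \<tau>) \<le> C * (1 + Im \<tau>)" by (rule growth) (use \<tau> in \<open>simp add: cusp_strip_def\<close>)
      hence "K * norm (F \<tau>) \<le> K * (C * (1 + Im \<tau>))" using K(1) by (rule mult_left_mono)
      also have "\<dots> \<le> K * (\<bar>C\<bar> * (1 + Im \<tau>))" using K(1) \<tau> by (intro mult_left_mono mult_right_mono) auto
      finally have "norm (f \<tau>) \<le> (exp (2 * pi * \<bar>Im (- l j)\<bar>) * exp (- 2 * pi * Re (- l j) * Im \<tau>)) * (K * (\<bar>C\<bar> * (1 + Im \<tau>)))"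
        unfolding f_def norm_mult using norm_exp_2pi_i_bounds[OF \<tau>(1), of "- l j"] by (intro mult_mono) auto
      thus ?thesis by (simp add: mult_ac)
    qed
    obtain g where g: "g holomorphic_on ball 0 1" "\<And>\<tau>. \<tau> \<in> \<H> \<Longrightarrow> f \<tau> = g (q_exp \<tau>)"
    proof -
      have "\<exists>g. g holomorphic_on ball 0 1 \<and> (\<forall>\<tau>\<in>\<H>. f \<tau> = g (q_exp \<tau>))"
        using hf per l(2) gr by (rule q_expansion_ex)
      thus thesis using that by blast
    qed
    have "(Q *v F \<tau>) $ j = q_pow (l j) \<tau> * g (q_exp \<tau>)" if "\<tau> \<in> \<H>" for \<tau>
    proof -
      have "q_pow (l j) \<tau> * q_pow (- l j) \<tau> = 1"
        unfolding exp_add[symmetric] by (simp add: algebra_simps)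
      hence "(Q *v F \<tau>) $ j = q_pow (l j) \<tau> * f \<tau>"
        by (simp only: f_def mult.assoc[symmetric] mult_1_left)
      thus ?thesis using g(2)[OF that] by simp
    qed
    thus ?thesis using g(1) by blast
  qed
  hence "\<forall>j. \<exists>g. g holomorphic_on ball 0 1 \<and> (\<forall>\<tau>\<in>\<H>. (Q *v F \<tau>) $ j = q_pow (l j) \<tau> * g (q_exp \<tau>))" by blast
  from choice[OF this] obtain g where "\<And>j. g j holomorphic_on ball 0 1"
    "\<And>j. \<forall>\<tau>\<in>\<H>. (Q *v F \<tau>) $ j = q_pow (l j) \<tau> * g j (q_exp \<tau>)" by blast
  thus ?thesis by blast
qed

lemma exp_times_holomorphic_bounded:
  assumes "g holomorphic_on ball 0 1" "0 \<le> Re l"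
  obtains C where "\<And>\<tau>. \<tau> \<in> cusp_strip \<Longrightarrow>
    norm (q_pow l \<tau> * g (q_exp \<tau>)) \<le> C"
proof -
  obtain C where C: "\<And>\<tau>. 1 \<le> Im \<tau> \<Longrightarrow> norm (g (q_exp \<tau>)) \<le> C"
    using bounded_on_cusp_strip_exp[OF assms(1)] by metis
  show thesis
  proof (rule that[of "exp (2 * pi * \<bar>Im l\<bar>) * C"])
    fix \<tau> assume "\<tau> \<in> cusp_strip"
    hence \<tau>: "\<bar>Re \<tau>\<bar> \<le> 1" "1 \<le> Im \<tau>" by (auto simp: cusp_strip_def)
    have "0 \<le> 2 * pi * Re l * Im \<tau>" using assms(2) \<tau>(2) by simp
    hence "exp (- 2 * pi * Re l * Im \<tau>) \<le> 1" by simp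
    hence "exp (2 * pi * \<bar>Im l\<bar>) * exp (- 2 * pi * Re l * Im \<tau>) \<le> exp (2 * pi * \<bar>Im l\<bar>) * 1"
      by (intro mult_left_mono) auto
    from order_trans[OF norm_exp_2pi_i_bounds[OF \<tau>(1)] this]
    have "norm (q_pow l \<tau>) \<le> exp (2 * pi * \<bar>Im l\<bar>)" by (simp only: mult_1_right)
    thus "norm (q_pow l \<tau> * g (q_exp \<tau>)) \<le> exp (2 * pi * \<bar>Im l\<bar>) * C"
      unfolding norm_mult using C[OF \<tau>(2)] by (intro mult_mono) auto
  qed
qed

text \<open>Since the exponents have real parts in \<open>[0, 1)\<close>, holomorphy at the cusp amounts to
  boundedness, and even to linear growth, in a vertical strip.\<close>

definition vvmf :: "(int^2^2 \<Rightarrow> complex^'n^'n) \<Rightarrow> int \<Rightarrow> (complex \<Rightarrow> complex^'n) \<Rightarrow> bool" where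
  "vvmf \<rho> k F \<longleftrightarrow>
     (\<forall>\<tau>. \<tau> \<notin> \<H> \<longrightarrow> F \<tau> = 0) \<and>
     (\<forall>j. (\<lambda>\<tau>. F \<tau> $ j) holomorphic_on \<H>) \<and>
     (\<forall>\<tau>\<in>\<H>. F (\<tau> + 1) = \<rho> T_mat *v F \<tau>) \<and>
     (\<forall>\<tau>\<in>\<H>. F (- 1 / \<tau>) = (\<tau> powi k) *s (\<rho> S_mat *v F \<tau>)) \<and>
     (\<exists>C. \<forall>\<tau>\<in>cusp_strip. norm (F \<tau>) \<le> C * (1 + Im \<tau>))"

lemma vvmf_expansion:
  assumes "T_eigenbasis \<rho> P Q l" "vvmf \<rho> k F"
  shows "\<exists>g. (\<forall>j. g j holomorphic_on ball 0 1) \<and>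
    (\<forall>j. \<forall>\<tau>\<in>\<H>. (Q *v F \<tau>) $ j = q_pow (l j) \<tau> * g j (q_exp \<tau>))"
proof -
  obtain C where C: "\<And>\<tau>. \<tau> \<in> cusp_strip \<Longrightarrow> norm (F \<tau>) \<le> C * (1 + Im \<tau>)"
    using assms(2) unfolding vvmf_def by blast
  have 1: "\<And>j. (\<lambda>\<tau>. F \<tau> $ j) holomorphic_on \<H>" "\<And>\<tau>. \<tau> \<in> \<H> \<Longrightarrow> F (\<tau> + 1) = \<rho> T_mat *v F \<tau>"
    using assms(2) unfolding vvmf_def by blast+
  show ?thesis using assms(1) 1 C by (rule T_component_expansion)
qed

lemma bounded_from_expansion:
  fixes F :: "complex \<Rightarrow> complex^'n"
  assumes "P ** Q = mat 1" "\<And>j. 0 \<le> Re (l j)" "\<And>j. g j holomorphic_on ball 0 1"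
    "\<And>j \<tau>. \<tau> \<in> \<H> \<Longrightarrow> (Q *v F \<tau>) $ j = q_pow (l j) \<tau> * g j (q_exp \<tau>)"
  shows "\<exists>C. \<forall>\<tau>\<in>cusp_strip. norm (F \<tau>) \<le> C"
proof -
  have "\<forall>j. \<exists>C. \<forall>\<tau>\<in>cusp_strip. norm (q_pow (l j) \<tau> * g j (q_exp \<tau>)) \<le> C"
  proof
    fix j show "\<exists>C. \<forall>\<tau>\<in>cusp_strip. norm (q_pow (l j) \<tau> * g j (q_exp \<tau>)) \<le> C"
      by (rule exp_times_holomorphic_bounded[OF assms(3)[of j] assms(2)[of j]]) blast
  qed
  from choice[OF this] obtain C where C: "\<And>j \<tau>. \<tau> \<in> cusp_strip \<Longrightarrow>
      norm (q_pow (l j) \<tau> * g j (q_exp \<tau>)) \<le> C j" by blast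
  obtain K where K: "0 \<le> K" "\<And>v. norm (P *v v) \<le> K * norm v" using matrix_vector_norm_bound[of P] by metis
  show ?thesis
  proof (intro exI ballI)
    fix \<tau> assume \<tau>: "\<tau> \<in> cusp_strip"
    have "norm ((Q *v F \<tau>) $ j) \<le> C j" for j
      using C[OF \<tau>, of j] assms(4)[OF cusp_strip_subset[OF \<tau>], of j] by simp
    hence "(\<Sum>j\<in>UNIV. norm ((Q *v F \<tau>) $ j)) \<le> sum C UNIV" by (intro sum_mono)
    hence "norm (Q *v F \<tau>) \<le> sum C UNIV" using norm_vec_le_sum order_trans by blast
    hence "K * norm (Q *v F \<tau>) \<le> K * sum C UNIV" using K(1) by (intro mult_left_mono)
    moreover have "F \<tau> = P *v (Q *v F \<tau>)" by (simp add: mv_assoc assms(1))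
    ultimately show "norm (F \<tau>) \<le> K * sum C UNIV" using K(2)[of "Q *v F \<tau>"] by simp
  qed
qed

lemma vvmf_bounded:
  assumes "T_eigenbasis \<rho> P Q l" "vvmf \<rho> k F"
  shows "\<exists>C. \<forall>\<tau>\<in>cusp_strip. norm (F \<tau>) \<le> C"
proof -
  obtain g where g: "\<And>j. g j holomorphic_on ball 0 1"
    "\<And>j \<tau>. \<tau> \<in> \<H> \<Longrightarrow> (Q *v F \<tau>) $ j = q_pow (l j) \<tau> * g j (q_exp \<tau>)"
    using vvmf_expansion[OF assms] by blast
  show ?thesis
    by (rule bounded_from_expansion[OF _ _ g]) (use assms(1) in \<open>auto simp: T_eigenbasis_def\<close>)
qed

text \<open>Analyticity at q = 0 bounds the form where |q| is small; the rest of the strip is a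
  compact rectangle.\<close>

lemma modular_forms_imp_growth:
  fixes \<rho> :: "int^2^2 \<Rightarrow> complex^'n^'n"
  assumes basis: "T_eigenbasis \<rho> P Q l" and F: "F \<in> modular_forms \<rho> k"
  shows "\<exists>C. \<forall>\<tau>\<in>cusp_strip. norm (F \<tau>) \<le> C"
proof -
  have PQ: "P ** Q = mat 1" "Q ** P = mat 1" and l: "\<And>j. 0 \<le> Re (l j)"
    using basis by (auto simp: T_eigenbasis_def)
  obtain G where G: "\<And>j. (\<lambda>q. G q $ j) analytic_on {0}"
    "\<And>\<tau>. \<tau> \<in> \<H> \<Longrightarrow> matrix_exp (mat (- 2 * of_real pi * \<i> * \<tau>) ** exponent_matrix \<rho>) *v F \<tau> = G (q_exp \<tau>)"
    using F unfolding modular_forms_def by blast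
  have QF: "(Q *v F \<tau>) $ j = q_pow (l j) \<tau> * (Q *v G (q_exp \<tau>)) $ j"
    if "\<tau> \<in> \<H>" for \<tau> j
  proof -
    have "Q *v G (q_exp \<tau>) = diag_mat (\<lambda>j. exp ((- 2 * of_real pi * \<i> * \<tau>) * l j)) *v (Q *v F \<tau>)"
      unfolding G(2)[OF that, symmetric] exponent_matrix_eq[OF basis] matrix_exp_diagonalizable[OF PQ]
      by (simp add: mv_assoc matrix_mul_assoc PQ)
    hence "(Q *v G (q_exp \<tau>)) $ j = exp ((- 2 * of_real pi * \<i> * \<tau>) * l j) * (Q *v F \<tau>) $ j"
      by (simp only: diag_mat_apply)
    moreover have "q_pow (l j) \<tau> * exp ((- 2 * of_real pi * \<i> * \<tau>) * l j) = 1"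
      unfolding exp_add[symmetric] by (simp add: algebra_simps)
    ultimately show ?thesis by (simp only: mult.assoc[symmetric] mult_1_left)
  qed
  have "\<forall>j. \<exists>e C. 0 < e \<and> (\<forall>q. norm q < e \<longrightarrow> norm (G q $ j) \<le> C)"
  proof
    fix j
    have "isCont (\<lambda>q. G q $ j) 0"
      using G(1)[of j] analytic_at_imp_isCont by blast
    then obtain e where "0 < e" "\<And>q. dist q 0 < e \<Longrightarrow> dist (G q $ j) (G 0 $ j) < 1"
      unfolding continuous_at_eps_delta by (metis zero_less_one)
    moreover from this have "norm (G q $ j) \<le> norm (G 0 $ j) + 1" if "norm q < e" for q
      using that norm_triangle_ineq2[of "G q $ j" "G 0 $ j"] by (force simp: dist_norm)
    ultimately show "\<exists>e C. 0 < e \<and> (\<forall>q. norm q < e \<longrightarrow> norm (G q $ j) \<le> C)" by blast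
  qed
  then obtain e C where eC: "\<And>j. 0 < e j" "\<And>j q. norm q < e j \<Longrightarrow> norm (G q $ j) \<le> C j" by metis
  define \<epsilon> where "\<epsilon> = Min (range e)"
  have \<epsilon>: "0 < \<epsilon>" "\<And>j. \<epsilon> \<le> e j" unfolding \<epsilon>_def using eC(1) by auto
  \<comment> \<open>Im \<tau> \<ge> Y forces |q| = exp (-2 pi Im \<tau>) < \<epsilon>.\<close>
  define Y where "Y = max 1 (- ln \<epsilon> / (2 * pi) + 1)"
  obtain K where K: "0 \<le> K" "\<And>v. norm (Q *v v) \<le> K * norm v" using matrix_vector_norm_bound[of Q] by metis
  obtain K' where K': "0 \<le> K'" "\<And>v. norm (P *v v) \<le> K' * norm v" using matrix_vector_norm_bound[of P] by metis
  have high: "norm (F \<tau>) \<le> K' * (\<Sum>j\<in>UNIV. exp (2 * pi * \<bar>Im (l j)\<bar>) * (K * sum C UNIV))"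
    if \<tau>: "\<tau> \<in> cusp_strip" "Y \<le> Im \<tau>" for \<tau>
  proof -
    let ?q = "q_exp \<tau>"
    have st: "\<bar>Re \<tau>\<bar> \<le> 1" "1 \<le> Im \<tau>" "\<tau> \<in> \<H>" using \<tau> by (auto simp: cusp_strip_def)
    have "- ln \<epsilon> / (2 * pi) < Im \<tau>" using \<tau> by (simp add: Y_def)
    hence "- 2 * pi * Im \<tau> < ln \<epsilon>" by (simp add: field_simps)
    hence "norm ?q < \<epsilon>" using \<epsilon>(1) by (simp add: ln_ge_iff[symmetric]) (metis exp_less_cancel_iff exp_ln)
    hence "norm (G ?q $ j) \<le> C j" for j using eC(2) \<epsilon>(2) by (meson order.strict_trans2)
    hence "norm (G ?q) \<le> sum C UNIV" by (intro order_trans[OF norm_vec_le_sum] sum_mono)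
    hence QG: "norm (Q *v G ?q) \<le> K * sum C UNIV" using K by (meson mult_left_mono order_trans)
    have "norm ((Q *v F \<tau>) $ j) \<le> exp (2 * pi * \<bar>Im (l j)\<bar>) * (K * sum C UNIV)" for j
    proof -
      have "0 \<le> 2 * pi * Re (l j) * Im \<tau>" using l[of j] st by simp
      hence "exp (- 2 * pi * Re (l j) * Im \<tau>) \<le> 1" by simp
      hence "exp (2 * pi * \<bar>Im (l j)\<bar>) * exp (- 2 * pi * Re (l j) * Im \<tau>) \<le> exp (2 * pi * \<bar>Im (l j)\<bar>) * 1"
        by (intro mult_left_mono) auto
      from order_trans[OF norm_exp_2pi_i_bounds[OF st(1)] this]
      have "norm (q_pow (l j) \<tau>) \<le> exp (2 * pi * \<bar>Im (l j)\<bar>)" by (simp only: mult_1_right)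
      moreover have "norm ((Q *v G ?q) $ j) \<le> K * sum C UNIV"
        using QG Finite_Cartesian_Product.norm_nth_le order_trans by blast
      ultimately show ?thesis unfolding QF[OF st(3)] norm_mult by (intro mult_mono) auto
    qed
    hence "norm (Q *v F \<tau>) \<le> (\<Sum>j\<in>UNIV. exp (2 * pi * \<bar>Im (l j)\<bar>) * (K * sum C UNIV))"
      by (intro order_trans[OF norm_vec_le_sum] sum_mono)
    hence "K' * norm (Q *v F \<tau>) \<le> K' * (\<Sum>j\<in>UNIV. exp (2 * pi * \<bar>Im (l j)\<bar>) * (K * sum C UNIV))"
      using K'(1) by (rule mult_left_mono)
    moreover have "F \<tau> = P *v (Q *v F \<tau>)" by (simp add: mv_assoc PQ)
    ultimately show ?thesis using K'(2)[of "Q *v F \<tau>"] by simp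
  qed
  let ?B = "cbox (Complex (-1) 1) (Complex 1 Y)"
  have BH: "?B \<subseteq> \<H>" by (auto simp: in_cbox_complex_iff)
  have "\<forall>j. \<exists>M. \<forall>\<tau>\<in>?B. norm (F \<tau> $ j) \<le> M"
  proof
    fix j
    have "(\<lambda>\<tau>. F \<tau> $ j) holomorphic_on \<H>" using F unfolding modular_forms_def by blast
    hence "continuous_on ?B (\<lambda>\<tau>. F \<tau> $ j)"
      using BH holomorphic_on_imp_continuous_on holomorphic_on_subset by blast
    hence "compact ((\<lambda>\<tau>. F \<tau> $ j) ` ?B)" by (intro compact_continuous_image) auto
    thus "\<exists>M. \<forall>\<tau>\<in>?B. norm (F \<tau> $ j) \<le> M"
    proof -
      assume "compact ((\<lambda>\<tau>. F \<tau> $ j) ` ?B)"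
      from compact_imp_bounded[OF this] obtain M where "\<forall>x\<in>(\<lambda>\<tau>. F \<tau> $ j) ` ?B. norm x \<le> M"
        unfolding bounded_iff by blast
      thus ?thesis by (intro exI[of _ M]) simp
    qed
  qed
  from choice[OF this] obtain M where M: "\<And>j \<tau>. \<tau> \<in> ?B \<Longrightarrow> norm (F \<tau> $ j) \<le> M j" by blast
  have low: "norm (F \<tau>) \<le> sum M UNIV" if "\<tau> \<in> ?B" for \<tau>
    using M[OF that] by (intro order_trans[OF norm_vec_le_sum] sum_mono)
  show ?thesis
  proof (intro exI ballI)
    fix \<tau> assume \<tau>: "\<tau> \<in> cusp_strip"
    show "norm (F \<tau>) \<le> max (sum M UNIV) (K' * (\<Sum>j\<in>UNIV. exp (2 * pi * \<bar>Im (l j)\<bar>) * (K * sum C UNIV)))"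
    proof (cases "Y \<le> Im \<tau>")
      case False
      hence "\<tau> \<in> ?B" using \<tau> by (auto simp: cusp_strip_def in_cbox_complex_iff)
      thus ?thesis using low by (simp add: le_max_iff_disj)
    qed (use high \<tau> in \<open>simp add: le_max_iff_disj\<close>)
  qed
qed

text \<open>The bridge to the definition of forms: the matrix exponential and the full group are
  traded for a growth bound and the two generators.\<close>

theorem modular_forms_iff:
  fixes \<rho> :: "int^2^2 \<Rightarrow> complex^'n^'n"
  assumes \<rho>: "sl2_rep \<rho>" and basis: "T_eigenbasis \<rho> P Q l"
  shows "F \<in> modular_forms \<rho> k \<longleftrightarrow> vvmf \<rho> k F"
proof
  assume F: "F \<in> modular_forms \<rho> k"
  obtain C where C: "\<And>\<tau>. \<tau> \<in> cusp_strip \<Longrightarrow> norm (F \<tau>) \<le> C"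
    using modular_forms_imp_growth[OF basis F] by blast
  have eq: "F (moebius_act g \<tau>) = (aut_factor g \<tau> powi k) *s (\<rho> g *v F \<tau>)" if "g \<in> SL2Z" "\<tau> \<in> \<H>" for g \<tau>
    using F that unfolding modular_forms_def by blast
  have "norm (F \<tau>) \<le> \<bar>C\<bar> * (1 + Im \<tau>)" if "\<tau> \<in> cusp_strip" for \<tau>
  proof -
    have "norm (F \<tau>) \<le> \<bar>C\<bar> * 1" using C[OF that] by simp
    also have "\<dots> \<le> \<bar>C\<bar> * (1 + Im \<tau>)" using that by (intro mult_left_mono) (auto simp: cusp_strip_def)
    finally show ?thesis .
  qed
  moreover have "F (\<tau> + 1) = \<rho> T_mat *v F \<tau>" "F (- 1 / \<tau>) = (\<tau> powi k) *s (\<rho> S_mat *v F \<tau>)" if "\<tau> \<in> \<H>" for \<tau>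
    using eq[OF T_mat_in_SL2Z that] eq[OF S_mat_in_SL2Z that] by simp_all
  moreover have "\<forall>\<tau>. \<tau> \<notin> \<H> \<longrightarrow> F \<tau> = 0" "\<forall>j. (\<lambda>\<tau>. F \<tau> $ j) holomorphic_on \<H>"
    using F unfolding modular_forms_def by blast+
  ultimately show "vvmf \<rho> k F" unfolding vvmf_def by blast
next
  assume F: "vvmf \<rho> k F"
  have PQ: "P ** Q = mat 1" "Q ** P = mat 1" using basis by (auto simp: T_eigenbasis_def)
  obtain g where g: "\<And>j. g j holomorphic_on ball 0 1"
    "\<And>j \<tau>. \<tau> \<in> \<H> \<Longrightarrow> (Q *v F \<tau>) $ j = q_pow (l j) \<tau> * g j (q_exp \<tau>)"
    using vvmf_expansion[OF basis F] by blast
  define G where "G q = P *v (\<chi> j. g j q)" for q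
  have "(\<lambda>q. G q $ j) analytic_on {0}" for j
  proof -
    have "(\<lambda>q. (\<chi> j. g j q) $ i) holomorphic_on ball 0 1" for i using g(1) by simp
    hence "(\<lambda>q. G q $ j) holomorphic_on ball 0 1"
      unfolding G_def by (rule holomorphic_on_matrix_vector)
    hence "(\<lambda>q. G q $ j) analytic_on ball 0 1" by (simp add: analytic_on_open)
    thus ?thesis by (rule analytic_on_subset) auto
  qed
  moreover have "matrix_exp (mat (- 2 * of_real pi * \<i> * \<tau>) ** exponent_matrix \<rho>) *v F \<tau> = G (q_exp \<tau>)"
    if "\<tau> \<in> \<H>" for \<tau>
  proof -
    have "diag_mat (\<lambda>j. exp ((- 2 * of_real pi * \<i> * \<tau>) * l j)) *v (Q *v F \<tau>) = (\<chi> j. g j (q_exp \<tau>))"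
    proof -
      have "exp ((- 2 * of_real pi * \<i> * \<tau>) * l j) * q_pow (l j) \<tau> = 1" for j
        unfolding exp_add[symmetric] by (simp add: algebra_simps)
      hence "exp ((- 2 * of_real pi * \<i> * \<tau>) * l j) * (q_pow (l j) \<tau> * z) = z" for j z
        by (simp only: mult.assoc[symmetric] mult_1_left)
      thus ?thesis unfolding vec_eq_iff diag_mat_apply g(2)[OF that] vec_lambda_beta by blast
    qed
    thus ?thesis
      unfolding exponent_matrix_eq[OF basis] matrix_exp_diagonalizable[OF PQ] G_def
      by (simp only: mv_assoc[symmetric])
  qed
  ultimately have "\<exists>G. (\<forall>j. (\<lambda>q. G q $ j) analytic_on {0}) \<and> (\<forall>\<tau>\<in>\<H>. matrix_exp (mat (- 2 * of_real pi * \<i> * \<tau>) ** exponent_matrix \<rho>) *v F \<tau> = G (q_exp \<tau>))"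
    by blast
  moreover have "F (moebius_act g \<tau>) = (aut_factor g \<tau> powi k) *s (\<rho> g *v F \<tau>)" if "g \<in> SL2Z" "\<tau> \<in> \<H>" for g \<tau>
    using F that unfolding vvmf_def by (intro transformation_from_generators[OF \<rho>]) blast+
  moreover have "\<forall>\<tau>. \<tau> \<notin> \<H> \<longrightarrow> F \<tau> = 0" "\<forall>j. (\<lambda>\<tau>. F \<tau> $ j) holomorphic_on \<H>"
    using F unfolding vvmf_def by blast+
  ultimately show "F \<in> modular_forms \<rho> k" unfolding modular_forms_def by blast
qed

subsection \<open>Scalar forms\<close>

definition sform :: "int \<Rightarrow> (complex \<Rightarrow> complex) \<Rightarrow> bool" where
  "sform k f \<longleftrightarrow>
     (\<forall>\<tau>. \<tau> \<notin> \<H> \<longrightarrow> f \<tau> = 0) \<and> f holomorphic_on \<H> \<and>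
     (\<forall>\<tau>\<in>\<H>. f (\<tau> + 1) = f \<tau>) \<and> (\<forall>\<tau>\<in>\<H>. f (- 1 / \<tau>) = \<tau> powi k * f \<tau>) \<and>
     (\<exists>C. \<forall>\<tau>\<in>cusp_strip. norm (f \<tau>) \<le> C * (1 + Im \<tau>))"

text \<open>The constant term of the q-expansion, read off along the imaginary axis so that no
  choice of expansion enters.\<close>

definition cusp_value :: "(complex \<Rightarrow> complex) \<Rightarrow> complex" where
  "cusp_value f = Lim at_top (\<lambda>y. f (\<i> * of_real y))"

lemma sform_expansion:
  assumes "sform k f"
  shows "\<exists>g. g holomorphic_on ball 0 1 \<and> (\<forall>\<tau>\<in>\<H>. f \<tau> = g (q_exp \<tau>))"
proof -
  obtain C where C: "\<And>\<tau>. \<tau> \<in> cusp_strip \<Longrightarrow> norm (f \<tau>) \<le> C * (1 + Im \<tau>)"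
    using assms unfolding sform_def by blast
  have "norm (f \<tau>) \<le> C * (1 + Im \<tau>) * exp (2 * pi * 0 * Im \<tau>)" if "\<bar>Re \<tau>\<bar> \<le> 1" "1 \<le> Im \<tau>" for \<tau>
    using C[of \<tau>] that by (simp add: cusp_strip_def)
  moreover have "f holomorphic_on \<H>" "\<And>\<tau>. \<tau> \<in> \<H> \<Longrightarrow> f (\<tau> + 1) = f \<tau>"
    using assms unfolding sform_def by blast+
  ultimately show ?thesis by (intro q_expansion_ex[where \<theta> = 0]) auto
qed

lemma cusp_value_expansion:
  assumes "g holomorphic_on ball 0 1" "\<And>\<tau>. \<tau> \<in> \<H> \<Longrightarrow> f \<tau> = g (q_exp \<tau>)"
  shows "((\<lambda>y. f (\<i> * of_real y)) \<longlongrightarrow> g 0) at_top" "cusp_value f = g 0"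
proof -
  show lim: "((\<lambda>y. f (\<i> * of_real y)) \<longlongrightarrow> g 0) at_top"
    by (rule Lim_transform_eventually[OF q_expansion_imag_axis[OF assms(1)]])
       (use assms(2) in \<open>auto intro!: eventually_mono[OF eventually_gt_at_top[of 0]]\<close>)
  show "cusp_value f = g 0" unfolding cusp_value_def using lim by (intro tendsto_Lim) auto
qed

lemma cusp_value_limit: "sform k f \<Longrightarrow> ((\<lambda>y. f (\<i> * of_real y)) \<longlongrightarrow> cusp_value f) at_top"
  using sform_expansion cusp_value_expansion by metis

lemma cusp_valueI: "((\<lambda>y. f (\<i> * of_real y)) \<longlongrightarrow> c) at_top \<Longrightarrow> cusp_value f = c"
  unfolding cusp_value_def by (intro tendsto_Lim) auto

lemma sform_bounded:
  assumes "sform k f" shows "\<exists>C. \<forall>\<tau>\<in>cusp_strip. norm (f \<tau>) \<le> C"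
proof -
  obtain g where g: "g holomorphic_on ball 0 1" "\<And>\<tau>. \<tau> \<in> \<H> \<Longrightarrow> f \<tau> = g (q_exp \<tau>)"
    using sform_expansion[OF assms] by blast
  obtain C where "\<And>\<tau>. 1 \<le> Im \<tau> \<Longrightarrow> norm (g (q_exp \<tau>)) \<le> C"
    using bounded_on_cusp_strip_exp[OF g(1)] by metis
  hence "norm (f \<tau>) \<le> C" if "\<tau> \<in> cusp_strip" for \<tau>
    using g(2)[OF cusp_strip_subset[OF that]] that by (simp add: cusp_strip_def)
  thus ?thesis by blast
qed

lemma bounded_imp_linear_growth:
  fixes f :: "complex \<Rightarrow> 'a::real_normed_vector"
  assumes "\<And>\<tau>. \<tau> \<in> cusp_strip \<Longrightarrow> norm (f \<tau>) \<le> C"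
  shows "\<exists>C. \<forall>\<tau>\<in>cusp_strip. norm (f \<tau>) \<le> C * (1 + Im \<tau>)"
proof (intro exI ballI)
  fix \<tau> assume \<tau>: "\<tau> \<in> cusp_strip"
  have "norm (f \<tau>) \<le> \<bar>C\<bar> * 1" using assms[OF \<tau>] by simp
  also have "\<dots> \<le> \<bar>C\<bar> * (1 + Im \<tau>)" using \<tau> by (intro mult_left_mono) (auto simp: cusp_strip_def)
  finally show "norm (f \<tau>) \<le> \<bar>C\<bar> * (1 + Im \<tau>)" .
qed

lemma sformI:
  assumes "\<And>\<tau>. \<tau> \<notin> \<H> \<Longrightarrow> f \<tau> = 0" "f holomorphic_on \<H>" "\<And>\<tau>. \<tau> \<in> \<H> \<Longrightarrow> f (\<tau> + 1) = f \<tau>"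
    "\<And>\<tau>. \<tau> \<in> \<H> \<Longrightarrow> f (- 1 / \<tau>) = \<tau> powi k * f \<tau>" "\<And>\<tau>. \<tau> \<in> cusp_strip \<Longrightarrow> norm (f \<tau>) \<le> C"
  shows "sform k f"
  using assms(1-4) bounded_imp_linear_growth[of f C, OF assms(5)] unfolding sform_def by blast

lemma sformD:
  assumes "sform k f"
  shows "\<tau> \<notin> \<H> \<Longrightarrow> f \<tau> = 0" "f holomorphic_on \<H>" "\<tau> \<in> \<H> \<Longrightarrow> f (\<tau> + 1) = f \<tau>"
    "\<tau> \<in> \<H> \<Longrightarrow> f (- 1 / \<tau>) = \<tau> powi k * f \<tau>"
  using assms unfolding sform_def by blast+

lemma sform_const [simp]: "sform 0 (\<lambda>\<tau>. if \<tau> \<in> \<H> then c else 0)"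
proof (rule sformI[where C = "norm c"])
  show "(\<lambda>\<tau>. if \<tau> \<in> \<H> then c else 0) holomorphic_on \<H>"
    by (rule holomorphic_transform[of "\<lambda>_. c"]) auto
qed (use neg_inverse_in_uhp cusp_strip_subset in auto)

lemma sform_zero [simp]: "sform k (\<lambda>_. 0)"
  by (rule sformI[where C = 0]) auto

lemma sform_add: assumes "sform k f" "sform k g" shows "sform k (\<lambda>\<tau>. f \<tau> + g \<tau>)"
proof -
  obtain C D where "\<And>\<tau>. \<tau> \<in> cusp_strip \<Longrightarrow> norm (f \<tau>) \<le> C" "\<And>\<tau>. \<tau> \<in> cusp_strip \<Longrightarrow> norm (g \<tau>) \<le> D"
    using sform_bounded assms by metis
  thus ?thesis using sformD[OF assms(1)] sformD[OF assms(2)]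
    by (intro sformI[where C = "C + D"]) (auto intro!: holomorphic_intros norm_triangle_mono simp: algebra_simps)
qed

lemma sform_mult: assumes "sform k f" "sform l g" shows "sform (k + l) (\<lambda>\<tau>. f \<tau> * g \<tau>)"
proof -
  obtain C D where CD: "\<And>\<tau>. \<tau> \<in> cusp_strip \<Longrightarrow> norm (f \<tau>) \<le> C" "\<And>\<tau>. \<tau> \<in> cusp_strip \<Longrightarrow> norm (g \<tau>) \<le> D"
    using sform_bounded assms by metis
  show ?thesis
  proof (rule sformI[where C = "C * D"])
    fix \<tau> assume \<tau>: "\<tau> \<in> \<H>"
    hence "\<tau> \<noteq> 0" by auto
    thus "f (- 1 / \<tau>) * g (- 1 / \<tau>) = \<tau> powi (k + l) * (f \<tau> * g \<tau>)"
      using sformD(4)[OF assms(1) \<tau>] sformD(4)[OF assms(2) \<tau>] by (simp add: power_int_add)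
  next
    fix \<tau> assume \<tau>: "\<tau> \<in> cusp_strip"
    have "0 \<le> C" using CD(1)[OF \<tau>] norm_ge_zero order_trans by blast
    thus "norm (f \<tau> * g \<tau>) \<le> C * D" unfolding norm_mult using CD[OF \<tau>] by (intro mult_mono) auto
  qed (use sformD[OF assms(1)] sformD[OF assms(2)] in \<open>auto intro!: holomorphic_intros\<close>)
qed

lemma sform_cmult: assumes "sform k f" shows "sform k (\<lambda>\<tau>. c * f \<tau>)"
proof -
  have "sform (0 + k) (\<lambda>\<tau>. (if \<tau> \<in> \<H> then c else 0) * f \<tau>)" using assms by (intro sform_mult sform_const)
  also have "(\<lambda>\<tau>. (if \<tau> \<in> \<H> then c else 0) * f \<tau>) = (\<lambda>\<tau>. c * f \<tau>)" using sformD(1)[OF assms] by auto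
  finally show ?thesis by simp
qed

lemma sform_diff: "sform k f \<Longrightarrow> sform k g \<Longrightarrow> sform k (\<lambda>\<tau>. f \<tau> - g \<tau>)"
  using sform_add[of k f "\<lambda>\<tau>. - 1 * g \<tau>"] sform_cmult[of k g "- 1"] by simp

lemma sform_power: "sform k f \<Longrightarrow> 0 < n \<Longrightarrow> sform (int n * k) (\<lambda>\<tau>. f \<tau> ^ n)"
proof (induction n)
  case (Suc n)
  show ?case
  proof (cases "n = 0")
    case False
    with Suc have "sform (k + int n * k) (\<lambda>\<tau>. f \<tau> * f \<tau> ^ n)" by (intro sform_mult) auto
    thus ?thesis by (simp add: algebra_simps)
  qed (use Suc in simp)
qed simp

abbreviation E4 :: "complex \<Rightarrow> complex" where "E4 \<equiv> eisenstein 4"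
abbreviation E6 :: "complex \<Rightarrow> complex" where "E6 \<equiv> eisenstein 6"

lemma sform_eisenstein: assumes "2 \<le> j" shows "sform (2 * int j) (eisenstein (2 * j))"
proof -
  obtain C where C: "\<And>\<tau>. \<bar>Re \<tau>\<bar> \<le> 1 \<Longrightarrow> 1 \<le> Im \<tau> \<Longrightarrow> norm (eisenstein (2 * j) \<tau>) \<le> C"
    using eisenstein_bounded[OF assms] by blast
  show ?thesis
  proof (rule sformI[where C = C])
    fix \<tau> assume "\<tau> \<in> \<H>"
    thus "eisenstein (2 * j) (- 1 / \<tau>) = \<tau> powi (2 * int j) * eisenstein (2 * j) \<tau>"
      using eisenstein_inversion[of \<tau> "2 * j"] by (simp add: power_int_def nat_mult_distrib)
  qed (use C eisenstein_holomorphic[OF assms] eisenstein_translation in \<open>auto simp: cusp_strip_def eisenstein_def\<close>)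
qed

lemma sform_E4: "sform 4 E4" and sform_E6: "sform 6 E6"
  using sform_eisenstein[of 2] sform_eisenstein[of 3] by simp_all

lemma cusp_value_E4: "cusp_value E4 = 1" and cusp_value_E6: "cusp_value E6 = 1"
  using eisenstein_imag_axis_limit[of 2] eisenstein_imag_axis_limit[of 3] by (auto intro: cusp_valueI)

lemma cusp_value_mult: "sform k f \<Longrightarrow> sform l g \<Longrightarrow> cusp_value (\<lambda>\<tau>. f \<tau> * g \<tau>) = cusp_value f * cusp_value g"
  by (intro cusp_valueI tendsto_mult cusp_value_limit)

lemma cusp_value_diff: "sform k f \<Longrightarrow> sform l g \<Longrightarrow> cusp_value (\<lambda>\<tau>. f \<tau> - g \<tau>) = cusp_value f - cusp_value g"
  by (intro cusp_valueI tendsto_diff cusp_value_limit)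

lemma cusp_value_cmult: "sform k f \<Longrightarrow> cusp_value (\<lambda>\<tau>. c * f \<tau>) = c * cusp_value f"
  by (intro cusp_valueI tendsto_mult tendsto_const cusp_value_limit)

lemma cusp_value_power: "sform k f \<Longrightarrow> cusp_value (\<lambda>\<tau>. f \<tau> ^ n) = cusp_value f ^ n"
  by (intro cusp_valueI tendsto_power cusp_value_limit)

section \<open>The discriminant and division by it\<close>

definition Delta :: "complex \<Rightarrow> complex" where "Delta \<tau> = eta4 \<tau> ^ 6"

lemma Delta_nonzero: "\<tau> \<in> \<H> \<Longrightarrow> Delta \<tau> \<noteq> 0"
  by (simp add: Delta_def eta4_nonzero)

lemma Delta_bounds:
  obtains a b where "0 < a"
    "\<And>\<tau>. 1 \<le> Im \<tau> \<Longrightarrow> a * exp (- 2 * pi * Im \<tau>) \<le> norm (Delta \<tau>)"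
    "\<And>\<tau>. 1 \<le> Im \<tau> \<Longrightarrow> norm (Delta \<tau>) \<le> b * exp (- 2 * pi * Im \<tau>)"
proof -
  obtain a b where ab: "0 < a"
    "\<And>\<tau>. 1 \<le> Im \<tau> \<Longrightarrow> a * exp (- pi / 3 * Im \<tau>) \<le> norm (eta4 \<tau>)"
    "\<And>\<tau>. 1 \<le> Im \<tau> \<Longrightarrow> norm (eta4 \<tau>) \<le> b * exp (- pi / 3 * Im \<tau>)"
    using eta4_bounds by metis
  have e: "(c * exp (- pi / 3 * y)) ^ 6 = c ^ 6 * exp (- 2 * pi * y)" for c y :: real
    unfolding power_mult_distrib by (simp flip: exp_of_nat_mult)
  show thesis
  proof (rule that[of "a ^ 6" "b ^ 6"])
    fix \<tau> :: complex assume \<tau>: "1 \<le> Im \<tau>"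
    show "a ^ 6 * exp (- 2 * pi * Im \<tau>) \<le> norm (Delta \<tau>)" "norm (Delta \<tau>) \<le> b ^ 6 * exp (- 2 * pi * Im \<tau>)"
      unfolding e[symmetric] Delta_def norm_power using ab \<tau> by (auto intro!: power_mono)
  qed (use ab in auto)
qed

lemma Delta_holomorphic: "Delta holomorphic_on \<H>"
  unfolding Delta_def[abs_def] by (intro holomorphic_intros eta4_holomorphic)

lemma Delta_translation: "\<tau> \<in> \<H> \<Longrightarrow> Delta (\<tau> + 1) = Delta \<tau>"
proof -
  assume \<tau>: "\<tau> \<in> \<H>"
  have "exp (\<i> * of_real pi / 3) ^ 6 = exp (2 * of_real pi * \<i>)"
    unfolding exp_of_nat_mult[symmetric] by (rule arg_cong[of _ _ exp]) simp
  also have "\<dots> = 1" by simp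
  finally have "exp (\<i> * of_real pi / 3) ^ 6 = 1" .
  thus ?thesis unfolding Delta_def eta4_translation[OF \<tau>] power_mult_distrib by simp
qed

lemma Delta_inversion: "\<tau> \<in> \<H> \<Longrightarrow> Delta (- 1 / \<tau>) = \<tau> ^ 12 * Delta \<tau>"
proof -
  assume \<tau>: "\<tau> \<in> \<H>"
  have "(- (x^2) * y) ^ 6 = x ^ 12 * y ^ 6" for x y :: complex by (simp add: power_mult_distrib)
  thus ?thesis unfolding Delta_def eta4_inversion[OF \<tau>] .
qed

lemma sform_Delta: "sform 12 Delta"
proof -
  obtain b where b: "\<And>\<tau>. 1 \<le> Im \<tau> \<Longrightarrow> norm (Delta \<tau>) \<le> b * exp (- 2 * pi * Im \<tau>)"
    using Delta_bounds by metis
  show ?thesis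
  proof (rule sformI[where C = "\<bar>b\<bar>"])
    fix \<tau> assume "\<tau> \<in> cusp_strip"
    hence \<tau>: "1 \<le> Im \<tau>" by (simp add: cusp_strip_def)
    have "norm (Delta \<tau>) \<le> b * exp (- 2 * pi * Im \<tau>)" by (rule b[OF \<tau>])
    also have "\<dots> \<le> \<bar>b\<bar> * 1" using \<tau> by (intro mult_mono) auto
    finally show "norm (Delta \<tau>) \<le> \<bar>b\<bar>" by simp
  qed (use Delta_holomorphic Delta_translation Delta_inversion in \<open>auto simp: Delta_def eta4_def\<close>)
qed

lemma cusp_value_Delta: "cusp_value Delta = 0"
proof (rule cusp_valueI)
  obtain b where b: "\<And>\<tau>. 1 \<le> Im \<tau> \<Longrightarrow> norm (Delta \<tau>) \<le> b * exp (- 2 * pi * Im \<tau>)"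
    using Delta_bounds by metis
  have lim: "((\<lambda>y. b * exp (- 2 * pi * y)) \<longlongrightarrow> 0) at_top" by real_asymp
  show "((\<lambda>y. Delta (\<i> * of_real y)) \<longlongrightarrow> 0) at_top"
    by (rule Lim_null_comparison[OF _ lim])
       (use b[of "\<i> * of_real _"] in \<open>auto intro!: eventually_mono[OF eventually_ge_at_top[of 1]]\<close>)
qed

lemma expansion_vanishing_at_cusp:
  assumes "g holomorphic_on ball 0 1" "g 0 = 0"
  obtains h where "h holomorphic_on ball 0 1" "\<And>q. q \<in> ball 0 1 \<Longrightarrow> g q = q * h q"
proof -
  define h where "h q = (if q = 0 then deriv g 0 else (g q - g 0) / (q - 0))" for q
  have "h holomorphic_on ball 0 1" unfolding h_def by (rule pole_lemma) (use assms in auto)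
  moreover have "g q = q * h q" for q using assms(2) by (simp add: h_def)
  ultimately show thesis by (rule that)
qed

lemma norm_vanishing_expansion_le:
  assumes "g holomorphic_on ball 0 1" "g 0 = 0"
  obtains C where "\<And>\<tau>. 1 \<le> Im \<tau> \<Longrightarrow> norm (g (q_exp \<tau>)) \<le> C * exp (- 2 * pi * Im \<tau>)"
proof -
  obtain h where h: "h holomorphic_on ball 0 1" "\<And>q. q \<in> ball 0 1 \<Longrightarrow> g q = q * h q"
    using expansion_vanishing_at_cusp[OF assms] by metis
  obtain C where C: "\<And>\<tau>. 1 \<le> Im \<tau> \<Longrightarrow> norm (h (q_exp \<tau>)) \<le> C"
    using bounded_on_cusp_strip_exp[OF h(1)] by metis
  show thesis
  proof (rule that[of C])
    fix \<tau> :: complex assume \<tau>: "1 \<le> Im \<tau>"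
    hence "q_exp \<tau> \<in> ball 0 1" by simp
    from h(2)[OF this] C[OF \<tau>]
    show "norm (g (q_exp \<tau>)) \<le> C * exp (- 2 * pi * Im \<tau>)"
      by (simp add: norm_mult mult.commute)
  qed
qed

text \<open>A vanishing constant term gives a factor q, while \<open>Delta\<close> is of exact order
  |q| and, as a power of an exponential, has no zeros.\<close>

lemma sform_div_Delta:
  assumes f: "sform k f" and "cusp_value f = 0"
  shows "sform (k - 12) (\<lambda>\<tau>. f \<tau> / Delta \<tau>)"
proof -
  obtain g where g: "g holomorphic_on ball 0 1" "\<And>\<tau>. \<tau> \<in> \<H> \<Longrightarrow> f \<tau> = g (q_exp \<tau>)"
    using sform_expansion[OF f] by blast
  have "g 0 = 0" using cusp_value_expansion(2)[OF g] assms(2) by simp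
  then obtain C where C: "\<And>\<tau>. 1 \<le> Im \<tau> \<Longrightarrow> norm (g (q_exp \<tau>)) \<le> C * exp (- 2 * pi * Im \<tau>)"
    using norm_vanishing_expansion_le[OF g(1)] by metis
  obtain a where a: "0 < a" "\<And>\<tau>. 1 \<le> Im \<tau> \<Longrightarrow> a * exp (- 2 * pi * Im \<tau>) \<le> norm (Delta \<tau>)"
    using Delta_bounds by metis
  show ?thesis
  proof (rule sformI[where C = "C / a"])
    fix \<tau> assume \<tau>: "\<tau> \<in> \<H>"
    have nz: "\<tau> \<noteq> 0" using \<tau> by auto
    have "\<tau> powi k = \<tau> powi (k - 12) * \<tau> ^ 12"
      using power_int_add[of \<tau> "k - 12" 12] nz by simp
    thus "f (- 1 / \<tau>) / Delta (- 1 / \<tau>) = \<tau> powi (k - 12) * (f \<tau> / Delta \<tau>)"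
      using nz Delta_nonzero[OF \<tau>] sformD(4)[OF f \<tau>] Delta_inversion[OF \<tau>] by (simp add: field_simps)
  next
    fix \<tau> assume \<tau>: "\<tau> \<in> cusp_strip"
    hence "norm (f \<tau> / Delta \<tau>) \<le> (C * exp (- 2 * pi * Im \<tau>)) / (a * exp (- 2 * pi * Im \<tau>))"
      unfolding norm_divide using C[of \<tau>] a g(2)[OF cusp_strip_subset[OF \<tau>]]
      by (intro frac_le) (auto simp: cusp_strip_def intro: order_trans[OF norm_ge_zero])
    thus "norm (f \<tau> / Delta \<tau>) \<le> C / a" by simp
  qed (use sformD[OF f] Delta_translation Delta_holomorphic Delta_nonzero in \<open>auto intro!: holomorphic_intros\<close>)
qed

text \<open>If |Re \<sigma>| \<le> 1/2 and Im \<sigma> < 1/2, then |\<sigma>|^2 \<le> 1/2 and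
  inversion at least doubles the imaginary part. The crude height 1/2, instead of a fundamental
  domain, makes the number of steps easy to bound.\<close>

lemma reduction_to_fundamental_strip:
  assumes T: "\<And>\<tau>. \<tau> \<in> \<H> \<Longrightarrow> f (\<tau> + 1) = f \<tau>" and S: "\<And>\<tau>. \<tau> \<in> \<H> \<Longrightarrow> f (- 1 / \<tau>) = f \<tau>"
  shows "\<tau> \<in> \<H> \<Longrightarrow> \<exists>\<tau>'. \<bar>Re \<tau>'\<bar> \<le> 1/2 \<and> 1/2 \<le> Im \<tau>' \<and> f \<tau>' = f (\<tau> :: complex)"
proof -
  have step: "\<exists>\<tau>'. \<bar>Re \<tau>'\<bar> \<le> 1/2 \<and> Im \<tau>' = Im \<tau> \<and> f \<tau>' = f \<tau>" if "\<tau> \<in> \<H>" for \<tau>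
  proof (intro exI conjI)
    let ?n = "- round (Re \<tau>)"
    show "\<bar>Re (\<tau> + of_int ?n)\<bar> \<le> 1/2" using of_int_round_abs_le[of "Re \<tau>"] by (simp add: abs_minus_commute)
    show "f (\<tau> + of_int ?n) = f \<tau>" using T that by (rule uhp_translate_int)
  qed auto
  have "\<exists>\<tau>'. \<bar>Re \<tau>'\<bar> \<le> 1/2 \<and> 1/2 \<le> Im \<tau>' \<and> f \<tau>' = f \<tau>" if "1/2 \<le> Im \<tau> * 2 ^ n" "\<tau> \<in> \<H>" for n \<tau>
    using that
  proof (induction n arbitrary: \<tau>)
    case 0
    thus ?case using step[of \<tau>] by auto
  next
    case (Suc n)
    obtain \<sigma> where \<sigma>: "\<bar>Re \<sigma>\<bar> \<le> 1/2" "Im \<sigma> = Im \<tau>" "f \<sigma> = f \<tau>" using step[OF Suc.prems(2)] by blast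
    show ?case
    proof (cases "1/2 \<le> Im \<sigma>")
      case True
      thus ?thesis using \<sigma> by auto
    next
      case False
      have im: "0 < Im \<sigma>" using \<sigma> Suc.prems by simp
      have r: "(Re \<sigma>)^2 \<le> (1/2)^2" using \<sigma>(1) by (metis abs_ge_zero power2_abs power_mono)
      have i: "(Im \<sigma>)^2 \<le> (1/2)^2" using False im by (intro power_mono) auto
      have pos: "0 < (Re \<sigma>)^2 + (Im \<sigma>)^2" using im by (intro add_nonneg_pos) auto
      have half: "(Re \<sigma>)^2 + (Im \<sigma>)^2 \<le> 1/2" using r i by (simp add: power2_eq_square)
      have "Im (- 1 / \<sigma>) = Im \<sigma> / ((Re \<sigma>)^2 + (Im \<sigma>)^2)" by (simp add: Im_divide)
      also have "\<dots> \<ge> Im \<sigma> / (1/2)" using half pos im by (intro divide_left_mono) auto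
      finally have "2 * Im \<sigma> \<le> Im (- 1 / \<sigma>)" by simp
      hence "2 * Im \<sigma> * 2 ^ n \<le> Im (- 1 / \<sigma>) * 2 ^ n" by (intro mult_right_mono) auto
      hence "1/2 \<le> Im (- 1 / \<sigma>) * 2 ^ n" using Suc.prems \<sigma> by simp
      moreover have "- 1 / \<sigma> \<in> \<H>" using neg_inverse_in_uhp im by simp
      ultimately obtain \<tau>' where "\<bar>Re \<tau>'\<bar> \<le> 1/2 \<and> 1/2 \<le> Im \<tau>' \<and> f \<tau>' = f (- 1 / \<sigma>)"
        using Suc.IH by blast
      moreover have "f (- 1 / \<sigma>) = f \<tau>" using S[of \<sigma>] im \<sigma>(3) by simp
      ultimately show ?thesis by auto
    qed
  qed
  moreover assume \<tau>: "\<tau> \<in> \<H>"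
  obtain n where "1 / (2 * Im \<tau>) < 2 ^ n" using real_arch_pow[of 2 "1 / (2 * Im \<tau>)"] by auto
  hence "1/2 \<le> Im \<tau> * 2 ^ n" using \<tau> by (simp add: field_simps)
  ultimately show ?thesis using \<tau> by blast
qed

text \<open>Maximum principle: f minus its cusp value tends to 0 at the cusp, so if it is nonzero
  somewhere its modulus has a global maximum, attained on a compact rectangle; but a constant
  tending to 0 is 0.\<close>

theorem sform_weight_0:
  assumes f: "sform 0 f" and \<tau>: "\<tau> \<in> \<H>" shows "f \<tau> = cusp_value f"
proof (rule ccontr)
  assume ne: "f \<tau> \<noteq> cusp_value f"
  obtain g where g: "g holomorphic_on ball 0 1" "\<And>\<tau>. \<tau> \<in> \<H> \<Longrightarrow> f \<tau> = g (q_exp \<tau>)"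
    using sform_expansion[OF f] by blast
  have g0: "cusp_value f = g 0" by (rule cusp_value_expansion(2)[OF g])
  define h where "h \<tau> = f \<tau> - g 0" for \<tau>
  have "(\<lambda>q. g q - g 0) holomorphic_on ball 0 1" using g(1) by (intro holomorphic_intros)
  then obtain C where C: "\<And>\<tau>. 1 \<le> Im \<tau> \<Longrightarrow> norm (g (q_exp \<tau>) - g 0) \<le> C * exp (- 2 * pi * Im \<tau>)"
    using norm_vanishing_expansion_le[of "\<lambda>q. g q - g 0"] by auto
  have C': "norm (h \<tau>) \<le> C * exp (- 2 * pi * Im \<tau>)" if "1 \<le> Im \<tau>" for \<tau>
    using C[OF that] g(2)[of \<tau>] that by (simp add: h_def)
  \<comment> \<open>The value at the offending point serves as threshold: above height Y the
    function is smaller, so the maximum over the rectangle is global.\<close>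
  define \<epsilon> where "\<epsilon> = norm (h \<tau>)"
  have \<epsilon>: "0 < \<epsilon>" using ne by (simp add: \<epsilon>_def h_def g0)
  have "((\<lambda>y. C * exp (- 2 * pi * y)) \<longlongrightarrow> 0) at_top" by real_asymp
  hence "\<forall>\<^sub>F y in at_top. C * exp (- 2 * pi * y) < \<epsilon>" using \<epsilon> by (rule order_tendstoD(2))
  then obtain Y0 where Y0: "\<And>y. Y0 \<le> y \<Longrightarrow> C * exp (- 2 * pi * y) < \<epsilon>"
    unfolding eventually_at_top_linorder by blast
  define Y where "Y = max 1 Y0"
  have small: "norm (h z) < \<epsilon>" if "Y \<le> Im z" for z
    using C'[of z] Y0[of "Im z"] that by (simp add: Y_def)
  let ?K = "cbox (Complex (-1/2) (1/2)) (Complex (1/2) Y)"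
  have KH: "?K \<subseteq> \<H>" by (auto simp: in_cbox_complex_iff)
  have hh: "h holomorphic_on \<H>" unfolding h_def using sformD(2)[OF f] by (intro holomorphic_intros)
  have "continuous_on ?K (\<lambda>z. norm (h z))"
    using holomorphic_on_imp_continuous_on[OF holomorphic_on_subset[OF hh KH]] by (rule continuous_on_norm)
  moreover have "?K \<noteq> {}" by (simp add: box_ne_empty Basis_complex_def Y_def inner_complex_def)
  ultimately obtain z0 where z0: "z0 \<in> ?K" "\<And>z. z \<in> ?K \<Longrightarrow> norm (h z) \<le> norm (h z0)"
    using continuous_attains_sup[of ?K "\<lambda>z. norm (h z)"] by (metis compact_cbox)
  have "h (z + 1) = h z" "h (- 1 / z) = h z" if "z \<in> \<H>" for z
    using sformD(3,4)[OF f that] by (simp_all add: h_def)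
  hence red: "\<exists>z'. \<bar>Re z'\<bar> \<le> 1/2 \<and> 1/2 \<le> Im z' \<and> h z' = h z" if "z \<in> \<H>" for z
    using reduction_to_fundamental_strip[of h z] that by blast
  have in_K: "z \<in> ?K" if "\<bar>Re z\<bar> \<le> 1/2" "1/2 \<le> Im z" "\<epsilon> \<le> norm (h z)" for z
  proof -
    have "Im z < Y" using small[of z] that(3) by (meson linorder_not_le)
    thus ?thesis using that by (auto simp: in_cbox_complex_iff abs_le_iff)
  qed
  have "\<epsilon> \<le> norm (h z0)"
    using red[OF \<tau>] in_K z0(2) unfolding \<epsilon>_def by (metis order_refl)
  have max: "norm (h z) \<le> norm (h z0)" if z: "z \<in> \<H>" for z
  proof -
    obtain z' where z': "\<bar>Re z'\<bar> \<le> 1/2" "1/2 \<le> Im z'" "h z' = h z" using red[OF z] by blast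
    show ?thesis
    proof (cases "\<epsilon> \<le> norm (h z')")
      case True
      thus ?thesis using in_K[OF z'(1,2)] z0(2)[of z'] z'(3) by simp
    qed (use z'(3) \<open>\<epsilon> \<le> norm (h z0)\<close> in simp)
  qed
  have "h constant_on \<H>"
    by (rule maximum_modulus_principle[OF hh open_uhp convex_connected[OF convex_uhp]
          open_uhp subset_refl]) (use z0(1) KH max in auto)
  then obtain c where c: "\<And>z. z \<in> \<H> \<Longrightarrow> h z = c" unfolding constant_on_def by blast
  have "norm c < \<epsilon>" using small[of "Complex 0 (max 1 Y)"] c[of "Complex 0 (max 1 Y)"] by simp
  thus False using c[OF \<tau>] by (simp add: \<epsilon>_def)
qed

text \<open>The product of f^12 and the power -k of the discriminant has weight 0 and vanishes at
  the cusp.\<close>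

lemma sform_negative_weight:
  assumes f: "sform k f" and "k < 0" shows "f \<tau> = 0"
proof (cases "\<tau> \<in> \<H>")
  case True
  define n where "n = nat (- k)"
  have n: "0 < n" "int n = - k" using assms by (auto simp: n_def)
  have 1: "sform (int 12 * k) (\<lambda>\<tau>. f \<tau> ^ 12)" using f by (rule sform_power) simp
  have 2: "sform (int n * 12) (\<lambda>\<tau>. Delta \<tau> ^ n)" using sform_Delta n(1) by (rule sform_power)
  have "sform 0 (\<lambda>\<tau>. f \<tau> ^ 12 * Delta \<tau> ^ n)" using sform_mult[OF 1 2] n(2) by simp
  from sform_weight_0[OF this True] have "f \<tau> ^ 12 * Delta \<tau> ^ n = cusp_value (\<lambda>\<tau>. f \<tau> ^ 12 * Delta \<tau> ^ n)" .
  also have "\<dots> = cusp_value (\<lambda>\<tau>. f \<tau> ^ 12) * cusp_value Delta ^ n"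
    by (simp only: cusp_value_mult[OF 1 2] cusp_value_power[OF sform_Delta])
  also have "\<dots> = 0" using n(1) by (simp add: cusp_value_Delta)
  finally show ?thesis using Delta_nonzero[OF True] by simp
qed (use sformD(1)[OF f] in simp)

text \<open>Applying the inversion law twice multiplies f by (-1)^k.\<close>

lemma sform_odd_weight:
  assumes f: "sform k f" and "odd k" shows "f \<tau> = 0"
proof (cases "\<tau> \<in> \<H>")
  case True
  hence nz: "\<tau> \<noteq> 0" by auto
  have "- 1 / \<tau> \<in> \<H>" using neg_inverse_in_uhp True by simp
  from sformD(4)[OF f this] have "f \<tau> = (- 1 / \<tau>) powi k * (\<tau> powi k * f \<tau>)"
    using nz sformD(4)[OF f True] by simp
  also have "\<dots> = ((- 1 / \<tau>) * \<tau>) powi k * f \<tau>" by (simp only: power_int_mult_distrib mult.assoc)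
  also have "(- 1 / \<tau>) * \<tau> = - 1" using nz by simp
  also have "(- 1 :: complex) powi k = - 1" using assms(2) by simp
  finally show ?thesis by simp
qed (use sformD(1)[OF f] in simp)

section \<open>Primitives of forms, and weight 2\<close>

lemma has_deriv_inversion:
  assumes \<tau>: "\<tau> \<in> \<H>" and F: "(F has_field_derivative d) (at (- 1 / \<tau>))"
  shows "((\<lambda>\<tau>. F (- 1 / \<tau>)) has_field_derivative d / \<tau>^2) (at \<tau>)"
proof -
  have "\<tau> \<noteq> 0" using \<tau> by auto
  hence "((\<lambda>\<tau>. - 1 / \<tau>) has_field_derivative 1 / \<tau>^2) (at \<tau>)"
    by (auto intro!: derivative_eq_intros simp: power2_eq_square)
  with F have "((\<lambda>\<tau>. F (- 1 / \<tau>)) has_field_derivative d * (1 / \<tau>^2)) (at \<tau>)"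
    by (rule DERIV_chain2[where f = F and g = "\<lambda>\<tau>. - 1 / \<tau>"])
  thus ?thesis by simp
qed

lemma has_deriv_translation:
  assumes F: "(F has_field_derivative d) (at (\<tau> + 1 :: complex))"
  shows "((\<lambda>\<tau>. F (\<tau> + 1)) has_field_derivative d) (at \<tau>)"
proof -
  have "((\<lambda>\<tau>::complex. \<tau> + 1) has_field_derivative 1) (at \<tau>)"
    by (auto intro!: derivative_eq_intros)
  with F have "((\<lambda>\<tau>. F (\<tau> + 1)) has_field_derivative d * 1) (at \<tau>)"
    by (rule DERIV_chain2[where f = F and g = "\<lambda>\<tau>. \<tau> + 1"])
  thus ?thesis by simp
qed

text \<open>Primitives are the reason for admitting linear growth in the definition of forms:
  integrating up the strip costs a factor of order Im \<tau>.\<close>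

lemma bounded_derivative_imp_linear_growth:
  assumes "\<And>\<tau>. \<tau> \<in> \<H> \<Longrightarrow> (F has_field_derivative f \<tau>) (at \<tau>)" "\<And>\<tau>. \<tau> \<in> cusp_strip \<Longrightarrow> norm (f \<tau>) \<le> C"
  shows "\<exists>C. \<forall>\<tau>\<in>cusp_strip. norm (F \<tau>) \<le> C * (1 + Im \<tau>)"
proof (intro exI ballI)
  have conv: "convex cusp_strip"
  proof -
    have "cusp_strip = {\<tau>. Re \<tau> \<le> 1} \<inter> {\<tau>. - 1 \<le> Re \<tau>} \<inter> {\<tau>. 1 \<le> Im \<tau>}"
      by (auto simp: cusp_strip_def)
    show ?thesis unfolding \<open>cusp_strip = _\<close>
      by (intro convex_Int convex_halfspace_Re_le convex_halfspace_Re_ge convex_halfspace_Im_ge)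
  qed
  have i: "\<i> \<in> cusp_strip" by (simp add: cusp_strip_def)
  have C: "0 \<le> C" using assms(2)[OF i] norm_ge_zero order_trans by blast
  fix \<tau> assume \<tau>: "\<tau> \<in> cusp_strip"
  have "norm (F \<tau> - F \<i>) \<le> C * norm (\<tau> - \<i>)"
    using assms(2) \<tau> i by (intro field_differentiable_bound[OF conv, of F f])
      (auto intro: has_field_derivative_at_within assms(1) dest: cusp_strip_subset)
  also have "norm (\<tau> - \<i>) \<le> \<bar>Re (\<tau> - \<i>)\<bar> + \<bar>Im (\<tau> - \<i>)\<bar>" by (rule cmod_le)
  also have "\<dots> \<le> 1 + Im \<tau>" using \<tau> by (auto simp: cusp_strip_def)
  finally have 1: "norm (F \<tau> - F \<i>) \<le> C * (1 + Im \<tau>)" using C by (simp add: mult_left_mono)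
  have "norm (F \<i>) * 1 \<le> norm (F \<i>) * (1 + Im \<tau>)" using \<tau> by (intro mult_left_mono) (auto simp: cusp_strip_def)
  moreover have "norm (F \<tau>) \<le> norm (F \<tau> - F \<i>) + norm (F \<i>)" by (metis diff_add_cancel norm_triangle_ineq)
  ultimately have "norm (F \<tau>) \<le> C * (1 + Im \<tau>) + norm (F \<i>) * (1 + Im \<tau>)" using 1 by linarith
  thus "norm (F \<tau>) \<le> (C + norm (F \<i>)) * (1 + Im \<tau>)" by (simp add: distrib_right)
qed

text \<open>The primitive of a form of weight 2 changes by constants, which vanish because \<open>S\<close> and
  \<open>ST\<close> have fixed points.\<close>

lemma sform_weight_2:
  assumes f: "sform 2 f" shows "f \<tau> = 0"
proof (cases "\<tau> \<in> \<H>")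
  case True
  obtain F where F: "\<And>\<tau>. \<tau> \<in> \<H> \<Longrightarrow> (F has_field_derivative f \<tau>) (at \<tau>)"
    using uhp_primitive[OF sformD(2)[OF f]] by metis
  have inv: "- 1 / \<tau> \<in> \<H>" if "\<tau> \<in> \<H>" for \<tau> using neg_inverse_in_uhp that by simp
  have "((\<lambda>\<tau>. F (- 1 / \<tau>) - F \<tau>) has_field_derivative 0) (at \<tau>)" if \<tau>: "\<tau> \<in> \<H>" for \<tau>
  proof -
    have "((\<lambda>\<tau>. F (- 1 / \<tau>) - F \<tau>) has_field_derivative f (- 1 / \<tau>) / \<tau>^2 - f \<tau>) (at \<tau>)"
      by (intro DERIV_diff has_deriv_inversion F \<tau> inv[OF \<tau>])
    moreover have "\<tau> \<noteq> 0" using \<tau> by auto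
    hence "f (- 1 / \<tau>) / \<tau>^2 - f \<tau> = 0" using sformD(4)[OF f \<tau>] by simp
    ultimately show ?thesis by simp
  qed
  from uhp_constant[OF this] obtain s where s: "\<And>\<tau>. \<tau> \<in> \<H> \<Longrightarrow> F (- 1 / \<tau>) - F \<tau> = s" by blast
  have "- 1 / \<i> = \<i>" by (simp add: complex_eq_iff)
  hence S: "F (- 1 / \<tau>) = F \<tau>" if "\<tau> \<in> \<H>" for \<tau> using s[OF that] s[of \<i>] by simp
  have "((\<lambda>\<tau>. F (\<tau> + 1) - F \<tau>) has_field_derivative 0) (at \<tau>)" if \<tau>: "\<tau> \<in> \<H>" for \<tau>
  proof -
    have "((\<lambda>\<tau>. F (\<tau> + 1) - F \<tau>) has_field_derivative f (\<tau> + 1) - f \<tau>) (at \<tau>)"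
      using \<tau> by (intro DERIV_diff has_deriv_translation F) auto
    thus ?thesis using sformD(3)[OF f \<tau>] by simp
  qed
  from uhp_constant[OF this] obtain t where t: "\<And>\<tau>. \<tau> \<in> \<H> \<Longrightarrow> F (\<tau> + 1) - F \<tau> = t" by blast
  \<comment> \<open>A primitive cube root of unity, with -1 / (\<omega> + 1) = \<omega>: it is fixed
    by ST as \<i> is by S.\<close>
  define \<omega> where "\<omega> = Complex (- 1 / 2) (sqrt 3 / 2)"
  have \<omega>: "\<omega> \<in> \<H>" "\<omega> + 1 \<in> \<H>" by (simp_all add: \<omega>_def)
  have "- 1 / (\<omega> + 1) = \<omega>"
    by (simp add: \<omega>_def complex_eq_iff Re_divide Im_divide field_simps power2_eq_square)
  hence "F \<omega> = F (\<omega> + 1)" using S[OF \<omega>(2)] by simp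
  hence "t = 0" using t[OF \<omega>(1)] by simp
  hence T: "F (\<tau> + 1) = F \<tau>" if "\<tau> \<in> \<H>" for \<tau> using t[OF that] by simp
  define F' where "F' \<tau> = (if \<tau> \<in> \<H> then F \<tau> else 0)" for \<tau>
  obtain B where "\<And>\<tau>. \<tau> \<in> cusp_strip \<Longrightarrow> norm (f \<tau>) \<le> B" using sform_bounded[OF f] by blast
  from bounded_derivative_imp_linear_growth[of F f, OF F this] obtain C where C: "\<And>\<tau>. \<tau> \<in> cusp_strip \<Longrightarrow> norm (F \<tau>) \<le> C * (1 + Im \<tau>)" by blast
  have "F holomorphic_on \<H>" using F unfolding holomorphic_on_open[OF open_uhp] by blast
  hence "F' holomorphic_on \<H>" by (rule holomorphic_transform) (simp add: F'_def)
  moreover have "\<exists>C. \<forall>\<tau>\<in>cusp_strip. norm (F' \<tau>) \<le> C * (1 + Im \<tau>)"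
    using C by (intro exI[of _ C]) (simp add: F'_def cusp_strip_subset[unfolded mem_Collect_eq])
  ultimately have "sform 0 F'"
    unfolding sform_def using S T inv by (auto simp: F'_def)
  hence c: "F' \<tau> = cusp_value F'" if "\<tau> \<in> \<H>" for \<tau> using sform_weight_0 that by blast
  have "((\<lambda>_. cusp_value F') has_field_derivative f \<tau>) (at \<tau>)"
    using F[OF True] by (rule has_field_derivative_transform_within_open[OF _ open_uhp True])
      (use c in \<open>auto simp: F'_def\<close>)
  thus ?thesis using DERIV_const DERIV_unique by blast
qed (use sformD(1)[OF f] in simp)

section \<open>The graded ring of E4 and E6, and Serre's derivative\<close>

definition mono46 :: "nat \<Rightarrow> nat \<Rightarrow> complex \<Rightarrow> complex" where
  "mono46 a b \<tau> = (if \<tau> \<in> \<H> then E4 \<tau> ^ a * E6 \<tau> ^ b else 0)"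

lemma mono46_induct_simps:
  "mono46 0 0 = (\<lambda>\<tau>. if \<tau> \<in> \<H> then 1 else 0)"
  "mono46 (Suc a) b = (\<lambda>\<tau>. E4 \<tau> * mono46 a b \<tau>)" "mono46 a (Suc b) = (\<lambda>\<tau>. E6 \<tau> * mono46 a b \<tau>)"
  by (auto simp: mono46_def fun_eq_iff)

lemma mono46_in_ring: "mono46 a b \<in> eisenstein_ring"
proof (induction a)
  case 0
  show ?case
    by (induction b) (auto simp: mono46_induct_simps intro: eisenstein_ring.intros)
qed (auto simp: mono46_induct_simps intro: eisenstein_ring.intros)

lemma sform_mono46: "sform (4 * int a + 6 * int b) (mono46 a b)"
proof (induction a)
  case 0
  show ?case
  proof (induction b)
    case (Suc b)
    from sform_mult[OF sform_E6 this] show ?case by (simp add: mono46_induct_simps algebra_simps)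
  qed (use sform_const[of 1] in \<open>simp add: mono46_induct_simps\<close>)
next
  case (Suc a)
  from sform_mult[OF sform_E4 this] show ?case by (simp add: mono46_induct_simps algebra_simps)
qed

lemma cusp_value_mono46: "cusp_value (mono46 a b) = 1"
proof (rule cusp_valueI)
  have "((\<lambda>y. E4 (\<i> * of_real y) ^ a * E6 (\<i> * of_real y) ^ b) \<longlongrightarrow> 1 ^ a * 1 ^ b) at_top"
    using cusp_value_limit[OF sform_E4] cusp_value_limit[OF sform_E6]
    unfolding cusp_value_E4 cusp_value_E6 by (intro tendsto_intros)
  hence lim: "((\<lambda>y. E4 (\<i> * of_real y) ^ a * E6 (\<i> * of_real y) ^ b) \<longlongrightarrow> 1) at_top" by simp
  show "((\<lambda>y. mono46 a b (\<i> * of_real y)) \<longlongrightarrow> 1) at_top"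
    by (rule Lim_transform_eventually[OF lim])
       (auto intro!: eventually_mono[OF eventually_gt_at_top[of 0]] simp: mono46_def)
qed

text \<open>Monomials have cusp value 1, so subtracting a multiple of one leaves a form divisible by
  the discriminant.\<close>

lemma sform_decompose:
  assumes f: "sform k f" and k: "k = 4 * int a + 6 * int b"
  obtains g where "sform (k - 12) g" "f = (\<lambda>\<tau>. cusp_value f * mono46 a b \<tau> + Delta \<tau> * g \<tau>)"
proof
  define h where "h = (\<lambda>\<tau>. f \<tau> - cusp_value f * mono46 a b \<tau>)"
  have m: "sform k (mono46 a b)" using sform_mono46 k by simp
  have h: "sform k h" unfolding h_def by (intro sform_diff f sform_cmult m)
  have "cusp_value h = 0" unfolding h_def
    by (simp add: cusp_value_diff[OF f sform_cmult[OF m]] cusp_value_cmult[OF m] cusp_value_mono46)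
  from sform_div_Delta[OF h this] show "sform (k - 12) (\<lambda>\<tau>. h \<tau> / Delta \<tau>)" .
  show "f = (\<lambda>\<tau>. cusp_value f * mono46 a b \<tau> + Delta \<tau> * (h \<tau> / Delta \<tau>))"
  proof
    fix \<tau> show "f \<tau> = cusp_value f * mono46 a b \<tau> + Delta \<tau> * (h \<tau> / Delta \<tau>)"
      using Delta_nonzero[of \<tau>] sformD(1)[OF f, of \<tau>] sformD(1)[OF m, of \<tau>]
      by (cases "\<tau> \<in> \<H>") (auto simp: h_def)
  qed
qed

lemma sform_small_weight:
  assumes f: "sform k f" and k: "k = 4 * int a + 6 * int b" "k < 12"
  shows "f \<tau> = cusp_value f * mono46 a b \<tau>"
proof -
  obtain g where g: "sform (k - 12) g" "f = (\<lambda>\<tau>. cusp_value f * mono46 a b \<tau> + Delta \<tau> * g \<tau>)"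
    using sform_decompose[OF f k(1)] .
  have "g \<tau> = 0" using sform_negative_weight[OF g(1)] k(2) by simp
  thus ?thesis using fun_cong[OF g(2), of \<tau>] by simp
qed

text \<open>Serre's derivative, where \<open>n\<close> is half the weight.\<close>

definition serre_deriv :: "int \<Rightarrow> (complex \<Rightarrow> complex) \<Rightarrow> complex \<Rightarrow> complex" where
  "serre_deriv n f \<tau> = (if \<tau> \<in> \<H> then deriv f \<tau> - of_int n * eta4_logderiv \<tau> * f \<tau> else 0)"

lemma uhp_deriv: "f holomorphic_on \<H> \<Longrightarrow> \<tau> \<in> \<H> \<Longrightarrow> (f has_field_derivative deriv f \<tau>) (at \<tau>)"
  using holomorphic_derivI open_uhp by blast

lemma serre_deriv_holomorphic:
  assumes "f holomorphic_on \<H>" shows "serre_deriv n f holomorphic_on \<H>"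
proof -
  have "(\<lambda>\<tau>. deriv f \<tau> - of_int n * eta4_logderiv \<tau> * f \<tau>) holomorphic_on \<H>"
    using assms by (intro holomorphic_intros eta4_logderiv_holomorphic holomorphic_deriv open_uhp)
  thus ?thesis by (rule holomorphic_transform) (simp add: serre_deriv_def)
qed

text \<open>Two functions occur, here and for the inversion, because the group carries a component
  of a vector-valued form to a component of \<open>\<rho> g\<close> applied to that form.\<close>

lemma serre_deriv_translation:
  assumes f: "f holomorphic_on \<H>" "h holomorphic_on \<H>" and T: "\<And>\<tau>. \<tau> \<in> \<H> \<Longrightarrow> f (\<tau> + 1) = h \<tau>" and \<tau>: "\<tau> \<in> \<H>"
  shows "serre_deriv n f (\<tau> + 1) = serre_deriv n h \<tau>"
proof -
  have \<tau>1: "\<tau> + 1 \<in> \<H>" using \<tau> by simp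
  have "(h has_field_derivative deriv f (\<tau> + 1)) (at \<tau>)"
    using has_deriv_translation[OF uhp_deriv[OF f(1) \<tau>1]]
    by (rule has_field_derivative_transform_within_open[OF _ open_uhp \<tau>]) (use T in simp)
  hence "deriv h \<tau> = deriv f (\<tau> + 1)" by (rule DERIV_imp_deriv)
  thus ?thesis using \<tau> \<tau>1 T[OF \<tau>] eta4_logderiv_translation[of \<tau>] by (simp add: serre_deriv_def)
qed

text \<open>Differentiating \<tau> powi (2 n) produces a term 2 n \<tau> powi (2 n - 1); n times the
  defect 2 \<tau> of \<open>eta4_logderiv\<close> cancels it.\<close>

lemma serre_deriv_inversion:
  assumes f: "f holomorphic_on \<H>" "h holomorphic_on \<H>"
    and S: "\<And>\<tau>. \<tau> \<in> \<H> \<Longrightarrow> f (- 1 / \<tau>) = \<tau> powi (2 * n) * h \<tau>" and \<tau>: "\<tau> \<in> \<H>"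
  shows "serre_deriv n f (- 1 / \<tau>) = \<tau> powi (2 * n + 2) * serre_deriv n h \<tau>"
proof -
  have nz: "\<tau> \<noteq> 0" using \<tau> by auto
  have inv: "- 1 / \<tau> \<in> \<H>" using neg_inverse_in_uhp \<tau> by simp
  define p where "p = \<tau> powi (2 * n)"
  have p2: "\<tau> powi (2 * n + 2) = p * \<tau>^2" and p1: "\<tau> powi (2 * n - 1) = p / \<tau>"
    using nz by (simp_all add: p_def power_int_add power_int_diff)
  have "((\<lambda>\<tau>. \<tau> powi (2 * n) * h \<tau>) has_field_derivative deriv f (- 1 / \<tau>) / \<tau>^2) (at \<tau>)"
    using has_deriv_inversion[OF \<tau> uhp_deriv[OF f(1) inv]]
    by (rule has_field_derivative_transform_within_open[OF _ open_uhp \<tau>]) (use S in simp)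
  moreover have "((\<lambda>\<tau>. \<tau> powi (2 * n) * h \<tau>) has_field_derivative of_int (2 * n) * \<tau> powi (2 * n - 1) * 1 * h \<tau> + deriv h \<tau> * \<tau> powi (2 * n)) (at \<tau>)"
    using nz by (intro DERIV_mult DERIV_power_int uhp_deriv f \<tau> DERIV_ident) auto
  ultimately have "deriv f (- 1 / \<tau>) / \<tau>^2 = of_int (2 * n) * (p / \<tau>) * h \<tau> + deriv h \<tau> * p"
    using DERIV_unique p1 p_def by fastforce
  hence d: "deriv f (- 1 / \<tau>) = \<tau>^2 * (of_int (2 * n) * (p / \<tau>) * h \<tau> + deriv h \<tau> * p)"
    using nz by (simp add: field_simps)
  have e: "eta4_logderiv (- 1 / \<tau>) = \<tau>^2 * eta4_logderiv \<tau> + 2 * \<tau>"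
    using eta4_logderiv_inversion \<tau> by simp
  have s: "f (- 1 / \<tau>) = p * h \<tau>" using S[OF \<tau>] by (simp add: p_def)
  have "serre_deriv n f (- 1 / \<tau>) = deriv f (- 1 / \<tau>) - of_int n * eta4_logderiv (- 1 / \<tau>) * f (- 1 / \<tau>)"
    using inv by (simp only: serre_deriv_def if_True)
  also have "\<dots> = p * \<tau>^2 * (deriv h \<tau> - of_int n * eta4_logderiv \<tau> * h \<tau>)"
    unfolding d e s using nz by (simp add: field_simps power2_eq_square)
  finally show ?thesis using \<tau> by (simp add: serre_deriv_def p2)
qed

text \<open>The derivative of q^l g(q) is q^l times 2 pi \<i> (l g + q g'), a function of the same
  shape.\<close>

lemma deriv_expansion_bounded:
  assumes g: "g holomorphic_on ball 0 1" and l: "0 \<le> Re l"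
    and u: "\<And>\<tau>. \<tau> \<in> \<H> \<Longrightarrow> u \<tau> = q_pow l \<tau> * g (q_exp \<tau>)"
  shows "\<exists>C. \<forall>\<tau>\<in>cusp_strip. norm (deriv u \<tau>) \<le> C"
proof -
  define c where "c = 2 * of_real pi * \<i>"
  define G where "G q = c * (l * g q + q * deriv g q)" for q
  have "G holomorphic_on ball 0 1"
    unfolding G_def using g by (intro holomorphic_intros holomorphic_deriv) auto
  then obtain C where C: "\<And>\<tau>. \<tau> \<in> cusp_strip \<Longrightarrow> norm (q_pow l \<tau> * G (q_exp \<tau>)) \<le> C"
    using exp_times_holomorphic_bounded[OF _ l, of G] by metis
  have "deriv u \<tau> = exp (c * l * \<tau>) * G (exp (c * \<tau>))" if \<tau>: "\<tau> \<in> \<H>" for \<tau>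
  proof (rule DERIV_imp_deriv)
    have q: "exp (c * \<tau>) \<in> ball 0 1" using \<tau> by (simp add: c_def)
    have e1: "((\<lambda>\<tau>. exp (c * \<tau>)) has_field_derivative c * exp (c * \<tau>)) (at \<tau>)"
      and e2: "((\<lambda>\<tau>. exp (c * l * \<tau>)) has_field_derivative c * l * exp (c * l * \<tau>)) (at \<tau>)"
      by (auto intro!: derivative_eq_intros)
    have "(g has_field_derivative deriv g (exp (c * \<tau>))) (at (exp (c * \<tau>)))"
      using holomorphic_derivI[OF g open_ball q] .
    hence "((\<lambda>\<tau>. g (exp (c * \<tau>))) has_field_derivative deriv g (exp (c * \<tau>)) * (c * exp (c * \<tau>))) (at \<tau>)"
      using e1 by (rule DERIV_chain2[where f = g and g = "\<lambda>\<tau>. exp (c * \<tau>)"])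
    from DERIV_mult[OF e2 this]
    have "((\<lambda>\<tau>. exp (c * l * \<tau>) * g (exp (c * \<tau>))) has_field_derivative exp (c * l * \<tau>) * G (exp (c * \<tau>))) (at \<tau>)"
      by (simp add: G_def algebra_simps)
    thus "(u has_field_derivative exp (c * l * \<tau>) * G (exp (c * \<tau>))) (at \<tau>)"
      by (rule has_field_derivative_transform_within_open[OF _ open_uhp \<tau>]) (simp add: u c_def)
  qed
  hence "norm (deriv u \<tau>) \<le> C" if "\<tau> \<in> cusp_strip" for \<tau>
    using C[OF that] cusp_strip_subset[OF that] by (simp add: c_def)
  thus ?thesis by blast
qed

lemma sform_serre_deriv:
  assumes f: "sform (2 * n) f" shows "sform (2 * n + 2) (serre_deriv n f)"
proof -
  obtain g where g: "g holomorphic_on ball 0 1" "\<And>\<tau>. \<tau> \<in> \<H> \<Longrightarrow> f \<tau> = g (q_exp \<tau>)"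
    using sform_expansion[OF f] by blast
  obtain C1 where C1: "\<And>\<tau>. \<tau> \<in> cusp_strip \<Longrightarrow> norm (deriv f \<tau>) \<le> C1"
    using deriv_expansion_bounded[OF g(1), of 0 f] g(2) by auto
  obtain C2 where C2: "\<And>\<tau>. \<tau> \<in> cusp_strip \<Longrightarrow> norm (f \<tau>) \<le> C2" using sform_bounded[OF f] by blast
  obtain C3 where C3: "\<And>\<tau>. \<tau> \<in> cusp_strip \<Longrightarrow> norm (eta4_logderiv \<tau>) \<le> C3"
    using eta4_logderiv_bounded unfolding cusp_strip_def by blast
  note hol = sformD(2)[OF f]
  show ?thesis
  proof (rule sformI[where C = "C1 + norm (of_int n :: complex) * C3 * C2"])
    fix \<tau> assume \<tau>: "\<tau> \<in> cusp_strip"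
    have "0 \<le> C3" using C3[OF \<tau>] norm_ge_zero order_trans by blast
    hence "norm (of_int n * eta4_logderiv \<tau> * f \<tau>) \<le> norm (of_int n :: complex) * C3 * C2"
      unfolding norm_mult using C2[OF \<tau>] C3[OF \<tau>] by (intro mult_mono mult_nonneg_nonneg) auto
    thus "norm (serre_deriv n f \<tau>) \<le> C1 + norm (of_int n :: complex) * C3 * C2"
      using C1[OF \<tau>] cusp_strip_subset[OF \<tau>] norm_triangle_ineq4[of "deriv f \<tau>" "of_int n * eta4_logderiv \<tau> * f \<tau>"]
      by (simp only: serre_deriv_def if_True)
  qed (use serre_deriv_holomorphic[OF hol] serre_deriv_translation[OF hol hol sformD(3)[OF f]]
        serre_deriv_inversion[OF hol hol sformD(4)[OF f]] in \<open>auto simp: serre_deriv_def\<close>)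
qed

text \<open>The Taylor coefficients of \<open>f\<close> and \<open>g\<close> at \<open>z\<close> vanish by induction.\<close>

lemma linear_ode_zero:
  assumes S: "open S" "connected S" "z \<in> S"
    and hol: "f holomorphic_on S" "g holomorphic_on S" "a holomorphic_on S" "b holomorphic_on S" "c holomorphic_on S" "d holomorphic_on S"
    and ode: "\<And>w. w \<in> S \<Longrightarrow> deriv f w = a w * f w + b w * g w" "\<And>w. w \<in> S \<Longrightarrow> deriv g w = c w * f w + d w * g w"
    and init: "f z = 0" "g z = 0" and w: "w \<in> S"
  shows "f w = 0"
proof -
  have prod0: "(deriv ^^ n) (\<lambda>w. u w * v w) z = 0"
    if "u holomorphic_on S" "v holomorphic_on S" "\<And>i. i \<le> n \<Longrightarrow> (deriv ^^ i) v z = 0" for u v n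
    using that by (subst higher_deriv_mult[OF that(1,2) S(1,3)]) auto
  have step: "(deriv ^^ Suc n) h z = 0"
    if "h holomorphic_on S" "\<And>w. w \<in> S \<Longrightarrow> deriv h w = u w * f w + v w * g w" "u holomorphic_on S" "v holomorphic_on S"
      "\<And>i. i \<le> n \<Longrightarrow> (deriv ^^ i) f z = 0" "\<And>i. i \<le> n \<Longrightarrow> (deriv ^^ i) g z = 0" for h u v n
  proof -
    have "(deriv ^^ Suc n) h z = (deriv ^^ n) (deriv h) z" by (simp only: funpow_Suc_right o_apply)
    also have "\<dots> = (deriv ^^ n) (\<lambda>w. u w * f w + v w * g w) z"
      using S that hol by (intro higher_deriv_transform_within_open[of _ S]) (auto intro!: holomorphic_intros holomorphic_deriv)
    also have "\<dots> = (deriv ^^ n) (\<lambda>w. u w * f w) z + (deriv ^^ n) (\<lambda>w. v w * g w) z"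
      using S that hol by (intro higher_deriv_add[of _ S]) (auto intro!: holomorphic_intros)
    also have "\<dots> = 0" using prod0[of u f n] prod0[of v g n] that hol by simp
    finally show ?thesis .
  qed
  have "(deriv ^^ n) f z = 0 \<and> (deriv ^^ n) g z = 0" for n
  proof (induction n rule: less_induct)
    case (less n)
    show ?case
    proof (cases n)
      case (Suc m)
      have "(deriv ^^ i) f z = 0" "(deriv ^^ i) g z = 0" if "i \<le> m" for i
        using less.IH[of i] that Suc by auto
      thus ?thesis unfolding Suc using step[of f a b m] step[of g c d m] hol ode by blast
    qed (use init in simp)
  qed
  thus ?thesis
    using holomorphic_fun_eq_0_on_connected[OF hol(1) S(1,2) _ S(3) w] by blast
qed

text \<open>E6 vanishes at \<i> because \<i>^6 = -1. If the cube and the square agreed, E4 would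
  vanish there too, and the system satisfied by E4 and E6 (Ramanujan's equations, up to constants)
  would force E4 = 0.\<close>

lemma E4_cubed_ne_E6_squared: "\<exists>\<tau>\<in>\<H>. E4 \<tau> ^ 3 \<noteq> E6 \<tau> ^ 2"
proof (rule ccontr)
  assume "\<not> ?thesis"
  hence eq: "\<And>\<tau>. \<tau> \<in> \<H> \<Longrightarrow> E4 \<tau> ^ 3 = E6 \<tau> ^ 2" by blast
  have "sform 6 (serre_deriv 2 E4)" using sform_serre_deriv[of 2 E4] sform_E4 by simp
  from sform_small_weight[OF this, of 0 1] obtain x where x: "\<And>\<tau>. serre_deriv 2 E4 \<tau> = x * mono46 0 1 \<tau>" by auto
  have "sform 8 (serre_deriv 3 E6)" using sform_serre_deriv[of 3 E6] sform_E6 by simp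
  from sform_small_weight[OF this, of 2 0] obtain y where y: "\<And>\<tau>. serre_deriv 3 E6 \<tau> = y * mono46 2 0 \<tau>" by auto
  have i: "\<i> \<in> \<H>" by simp
  have "- 1 / \<i> = \<i>" by (simp add: complex_eq_iff)
  with sformD(4)[OF sform_E6 i] have "E6 \<i> = \<i> ^ 6 * E6 \<i>" by (simp only: power_int_numeral)
  also have "\<i> ^ 6 = - 1" by (simp add: eval_nat_numeral)
  finally have 6: "E6 \<i> = 0" by simp
  with eq[OF i] have 4: "E4 \<i> = 0" by simp
  have "E4 w = 0" if "w \<in> \<H>" for w
  proof (rule linear_ode_zero[where S = \<H> and z = \<i> and f = E4 and g = E6 and w = w and a = "\<lambda>\<tau>. 2 * eta4_logderiv \<tau>" and b = "\<lambda>_. x" and c = "\<lambda>\<tau>. y * E4 \<tau>" and d = "\<lambda>\<tau>. 3 * eta4_logderiv \<tau>"])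
    fix \<tau> assume \<tau>: "\<tau> \<in> \<H>"
    show "deriv E4 \<tau> = 2 * eta4_logderiv \<tau> * E4 \<tau> + x * E6 \<tau>"
      using x[of \<tau>] \<tau> by (simp add: serre_deriv_def mono46_def algebra_simps)
    show "deriv E6 \<tau> = y * E4 \<tau> * E4 \<tau> + 3 * eta4_logderiv \<tau> * E6 \<tau>"
      using y[of \<tau>] \<tau> by (simp add: serre_deriv_def mono46_def algebra_simps power2_eq_square)
  qed (use sformD(2)[OF sform_E4] sformD(2)[OF sform_E6] eta4_logderiv_holomorphic i 4 6 that
        open_uhp convex_connected[OF convex_uhp] in \<open>auto intro!: holomorphic_intros\<close>)
  hence "((\<lambda>y. E4 (\<i> * of_real y)) \<longlongrightarrow> 0) at_top"
    by (intro tendsto_eventually eventually_mono[OF eventually_gt_at_top[of 0]]) auto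
  hence "cusp_value E4 = 0" by (rule cusp_valueI)
  thus False by (simp add: cusp_value_E4)
qed

text \<open>The difference divided by the discriminant has weight 0. The constant stays abstract
  because \<open>Delta\<close> is normalised only up to a factor.\<close>

lemma E4_cubed_minus_E6_squared:
  obtains c where "c \<noteq> 0" "\<And>\<tau>. E4 \<tau> ^ 3 - E6 \<tau> ^ 2 = c * Delta \<tau>"
proof -
  have s: "sform 12 (\<lambda>\<tau>. E4 \<tau> ^ 3)" "sform 12 (\<lambda>\<tau>. E6 \<tau> ^ 2)"
    using sform_power[OF sform_E4, of 3] sform_power[OF sform_E6, of 2] by simp_all
  define h where "h = (\<lambda>\<tau>. E4 \<tau> ^ 3 - E6 \<tau> ^ 2)"
  have h: "sform 12 h" unfolding h_def by (intro sform_diff s)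
  have "cusp_value h = 0" unfolding h_def
    by (simp add: cusp_value_diff[OF s] cusp_value_power[OF sform_E4] cusp_value_power[OF sform_E6] cusp_value_E4 cusp_value_E6)
  from sform_div_Delta[OF h this] have d: "sform 0 (\<lambda>\<tau>. h \<tau> / Delta \<tau>)" by simp
  define c where "c = cusp_value (\<lambda>\<tau>. h \<tau> / Delta \<tau>)"
  have eq: "h \<tau> = c * Delta \<tau>" for \<tau>
  proof (cases "\<tau> \<in> \<H>")
    case True
    thus ?thesis using sform_weight_0[OF d True] Delta_nonzero[OF True] by (simp add: c_def field_simps)
  qed (use sformD(1)[OF h] sformD(1)[OF sform_Delta] in simp)
  have "c \<noteq> 0" using E4_cubed_ne_E6_squared eq by (auto simp: h_def)
  thus thesis using eq by (intro that[of c]) (simp_all add: h_def)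
qed

lemma eisenstein_ring_cmult: "f \<in> eisenstein_ring \<Longrightarrow> (\<lambda>\<tau>. c * f \<tau>) \<in> eisenstein_ring"
proof -
  assume f: "f \<in> eisenstein_ring"
  have off: "f \<tau> = 0" if "\<tau> \<notin> \<H>" for \<tau> using f that by induction (auto simp: eisenstein_def)
  have "(\<lambda>\<tau>. (if \<tau> \<in> \<H> then c else 0) * f \<tau>) \<in> eisenstein_ring"
    using eisenstein_ring.mult[OF eisenstein_ring.const f] by simp
  also have "(\<lambda>\<tau>. (if \<tau> \<in> \<H> then c else 0) * f \<tau>) = (\<lambda>\<tau>. c * f \<tau>)" using off by auto
  finally show ?thesis .
qed

lemma Delta_in_ring: "Delta \<in> eisenstein_ring"
proof -
  obtain c where c: "c \<noteq> 0" "\<And>\<tau>. E4 \<tau> ^ 3 - E6 \<tau> ^ 2 = c * Delta \<tau>"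
    using E4_cubed_minus_E6_squared by metis
  have "Delta = (\<lambda>\<tau>. (1 / c) * (mono46 3 0 \<tau> + (- 1) * mono46 0 2 \<tau>))"
  proof
    fix \<tau> show "Delta \<tau> = (1 / c) * (mono46 3 0 \<tau> + (- 1) * mono46 0 2 \<tau>)"
      using c(1) c(2)[of \<tau>] sformD(1)[OF sform_Delta, of \<tau>] by (auto simp: mono46_def)
  qed
  also have "\<dots> \<in> eisenstein_ring"
    by (intro eisenstein_ring_cmult eisenstein_ring.add mono46_in_ring)
  finally show ?thesis .
qed

lemma even_weight_decomposition:
  assumes "even k" "k \<noteq> 2" shows "\<exists>a b. int k = 4 * int a + 6 * int b"
proof -
  obtain m where m: "k = 2 * m" using assms(1) by blast
  show ?thesis
  proof (cases "even m")
    case True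
    then obtain a where "m = 2 * a" by blast
    thus ?thesis using m by (intro exI[of _ a] exI[of _ 0]) simp
  next
    case False
    then obtain a where a: "m = 2 * a + 1" using oddE by blast
    with assms(2) m have "0 < a" by (cases a) auto
    thus ?thesis using m a by (intro exI[of _ "a - 1"] exI[of _ 1]) simp
  qed
qed

text \<open>Induction in steps of 12; weight 2 and the odd weights, which no monomial reaches, carry
  no forms.\<close>

theorem sform_in_ring:
  assumes "sform k f" shows "f \<in> eisenstein_ring"
proof -
  have zero: "(\<lambda>_. 0) \<in> eisenstein_ring" using eisenstein_ring.const[of 0] by simp
  have "f \<in> eisenstein_ring" if "sform (int k) f" for k f
    using that
  proof (induction k arbitrary: f rule: less_induct)
    case (less k)
    show ?case
    proof (cases "odd k \<or> k = 2")
      case True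
      hence "f = (\<lambda>_. 0)" using sform_odd_weight[OF less.prems] sform_weight_2[of f] less.prems by auto
      thus ?thesis using zero by simp
    next
      case False
      then obtain a b where ab: "int k = 4 * int a + 6 * int b" using even_weight_decomposition by blast
      obtain g where g: "sform (int k - 12) g" "f = (\<lambda>\<tau>. cusp_value f * mono46 a b \<tau> + Delta \<tau> * g \<tau>)"
        using sform_decompose[OF less.prems ab] .
      have "g \<in> eisenstein_ring"
      proof (cases "k < 12")
        case True
        hence "g = (\<lambda>_. 0)" using sform_negative_weight[OF g(1)] by auto
        thus ?thesis using zero by simp
      next
        case False
        thus ?thesis using less.IH[of "k - 12" g] g(1) by (simp add: of_nat_diff)
      qed
      thus ?thesis
        by (subst g(2)) (intro eisenstein_ring.add eisenstein_ring.mult eisenstein_ring_cmult mono46_in_ring Delta_in_ring)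
    qed
  qed
  moreover have "f = (\<lambda>_. 0)" if "k < 0" using sform_negative_weight[OF assms that] by auto
  ultimately show ?thesis using assms zero by (metis int_nat_eq not_le)
qed

subsection \<open>The module of vector-valued forms\<close>

lemma vvmfD:
  assumes "vvmf \<rho> k F"
  shows "\<tau> \<notin> \<H> \<Longrightarrow> F \<tau> = 0" "(\<lambda>\<tau>. F \<tau> $ j) holomorphic_on \<H>"
    "\<tau> \<in> \<H> \<Longrightarrow> F (\<tau> + 1) = \<rho> T_mat *v F \<tau>"
    "\<tau> \<in> \<H> \<Longrightarrow> F (- 1 / \<tau>) = (\<tau> powi k) *s (\<rho> S_mat *v F \<tau>)"
    "\<exists>C. \<forall>\<tau>\<in>cusp_strip. norm (F \<tau>) \<le> C * (1 + Im \<tau>)"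
  using assms unfolding vvmf_def by blast+

lemma vvmfI:
  assumes "\<And>\<tau>. \<tau> \<notin> \<H> \<Longrightarrow> F \<tau> = 0" "\<And>j. (\<lambda>\<tau>. F \<tau> $ j) holomorphic_on \<H>"
    "\<And>\<tau>. \<tau> \<in> \<H> \<Longrightarrow> F (\<tau> + 1) = \<rho> T_mat *v F \<tau>"
    "\<And>\<tau>. \<tau> \<in> \<H> \<Longrightarrow> F (- 1 / \<tau>) = (\<tau> powi k) *s (\<rho> S_mat *v F \<tau>)"
    "\<And>\<tau>. \<tau> \<in> cusp_strip \<Longrightarrow> norm (F \<tau>) \<le> C * (1 + Im \<tau>)"
  shows "vvmf \<rho> k F"
  using assms unfolding vvmf_def by blast

lemma norm_vec_smult: "norm (c *s (v :: complex^'n)) = norm c * norm v"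
proof -
  have "norm (c *s v) = L2_set (\<lambda>i. norm c * norm (v $ i)) UNIV" by (simp add: norm_vec_def norm_mult)
  thus ?thesis by (simp add: norm_vec_def L2_set_right_distrib)
qed

lemma vvmf_smult:
  assumes f: "sform k f" and F: "vvmf \<rho> l F"
  shows "vvmf \<rho> (k + l) (\<lambda>\<tau>. f \<tau> *s F \<tau>)"
proof -
  obtain C where C: "\<And>\<tau>. \<tau> \<in> cusp_strip \<Longrightarrow> norm (f \<tau>) \<le> C" using sform_bounded[OF f] by blast
  obtain D where D: "\<And>\<tau>. \<tau> \<in> cusp_strip \<Longrightarrow> norm (F \<tau>) \<le> D * (1 + Im \<tau>)" using vvmfD(5)[OF F] by blast
  show ?thesis
  proof (rule vvmfI[where C = "C * D"])
    fix \<tau> assume \<tau>: "\<tau> \<in> cusp_strip"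
    have "0 \<le> C" using C[OF \<tau>] norm_ge_zero order_trans by blast
    hence "norm (f \<tau>) * norm (F \<tau>) \<le> C * (D * (1 + Im \<tau>))" using C[OF \<tau>] D[OF \<tau>] by (intro mult_mono) auto
    thus "norm (f \<tau> *s F \<tau>) \<le> C * D * (1 + Im \<tau>)" by (simp add: norm_vec_smult mult.assoc)
  next
    fix \<tau> assume \<tau>: "\<tau> \<in> \<H>"
    hence "\<tau> \<noteq> 0" by auto
    thus "f (- 1 / \<tau>) *s F (- 1 / \<tau>) = (\<tau> powi (k + l)) *s (\<rho> S_mat *v (f \<tau> *s F \<tau>))"
      unfolding sformD(4)[OF f \<tau>] vvmfD(4)[OF F \<tau>]
      by (simp add: mv_smult vector_smult_assoc power_int_add mult_ac)
    show "f (\<tau> + 1) *s F (\<tau> + 1) = \<rho> T_mat *v (f \<tau> *s F \<tau>)"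
      unfolding sformD(3)[OF f \<tau>] vvmfD(3)[OF F \<tau>] by (simp add: mv_smult)
  qed (use sformD(1,2)[OF f] vvmfD(1,2)[OF F] in \<open>auto intro!: holomorphic_intros\<close>)
qed

lemma vvmf_add:
  assumes F: "vvmf \<rho> k F" and G: "vvmf \<rho> k G"
  shows "vvmf \<rho> k (\<lambda>\<tau>. F \<tau> + G \<tau>)"
proof -
  obtain C where C: "\<And>\<tau>. \<tau> \<in> cusp_strip \<Longrightarrow> norm (F \<tau>) \<le> C * (1 + Im \<tau>)" using vvmfD(5)[OF F] by blast
  obtain D where D: "\<And>\<tau>. \<tau> \<in> cusp_strip \<Longrightarrow> norm (G \<tau>) \<le> D * (1 + Im \<tau>)" using vvmfD(5)[OF G] by blast
  show ?thesis
  proof (rule vvmfI[where C = "C + D"])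
    fix \<tau> assume \<tau>: "\<tau> \<in> cusp_strip"
    show "norm (F \<tau> + G \<tau>) \<le> (C + D) * (1 + Im \<tau>)"
      using norm_triangle_mono[OF C[OF \<tau>] D[OF \<tau>]] by (simp add: distrib_right)
  next
    fix \<tau> assume \<tau>: "\<tau> \<in> \<H>"
    show "F (- 1 / \<tau>) + G (- 1 / \<tau>) = (\<tau> powi k) *s (\<rho> S_mat *v (F \<tau> + G \<tau>))"
      "F (\<tau> + 1) + G (\<tau> + 1) = \<rho> T_mat *v (F \<tau> + G \<tau>)"
      unfolding vvmfD(4)[OF F \<tau>] vvmfD(4)[OF G \<tau>] vvmfD(3)[OF F \<tau>] vvmfD(3)[OF G \<tau>]
      by (simp_all add: mv_add vector_add_ldistrib)
  qed (use vvmfD(1,2)[OF F] vvmfD(1,2)[OF G] in \<open>auto intro!: holomorphic_intros\<close>)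
qed

lemma vvmf_zero [simp]: "vvmf \<rho> k (\<lambda>_. 0)"
  by (rule vvmfI[where C = 0]) auto

lemma vvmf_cmult: assumes F: "vvmf \<rho> k F" shows "vvmf \<rho> k (\<lambda>\<tau>. c *s F \<tau>)"
proof -
  have "vvmf \<rho> (0 + k) (\<lambda>\<tau>. (if \<tau> \<in> \<H> then c else 0) *s F \<tau>)" by (rule vvmf_smult[OF sform_const F])
  also have "(\<lambda>\<tau>. (if \<tau> \<in> \<H> then c else 0) *s F \<tau>) = (\<lambda>\<tau>. c *s F \<tau>)" using vvmfD(1)[OF F] by auto
  finally show ?thesis by simp
qed

lemma vvmf_diff: "vvmf \<rho> k F \<Longrightarrow> vvmf \<rho> k G \<Longrightarrow> vvmf \<rho> k (\<lambda>\<tau>. F \<tau> - G \<tau>)"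
  using vvmf_add[of \<rho> k F "\<lambda>\<tau>. (- 1) *s G \<tau>"] vvmf_cmult[of \<rho> k G "- 1"] by simp

lemma vvmf_matrix_apply:
  fixes M :: "complex^'n^'m"
  assumes M: "intertwines M \<rho> \<sigma>" and F: "vvmf \<rho> k F"
  shows "vvmf \<sigma> k (\<lambda>\<tau>. M *v F \<tau>)"
proof -
  obtain C where C: "\<And>\<tau>. \<tau> \<in> cusp_strip \<Longrightarrow> norm (F \<tau>) \<le> C * (1 + Im \<tau>)" using vvmfD(5)[OF F] by blast
  obtain K where K: "0 \<le> K" "\<And>v. norm (M *v v) \<le> K * norm v" using matrix_vector_norm_bound[of M] by metis
  have comm: "M *v (\<rho> g *v v) = \<sigma> g *v (M *v v)" if "g \<in> SL2Z" for g v
    using M that unfolding intertwines_def by (simp add: mv_assoc)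
  show ?thesis
  proof (rule vvmfI[where C = "K * C"])
    fix \<tau> assume \<tau>: "\<tau> \<in> cusp_strip"
    have "K * norm (F \<tau>) \<le> K * (C * (1 + Im \<tau>))" using C[OF \<tau>] K(1) by (rule mult_left_mono)
    thus "norm (M *v F \<tau>) \<le> K * C * (1 + Im \<tau>)" using K(2)[of "F \<tau>"] by (simp add: mult.assoc)
  next
    fix \<tau> assume \<tau>: "\<tau> \<in> \<H>"
    show "M *v F (- 1 / \<tau>) = (\<tau> powi k) *s (\<sigma> S_mat *v (M *v F \<tau>))" "M *v F (\<tau> + 1) = \<sigma> T_mat *v (M *v F \<tau>)"
      unfolding vvmfD(4)[OF F \<tau>] vvmfD(3)[OF F \<tau>] by (simp_all add: mv_smult comm)
  qed (use vvmfD(1,2)[OF F] in \<open>auto intro!: holomorphic_on_matrix_vector\<close>)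
qed

text \<open>The left inverse N is merely linear. Equivariance comes from cancelling the injective M,
  while N transports holomorphy and growth.\<close>

lemma vvmf_pullback:
  fixes M :: "complex^'n^'m" and N :: "complex^'m^'n"
  assumes M: "intertwines M \<rho> \<sigma>" and N: "N ** M = mat 1" and F: "vvmf \<sigma> k (\<lambda>\<tau>. M *v F \<tau>)"
  shows "vvmf \<rho> k F"
proof -
  have NM: "N *v (M *v v) = v" for v by (simp add: mv_assoc N)
  hence inj: "M *v v = M *v w \<Longrightarrow> v = w" for v w by metis
  obtain C where C: "\<And>\<tau>. \<tau> \<in> cusp_strip \<Longrightarrow> norm (M *v F \<tau>) \<le> C * (1 + Im \<tau>)" using vvmfD(5)[OF F] by blast
  obtain K where K: "0 \<le> K" "\<And>v. norm (N *v v) \<le> K * norm v" using matrix_vector_norm_bound[of N] by metis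
  have comm: "M *v (\<rho> g *v v) = \<sigma> g *v (M *v v)" if "g \<in> SL2Z" for g v
    using M that unfolding intertwines_def by (simp add: mv_assoc)
  show ?thesis
  proof (rule vvmfI[where C = "K * C"])
    fix \<tau> assume \<tau>: "\<tau> \<in> cusp_strip"
    have "K * norm (M *v F \<tau>) \<le> K * (C * (1 + Im \<tau>))" using C[OF \<tau>] K(1) by (rule mult_left_mono)
    thus "norm (F \<tau>) \<le> K * C * (1 + Im \<tau>)" using K(2)[of "M *v F \<tau>"] by (simp add: NM mult.assoc)
  next
    fix \<tau> assume \<tau>: "\<tau> \<in> \<H>"
    show "F (- 1 / \<tau>) = (\<tau> powi k) *s (\<rho> S_mat *v F \<tau>)" "F (\<tau> + 1) = \<rho> T_mat *v F \<tau>"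
      using vvmfD(4)[OF F \<tau>] vvmfD(3)[OF F \<tau>] by (auto intro!: inj simp: mv_smult comm)
  next
    fix \<tau> assume "\<tau> \<notin> \<H>"
    hence "M *v F \<tau> = M *v 0" using vvmfD(1)[OF F] by simp
    thus "F \<tau> = 0" by (rule inj)
  next
    fix j
    have "(\<lambda>\<tau>. (N *v (M *v F \<tau>)) $ j) holomorphic_on \<H>" by (rule holomorphic_on_matrix_vector[OF vvmfD(2)[OF F]])
    thus "(\<lambda>\<tau>. F \<tau> $ j) holomorphic_on \<H>" by (simp add: NM)
  qed
qed

lemma vvmf_odd_weight:
  assumes \<rho>: "psl2_rep \<rho>" and F: "vvmf \<rho> k F" and k: "odd k"
  shows "F \<tau> = 0"
proof (cases "\<tau> \<in> \<H>")
  case True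
  hence nz: "\<tau> \<noteq> 0" by auto
  have sl: "sl2_rep \<rho>" and m1: "\<rho> (- mat 1) = mat 1" using \<rho> by (auto simp: psl2_rep_def)
  have SS: "\<rho> S_mat ** \<rho> S_mat = mat 1" by (simp add: sl2_rep_mult[OF sl, symmetric] S_mat_squared m1)
  have "- 1 / \<tau> \<in> \<H>" using neg_inverse_in_uhp True by simp
  from vvmfD(4)[OF F this] have "F \<tau> = ((- 1 / \<tau>) powi k) *s (\<rho> S_mat *v F (- 1 / \<tau>))" using nz by simp
  also have "\<dots> = ((- 1 / \<tau>) powi k * \<tau> powi k) *s F \<tau>"
    unfolding vvmfD(4)[OF F True] by (simp add: mv_smult vector_smult_assoc mv_assoc SS)
  also have "(- 1 / \<tau>) powi k * \<tau> powi k = ((- 1 / \<tau>) * \<tau>) powi k" by (simp only: power_int_mult_distrib)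
  also have "(- 1 / \<tau>) * \<tau> = - 1" using nz by simp
  also have "(- 1 :: complex) powi k = - 1" using k by simp
  finally have "F \<tau> + F \<tau> = 0" by (simp add: eq_neg_iff_add_eq_0)
  thus ?thesis by (simp add: vec_eq_iff)
qed (use vvmfD(1)[OF F] in simp)

section \<open>Serre's derivative of vector-valued forms\<close>

definition vserre :: "int \<Rightarrow> (complex \<Rightarrow> complex^'n) \<Rightarrow> complex \<Rightarrow> complex^'n" where
  "vserre n F \<tau> = (\<chi> j. serre_deriv n (\<lambda>\<tau>. F \<tau> $ j) \<tau>)"

lemma serre_deriv_matrix_vector:
  fixes M :: "complex^'n^'m"
  assumes "\<And>j. (\<lambda>\<tau>. F \<tau> $ j) holomorphic_on \<H>"
  shows "serre_deriv n (\<lambda>\<tau>. (M *v F \<tau>) $ i) \<tau> = (M *v vserre n F \<tau>) $ i"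
proof (cases "\<tau> \<in> \<H>")
  case True
  have "((\<lambda>\<tau>. \<Sum>j\<in>UNIV. M $ i $ j * F \<tau> $ j) has_field_derivative (\<Sum>j\<in>UNIV. M $ i $ j * deriv (\<lambda>\<tau>. F \<tau> $ j) \<tau>)) (at \<tau>)"
    using assms True by (intro DERIV_sum DERIV_cmult uhp_deriv)
  hence "deriv (\<lambda>\<tau>. (M *v F \<tau>) $ i) \<tau> = (\<Sum>j\<in>UNIV. M $ i $ j * deriv (\<lambda>\<tau>. F \<tau> $ j) \<tau>)"
    by (simp add: matrix_vector_mult_def DERIV_imp_deriv)
  thus ?thesis using True
    by (simp add: serre_deriv_def vserre_def matrix_vector_mult_def sum_subtractf[symmetric] sum_distrib_left algebra_simps)
qed (simp add: serre_deriv_def vserre_def matrix_vector_mult_def)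

lemma vserre_matrix_vector:
  fixes M :: "complex^'n^'m"
  assumes "\<And>j. (\<lambda>\<tau>. F \<tau> $ j) holomorphic_on \<H>"
  shows "vserre n (\<lambda>\<tau>. M *v F \<tau>) \<tau> = M *v vserre n F \<tau>"
proof -
  have "vserre n (\<lambda>\<tau>. M *v F \<tau>) \<tau> $ i = serre_deriv n (\<lambda>\<tau>. (M *v F \<tau>) $ i) \<tau>" for i
    by (simp add: vserre_def)
  thus ?thesis unfolding vec_eq_iff serre_deriv_matrix_vector[OF assms] by blast
qed

lemma vvmf_deriv_growth:
  assumes basis: "T_eigenbasis \<rho> P Q l" and F: "vvmf \<rho> k F"
  shows "\<exists>C. \<forall>\<tau>\<in>cusp_strip. norm (deriv (\<lambda>\<tau>. F \<tau> $ i) \<tau>) \<le> C"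
proof -
  have PQ: "P ** Q = mat 1" and l: "\<And>j. 0 \<le> Re (l j)" using basis by (auto simp: T_eigenbasis_def)
  obtain g where g: "\<And>j. g j holomorphic_on ball 0 1"
    "\<And>j \<tau>. \<tau> \<in> \<H> \<Longrightarrow> (Q *v F \<tau>) $ j = q_pow (l j) \<tau> * g j (q_exp \<tau>)"
    using vvmf_expansion[OF basis F] by blast
  have "\<exists>C. \<forall>\<tau>\<in>cusp_strip. norm (deriv (\<lambda>\<tau>. (Q *v F \<tau>) $ j) \<tau>) \<le> C" for j
    using g(1)[of j] l[of j] g(2)[of _ j] by (rule deriv_expansion_bounded)
  hence "\<forall>j. \<exists>C. \<forall>\<tau>\<in>cusp_strip. norm (deriv (\<lambda>\<tau>. (Q *v F \<tau>) $ j) \<tau>) \<le> C" by blast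
  from choice[OF this] obtain C where C: "\<And>j \<tau>. \<tau> \<in> cusp_strip \<Longrightarrow> norm (deriv (\<lambda>\<tau>. (Q *v F \<tau>) $ j) \<tau>) \<le> C j" by blast
  have hQ: "(\<lambda>\<tau>. (Q *v F \<tau>) $ j) holomorphic_on \<H>" for j by (rule holomorphic_on_matrix_vector[OF vvmfD(2)[OF F]])
  have "norm (deriv (\<lambda>\<tau>. F \<tau> $ i) \<tau>) \<le> (\<Sum>j\<in>UNIV. norm (P $ i $ j) * C j)" if \<tau>: "\<tau> \<in> cusp_strip" for \<tau>
  proof -
    have "((\<lambda>\<tau>. \<Sum>j\<in>UNIV. P $ i $ j * (Q *v F \<tau>) $ j) has_field_derivative (\<Sum>j\<in>UNIV. P $ i $ j * deriv (\<lambda>\<tau>. (Q *v F \<tau>) $ j) \<tau>)) (at \<tau>)"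
      using hQ cusp_strip_subset[OF \<tau>] by (intro DERIV_sum DERIV_cmult uhp_deriv)
    moreover have "(\<Sum>j\<in>UNIV. P $ i $ j * (Q *v F \<tau>) $ j) = F \<tau> $ i" for \<tau>
    proof -
      have "(\<Sum>j\<in>UNIV. P $ i $ j * (Q *v F \<tau>) $ j) = (P *v (Q *v F \<tau>)) $ i" by (simp add: matrix_vector_mult_def)
      thus ?thesis by (simp add: mv_assoc PQ)
    qed
    ultimately have "deriv (\<lambda>\<tau>. F \<tau> $ i) \<tau> = (\<Sum>j\<in>UNIV. P $ i $ j * deriv (\<lambda>\<tau>. (Q *v F \<tau>) $ j) \<tau>)"
      by (simp add: DERIV_imp_deriv)
    also have "norm \<dots> \<le> (\<Sum>j\<in>UNIV. norm (P $ i $ j) * C j)"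
      using C[OF \<tau>] by (intro sum_norm_le) (auto simp: norm_mult intro!: mult_left_mono)
    finally show ?thesis .
  qed
  thus ?thesis by blast
qed

theorem vvmf_serre_deriv:
  fixes \<rho> :: "int^2^2 \<Rightarrow> complex^'n^'n"
  assumes basis: "T_eigenbasis \<rho> P Q l" and F: "vvmf \<rho> (2 * n) F"
  shows "vvmf \<rho> (2 * n + 2) (vserre n F)"
proof -
  have "\<forall>i. \<exists>C. \<forall>\<tau>\<in>cusp_strip. norm (deriv (\<lambda>\<tau>. F \<tau> $ i) \<tau>) \<le> C"
    using vvmf_deriv_growth[OF basis F] by blast
  from choice[OF this] obtain C1 where C1: "\<And>i \<tau>. \<tau> \<in> cusp_strip \<Longrightarrow> norm (deriv (\<lambda>\<tau>. F \<tau> $ i) \<tau>) \<le> C1 i" by blast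
  obtain C2 where C2: "\<And>\<tau>. \<tau> \<in> cusp_strip \<Longrightarrow> norm (F \<tau>) \<le> C2" using vvmf_bounded[OF basis F] by blast
  obtain C3 where C3: "\<And>\<tau>. \<tau> \<in> cusp_strip \<Longrightarrow> norm (eta4_logderiv \<tau>) \<le> C3"
    using eta4_logderiv_bounded unfolding cusp_strip_def by blast
  note hol = vvmfD(2)[OF F]
  define B where "B = (\<Sum>i\<in>UNIV. C1 i + norm (of_int n :: complex) * C3 * C2)"
  have bound: "norm (vserre n F \<tau>) \<le> B" if \<tau>: "\<tau> \<in> cusp_strip" for \<tau>
  proof -
    have "norm (serre_deriv n (\<lambda>\<tau>. F \<tau> $ i) \<tau>) \<le> C1 i + norm (of_int n :: complex) * C3 * C2" for i
    proof -
      have "0 \<le> C3" using C3[OF \<tau>] norm_ge_zero order_trans by blast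
      moreover have "norm (F \<tau> $ i) \<le> C2" using C2[OF \<tau>] Finite_Cartesian_Product.norm_nth_le order_trans by blast
      ultimately have "norm (of_int n * eta4_logderiv \<tau> * F \<tau> $ i) \<le> norm (of_int n :: complex) * C3 * C2"
        unfolding norm_mult using C3[OF \<tau>] by (intro mult_mono mult_nonneg_nonneg) auto
      thus ?thesis
        using C1[OF \<tau>, of i] cusp_strip_subset[OF \<tau>] norm_triangle_ineq4[of "deriv (\<lambda>\<tau>. F \<tau> $ i) \<tau>" "of_int n * eta4_logderiv \<tau> * F \<tau> $ i"]
        by (simp only: serre_deriv_def if_True)
    qed
    thus ?thesis unfolding B_def vserre_def
      by (intro order_trans[OF norm_vec_le_sum] sum_mono) simp
  qed
  obtain C where C: "\<And>\<tau>. \<tau> \<in> cusp_strip \<Longrightarrow> norm (vserre n F \<tau>) \<le> C * (1 + Im \<tau>)"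
    using bounded_imp_linear_growth[of "vserre n F" B, OF bound] by blast
  show ?thesis
  proof (rule vvmfI[OF _ _ _ _ C])
    fix j show "(\<lambda>\<tau>. vserre n F \<tau> $ j) holomorphic_on \<H>"
      using serre_deriv_holomorphic[OF hol] by (simp add: vserre_def)
  next
    fix \<tau> assume \<tau>: "\<tau> \<in> \<H>"
    have "serre_deriv n (\<lambda>\<tau>. F \<tau> $ i) (\<tau> + 1) = serre_deriv n (\<lambda>\<tau>. (\<rho> T_mat *v F \<tau>) $ i) \<tau>" for i
      using vvmfD(3)[OF F] \<tau> by (intro serre_deriv_translation hol holomorphic_on_matrix_vector) auto
    thus "vserre n F (\<tau> + 1) = \<rho> T_mat *v vserre n F \<tau>"
      unfolding serre_deriv_matrix_vector[OF hol] by (simp add: vec_eq_iff vserre_def)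
    have "serre_deriv n (\<lambda>\<tau>. F \<tau> $ i) (- 1 / \<tau>) = \<tau> powi (2 * n + 2) * serre_deriv n (\<lambda>\<tau>. (\<rho> S_mat *v F \<tau>) $ i) \<tau>" for i
      using vvmfD(4)[OF F] \<tau> by (intro serre_deriv_inversion hol holomorphic_on_matrix_vector) auto
    thus "vserre n F (- 1 / \<tau>) = (\<tau> powi (2 * n + 2)) *s (\<rho> S_mat *v vserre n F \<tau>)"
      unfolding serre_deriv_matrix_vector[OF hol] by (simp add: vec_eq_iff vserre_def)
  qed (auto simp: vserre_def serre_deriv_def vec_eq_iff)
qed

lemma vserre_smult:
  assumes f: "f holomorphic_on \<H>" and F: "\<And>j. (\<lambda>\<tau>. F \<tau> $ j) holomorphic_on \<H>"
  shows "vserre (m + n) (\<lambda>\<tau>. f \<tau> *s F \<tau>) \<tau> = serre_deriv m f \<tau> *s F \<tau> + f \<tau> *s vserre n F \<tau>"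
proof (cases "\<tau> \<in> \<H>")
  case True
  have "deriv (\<lambda>\<tau>. f \<tau> * F \<tau> $ j) \<tau> = deriv f \<tau> * F \<tau> $ j + f \<tau> * deriv (\<lambda>\<tau>. F \<tau> $ j) \<tau>" for j
    using DERIV_mult[OF uhp_deriv[OF f True] uhp_deriv[OF F[of j] True]]
    by (intro DERIV_imp_deriv) (simp add: mult.commute add.commute)
  thus ?thesis using True
    by (simp add: vec_eq_iff vserre_def serre_deriv_def algebra_simps)
qed (simp add: vec_eq_iff vserre_def serre_deriv_def)

lemma vserre_add:
  assumes F: "\<And>j. (\<lambda>\<tau>. F \<tau> $ j) holomorphic_on \<H>" and G: "\<And>j. (\<lambda>\<tau>. G \<tau> $ j) holomorphic_on \<H>"
  shows "vserre n (\<lambda>\<tau>. F \<tau> + G \<tau>) \<tau> = vserre n F \<tau> + vserre n G \<tau>"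
proof (cases "\<tau> \<in> \<H>")
  case True
  have "deriv (\<lambda>\<tau>. F \<tau> $ j + G \<tau> $ j) \<tau> = deriv (\<lambda>\<tau>. F \<tau> $ j) \<tau> + deriv (\<lambda>\<tau>. G \<tau> $ j) \<tau>" for j
    by (intro DERIV_imp_deriv DERIV_add uhp_deriv F G True)
  thus ?thesis using True
    by (simp add: vec_eq_iff vserre_def serre_deriv_def algebra_simps)
qed (simp add: vec_eq_iff vserre_def serre_deriv_def)

text \<open>Multiplying by x powi (-m), with m the least exponent, gives a polynomial with
  infinitely many roots.\<close>

lemma power_int_sum_zero:
  fixes a :: "int \<Rightarrow> complex" and X :: "complex set"
  assumes W: "finite W" and X: "infinite X" "0 \<notin> X" and eq: "\<And>x. x \<in> X \<Longrightarrow> (\<Sum>w\<in>W. x powi w * a w) = 0"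
    and w: "w \<in> W"
  shows "a w = 0"
proof -
  define m where "m = Min W"
  have m: "m \<le> u" if "u \<in> W" for u using W that by (simp add: m_def)
  define p where "p = (\<Sum>u\<in>W. monom (a u) (nat (u - m)))"
  have "poly p x = 0" if "x \<in> X" for x
  proof -
    have x: "x \<noteq> 0" using X(2) that by auto
    have "x ^ nat (u - m) * a u = x powi (- m) * (x powi u * a u)" if "u \<in> W" for u
    proof -
      have "x ^ nat (u - m) = x powi (u - m)" using m[OF that] by (simp add: power_int_def)
      also have "\<dots> = x powi (- m) * x powi u" using x by (simp add: power_int_add[symmetric])
      finally show ?thesis by (simp add: mult.assoc)
    qed
    note e = this
    have "poly p x = (\<Sum>u\<in>W. x ^ nat (u - m) * a u)"
      by (simp add: p_def poly_sum poly_monom mult.commute[of "a _"])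
    also have "\<dots> = (\<Sum>u\<in>W. x powi (- m) * (x powi u * a u))" by (rule sum.cong[OF refl e])
    also have "\<dots> = x powi (- m) * (\<Sum>u\<in>W. x powi u * a u)" by (simp only: sum_distrib_left)
    finally show ?thesis using eq[OF that] by simp
  qed
  hence "X \<subseteq> {x. poly p x = 0}" by blast
  hence "p = 0" using X(1) poly_roots_finite finite_subset by blast
  hence "coeff p (nat (w - m)) = 0" by simp
  also have "coeff p (nat (w - m)) = (\<Sum>u\<in>W. if u = w then a u else 0)"
    unfolding p_def coeff_sum coeff_monom using m w by (intro sum.cong) (auto simp: eq_nat_nat_iff)
  also have "\<dots> = a w" using W w by simp
  finally show ?thesis .
qed

lemma vvmf_transformation:
  assumes "sl2_rep \<rho>" "vvmf \<rho> k F" "g \<in> SL2Z" "\<tau> \<in> \<H>"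
  shows "F (moebius_act g \<tau>) = (aut_factor g \<tau> powi k) *s (\<rho> g *v F \<tau>)"
  using vvmfD(3,4)[OF assms(2)] assms(3,4) by (intro transformation_from_generators[OF assms(1)]) blast+

lemma matrix_vector_sum: "A *v (\<Sum>w\<in>W. f w) = (\<Sum>w\<in>W. A *v (f w :: complex^'n))"
  by (induction W rule: infinite_finite_induct) (auto simp: mv_add)

text \<open>Evaluate along the orbit of \<open>\<tau>\<close> under lower unipotent matrices.\<close>

theorem vvmf_weights_independent:
  fixes F :: "int \<Rightarrow> complex \<Rightarrow> complex^'n"
  assumes \<rho>: "sl2_rep \<rho>" and W: "finite W" and F: "\<And>w. w \<in> W \<Longrightarrow> vvmf \<rho> w (F w)"
    and sum: "\<And>\<tau>. (\<Sum>w\<in>W. F w \<tau>) = 0" and w: "w \<in> W"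
  shows "F w \<tau> = 0"
proof (cases "\<tau> \<in> \<H>")
  case True
  \<comment> \<open>The factors n \<tau> + 1 take infinitely many nonzero values x. Undoing
    \<open>\<rho> (g n)\<close> turns the assumed relation at the translated point into the
    vanishing of the sum of x powi w times F w \<tau>.\<close>
  define g where "g n = (vector [vector [1, 0], vector [n, 1]] :: int^2^2)" for n
  have g: "g n \<in> SL2Z" "aut_factor (g n) \<tau> = of_int n * \<tau> + 1" for n
    by (simp_all add: g_def SL2Z_iff aut_factor_def)
  have ginv: "\<rho> (g (- n)) ** \<rho> (g n) = mat 1" for n
  proof -
    have "g (- n) ** g n = mat 1" by (simp add: g_def matrix_eq_2_2 matrix_mult_2_2)
    thus ?thesis by (simp add: sl2_rep_mult[OF \<rho>, symmetric] g(1) sl2_rep_one[OF \<rho>])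
  qed
  define X where "X = range (\<lambda>n::int. of_int n * \<tau> + 1)"
  have "inj (\<lambda>n::int. of_int n * \<tau> + 1)" using True by (auto simp: inj_def)
  hence X: "infinite X" unfolding X_def using finite_imageD infinite_UNIV_int by blast
  have X0: "0 \<notin> X"
  proof
    assume "0 \<in> X"
    then obtain n where "0 = of_int n * \<tau> + 1" unfolding X_def by (rule rangeE)
    thus False using aut_factor_nonzero[OF g(1) True, of n] unfolding g(2) by simp
  qed
  have eq: "(\<Sum>w\<in>W. x powi w * F w \<tau> $ j) = 0" if xX: "x \<in> X" for x j
  proof -
    obtain n where x: "x = of_int n * \<tau> + 1" using xX unfolding X_def by (rule rangeE)
    have "0 = \<rho> (g (- n)) *v (\<Sum>w\<in>W. F w (moebius_act (g n) \<tau>))" by (simp add: sum)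
    also have "\<dots> = (\<Sum>w\<in>W. \<rho> (g (- n)) *v ((x powi w) *s (\<rho> (g n) *v F w \<tau>)))"
      unfolding matrix_vector_sum
      by (intro sum.cong refl) (simp add: vvmf_transformation[OF \<rho> F g(1) True] g(2) x)
    also have "\<dots> = (\<Sum>w\<in>W. (x powi w) *s F w \<tau>)"
      by (simp add: mv_smult mv_assoc ginv)
    finally have "(\<Sum>w\<in>W. (x powi w) *s F w \<tau>) $ j = 0" by simp
    thus ?thesis by simp
  qed
  have "F w \<tau> $ j = 0" for j using power_int_sum_zero[OF W X X0 eq w] .
  thus ?thesis by (simp add: vec_eq_iff)
qed (use vvmfD(1)[OF F[OF w]] in simp)

text \<open>The components \<open>h\<close> are indexed by all integers and vanish off K, so that
  sums over different index sets can be merged and products become convolutions.\<close>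

lemma eisenstein_ring_graded:
  assumes "f \<in> eisenstein_ring"
  shows "\<exists>K h. finite K \<and> (\<forall>w. sform w (h w)) \<and> (\<forall>w. w \<notin> K \<longrightarrow> h w = (\<lambda>_. 0)) \<and> f = (\<lambda>\<tau>. \<Sum>w\<in>K. h w \<tau>)"
  using assms
proof induction
  have single: "\<exists>K h. finite K \<and> (\<forall>w. sform w (h w)) \<and> (\<forall>w. w \<notin> K \<longrightarrow> h w = (\<lambda>_. 0)) \<and> f = (\<lambda>\<tau>. \<Sum>w\<in>K. h w \<tau>)"
    if "sform k f" for k f
    using that by (intro exI[of _ "{k}"] exI[of _ "\<lambda>w. if w = k then f else (\<lambda>_. 0)"]) auto
  {
    case (const c) show ?case using single[OF sform_const[of c]] by simp
  next
    case E4 show ?case by (rule single[OF sform_E4])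
  next
    case E6 show ?case by (rule single[OF sform_E6])
  next
    case (add f g)
    obtain K h where K0: "finite K \<and> (\<forall>w. sform w (h w)) \<and> (\<forall>w. w \<notin> K \<longrightarrow> h w = (\<lambda>_. 0)) \<and> f = (\<lambda>\<tau>. \<Sum>w\<in>K. h w \<tau>)"
      using add.IH(1) by (elim exE)
    hence K: "finite K" "\<And>w. sform w (h w)" "\<And>w. w \<notin> K \<Longrightarrow> h w = (\<lambda>_. 0)" "f = (\<lambda>\<tau>. \<Sum>w\<in>K. h w \<tau>)"
      by simp_all
    obtain K' h' where K0': "finite K' \<and> (\<forall>w. sform w (h' w)) \<and> (\<forall>w. w \<notin> K' \<longrightarrow> h' w = (\<lambda>_. 0)) \<and> g = (\<lambda>\<tau>. \<Sum>w\<in>K'. h' w \<tau>)"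
      using add.IH(2) by (elim exE)
    hence K': "finite K'" "\<And>w. sform w (h' w)" "\<And>w. w \<notin> K' \<Longrightarrow> h' w = (\<lambda>_. 0)" "g = (\<lambda>\<tau>. \<Sum>w\<in>K'. h' w \<tau>)"
      by simp_all
    have "(\<Sum>w\<in>K. h w \<tau>) = (\<Sum>w\<in>K \<union> K'. h w \<tau>)" "(\<Sum>w\<in>K'. h' w \<tau>) = (\<Sum>w\<in>K \<union> K'. h' w \<tau>)" for \<tau>
      using K(1,3) K'(1,3) by (auto intro!: sum.mono_neutral_left)
    hence "(\<lambda>\<tau>. f \<tau> + g \<tau>) = (\<lambda>\<tau>. \<Sum>w\<in>K \<union> K'. h w \<tau> + h' w \<tau>)"
      unfolding K(4) K'(4) by (simp add: sum.distrib)
    thus ?case using K K' by (intro exI[of _ "K \<union> K'"] exI[of _ "\<lambda>w \<tau>. h w \<tau> + h' w \<tau>"]) (auto intro: sform_add)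
  next
    case (mult f g)
    obtain K h where K0: "finite K \<and> (\<forall>w. sform w (h w)) \<and> (\<forall>w. w \<notin> K \<longrightarrow> h w = (\<lambda>_. 0)) \<and> f = (\<lambda>\<tau>. \<Sum>w\<in>K. h w \<tau>)"
      using mult.IH(1) by (elim exE)
    hence K: "finite K" "\<And>w. sform w (h w)" "\<And>w. w \<notin> K \<Longrightarrow> h w = (\<lambda>_. 0)" "f = (\<lambda>\<tau>. \<Sum>w\<in>K. h w \<tau>)"
      by simp_all
    obtain K' h' where K0': "finite K' \<and> (\<forall>w. sform w (h' w)) \<and> (\<forall>w. w \<notin> K' \<longrightarrow> h' w = (\<lambda>_. 0)) \<and> g = (\<lambda>\<tau>. \<Sum>w\<in>K'. h' w \<tau>)"
      using mult.IH(2) by (elim exE)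
    hence K': "finite K'" "\<And>w. sform w (h' w)" "\<And>w. w \<notin> K' \<Longrightarrow> h' w = (\<lambda>_. 0)" "g = (\<lambda>\<tau>. \<Sum>w\<in>K'. h' w \<tau>)"
      by simp_all
    \<comment> \<open>L contains the weights that a product of components can have, and H is the
      Cauchy product of the two families.\<close>
    define L where "L = (\<lambda>(u, v). u + v) ` (K \<times> K')"
    define H where "H w = (\<lambda>\<tau>. \<Sum>u\<in>K. h u \<tau> * h' (w - u) \<tau>)" for w
    have L: "finite L" using K(1) K'(1) by (simp add: L_def)
    have "sform w (H w)" for w
    proof -
      have "sform w (\<lambda>\<tau>. \<Sum>u\<in>A. h u \<tau> * h' (w - u) \<tau>)" if "finite A" for A
        using that
      proof induction
        case (insert u A)
        have "sform (u + (w - u)) (\<lambda>\<tau>. h u \<tau> * h' (w - u) \<tau>)" using K(2) K'(2) by (intro sform_mult)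
        thus ?case using insert by (simp add: sform_add)
      qed simp
      thus ?thesis unfolding H_def using K(1) by blast
    qed
    moreover have "H w = (\<lambda>_. 0)" if "w \<notin> L" for w
    proof -
      have "h' (w - u) = (\<lambda>_. 0)" if "u \<in> K" for u
        using K'(3)[of "w - u"] \<open>w \<notin> L\<close> that unfolding L_def by (force simp: image_iff)
      thus ?thesis by (simp add: H_def fun_eq_iff)
    qed
    moreover have "(\<lambda>\<tau>. f \<tau> * g \<tau>) = (\<lambda>\<tau>. \<Sum>w\<in>L. H w \<tau>)"
    proof
      fix \<tau>
      have inner: "(\<Sum>w\<in>L. h' (w - u) \<tau>) = (\<Sum>v\<in>K'. h' v \<tau>)" if u: "u \<in> K" for u
      proof -
        have "(\<Sum>w\<in>L. h' (w - u) \<tau>) = (\<Sum>w\<in>(\<lambda>v. u + v) ` K'. h' (w - u) \<tau>)"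
        proof (rule sum.mono_neutral_right[OF L])
          show "\<forall>w\<in>L - (\<lambda>v. u + v) ` K'. h' (w - u) \<tau> = 0"
          proof
            fix w assume "w \<in> L - (\<lambda>v. u + v) ` K'"
            hence "w - u \<notin> K'" by (metis DiffE add.commute diff_add_cancel image_eqI)
            thus "h' (w - u) \<tau> = 0" using K'(3) by simp
          qed
        qed (use u in \<open>auto simp: L_def\<close>)
        also have "\<dots> = (\<Sum>v\<in>K'. h' v \<tau>)" by (subst sum.reindex) (auto simp: inj_on_def)
        finally show ?thesis .
      qed
      have "(\<Sum>w\<in>L. H w \<tau>) = (\<Sum>u\<in>K. \<Sum>w\<in>L. h u \<tau> * h' (w - u) \<tau>)" unfolding H_def by (rule sum.swap)
      also have "\<dots> = (\<Sum>u\<in>K. h u \<tau> * (\<Sum>v\<in>K'. h' v \<tau>))"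
        by (intro sum.cong refl) (simp only: sum_distrib_left[symmetric] inner)
      also have "\<dots> = f \<tau> * g \<tau>" unfolding K(4) K'(4) by (simp only: sum_distrib_right)
      finally show "f \<tau> * g \<tau> = (\<Sum>w\<in>L. H w \<tau>)" by simp
    qed
    ultimately show ?case using L by (intro exI[of _ L] exI[of _ H]) simp
  }
qed

subsection \<open>Representations and cohomology in dimension 2\<close>

lemma subrep_from_generators:
  assumes \<rho>: "sl2_rep \<rho>" and W: "vec.subspace W"
    and S: "\<And>v. v \<in> W \<Longrightarrow> \<rho> S_mat *v v \<in> W" and T: "\<And>v. v \<in> W \<Longrightarrow> \<rho> T_mat *v v \<in> W"
  shows "subrep \<rho> W"
proof -
  \<comment> \<open>From S^2 = -I and (ST)^3 = -I the inverse of T is a positive word in S and T, so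
    invariance passes to it.\<close>
  have Tinv: "T_power (-1) ** g = S_mat ** (T_mat ** (S_mat ** (T_mat ** (S_mat ** (S_mat ** (S_mat ** g))))))" for g :: "int^2^2"
    by (simp add: matrix_eq_2_2 matrix_mult_2_2 flip: T_power_1)
  have S': "\<forall>v\<in>W. \<rho> (S_mat ** g) *v v \<in> W" if "g \<in> SL2Z" "\<forall>v\<in>W. \<rho> g *v v \<in> W" for g
    using that S by (simp add: sl2_rep_mult[OF \<rho>] mv_assoc[symmetric])
  have T': "\<forall>v\<in>W. \<rho> (T_mat ** g) *v v \<in> W" if "g \<in> SL2Z" "\<forall>v\<in>W. \<rho> g *v v \<in> W" for g
    using that T by (simp add: sl2_rep_mult[OF \<rho>] mv_assoc[symmetric])
  have "\<forall>v\<in>W. \<rho> g *v v \<in> W" if "g \<in> SL2Z" for g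
    using that
  proof (induction rule: SL2Z_induct)
    case (Tinv g)
    thus ?case unfolding \<open>\<And>g. T_power (-1) ** g = _ g\<close> by (intro S' T' SL2Z_mult S_mat_in_SL2Z T_mat_in_SL2Z)
  qed (use S' T' sl2_rep_one[OF \<rho>] in auto)
  thus ?thesis using W unfolding subrep_def by blast
qed

lemma subspace_line: "vec.subspace {c *s v | c. True}" for v :: "complex^'n"
  unfolding vec.subspace_def
proof (intro conjI allI impI ballI)
  show "0 \<in> {c *s v | c. True}" by (auto intro: exI[of _ 0])
next
  fix x y assume "x \<in> {c *s v | c. True}" "y \<in> {c *s v | c. True}"
  then obtain c d where "x = c *s v" "y = d *s v" by blast
  hence "x + y = (c + d) *s v" by (simp add: vector_sadd_rdistrib)
  thus "x + y \<in> {c *s v | c. True}" by blast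
next
  fix b x assume "x \<in> {c *s v | c. True}"
  then obtain c where "x = c *s v" by blast
  hence "b *s x = (b * c) *s v" by (simp add: vector_smult_assoc)
  thus "b *s x \<in> {c *s v | c. True}" by blast
qed

lemma subrep_line:
  assumes \<rho>: "sl2_rep \<rho>" and S: "\<rho> S_mat *v v = \<alpha> *s v" and T: "\<rho> T_mat *v v = \<beta> *s v"
  shows "subrep \<rho> {c *s v | c. True}"
  using S T by (intro subrep_from_generators[OF \<rho> subspace_line])
    (auto simp: mv_smult vector_smult_assoc)

lemma irreducible_no_common_eigenvector:
  fixes \<rho> :: "int^2^2 \<Rightarrow> complex^2^2"
  assumes \<rho>: "sl2_rep \<rho>" "irreducible_rep \<rho>" and v: "v \<noteq> 0"
    and S: "\<rho> S_mat *v v = \<alpha> *s v" and T: "\<rho> T_mat *v v = \<beta> *s v"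
  shows False
proof -
  have "subrep \<rho> {c *s v | c. True}" by (rule subrep_line[OF \<rho>(1) S T])
  hence "{c *s v | c. True} = {0} \<or> {c *s v | c. True} = UNIV" using \<rho>(2) unfolding irreducible_rep_def by blast
  moreover have "v \<in> {c *s v | c. True}" by (auto intro: exI[of _ 1])
  ultimately have U: "{c *s v | c. True} = UNIV" using v by blast
  \<comment> \<open>A vector orthogonal to v for the Hermitian product; if it lay on the line of v,
    then |v_1|^2 + |v_2|^2 would be 0.\<close>
  define w :: "complex^2" where "w = vector [- cnj (v $ 2), cnj (v $ 1)]"
  have "w \<in> {c *s v | c. True}" unfolding U by simp
  then obtain c where c: "w = c *s v" by blast
  have "- cnj (v $ 2) = c * v $ 1" "cnj (v $ 1) = c * v $ 2"
    using arg_cong[OF c, of "\<lambda>x. x $ 1"] arg_cong[OF c, of "\<lambda>x. x $ 2"] by (simp_all add: w_def)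
  hence "cnj (v $ 2) = - (c * v $ 1)" "cnj (v $ 1) = c * v $ 2" by (metis minus_minus)+
  hence "v $ 1 * cnj (v $ 1) + v $ 2 * cnj (v $ 2) = 0" by simp
  hence "complex_of_real ((norm (v $ 1))^2 + (norm (v $ 2))^2) = 0"
    by (simp only: of_real_add complex_norm_square)
  hence "(norm (v $ 1))^2 + (norm (v $ 2))^2 = 0" using of_real_eq_0_iff by blast
  hence "v $ 1 = 0" "v $ 2 = 0" by (simp_all add: sum_power2_eq_zero_iff)
  thus False using v by (simp add: vec_eq_iff forall_2)
qed

lemma eigenvector_exists:
  fixes L :: "complex^'n^'n"
  shows "\<exists>r v. v \<noteq> 0 \<and> L *v v = r *s v"
proof -
  obtain v :: "complex^'n" where v: "v \<noteq> 0" by (metis axis_eq_0_iff zero_neq_one)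
  obtain p0 where "p0 \<noteq> 0 \<and> poly_apply L p0 v = 0" using annihilating_poly_exists by blast
  from ex_has_least_nat[of "\<lambda>p. p \<noteq> 0 \<and> poly_apply L p v = 0", OF this, of degree]
  obtain p where p: "p \<noteq> 0" "poly_apply L p v = 0"
    and min: "\<And>q. q \<noteq> 0 \<Longrightarrow> poly_apply L q v = 0 \<Longrightarrow> degree p \<le> degree q" by blast
  have "degree p \<noteq> 0"
  proof
    assume "degree p = 0"
    then obtain a where "p = [:a:]" by (metis degree_eq_zeroE)
    thus False using p v by (auto simp: vec_eq_iff)
  qed
  then obtain r where "poly p r = 0" using poly_root_exists by blast
  then obtain s where s: "p = [:- r, 1:] * s" by (auto simp: poly_eq_0_iff_dvd)
  have s0: "s \<noteq> 0" using s p by auto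
  have "degree p = Suc (degree s)" unfolding s using s0 by (subst degree_mult_eq) auto
  hence "poly_apply L s v \<noteq> 0" using min[OF s0] by auto
  moreover have "L *v poly_apply L s v = r *s poly_apply L s v"
    using p(2) unfolding s poly_apply_linear_factor by simp
  ultimately show ?thesis by blast
qed

text \<open>The determinant with columns x and y; applied to the two generators of forms it plays
  the part of a Wronskian.\<close>

definition cross2 :: "complex^2 \<Rightarrow> complex^2 \<Rightarrow> complex" where
  "cross2 x y = x $ 1 * y $ 2 - x $ 2 * y $ 1"

lemma cross2_span:
  assumes "cross2 x y \<noteq> 0"
  shows "z = (cross2 z y / cross2 x y) *s x + (cross2 x z / cross2 x y) *s y"
  using assms by (simp add: vec_eq_iff forall_2 field_simps) (simp add: cross2_def algebra_simps)

lemma cross2_parallel: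
  assumes "cross2 x y = 0" "x \<noteq> 0" shows "\<exists>c. y = c *s x"
proof -
  have e: "x $ 1 * y $ 2 = x $ 2 * y $ 1" using assms(1) by (simp add: cross2_def)
  show ?thesis
  proof (cases "x $ 1 = 0")
    case True
    hence "x $ 2 \<noteq> 0" using assms(2) by (auto simp: vec_eq_iff forall_2)
    thus ?thesis using e True by (intro exI[of _ "y $ 2 / x $ 2"]) (simp add: vec_eq_iff forall_2)
  next
    case False
    thus ?thesis using e by (intro exI[of _ "y $ 1 / x $ 1"]) (simp add: vec_eq_iff forall_2 field_simps)
  qed
qed

lemma cayley_hamilton_2:
  fixes M :: "complex^2^2"
  shows "M *v (M *v v) = (M $ 1 $ 1 + M $ 2 $ 2) *s (M *v v) - det M *s v"
  by (simp add: vec_eq_iff forall_2 matrix_vector_mult_def sum_2 det_2 algebra_simps)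

text \<open>Cayley-Hamilton factors as (M - r)(M - r') = 0. If r = r', the hypothesis makes M
  scalar; otherwise a nonzero vector (M - r) y is an eigenvector for r' and completes v to a
  basis.\<close>

lemma diagonalizable_2:
  fixes M :: "complex^2^2"
  assumes ss: "\<And>r x. M *v (M *v x - r *s x) = r *s (M *v x - r *s x) \<Longrightarrow> M *v x = r *s x"
  shows "diagonalizable_matrix M"
proof -
  obtain r v where v: "v \<noteq> 0" "M *v v = r *s v" using eigenvector_exists by blast
  define tr where "tr = M $ 1 $ 1 + M $ 2 $ 2"
  define r' where "r' = tr - r"
  have "r *s (r *s v) = tr *s (r *s v) - det M *s v"
    using cayley_hamilton_2[of M v] by (simp add: v(2) mv_smult tr_def)
  hence "(r * r - tr * r + det M) *s v = 0" by (simp add: vec_eq_iff algebra_simps)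
  hence "r * r - tr * r + det M = 0" using v(1) vector_mul_eq_0 by blast
  hence d: "det M = r * r'" by (simp add: r'_def algebra_simps)
  have CH: "M *v (M *v x) = (r + r') *s (M *v x) - (r * r') *s x" for x
    using cayley_hamilton_2[of M x] by (simp add: d r'_def tr_def)
  have scalar: "diagonalizable_matrix M" if "\<And>x. M *v x = q *s x" for q
  proof -
    have "M = mat q" by (rule matrix_eq_on_axes) (simp add: that mat_vector_mult)
    moreover have "matrix_inv (mat 1 :: complex^2^2) = mat 1"
      using matrix_inv_def[of "mat 1 :: complex^2^2"] by (metis (mono_tags, lifting) matrix_mul_lid matrix_mul_rid someI_ex)
    ultimately show ?thesis unfolding diagonalizable_matrix_def
      by (intro exI[of _ "mat 1"] exI[of _ "mat q"]) (auto simp: invertible_def mat_def[of q])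
  qed
  show ?thesis
  proof (cases "r = r'")
    case True
    have "M *v x = r *s x" for x
      by (rule ss) (simp add: mv_diff mv_smult CH True[symmetric] vec_eq_iff algebra_simps)
    thus ?thesis by (rule scalar)
  next
    case False
    show ?thesis
    proof (cases "\<forall>x. M *v x = r *s x")
      case True
      thus ?thesis using scalar by blast
    next
      case ne: False
      then obtain y where y: "M *v y \<noteq> r *s y" by blast
      define w where "w = M *v y - r *s y"
      have w: "w \<noteq> 0" "M *v w = r' *s w"
        using y by (simp_all add: w_def mv_diff mv_smult CH vec_eq_iff algebra_simps)
      have cr: "cross2 v w \<noteq> 0"
      proof
        assume "cross2 v w = 0"
        then obtain c where c: "w = c *s v" using cross2_parallel v(1) by blast
        hence "c \<noteq> 0" using w(1) by auto
        have "M *v w = r *s w" unfolding c by (simp only: mv_smult v(2) vector_smult_assoc mult.commute)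
        hence "r' *s w = r *s w" by (simp only: w(2))
        thus False using w(1) False unfolding vector_mul_rcancel by auto
      qed
      define P :: "complex^2^2" where "P = (\<chi> i j. if j = 1 then v $ i else w $ i)"
      define D :: "complex^2^2" where "D = diag_mat (\<lambda>j. if j = 1 then r else r')"
      have "det P = cross2 v w" by (simp add: P_def det_2 cross2_def mult.commute)
      hence P: "invertible P" using cr by (simp add: invertible_det_nz)
      hence PI: "P ** matrix_inv P = mat 1"
        unfolding matrix_inv_def using someI_ex[OF P[unfolded invertible_def]] by simp
      have Pa: "P *v axis 1 1 = v" "P *v axis 2 1 = w"
        by (simp_all add: vec_eq_iff P_def matrix_vector_mult_def sum_2 axis_def)
      have "M ** P = P ** D"
      proof (rule matrix_eq_on_axes)
        fix j :: 2
        show "(M ** P) *v axis j 1 = (P ** D) *v axis j 1"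
          using exhaust_2[of j] by (auto simp: mv_assoc[symmetric] D_def diag_mat_axis mv_smult Pa v w)
      qed
      hence "M ** P ** matrix_inv P = P ** D ** matrix_inv P" by simp
      hence "M = P ** D ** matrix_inv P" by (simp add: matrix_mul_assoc[symmetric] PI)
      thus ?thesis unfolding diagonalizable_matrix_def using P
        by (intro exI[of _ P] exI[of _ D]) (auto simp: D_def diag_mat_def)
    qed
  qed
qed

lemma diagonalizable_semisimple:
  fixes M :: "complex^'n^'n"
  assumes "diagonalizable_matrix M" and x: "M *v (M *v x - r *s x) = r *s (M *v x - r *s x)"
  shows "M *v x = r *s x"
proof -
  obtain P D :: "complex^'n^'n" where PD: "invertible P \<and> (\<forall>i j. i \<noteq> j \<longrightarrow> D $ i $ j = 0) \<and> M = P ** D ** matrix_inv P"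
    using assms(1) unfolding diagonalizable_matrix_def by (elim exE)
  define Q where "Q = matrix_inv P"
  have PQ: "P ** Q = mat 1" "Q ** P = mat 1"
    unfolding Q_def matrix_inv_def using someI_ex[of "\<lambda>B. P ** B = mat 1 \<and> B ** P = mat 1"] PD unfolding invertible_def by blast+
  have D: "D = diag_mat (\<lambda>j. D $ j $ j)" using PD by (auto simp: diag_mat_def vec_eq_iff)
  have QM: "Q *v (M *v y) = D *v (Q *v y)" for y
  proof -
    have "Q *v (M *v y) = (Q ** P) *v (D *v (Q *v y))"
      using PD by (simp only: Q_def[symmetric] mv_assoc matrix_mul_assoc)
    thus ?thesis by (simp add: PQ)
  qed
  have "(Q *v (M *v x)) $ j = (r *s (Q *v x)) $ j" for j
  proof -
    have "D *v (D *v (Q *v x) - r *s (Q *v x)) = r *s (D *v (Q *v x) - r *s (Q *v x))"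
      using arg_cong[OF x, of "\<lambda>y. Q *v y"] by (simp only: QM mv_diff mv_smult)
    hence "(D *v (D *v (Q *v x) - r *s (Q *v x))) $ j = (r *s (D *v (Q *v x) - r *s (Q *v x))) $ j" by simp
    hence "(D $ j $ j - r) * ((D $ j $ j - r) * (Q *v x) $ j) = 0"
      by (subst (asm) (1 2 3) D) (simp add: algebra_simps)
    hence "D $ j $ j * (Q *v x) $ j = r * (Q *v x) $ j" by auto
    thus ?thesis unfolding QM by (subst D) simp
  qed
  hence "Q *v (M *v x) = r *s (Q *v x)" by (simp add: vec_eq_iff)
  hence "P *v (Q *v (M *v x)) = P *v (r *s (Q *v x))" by simp
  thus ?thesis by (simp only: mv_smult mv_assoc[of P Q] PQ matrix_vector_mul_lid)
qed

text \<open>Semisimplicity, in the form that (M - r)^2 and M - r have the same kernel, passes to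
  invariant subspaces. This is how diagonalizability at T reaches \<open>\<rho>0\<close>.\<close>

lemma diagonalizable_restrict_2:
  fixes M :: "complex^2^2" and N :: "complex^'n^'n" and \<iota> :: "complex^2^'n"
  assumes N: "diagonalizable_matrix N" and inj: "inj ((*v) \<iota>)" and comm: "\<And>x. \<iota> *v (M *v x) = N *v (\<iota> *v x)"
  shows "diagonalizable_matrix M"
proof (rule diagonalizable_2)
  fix r x assume x: "M *v (M *v x - r *s x) = r *s (M *v x - r *s x)"
  have "N *v (N *v (\<iota> *v x) - r *s (\<iota> *v x)) = r *s (N *v (\<iota> *v x) - r *s (\<iota> *v x))"
    using arg_cong[OF x, of "\<lambda>y. \<iota> *v y"] by (simp only: comm mv_diff mv_smult)
  hence "N *v (\<iota> *v x) = r *s (\<iota> *v x)" by (rule diagonalizable_semisimple[OF N])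
  hence "\<iota> *v (M *v x) = \<iota> *v (r *s x)" by (simp add: comm mv_smult)
  thus "M *v x = r *s x" using inj by (simp add: inj_eq)
qed

text \<open>The first cohomology of \<open>\<int>/2 * \<int>/3\<close> with coefficients in an irreducible plane: a
  cocycle is given by \<open>s\<close> and \<open>u\<close>, its values on the two generators, acting by \<open>A\<close> and \<open>U\<close>.
  Every \<open>u\<close> is the coboundary of \<open>- (U + 2) u / 3\<close> on the second generator, and what remains
  lies in the line on which \<open>A\<close> is \<open>- 1\<close>.\<close>

locale modular_plane =
  fixes A U :: "complex^2^2"
  assumes A2: "A *v (A *v v) = v" and U3: "U *v (U *v (U *v v)) = v"
    and irr: "v \<noteq> 0 \<Longrightarrow> A *v v = \<alpha> *s v \<Longrightarrow> U *v v = \<beta> *s v \<Longrightarrow> False"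
begin

text \<open>Two independent such vectors would make A equal to -1, and every eigenvector of U a
  common eigenvector.\<close>

lemma minus_eigenline:
  assumes "A *v e = - e" "A *v s = - s" "e \<noteq> 0" shows "\<exists>c. s = c *s e"
proof (rule ccontr)
  assume "\<not> ?thesis"
  hence "cross2 e s \<noteq> 0" using cross2_parallel assms(3) by blast
  hence span: "\<exists>x y. z = x *s e + y *s s" for z using cross2_span[of e s z] by blast
  have "A *v (x *s e + y *s s) = (- 1) *s (x *s e + y *s s)" for x y
    by (simp add: mv_add mv_smult assms vec_eq_iff)
  hence all: "A *v z = (- 1) *s z" for z using span[of z] by blast
  obtain r v where "v \<noteq> 0" "U *v v = r *s v" using eigenvector_exists by blast
  thus False using irr all by blast
qed

lemma coboundary_on_U:
  assumes "u + U *v u + U *v (U *v u) = 0"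
  shows "u = U *v ((- 1 / 3) *s (U *v u + 2 *s u)) - (- 1 / 3) *s (U *v u + 2 *s u)"
proof -
  have e: "U *v (U *v u) = - (u + U *v u)" using assms by (metis add.commute eq_neg_iff_add_eq_0)
  have "U *v ((- 1 / 3) *s (U *v u + 2 *s u)) = (- 1 / 3) *s (- (u + U *v u) + 2 *s (U *v u))"
    by (simp only: mv_smult mv_add e)
  thus ?thesis by (simp only:) (simp add: vec_eq_iff field_simps)
qed

text \<open>Subtracting coboundaries makes both cocycles vanish on U. Their remaining values d and e
  on A lie on the line where A is -1, and e \<noteq> 0 because the second cocycle is not a
  coboundary.\<close>

lemma cocycle_multiple:
  assumes su: "s + A *v s = 0" "u + U *v u + U *v (U *v u) = 0"
    and su': "s' + A *v s' = 0" "u' + U *v u' + U *v (U *v u') = 0"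
    and nc: "\<not> (\<exists>w. s' = A *v w - w \<and> u' = U *v w - w)"
  shows "\<exists>\<alpha> w. s = \<alpha> *s s' + (A *v w - w) \<and> u = \<alpha> *s u' + (U *v w - w)"
proof -
  define w where "w = (- 1 / 3) *s (U *v u + 2 *s u)"
  define w' where "w' = (- 1 / 3) *s (U *v u' + 2 *s u')"
  have u: "u = U *v w - w" and u': "u' = U *v w' - w'"
    unfolding w_def w'_def by (rule coboundary_on_U, fact)+
  define e where "e = s' - (A *v w' - w')"
  define d where "d = s - (A *v w - w)"
  have "A *v s = - s" "A *v s' = - s'" using su(1) su'(1) by (simp_all add: eq_neg_iff_add_eq_0 add.commute)
  hence "A *v e = - e" "A *v d = - d"
    by (simp_all add: e_def d_def mv_diff A2)
  moreover have "e \<noteq> 0" using nc u' by (auto simp: e_def)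
  ultimately obtain \<alpha> where "d = \<alpha> *s e" using minus_eigenline by blast
  hence "s = \<alpha> *s s' + (A *v (w - \<alpha> *s w') - (w - \<alpha> *s w'))"
    unfolding d_def e_def
    by (simp add: mv_diff mv_smult vec_eq_iff algebra_simps)
  moreover have "u = \<alpha> *s u' + (U *v (w - \<alpha> *s w') - (w - \<alpha> *s w'))"
  proof -
    have "U *v (w - \<alpha> *s w') = U *v w - \<alpha> *s (U *v w')"
      by (simp only: mv_diff mv_smult)
    moreover have "U *v w = u + w" "U *v w' = u' + w'" using u u' by (simp_all add: eq_diff_eq)
    ultimately show ?thesis by (simp add: vec_eq_iff algebra_simps)
  qed
  ultimately show ?thesis by blast
qed

text \<open>U has no nonzero fixed vector z: otherwise A z - z would span the line where A is -1 and
  the cocycle would be a coboundary. Hence 1 + U + U^2 = 0. By irreducibility neither A nor U is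
  scalar, so comparison with Cayley-Hamilton determines both determinants.\<close>

lemma det_of_noncoboundary:
  assumes su: "s + A *v s = 0" "u + U *v u + U *v (U *v u) = 0"
    and nc: "\<not> (\<exists>w. s = A *v w - w \<and> u = U *v w - w)"
  shows "det A = - 1" "det U = 1"
proof -
  define w where "w = (- 1 / 3) *s (U *v u + 2 *s u)"
  have u: "u = U *v w - w" unfolding w_def by (rule coboundary_on_U) fact
  define e where "e = s - (A *v w - w)"
  have "A *v s = - s" using su(1) by (simp add: eq_neg_iff_add_eq_0 add.commute)
  hence e: "A *v e = - e" by (simp add: e_def mv_diff A2)
  have no1: "z = 0" if z: "U *v z = z" for z
  proof (rule ccontr)
    assume z0: "z \<noteq> 0"
    let ?y = "A *v z - z"
    have "?y \<noteq> 0" using irr[OF z0, of 1 1] z by auto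
    moreover have "A *v ?y = - ?y" by (simp add: mv_diff A2)
    ultimately obtain c where "e = c *s ?y" using minus_eigenline[OF _ e] by blast
    hence "s = A *v (w + c *s z) - (w + c *s z)"
      unfolding e_def by (simp add: mv_add mv_smult vec_eq_iff algebra_simps)
    moreover have "u = U *v (w + c *s z) - (w + c *s z)"
      using u by (simp add: mv_add mv_smult z)
    ultimately show False using nc by blast
  qed
  have not_scalar: False if "\<And>v. M *v v = r *s v" "M = A \<or> M = U" for r M
  proof -
    obtain r1 v1 where v1: "v1 \<noteq> 0" "A *v v1 = r1 *s v1" using eigenvector_exists by blast
    obtain r2 v2 where v2: "v2 \<noteq> 0" "U *v v2 = r2 *s v2" using eigenvector_exists by blast
    show False using that(2)
    proof
      assume "M = A" thus False using irr[OF v2(1) _ v2(2)] that(1) by blast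
    next
      assume "M = U" thus False using irr[OF v1(1) v1(2)] that(1) by blast
    qed
  qed
  have U2: "U *v (U *v v) = - (U *v v) - v" for v
  proof -
    have "U *v (v + U *v v + U *v (U *v v)) = v + U *v v + U *v (U *v v)"
      by (simp add: mv_add U3)
    from no1[OF this] show ?thesis by (simp add: vec_eq_iff algebra_simps eq_neg_iff_add_eq_0)
  qed
  obtain x :: "complex^2" where x: "x \<noteq> 0" by (metis axis_eq_0_iff zero_neq_one)
  define tA tU where "tA = A $ 1 $ 1 + A $ 2 $ 2" and "tU = U $ 1 $ 1 + U $ 2 $ 2"
  have rA: "tA *s (A *v v) = (1 + det A) *s v" for v
    using cayley_hamilton_2[of A v] unfolding A2 tA_def[symmetric] by (simp add: vec_eq_iff algebra_simps)
  have "tA = 0"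
  proof (rule ccontr)
    assume "tA \<noteq> 0"
    hence "A *v v = ((1 + det A) / tA) *s v" for v using rA[of v] by (simp add: vec_eq_iff field_simps)
    thus False using not_scalar by blast
  qed
  hence "(1 + det A) *s x = 0" using rA[of x] by simp
  hence "1 + det A = 0" using x vector_mul_eq_0 by blast
  thus "det A = - 1" by (simp add: eq_neg_iff_add_eq_0 add.commute)
  have rU: "(tU + 1) *s (U *v v) = (det U - 1) *s v" for v
    using cayley_hamilton_2[of U v] unfolding U2 tU_def[symmetric] by (simp add: vec_eq_iff algebra_simps)
  have "tU + 1 = 0"
  proof (rule ccontr)
    assume "tU + 1 \<noteq> 0"
    hence "U *v v = ((det U - 1) / (tU + 1)) *s v" for v using rU[of v] by (simp add: vec_eq_iff field_simps)
    thus False using not_scalar by blast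
  qed
  hence "(det U - 1) *s x = 0" using rU[of x] by simp
  hence "det U - 1 = 0" using x vector_mul_eq_0 by blast
  thus "det U = 1" by simp
qed

end

subsection \<open>The extension\<close>

lemma S_T_cube: "(S_mat ** T_mat) ** ((S_mat ** T_mat) ** (S_mat ** T_mat)) = - mat 1"
  by (simp add: matrix_eq_2_2 matrix_mult_2_2 flip: T_power_1)

text \<open>A and U are the values at S and ST of \<sigma> twisted by the inverse of a character
  with value x at S, which is its own inverse, and y at T. The conclusions are the relations of the
  modular group.\<close>

lemma twisted_rep_relations:
  fixes \<sigma> :: "int^2^2 \<Rightarrow> complex^'n^'n"
  assumes \<sigma>: "psl2_rep \<sigma>" and xy: "x * x = 1" "x = y ^ 3" "x * y ^ 3 = (1::complex)"
  defines "A \<equiv> mat x ** \<sigma> S_mat" and "U \<equiv> (mat x ** \<sigma> S_mat) ** (mat (1 / y) ** \<sigma> T_mat)"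
  shows "A *v (A *v v) = v" "U *v (U *v (U *v v)) = v"
proof -
  have sl: "sl2_rep \<sigma>" and m1: "\<sigma> (- mat 1) = mat 1" using \<sigma> by (auto simp: psl2_rep_def)
  have A: "A *v v = x *s (\<sigma> S_mat *v v)" for v
    by (simp only: A_def mv_assoc[symmetric] mat_vector_mult)
  have U: "U *v v = (x / y) *s (\<sigma> (S_mat ** T_mat) *v v)" for v
    by (simp add: U_def mv_assoc[symmetric] mat_vector_mult mv_smult vector_smult_assoc sl2_rep_mult[OF sl])
  have "\<sigma> S_mat *v (\<sigma> S_mat *v v) = v" for v
    by (simp add: mv_assoc sl2_rep_mult[OF sl, symmetric] S_mat_squared m1)
  thus "A *v (A *v v) = v" by (simp only: A mv_smult vector_smult_assoc xy(1) vector_smult_lid)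
  have y0: "y \<noteq> 0" using xy(3) by auto
  have "\<sigma> (S_mat ** T_mat) *v (\<sigma> (S_mat ** T_mat) *v (\<sigma> (S_mat ** T_mat) *v v)) = (\<sigma> (S_mat ** T_mat) ** (\<sigma> (S_mat ** T_mat) ** \<sigma> (S_mat ** T_mat))) *v v"
    by (simp only: mv_assoc)
  also have "\<sigma> (S_mat ** T_mat) ** (\<sigma> (S_mat ** T_mat) ** \<sigma> (S_mat ** T_mat)) = \<sigma> ((S_mat ** T_mat) ** ((S_mat ** T_mat) ** (S_mat ** T_mat)))"
    by (simp only: sl2_rep_mult[OF sl] SL2Z_mult S_mat_in_SL2Z T_mat_in_SL2Z)
  finally have cube: "\<sigma> (S_mat ** T_mat) *v (\<sigma> (S_mat ** T_mat) *v (\<sigma> (S_mat ** T_mat) *v v)) = v"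
    by (simp only: S_T_cube m1 matrix_vector_mul_lid)
  have "(x / y) * ((x / y) * (x / y)) = (x * x * x) / y ^ 3" by (simp add: power3_eq_cube mult.assoc)
  also have "\<dots> = 1" using xy(1,2) y0 by simp
  finally have c: "(x / y) * ((x / y) * (x / y)) = 1" .
  have "U *v (U *v (U *v v)) = ((x / y) * ((x / y) * (x / y))) *s (\<sigma> (S_mat ** T_mat) *v (\<sigma> (S_mat ** T_mat) *v (\<sigma> (S_mat ** T_mat) *v v)))"
    by (simp only: U mv_smult vector_smult_assoc mult.assoc)
  thus "U *v (U *v (U *v v)) = v" by (simp only: cube c vector_smult_lid)
qed

lemma det_scaled_2: "det (mat c ** M) = c^2 * det (M :: complex^2^2)"
  by (simp add: det_2 matrix_mult_2_2 power2_eq_square algebra_simps)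

lemma cross2_matrix: "cross2 (M *v x) (M *v y) = det M * cross2 x y"
  by (simp add: cross2_def matrix_vector_mult_def sum_2 det_2 algebra_simps)

locale extension =
  fixes \<rho>0 :: "int^2^2 \<Rightarrow> complex^2^2" and \<rho> :: "int^2^2 \<Rightarrow> complex^3^3" and \<xi> :: "int^2^2 \<Rightarrow> complex^1^1"
    and \<iota> :: "complex^2^3" and p :: "complex^3^1" and k1 k2 :: int and a :: nat
  assumes psl0: "psl2_rep \<rho>0" and irr0: "irreducible_rep \<rho>0"
    and gw: "has_generating_weights \<rho>0 [k1, k2]"
    and k12: "k1 \<le> k2" "k1 \<in> {0..11}" "k2 \<in> {0..11}"
    and psl: "psl2_rep \<rho>" and indec: "indecomposable_rep \<rho>" and diag: "diagonalizable_matrix (\<rho> T_mat)"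
    and chi: "is_chi_power (2 * a) \<xi>" and exact: "short_exact_reps \<rho>0 \<iota> \<rho> p \<xi>"
begin

lemma sl: "sl2_rep \<rho>" and sl0: "sl2_rep \<rho>0" and slc: "sl2_rep \<xi>"
  and minus_one: "\<rho> (- mat 1) = mat 1"
  using psl0 psl chi by (auto simp: psl2_rep_def is_chi_power_def)

lemma \<iota>_intertwines: "intertwines \<iota> \<rho>0 \<rho>" and p_intertwines: "intertwines p \<rho> \<xi>"
  and \<iota>_inj: "inj ((*v) \<iota>)"
  using exact by (auto simp: short_exact_reps_def)

lemma \<iota>_cancel: "\<iota> *v x = \<iota> *v y \<Longrightarrow> x = y"
  using \<iota>_inj by (simp add: inj_eq)

lemma \<iota>_comm: "g \<in> SL2Z \<Longrightarrow> \<iota> *v (\<rho>0 g *v x) = \<rho> g *v (\<iota> *v x)"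
  using \<iota>_intertwines by (simp add: intertwines_def mv_assoc)

lemma p_comm: "g \<in> SL2Z \<Longrightarrow> p *v (\<rho> g *v v) = \<xi> g *v (p *v v)"
  using p_intertwines by (simp add: intertwines_def mv_assoc)

lemma p_\<iota>: "p *v (\<iota> *v x) = 0"
  using exact unfolding short_exact_reps_def by blast

lemma ker_p: "p *v v = 0 \<Longrightarrow> \<exists>x. v = \<iota> *v x"
  using exact unfolding short_exact_reps_def by blast

definition X :: "int^2^2 \<Rightarrow> complex" where "X g = \<xi> g $ 1 $ 1"

lemma chi_apply: "\<xi> g *v u = X g *s u"
  by (simp add: vec_eq_iff forall_1 matrix_vector_mult_def sum_1 X_def)

lemma X_mult: "g \<in> SL2Z \<Longrightarrow> h \<in> SL2Z \<Longrightarrow> X (g ** h) = X g * X h"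
  unfolding X_def by (subst sl2_rep_mult[OF slc]) (simp_all add: matrix_matrix_mult_def[of "\<xi> _"] sum_1)

text \<open>Any lift of the basis vector of the quotient will do: another choice changes the cocycle
  below by a coboundary.\<close>

definition v1 :: "complex^3" where "v1 = (SOME v. p *v v = axis 1 1)"

lemma p_v1: "p *v v1 = axis 1 1"
proof -
  have "surj ((*v) p)" using exact by (simp add: short_exact_reps_def)
  then obtain v where "axis 1 1 = p *v v" by (rule surjE)
  hence "\<exists>v. p *v v = axis 1 1" by metis
  thus ?thesis unfolding v1_def by (rule someI_ex)
qed

lemma vec_1_axis: "(u :: complex^1) = u $ 1 *s axis 1 1"
  by (simp add: vec_eq_iff forall_1 axis_def)

lemma X_T: "X T_mat = exp (\<i> * of_real pi / 3) ^ a"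
proof -
  have "X T_mat = exp (2 * of_real pi * \<i> * of_nat (2 * a) / 12)"
    using chi by (simp add: X_def is_chi_power_def mat_def)
  also have "2 * of_real pi * \<i> * of_nat (2 * a) / 12 = of_nat a * (\<i> * of_real pi / 3)" by simp
  finally show ?thesis by (simp only: exp_of_nat_mult)
qed

text \<open>The character inherits triviality on -I from \<open>\<rho>\<close>, whose quotient it
  is; its value at S is then determined by the one at T.\<close>

lemma X_minus_one: "X (- mat 1) = 1"
proof -
  have "p *v (\<rho> (- mat 1) *v v1) = X (- mat 1) *s (p *v v1)"
    by (simp add: p_comm chi_apply)
  hence "(axis 1 1 :: complex^1) $ 1 = (X (- mat 1) *s axis 1 1 :: complex^1) $ 1" by (simp add: minus_one p_v1)
  thus ?thesis by (simp add: axis_def)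
qed

lemma X_S_sq: "X S_mat * X S_mat = 1"
  using X_mult[of S_mat S_mat] by (simp add: S_mat_squared X_minus_one)

lemma exp_pi_third_cube: "exp (\<i> * of_real pi / 3) ^ 3 = - 1"
proof -
  have "exp (\<i> * of_real pi / 3) ^ 3 = exp (of_nat 3 * (\<i> * of_real pi / 3))" by (simp only: exp_of_nat_mult)
  also have "\<dots> = exp (\<i> * of_real pi)" by simp
  finally show ?thesis by simp
qed

lemma X_T_cube: "X T_mat ^ 3 = (- 1) ^ a"
  by (simp only: X_T power_mult[symmetric] mult.commute[of a 3]) (simp only: power_mult exp_pi_third_cube)

lemma X_S: "X S_mat = (- 1) ^ a" and X_S_T: "X S_mat = X T_mat ^ 3" "X S_mat * X T_mat ^ 3 = 1"
proof -
  have "X ((S_mat ** T_mat) ** ((S_mat ** T_mat) ** (S_mat ** T_mat))) = (X S_mat * X S_mat) * X S_mat * X T_mat ^ 3"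
    by (simp add: X_mult power3_eq_cube mult_ac)
  thus eq: "X S_mat * X T_mat ^ 3 = 1" by (simp add: S_T_cube X_minus_one X_S_sq)
  have "X S_mat * (X S_mat * X T_mat ^ 3) = (X S_mat * X S_mat) * X T_mat ^ 3" by (simp only: mult.assoc)
  thus "X S_mat = X T_mat ^ 3" by (simp add: eq X_S_sq)
  thus "X S_mat = (- 1) ^ a" by (simp add: X_T_cube)
qed

lemma X_T_nonzero: "X T_mat \<noteq> 0" and X_S_nonzero: "X S_mat \<noteq> 0"
  by (simp_all add: X_T X_S)

text \<open>A, B and U are the values on S, T and ST of \<open>\<rho>0\<close> twisted by the
  inverse character, as are \<open>RS\<close> and \<open>RT\<close> below for \<open>\<rho>\<close>.
  The twist makes the quotient trivial, so that the extension becomes an ordinary class in the first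
  cohomology.\<close>

definition A :: "complex^2^2" where "A = mat (X S_mat) ** \<rho>0 S_mat"
definition B :: "complex^2^2" where "B = mat (1 / X T_mat) ** \<rho>0 T_mat"
definition U :: "complex^2^2" where "U = A ** B"

lemma A_apply: "A *v x = X S_mat *s (\<rho>0 S_mat *v x)" and B_apply: "B *v x = (1 / X T_mat) *s (\<rho>0 T_mat *v x)"
  and U_apply: "U *v x = A *v (B *v x)"
  by (simp_all add: A_def B_def U_def mv_assoc[symmetric] mat_vector_mult)

sublocale plane: modular_plane A U
proof
  show A2: "A *v (A *v v) = v" for v
    unfolding A_def using twisted_rep_relations(1)[OF psl0 X_S_sq X_S_T] .
  show "U *v (U *v (U *v v)) = v" for v
    unfolding U_def A_def B_def using twisted_rep_relations(2)[OF psl0 X_S_sq X_S_T] .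
  fix v \<alpha> \<beta> assume v: "v \<noteq> 0" "A *v v = \<alpha> *s v" "U *v v = \<beta> *s v"
  have "X S_mat *s (A *v v) = (X S_mat * X S_mat) *s (\<rho>0 S_mat *v v)" by (simp add: A_apply vector_smult_assoc)
  hence S: "\<rho>0 S_mat *v v = (X S_mat * \<alpha>) *s v" by (simp add: X_S_sq v vector_smult_assoc)
  have "B *v v = A *v (U *v v)" by (simp add: U_apply A2)
  hence "X T_mat *s (B *v v) = (X T_mat * (\<beta> * \<alpha>)) *s v" by (simp add: v mv_smult vector_smult_assoc mult_ac)
  hence T: "\<rho>0 T_mat *v v = (X T_mat * (\<beta> * \<alpha>)) *s v" by (simp add: B_apply vector_smult_assoc X_T_nonzero)
  show False by (rule irreducible_no_common_eigenvector[OF sl0 irr0 v(1) S T])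
qed

definition RS :: "complex^3^3" where "RS = mat (X S_mat) ** \<rho> S_mat"
definition RT :: "complex^3^3" where "RT = mat (1 / X T_mat) ** \<rho> T_mat"

lemma RS_apply: "RS *v x = X S_mat *s (\<rho> S_mat *v x)" and RT_apply: "RT *v x = (1 / X T_mat) *s (\<rho> T_mat *v x)"
  by (simp_all add: RS_def RT_def mv_assoc[symmetric] mat_vector_mult)

lemma RS_sq: "RS *v (RS *v v) = v" and RU_cube: "(RS ** RT) *v ((RS ** RT) *v ((RS ** RT) *v v)) = v"
  unfolding RS_def RT_def using twisted_rep_relations[OF psl X_S_sq X_S_T] by blast+

lemma RS_\<iota>: "RS *v (\<iota> *v x) = \<iota> *v (A *v x)" and RT_\<iota>: "RT *v (\<iota> *v x) = \<iota> *v (B *v x)"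
  by (simp_all add: RS_apply RT_apply A_apply B_apply mv_smult \<iota>_comm)

lemma cocycle_exists: "\<exists>x. RS *v v1 = v1 + \<iota> *v x" "\<exists>x. RT *v v1 = v1 + \<iota> *v x"
proof -
  have "p *v (RS *v v1 - v1) = 0" "p *v (RT *v v1 - v1) = 0"
    by (simp_all add: RS_apply RT_apply mv_diff mv_smult p_comm chi_apply p_v1 vector_smult_assoc X_S_sq X_T_nonzero)
  thus "\<exists>x. RS *v v1 = v1 + \<iota> *v x" "\<exists>x. RT *v v1 = v1 + \<iota> *v x"
    using ker_p by (metis diff_add_cancel add.commute)+
qed

text \<open>The cocycle of the extension: the failure of the lift \<open>v1\<close> to be fixed by
  S, T and ST in the twisted representation.\<close>

definition cS :: "complex^2" where "cS = (SOME x. RS *v v1 = v1 + \<iota> *v x)"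
definition cT :: "complex^2" where "cT = (SOME x. RT *v v1 = v1 + \<iota> *v x)"
definition cU :: "complex^2" where "cU = A *v cT + cS"

lemma RS_v1: "RS *v v1 = v1 + \<iota> *v cS" and RT_v1: "RT *v v1 = v1 + \<iota> *v cT"
  unfolding cS_def cT_def using someI_ex[OF cocycle_exists(1)] someI_ex[OF cocycle_exists(2)] .

lemma RU_v1: "(RS ** RT) *v v1 = v1 + \<iota> *v cU" and RU_\<iota>: "(RS ** RT) *v (\<iota> *v x) = \<iota> *v (U *v x)"
  by (simp_all add: mv_assoc[symmetric] RT_v1 RT_\<iota> RS_\<iota> RS_v1 U_apply cU_def mv_add add_ac)

lemma cS_relation: "cS + A *v cS = 0"
proof -
  have "v1 = v1 + \<iota> *v (cS + A *v cS)"
    using RS_sq[of v1] by (simp add: RS_v1 RS_\<iota> mv_add add_ac)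
  hence "\<iota> *v (cS + A *v cS) = \<iota> *v 0" by simp
  thus ?thesis by (rule \<iota>_cancel)
qed

lemma cU_relation: "cU + U *v cU + U *v (U *v cU) = 0"
proof -
  have "v1 = v1 + \<iota> *v (cU + U *v cU + U *v (U *v cU))"
    using RU_cube[of v1] by (simp add: RU_v1 RU_\<iota> mv_add add_ac)
  hence "\<iota> *v (cU + U *v cU + U *v (U *v cU)) = \<iota> *v 0" by simp
  thus ?thesis by (rule \<iota>_cancel)
qed

lemma range_\<iota>_subrep: "subrep \<rho> (range ((*v) \<iota>))"
proof (rule subrep_from_generators[OF sl])
  show "vec.subspace (range ((*v) \<iota>))"
    unfolding vec.subspace_def
  proof (intro conjI allI impI ballI)
    show "0 \<in> range ((*v) \<iota>)" by (rule range_eqI[of _ _ 0]) simp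
  next
    fix x y assume "x \<in> range ((*v) \<iota>)" "y \<in> range ((*v) \<iota>)"
    then obtain x' y' where "x = \<iota> *v x'" "y = \<iota> *v y'" by blast
    thus "x + y \<in> range ((*v) \<iota>)" by (intro range_eqI[of _ _ "x' + y'"]) (simp add: mv_add)
  next
    fix c x assume "x \<in> range ((*v) \<iota>)"
    then obtain x' where "x = \<iota> *v x'" by blast
    thus "c *s x \<in> range ((*v) \<iota>)" by (intro range_eqI[of _ _ "c *s x'"]) (simp add: mv_smult)
  qed
qed (auto simp: \<iota>_comm[symmetric])

text \<open>The line of v would be an invariant complement to the image of \<iota>, against
  indecomposability.\<close>

lemma no_invariant_complement:
  assumes "p *v v = axis 1 1" "\<rho> S_mat *v v = \<alpha> *s v" "\<rho> T_mat *v v = \<beta> *s v"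
  shows False
proof -
  let ?L = "{c *s v | c. True}" and ?R = "range ((*v) \<iota>)"
  have L: "subrep \<rho> ?L" by (rule subrep_line[OF sl assms(2,3)])
  have R: "?R \<noteq> {0}"
  proof
    assume "?R = {0}"
    hence "\<iota> *v axis 1 1 = \<iota> *v 0" by (metis matrix_vector_mult_0_right rangeI singletonD)
    hence "(axis 1 1 :: complex^2) = 0" by (rule \<iota>_cancel)
    thus False by (simp add: axis_eq_0_iff)
  qed
  have "v \<noteq> 0" using assms(1) by (auto simp: axis_eq_0_iff)
  moreover have "v \<in> ?L" by (intro CollectI exI[of _ 1]) simp
  ultimately have "?L \<noteq> {0}" by blast
  have int: "?R \<inter> ?L = {0}"
  proof -
    have "c *s v = 0" if "\<iota> *v x = c *s v" for x c
    proof -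
      have "c *s (axis 1 1 :: complex^1) = p *v (c *s v)" by (simp add: mv_smult assms(1))
      also have "\<dots> = 0" by (simp only: that[symmetric] p_\<iota>)
      finally show ?thesis by (auto simp: axis_eq_0_iff)
    qed
    moreover have "0 \<in> ?R" by (rule range_eqI[of _ _ 0]) simp
    moreover have "0 \<in> ?L" by (auto intro: exI[of _ 0])
    ultimately show ?thesis by fastforce
  qed
  have sum: "{u + w | u w. u \<in> ?R \<and> w \<in> ?L} = UNIV"
  proof -
    have "\<exists>u w. y = u + w \<and> u \<in> ?R \<and> w \<in> ?L" for y
    proof -
      have "p *v (y - (p *v y) $ 1 *s v) = 0"
        using vec_1_axis[of "p *v y"] by (simp add: mv_diff mv_smult assms(1))
      then obtain x where "y - (p *v y) $ 1 *s v = \<iota> *v x" using ker_p by blast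
      hence "y = \<iota> *v x + (p *v y) $ 1 *s v" by (simp add: diff_eq_eq)
      thus ?thesis by blast
    qed
    thus ?thesis by blast
  qed
  show False using indec range_\<iota>_subrep L R \<open>?L \<noteq> {0}\<close> int sum unfolding indecomposable_rep_def by blast
qed

lemma not_coboundary: "\<not> (\<exists>w. cS = A *v w - w \<and> cU = U *v w - w)"
proof
  assume "\<exists>w. cS = A *v w - w \<and> cU = U *v w - w"
  then obtain w where w: "cS = A *v w - w" "cU = U *v w - w" by blast
  define v where "v = v1 - \<iota> *v w"
  have "RS *v v = v" by (simp add: v_def mv_diff RS_v1 RS_\<iota> w)
  moreover have "(RS ** RT) *v v = v" by (simp add: v_def mv_diff RU_v1 RU_\<iota> w)
  hence "RS *v (RS *v (RT *v v)) = RS *v v" by (simp add: mv_assoc)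
  hence "RT *v v = RS *v v" by (simp only: RS_sq)
  ultimately have RSv: "RS *v v = v" "RT *v v = v" by simp_all
  have "X S_mat *s (RS *v v) = \<rho> S_mat *v v" "X T_mat *s (RT *v v) = \<rho> T_mat *v v"
    by (simp_all add: RS_apply RT_apply vector_smult_assoc X_S_sq X_T_nonzero)
  hence "\<rho> S_mat *v v = X S_mat *s v" "\<rho> T_mat *v v = X T_mat *s v" by (simp_all add: RSv)
  moreover have "p *v v = axis 1 1" by (simp add: v_def mv_diff p_v1 p_\<iota>)
  ultimately show False using no_invariant_complement by blast
qed

text \<open>From U = A B the determinant of B is -1; undoing the twist in dimension 2 multiplies it
  by the square of the character value.\<close>

lemma det_\<rho>0_T: "det (\<rho>0 T_mat) = - (X T_mat ^ 2)"
proof -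
  have d: "det A = - 1" "det U = 1"
    using plane.det_of_noncoboundary[OF cS_relation cU_relation not_coboundary] by blast+
  hence "- det B = 1" by (simp add: U_def det_mul)
  hence "det B = - 1" by (metis minus_minus)
  hence "(1 / X T_mat)^2 * det (\<rho>0 T_mat) = - 1" by (simp only: B_def det_scaled_2)
  thus ?thesis using X_T_nonzero by (simp add: field_simps power2_eq_square)
qed

lemma basis_exists: "\<exists>P Q l. T_eigenbasis \<rho> P Q l" "\<exists>P Q l. T_eigenbasis \<rho>0 P Q l" "\<exists>P Q l. T_eigenbasis \<xi> P Q l"
proof -
  show "\<exists>P Q l. T_eigenbasis \<rho> P Q l" by (rule T_eigenbasis_exists[OF sl diag]) blast
  have d0: "diagonalizable_matrix (\<rho>0 T_mat)"
    by (rule diagonalizable_restrict_2[OF diag \<iota>_inj]) (simp add: \<iota>_comm)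
  show "\<exists>P Q l. T_eigenbasis \<rho>0 P Q l" by (rule T_eigenbasis_exists[OF sl0 d0]) blast
  obtain l where l: "q_exp l = X T_mat" "0 \<le> Re l" "Re l < 1"
    using logarithm_in_strip_exists[OF X_T_nonzero] by blast
  have "\<xi> T_mat = mat 1 ** diag_mat (\<lambda>j. X T_mat) ** mat 1"
    by (rule matrix_eq_on_axes) (simp add: chi_apply diag_mat_axis)
  hence "T_eigenbasis \<xi> (mat 1) (mat 1) (\<lambda>_. l)" by (simp add: T_eigenbasis_def l)
  thus "\<exists>P Q l. T_eigenbasis \<xi> P Q l" by blast
qed

lemma forms: "F \<in> modular_forms \<rho> k \<longleftrightarrow> vvmf \<rho> k F"
  and forms0: "F0 \<in> modular_forms \<rho>0 k \<longleftrightarrow> vvmf \<rho>0 k F0"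
  and formsc: "Fc \<in> modular_forms \<xi> k \<longleftrightarrow> vvmf \<xi> k Fc"
  using basis_exists modular_forms_iff sl sl0 slc by metis+

section \<open>The module of forms of the irreducible plane\<close>

definition Bs :: "nat \<Rightarrow> complex \<Rightarrow> complex^2" where
  "Bs = (SOME B. (\<forall>i<length [k1, k2]. B i \<in> modular_forms \<rho>0 ([k1, k2] ! i)) \<and>
          (\<forall>F\<in>modular_form_module \<rho>0.
             \<exists>!f. f \<in> {..<length [k1, k2]} \<rightarrow>\<^sub>E eisenstein_ring \<and>
                  F = (\<lambda>\<tau>. \<Sum>i<length [k1, k2]. f i \<tau> *s B i \<tau>)))"

abbreviation B0 :: "complex \<Rightarrow> complex^2" where "B0 \<equiv> Bs 0"
abbreviation B1 :: "complex \<Rightarrow> complex^2" where "B1 \<equiv> Bs 1"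

lemma Bs_spec: "\<forall>i<length [k1, k2]. Bs i \<in> modular_forms \<rho>0 ([k1, k2] ! i)"
  "\<forall>F\<in>modular_form_module \<rho>0.
     \<exists>!f. f \<in> {..<length [k1, k2]} \<rightarrow>\<^sub>E eisenstein_ring \<and> F = (\<lambda>\<tau>. \<Sum>i<length [k1, k2]. f i \<tau> *s Bs i \<tau>)"
  using someI_ex[OF gw[unfolded has_generating_weights_def]] unfolding Bs_def by blast+

lemma vvmf_B0: "vvmf \<rho>0 k1 B0" and vvmf_B1: "vvmf \<rho>0 k2 B1"
  using Bs_spec(1) forms0 by (force simp: less_Suc_eq)+

lemma in_module: "F \<in> modular_forms \<sigma> k \<Longrightarrow> F \<in> modular_form_module \<sigma>"
  unfolding modular_form_module_def
  by (intro CollectI exI[of _ "{k}"] exI[of _ "\<lambda>_. F"]) auto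

lemma sum_two: "(\<Sum>i<length [k1, k2]. f i) = f 0 + f 1"
  by simp

lemma gens_unique:
  assumes "f \<in> eisenstein_ring" "g \<in> eisenstein_ring" "\<And>\<tau>. f \<tau> *s B0 \<tau> + g \<tau> *s B1 \<tau> = 0"
  shows "f = (\<lambda>_. 0)" "g = (\<lambda>_. 0)"
proof -
  have z: "(\<lambda>_. 0) \<in> eisenstein_ring" using sform_in_ring[OF sform_zero[of 0]] .
  define e where "e u v = (\<lambda>i\<in>{..<length [k1, k2]}. if i = 0 then u else v :: complex \<Rightarrow> complex)" for u v
  have e: "e u v \<in> {..<length [k1, k2]} \<rightarrow>\<^sub>E eisenstein_ring" if "u \<in> eisenstein_ring" "v \<in> eisenstein_ring" for u v
    using that by (auto simp: e_def)
  have "(\<lambda>_. 0) \<in> modular_form_module \<rho>0"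
    by (rule in_module[of _ _ 0]) (simp add: forms0)
  hence u: "\<exists>!f. f \<in> {..<length [k1, k2]} \<rightarrow>\<^sub>E eisenstein_ring \<and> (\<lambda>_. 0) = (\<lambda>\<tau>. \<Sum>i<length [k1, k2]. f i \<tau> *s Bs i \<tau>)"
    using Bs_spec(2) by blast
  have "e f g = e (\<lambda>_. 0) (\<lambda>_. 0)"
  proof (rule ex1E[OF u])
    fix h assume h: "\<forall>y. y \<in> {..<length [k1, k2]} \<rightarrow>\<^sub>E eisenstein_ring \<and> (\<lambda>_. 0) = (\<lambda>\<tau>. \<Sum>i<length [k1, k2]. y i \<tau> *s Bs i \<tau>) \<longrightarrow> y = h"
    have "(\<lambda>_. 0) = (\<lambda>\<tau>. \<Sum>i<length [k1, k2]. e f g i \<tau> *s Bs i \<tau>)"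
      unfolding sum_two using assms(3) by (simp add: e_def fun_eq_iff)
    hence "e f g = h" using h e[OF assms(1,2)] by blast
    moreover have "(\<lambda>_. 0) = (\<lambda>\<tau>. \<Sum>i<length [k1, k2]. e (\<lambda>_. 0) (\<lambda>_. 0) i \<tau> *s Bs i \<tau>)"
      unfolding sum_two by (simp add: e_def)
    hence "e (\<lambda>_. 0) (\<lambda>_. 0) = h" using h e[OF z z] by blast
    ultimately show ?thesis by simp
  qed
  hence "e f g 0 = e (\<lambda>_. 0) (\<lambda>_. 0) 0" "e f g 1 = e (\<lambda>_. 0) (\<lambda>_. 0) 1" by simp_all
  thus "f = (\<lambda>_. 0)" "g = (\<lambda>_. 0)" by (simp_all add: e_def)
qed

lemma gens_ring:
  assumes "F \<in> modular_form_module \<rho>0"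
  shows "\<exists>f g. f \<in> eisenstein_ring \<and> g \<in> eisenstein_ring \<and> F = (\<lambda>\<tau>. f \<tau> *s B0 \<tau> + g \<tau> *s B1 \<tau>)"
proof -
  obtain f where f: "f \<in> {..<length [k1, k2]} \<rightarrow>\<^sub>E eisenstein_ring" "F = (\<lambda>\<tau>. \<Sum>i<length [k1, k2]. f i \<tau> *s Bs i \<tau>)"
    using Bs_spec(2) assms by blast
  have "f 0 \<in> eisenstein_ring" "f 1 \<in> eisenstein_ring" using f(1) by auto
  thus ?thesis using f(2) unfolding sum_two by blast
qed

text \<open>The basis property supplies coefficients that may be inhomogeneous. Independence of
  weights isolates the part of weight k of the identity, where the coefficients are forms of weights
  k - k1 and k - k2.\<close>

lemma gens_exist:
  assumes F: "vvmf \<rho>0 k F"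
  shows "\<exists>f g. sform (k - k1) f \<and> sform (k - k2) g \<and> F = (\<lambda>\<tau>. f \<tau> *s B0 \<tau> + g \<tau> *s B1 \<tau>)"
proof -
  have "F \<in> modular_form_module \<rho>0" using F forms0 in_module by blast
  then obtain f g where fg: "f \<in> eisenstein_ring" "g \<in> eisenstein_ring" "F = (\<lambda>\<tau>. f \<tau> *s B0 \<tau> + g \<tau> *s B1 \<tau>)"
    using gens_ring by blast
  obtain K h where "finite K \<and> (\<forall>w. sform w (h w)) \<and> (\<forall>w. w \<notin> K \<longrightarrow> h w = (\<lambda>_. 0)) \<and> f = (\<lambda>\<tau>. \<Sum>w\<in>K. h w \<tau>)"
    using eisenstein_ring_graded[OF fg(1)] by (elim exE)
  hence K: "finite K" "\<And>w. sform w (h w)" "\<And>w. w \<notin> K \<Longrightarrow> h w = (\<lambda>_. 0)" "f = (\<lambda>\<tau>. \<Sum>w\<in>K. h w \<tau>)" by simp_all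
  obtain K' h' where "finite K' \<and> (\<forall>w. sform w (h' w)) \<and> (\<forall>w. w \<notin> K' \<longrightarrow> h' w = (\<lambda>_. 0)) \<and> g = (\<lambda>\<tau>. \<Sum>w\<in>K'. h' w \<tau>)"
    using eisenstein_ring_graded[OF fg(2)] by (elim exE)
  hence K': "finite K'" "\<And>w. sform w (h' w)" "\<And>w. w \<notin> K' \<Longrightarrow> h' w = (\<lambda>_. 0)" "g = (\<lambda>\<tau>. \<Sum>w\<in>K'. h' w \<tau>)" by simp_all
  \<comment> \<open>All weights that occur; \<open>H w\<close> is the part of weight w of f B0 + g
    B1 - F.\<close>
  define W where "W = insert k ((\<lambda>w. w + k1) ` K \<union> (\<lambda>w. w + k2) ` K')"
  have W: "finite W" using K(1) K'(1) by (simp add: W_def)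
  define H where "H w = (\<lambda>\<tau>. h (w - k1) \<tau> *s B0 \<tau> + h' (w - k2) \<tau> *s B1 \<tau> - (if w = k then F \<tau> else 0))" for w
  have "vvmf \<rho>0 w (\<lambda>\<tau>. if w = k then F \<tau> else 0)" for w using F by (cases "w = k") auto
  moreover have "vvmf \<rho>0 w (\<lambda>\<tau>. h (w - k1) \<tau> *s B0 \<tau> + h' (w - k2) \<tau> *s B1 \<tau>)" for w
    using vvmf_smult[OF K(2)[of "w - k1"] vvmf_B0] vvmf_smult[OF K'(2)[of "w - k2"] vvmf_B1]
    by (simp add: vvmf_add)
  ultimately have H: "vvmf \<rho>0 w (H w)" for w unfolding H_def by (intro vvmf_diff)
  have shift: "(\<Sum>w\<in>W. u (w - c) \<tau>) = (\<Sum>w\<in>L. u w \<tau>)"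
    if "finite L" "(\<lambda>w. w + c) ` L \<subseteq> W" "\<And>w. w \<notin> L \<Longrightarrow> u w = (\<lambda>_. 0)" for u :: "int \<Rightarrow> complex \<Rightarrow> complex" and c L \<tau>
  proof -
    have "(\<Sum>w\<in>W. u (w - c) \<tau>) = (\<Sum>w\<in>(\<lambda>w. w + c) ` L. u (w - c) \<tau>)"
    proof (rule sum.mono_neutral_right[OF W that(2)])
      show "\<forall>w\<in>W - (\<lambda>w. w + c) ` L. u (w - c) \<tau> = 0"
      proof
        fix w assume "w \<in> W - (\<lambda>w. w + c) ` L"
        hence "w - c \<notin> L" by (metis DiffE diff_add_cancel image_eqI)
        thus "u (w - c) \<tau> = 0" using that(3) by simp
      qed
    qed
    also have "\<dots> = (\<Sum>w\<in>L. u w \<tau>)" by (subst sum.reindex) (auto simp: inj_on_def)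
    finally show ?thesis .
  qed
  have smult_sum: "(\<Sum>w\<in>W. c w *s v) = (\<Sum>w\<in>W. c w) *s v" for c and v :: "complex^2"
    by (simp add: vec_eq_iff sum_distrib_right)
  have "(\<Sum>w\<in>W. H w \<tau>) = 0" for \<tau>
  proof -
    have "(\<Sum>w\<in>W. H w \<tau>) = (\<Sum>w\<in>W. h (w - k1) \<tau>) *s B0 \<tau> + (\<Sum>w\<in>W. h' (w - k2) \<tau>) *s B1 \<tau> - F \<tau>"
      unfolding H_def sum_subtractf sum.distrib smult_sum using W by (simp add: W_def)
    also have "(\<Sum>w\<in>W. h (w - k1) \<tau>) = f \<tau>"
      unfolding K(4) by (rule shift[OF K(1) _ K(3)]) (auto simp: W_def)
    also have "(\<Sum>w\<in>W. h' (w - k2) \<tau>) = g \<tau>"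
      unfolding K'(4) by (rule shift[OF K'(1) _ K'(3)]) (auto simp: W_def)
    finally show ?thesis by (simp add: fg(3))
  qed
  from vvmf_weights_independent[OF sl0 W H this, of k]
  have "H k \<tau> = 0" for \<tau> by (simp add: W_def)
  hence "F = (\<lambda>\<tau>. h (k - k1) \<tau> *s B0 \<tau> + h' (k - k2) \<tau> *s B1 \<tau>)" by (simp add: H_def fun_eq_iff)
  thus ?thesis using K(2) K'(2) by blast
qed

lemma one_ne_zero_fun: "(\<lambda>\<tau>. if \<tau> \<in> \<H> then 1 else (0::complex)) \<noteq> (\<lambda>_. 0)"
  using fun_cong[of _ _ \<i>] by fastforce

lemma B0_nonzero: "\<exists>\<tau>\<in>\<H>. B0 \<tau> \<noteq> 0" and B1_nonzero: "\<exists>\<tau>\<in>\<H>. B1 \<tau> \<noteq> 0"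
proof -
  note one = sform_in_ring[OF sform_const[of 1]] and zero = sform_in_ring[OF sform_zero[of 0]]
  show "\<exists>\<tau>\<in>\<H>. B0 \<tau> \<noteq> 0"
  proof (rule ccontr)
    assume "\<not> ?thesis"
    hence "B0 \<tau> = 0" for \<tau> using vvmfD(1)[OF vvmf_B0] by blast
    thus False using gens_unique(1)[OF one zero] one_ne_zero_fun by simp
  qed
  show "\<exists>\<tau>\<in>\<H>. B1 \<tau> \<noteq> 0"
  proof (rule ccontr)
    assume "\<not> ?thesis"
    hence "B1 \<tau> = 0" for \<tau> using vvmfD(1)[OF vvmf_B1] by blast
    thus False using gens_unique(2)[OF zero one] one_ne_zero_fun by simp
  qed
qed

lemma even_weights: "even k1" "even k2"
  using vvmf_odd_weight[OF psl0 vvmf_B0] vvmf_odd_weight[OF psl0 vvmf_B1] B0_nonzero B1_nonzero by blast+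

text \<open>Comparing the values at \<tau>, \<tau> + 1 and -1 / \<tau> shows that the line of w is
  invariant, against irreducibility.\<close>

lemma no_line:
  assumes F: "vvmf \<rho>0 k F" and \<tau>: "\<tau> \<in> \<H>" "F \<tau> \<noteq> 0" and w: "w \<noteq> 0"
    and line: "\<And>\<tau>. \<tau> \<in> \<H> \<Longrightarrow> cross2 w (F \<tau>) = 0"
  shows False
proof -
  have par: "\<exists>c. F \<tau> = c *s w" if "\<tau> \<in> \<H>" for \<tau> using cross2_parallel[OF line[OF that] w] .
  obtain c where c: "F \<tau> = c *s w" using par \<tau>(1) by blast
  hence c0: "c \<noteq> 0" using \<tau>(2) by auto
  have nz: "\<tau> \<noteq> 0" using \<tau>(1) by auto
  have 1: "\<tau> + 1 \<in> \<H>" "- 1 / \<tau> \<in> \<H>" using \<tau>(1) neg_inverse_in_uhp by simp_all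
  obtain d where d: "F (\<tau> + 1) = d *s w" using par 1 by blast
  obtain e where e: "F (- 1 / \<tau>) = e *s w" using par 1 by blast
  have "c *s (\<rho>0 T_mat *v w) = d *s w" using vvmfD(3)[OF F \<tau>(1)] by (simp add: c d mv_smult)
  hence "(1 / c) *s (c *s (\<rho>0 T_mat *v w)) = (1 / c) *s (d *s w)" by simp
  hence T: "\<rho>0 T_mat *v w = (1 / c * d) *s w" using c0 by (simp add: vector_smult_assoc)
  have pz: "\<tau> powi k * c \<noteq> 0" using nz c0 by simp
  have "(\<tau> powi k * c) *s (\<rho>0 S_mat *v w) = e *s w"
    using vvmfD(4)[OF F \<tau>(1)] unfolding c e mv_smult vector_smult_assoc by simp
  hence "(1 / (\<tau> powi k * c)) *s ((\<tau> powi k * c) *s (\<rho>0 S_mat *v w)) = (1 / (\<tau> powi k * c)) *s (e *s w)" by simp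
  hence "(1 / (\<tau> powi k * c) * (\<tau> powi k * c)) *s (\<rho>0 S_mat *v w) = (1 / (\<tau> powi k * c) * e) *s w"
    by (simp only: vector_smult_assoc)
  moreover have "1 / (\<tau> powi k * c) * (\<tau> powi k * c) = 1" using pz by (simp only: nonzero_eq_divide_eq divide_self_if times_divide_eq_left if_False mult_1_left)
  ultimately have S: "\<rho>0 S_mat *v w = (1 / (\<tau> powi k * c) * e) *s w" by (simp only: vector_smult_lid)
  show False by (rule irreducible_no_common_eigenvector[OF sl0 irr0 w S T])
qed

lemma vvmf0_serre_deriv: "vvmf \<rho>0 (2 * n) F \<Longrightarrow> vvmf \<rho>0 (2 * n + 2) (vserre n F)"
  using basis_exists(2) vvmf_serre_deriv by blast

section \<open>The weights and the differential system of the generators\<close>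

definition m :: nat where "m = nat (k1 div 2)"

lemma k1_eq: "2 * int m = k1"
  using even_weights(1) k12(2) by (auto simp: m_def)

lemma vserre_components:
  assumes "\<tau> \<in> \<H>"
  shows "deriv (\<lambda>\<tau>. F \<tau> $ j) \<tau> = vserre n F \<tau> $ j + of_int n * eta4_logderiv \<tau> * F \<tau> $ j"
  using assms by (simp add: vserre_def serre_deriv_def)

lemma deriv_cross2:
  assumes "\<And>j. (\<lambda>\<tau>. F \<tau> $ j) holomorphic_on \<H>" "\<tau> \<in> \<H>"
  shows "((\<lambda>\<tau>. cross2 w (F \<tau>)) has_field_derivative
    (cross2 w (vserre n F \<tau>) + of_int n * eta4_logderiv \<tau> * cross2 w (F \<tau>))) (at \<tau>)"
proof -
  have "((\<lambda>\<tau>. cross2 w (F \<tau>)) has_field_derivative w $ 1 * deriv (\<lambda>\<tau>. F \<tau> $ 2) \<tau> - w $ 2 * deriv (\<lambda>\<tau>. F \<tau> $ 1) \<tau>) (at \<tau>)"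
    unfolding cross2_def using assms by (intro DERIV_diff DERIV_cmult uhp_deriv)
  also have "w $ 1 * deriv (\<lambda>\<tau>. F \<tau> $ 2) \<tau> - w $ 2 * deriv (\<lambda>\<tau>. F \<tau> $ 1) \<tau> =
      cross2 w (vserre n F \<tau>) + of_int n * eta4_logderiv \<tau> * cross2 w (F \<tau>)"
    unfolding vserre_components[OF assms(2), where n = n] by (simp add: cross2_def algebra_simps)
  finally show ?thesis .
qed

lemma cross2_holomorphic:
  assumes "\<And>j. (\<lambda>\<tau>. F \<tau> $ j) holomorphic_on \<H>" shows "(\<lambda>\<tau>. cross2 w (F \<tau>)) holomorphic_on \<H>"
  unfolding cross2_def using assms by (intro holomorphic_intros)

text \<open>A solution of the linear system formed by \<open>B0\<close> and \<open>B1\<close> under the Serre derivative whose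
  values at one point are parallel stays in a fixed line.\<close>

lemma system_nondegenerate:
  assumes D0: "\<And>\<tau>. \<tau> \<in> \<H> \<Longrightarrow> vserre n B0 \<tau> = c1 *s B1 \<tau>"
    and D1: "\<And>\<tau>. \<tau> \<in> \<H> \<Longrightarrow> vserre n' B1 \<tau> = (c2 * E4 \<tau>) *s B0 \<tau>"
    and \<tau>: "\<tau> \<in> \<H>" "B0 \<tau> \<noteq> 0"
  shows "cross2 (B0 \<tau>) (B1 \<tau>) \<noteq> 0"
proof
  assume 0: "cross2 (B0 \<tau>) (B1 \<tau>) = 0"
  let ?w = "B0 \<tau>"
  note h0 = vvmfD(2)[OF vvmf_B0] and h1 = vvmfD(2)[OF vvmf_B1]
  have "cross2 ?w (B0 z) = 0" if z: "z \<in> \<H>" for z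
  proof (rule linear_ode_zero[where S = \<H> and z = \<tau> and w = z and f = "\<lambda>z. cross2 ?w (B0 z)" and g = "\<lambda>z. cross2 ?w (B1 z)"
        and a = "\<lambda>z. of_int n * eta4_logderiv z" and b = "\<lambda>_. c1" and c = "\<lambda>z. c2 * E4 z" and d = "\<lambda>z. of_int n' * eta4_logderiv z"])
    fix z assume z: "z \<in> \<H>"
    show "deriv (\<lambda>z. cross2 ?w (B0 z)) z = of_int n * eta4_logderiv z * cross2 ?w (B0 z) + c1 * cross2 ?w (B1 z)"
      by (rule DERIV_imp_deriv, rule DERIV_cong, rule deriv_cross2[OF h0 z, of ?w n])
        (simp del: One_nat_def add: D0[OF z] cross2_def algebra_simps)
    show "deriv (\<lambda>z. cross2 ?w (B1 z)) z = c2 * E4 z * cross2 ?w (B0 z) + of_int n' * eta4_logderiv z * cross2 ?w (B1 z)"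
      by (rule DERIV_imp_deriv, rule DERIV_cong, rule deriv_cross2[OF h1 z, of ?w n'])
        (simp del: One_nat_def add: D1[OF z] cross2_def algebra_simps)
  next
    show "cross2 ?w (B0 \<tau>) = 0" by (simp add: cross2_def)
  qed (use 0 \<tau> z open_uhp convex_connected[OF convex_uhp] sformD(2)[OF sform_E4]
      in \<open>auto simp del: One_nat_def intro!: holomorphic_intros cross2_holomorphic h0 h1 eta4_logderiv_holomorphic\<close>)
  thus False using no_line[OF vvmf_B0 \<tau> \<tau>(2)] by blast
qed

text \<open>The values of \<open>B0\<close> would span an invariant line, because the derivative of
  \<open>B0 / eta4 ^ n\<close> would vanish.\<close>

lemma serre_deriv_B0_nonzero:
  assumes D: "\<And>\<tau>. \<tau> \<in> \<H> \<Longrightarrow> vserre n B0 \<tau> = 0"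
  shows False
proof -
  obtain \<sigma> where \<sigma>: "\<sigma> \<in> \<H>" "B0 \<sigma> \<noteq> 0" using B0_nonzero by blast
  note h0 = vvmfD(2)[OF vvmf_B0]
  have "cross2 (B0 \<sigma>) (B0 z) = 0" if z: "z \<in> \<H>" for z
  proof (rule linear_ode_zero[where S = \<H> and z = \<sigma> and w = z and f = "\<lambda>z. cross2 (B0 \<sigma>) (B0 z)" and g = "\<lambda>_. 0"
        and a = "\<lambda>z. of_int n * eta4_logderiv z" and b = "\<lambda>_. 0" and c = "\<lambda>z. 0" and d = "\<lambda>z. 0"])
    fix z assume z: "z \<in> \<H>"
    show "deriv (\<lambda>z. cross2 (B0 \<sigma>) (B0 z)) z = of_int n * eta4_logderiv z * cross2 (B0 \<sigma>) (B0 z) + 0 * 0"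
      by (rule DERIV_imp_deriv, rule DERIV_cong, rule deriv_cross2[OF h0 z, of "B0 \<sigma>" n])
        (simp add: D[OF z] cross2_def)
  next
    show "cross2 (B0 \<sigma>) (B0 \<sigma>) = 0" by (simp add: cross2_def)
  qed (use \<sigma> z open_uhp convex_connected[OF convex_uhp]
      in \<open>auto intro!: holomorphic_intros cross2_holomorphic h0 eta4_logderiv_holomorphic\<close>)
  thus False using no_line[OF vvmf_B0 \<sigma> \<sigma>(2)] by blast
qed

text \<open>The derivative of B0 has a coefficient of weight 2 at B0, hence 0. It does not vanish,
  so its coefficient at B1 has weight 0, which fixes k2. For B1 the coefficients have weights 4 and
  2, leaving a multiple of E4 times B0.\<close>

lemma weights_and_system:
  "\<exists>c1 c2. c1 \<noteq> 0 \<and> k2 = 2 * int m + 2 \<and>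
    (\<forall>\<tau>. vserre (int m) B0 \<tau> = c1 *s B1 \<tau>) \<and>
    (\<forall>\<tau>. vserre (int m + 1) B1 \<tau> = (c2 * E4 \<tau>) *s B0 \<tau>)"
proof -
  have "vvmf \<rho>0 (2 * int m + 2) (vserre (int m) B0)"
    by (rule vvmf0_serre_deriv) (simp add: k1_eq vvmf_B0)
  from gens_exist[OF this] obtain f g where
    fg0: "sform (2 * int m + 2 - k1) f \<and> sform (2 * int m + 2 - k2) g \<and>
      vserre (int m) B0 = (\<lambda>\<tau>. f \<tau> *s B0 \<tau> + g \<tau> *s B1 \<tau>)" by (elim exE)
  have "2 * int m + 2 - k1 = 2" using k1_eq by simp
  hence f: "sform 2 f" and g: "sform (2 * int m + 2 - k2) g" using fg0 by simp_all
  have D0: "vserre (int m) B0 \<tau> = g \<tau> *s B1 \<tau>" for \<tau>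
    using sform_weight_2[OF f] fg0 by simp
  have k2: "k2 = 2 * int m + 2"
  proof (rule ccontr)
    assume ne: "k2 \<noteq> 2 * int m + 2"
    have "g \<tau> = 0" for \<tau>
    proof (cases "2 * int m + 2 - k2 < 0")
      case True
      thus ?thesis using sform_negative_weight[OF g] by blast
    next
      case False
      moreover obtain n where "k2 = 2 * n" using even_weights(2) by (rule evenE)
      ultimately have "2 * int m + 2 - k2 = 2" using k12(1) k1_eq ne by presburger
      hence "sform 2 g" using g by simp
      thus ?thesis by (rule sform_weight_2)
    qed
    thus False using D0 by (intro serre_deriv_B0_nonzero[of "int m"]) simp
  qed
  have g0: "sform 0 g" using g k2 by simp
  define c1 where "c1 = cusp_value g"
  have D0': "vserre (int m) B0 \<tau> = c1 *s B1 \<tau>" for \<tau>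
    using D0[of \<tau>] sform_weight_0[OF g0, of \<tau>] vvmfD(1)[OF vvmf_B1, of \<tau>] by (cases "\<tau> \<in> \<H>") (auto simp: c1_def)
  have "vvmf \<rho>0 (2 * (int m + 1) + 2) (vserre (int m + 1) B1)"
    using vvmf_B1 k2 by (intro vvmf0_serre_deriv) simp
  from gens_exist[OF this] obtain f' g' where
    fg': "sform (2 * (int m + 1) + 2 - k1) f' \<and> sform (2 * (int m + 1) + 2 - k2) g' \<and>
      vserre (int m + 1) B1 = (\<lambda>\<tau>. f' \<tau> *s B0 \<tau> + g' \<tau> *s B1 \<tau>)" by (elim exE)
  have "2 * (int m + 1) + 2 - k1 = 4" "2 * (int m + 1) + 2 - k2 = 2" using k1_eq k2 by simp_all
  hence f': "sform 4 f'" and g': "sform 2 g'" using fg' by metis+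
  have "f' \<tau> = cusp_value f' * E4 \<tau>" for \<tau>
  proof (cases "\<tau> \<in> \<H>")
    case True
    thus ?thesis using sform_small_weight[OF f', of 1 0 \<tau>] by (simp add: mono46_def)
  next
    case False
    thus ?thesis using sformD(1)[OF sform_E4, of \<tau>] sformD(1)[OF f', of \<tau>] by simp
  qed
  hence D1: "vserre (int m + 1) B1 \<tau> = (cusp_value f' * E4 \<tau>) *s B0 \<tau>" for \<tau>
    using sform_weight_2[OF g'] fg' by simp
  have "c1 \<noteq> 0" using serre_deriv_B0_nonzero[of "int m"] D0' by auto
  thus ?thesis using k2 D0' D1 by blast
qed

end

subsection \<open>Eichler integrals\<close>

text \<open>Integration turns the rate exp (c Im \<tau>) of f into (1 + Im \<tau>) exp (c Im \<tau>)
  for F, and the decay of E removes the exponential. This is meant for a power of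
  \<open>eta4\<close> times the primitive of a form divided by that power.\<close>

lemma weighted_linear_growth:
  fixes F :: "complex \<Rightarrow> complex"
  assumes F: "\<And>\<tau>. \<tau> \<in> \<H> \<Longrightarrow> (F has_field_derivative f \<tau>) (at \<tau>)" and c: "0 \<le> c"
    and f: "\<And>\<tau>. \<tau> \<in> cusp_strip \<Longrightarrow> norm (f \<tau>) \<le> C * exp (c * Im \<tau>)"
    and E: "\<And>\<tau>. \<tau> \<in> cusp_strip \<Longrightarrow> norm (E \<tau>) \<le> b * exp (- (c * Im \<tau>))"
  shows "\<exists>C. \<forall>\<tau>\<in>cusp_strip. norm (E \<tau> * F \<tau>) \<le> C * (1 + Im \<tau>)"
proof (intro exI ballI)
  have i: "\<i> \<in> cusp_strip" by (simp add: cusp_strip_def)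
  have "0 \<le> C * exp c" "0 \<le> b * exp (- c)"
    using order_trans[OF norm_ge_zero f[OF i]] order_trans[OF norm_ge_zero E[OF i]] by simp_all
  hence C: "0 \<le> C" and b: "0 \<le> b" by (simp_all add: zero_le_mult_iff)
  fix \<tau> assume \<tau>: "\<tau> \<in> cusp_strip"
  \<comment> \<open>The strip is cut off at the height of \<tau>, since the bound for f increases
    with the height.\<close>
  define K where "K = {\<tau>. Re \<tau> \<le> 1} \<inter> {\<tau>. - 1 \<le> Re \<tau>} \<inter> {\<tau>. 1 \<le> Im \<tau>} \<inter> {z. Im z \<le> Im \<tau>}"
  have conv: "convex K"
    unfolding K_def by (intro convex_Int convex_halfspace_Re_le convex_halfspace_Re_ge convex_halfspace_Im_ge convex_halfspace_Im_le)
  have K: "z \<in> cusp_strip" "Im z \<le> Im \<tau>" if "z \<in> K" for z using that unfolding K_def cusp_strip_def by (simp_all add: abs_le_iff)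
  have "norm (F \<tau> - F \<i>) \<le> (C * exp (c * Im \<tau>)) * norm (\<tau> - \<i>)"
  proof (rule field_differentiable_bound[OF conv, of F f])
    fix z assume z: "z \<in> K"
    show "(F has_field_derivative f z) (at z within K)"
      by (rule has_field_derivative_at_within[OF F[OF cusp_strip_subset[OF K(1)[OF z]]]])
    have "c * Im z \<le> c * Im \<tau>" using c K(2)[OF z] by (rule mult_left_mono[rotated])
    hence "C * exp (c * Im z) \<le> C * exp (c * Im \<tau>)" using C by (intro mult_left_mono) auto
    thus "norm (f z) \<le> C * exp (c * Im \<tau>)" using f[OF K(1)[OF z]] by linarith
  qed (use \<tau> in \<open>auto simp: K_def cusp_strip_def\<close>)
  also have "norm (\<tau> - \<i>) \<le> \<bar>Re (\<tau> - \<i>)\<bar> + \<bar>Im (\<tau> - \<i>)\<bar>" by (rule cmod_le)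
  also have "\<dots> \<le> 1 + Im \<tau>" using \<tau> by (auto simp: cusp_strip_def)
  finally have 1: "norm (F \<tau> - F \<i>) \<le> C * exp (c * Im \<tau>) * (1 + Im \<tau>)" using C by (simp add: mult_left_mono)
  have y: "0 \<le> Im \<tau>" using \<tau> by (simp add: cusp_strip_def)
  have "1 * 1 \<le> exp (c * Im \<tau>) * (1 + Im \<tau>)" using c y by (intro mult_mono) auto
  hence "norm (F \<i>) * 1 \<le> norm (F \<i>) * (exp (c * Im \<tau>) * (1 + Im \<tau>))" by (intro mult_left_mono) auto
  moreover have "norm (F \<tau>) \<le> norm (F \<tau> - F \<i>) + norm (F \<i>)" by (metis diff_add_cancel norm_triangle_ineq)
  ultimately have "norm (F \<tau>) \<le> (C + norm (F \<i>)) * (exp (c * Im \<tau>) * (1 + Im \<tau>))" using 1 by (simp add: algebra_simps)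
  hence "norm (E \<tau>) * norm (F \<tau>) \<le> (b * exp (- (c * Im \<tau>))) * ((C + norm (F \<i>)) * (exp (c * Im \<tau>) * (1 + Im \<tau>)))"
    using E[OF \<tau>] b by (intro mult_mono) auto
  also have "\<dots> = b * (C + norm (F \<i>)) * (1 + Im \<tau>) * (exp (- (c * Im \<tau>)) * exp (c * Im \<tau>))" by (simp add: mult_ac)
  also have "exp (- (c * Im \<tau>)) * exp (c * Im \<tau>) = 1" by (simp add: exp_minus)
  finally show "norm (E \<tau> * F \<tau>) \<le> b * (C + norm (F \<i>)) * (1 + Im \<tau>)" by (simp add: norm_mult)
qed

definition has_vec_deriv :: "(complex \<Rightarrow> complex^'n) \<Rightarrow> complex^'n \<Rightarrow> complex \<Rightarrow> bool" where
  "has_vec_deriv Y d \<tau> \<longleftrightarrow> (\<forall>j. ((\<lambda>\<tau>. Y \<tau> $ j) has_field_derivative d $ j) (at \<tau>))"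

lemma has_vec_deriv_matrix_vector:
  "has_vec_deriv Y d \<tau> \<Longrightarrow> has_vec_deriv (\<lambda>\<tau>. M *v Y \<tau>) (M *v d) \<tau>"
  unfolding has_vec_deriv_def matrix_vector_mult_def
  by (auto intro!: DERIV_sum DERIV_cmult)

lemma has_vec_deriv_diff:
  "has_vec_deriv Y d \<tau> \<Longrightarrow> has_vec_deriv Z e \<tau> \<Longrightarrow> has_vec_deriv (\<lambda>\<tau>. Y \<tau> - Z \<tau>) (d - e) \<tau>"
  unfolding has_vec_deriv_def by (auto intro!: DERIV_diff)

lemma has_vec_deriv_inversion:
  "\<tau> \<in> \<H> \<Longrightarrow> has_vec_deriv Y d (- 1 / \<tau>) \<Longrightarrow> has_vec_deriv (\<lambda>\<tau>. Y (- 1 / \<tau>)) ((1 / \<tau>^2) *s d) \<tau>"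
  unfolding has_vec_deriv_def using has_deriv_inversion[of \<tau>] by fastforce

lemma has_vec_deriv_translation:
  "has_vec_deriv Y d (\<tau> + 1) \<Longrightarrow> has_vec_deriv (\<lambda>\<tau>. Y (\<tau> + 1)) d \<tau>"
  unfolding has_vec_deriv_def using has_deriv_translation by blast

lemma vec_deriv_zero_constant:
  assumes "\<And>\<tau>. \<tau> \<in> \<H> \<Longrightarrow> has_vec_deriv Z 0 \<tau>" shows "\<exists>c. \<forall>\<tau>\<in>\<H>. Z \<tau> = c"
proof -
  have "\<exists>c. \<forall>\<tau>\<in>\<H>. Z \<tau> $ j = c" for j
    using assms by (intro uhp_constant) (auto simp: has_vec_deriv_def)
  then obtain c where "\<forall>j. \<forall>\<tau>\<in>\<H>. Z \<tau> $ j = c j" by metis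
  hence "\<forall>\<tau>\<in>\<H>. Z \<tau> = (\<chi> j. c j)" by (simp add: vec_eq_iff)
  thus ?thesis by blast
qed

context extension
begin

text \<open>The Wronskian of the generators is a constant multiple of \<open>eta4 ^ (2 * m + 1)\<close>, which
  computes the determinant of \<open>\<rho>0 T_mat\<close>; the cocycle computes it as well.\<close>

lemma weight_congruence: "\<exists>n::int. int m = int a + 1 + 3 * n"
proof -
  obtain c1 c2 where sys: "\<And>\<tau>. vserre (int m) B0 \<tau> = c1 *s B1 \<tau>"
    "\<And>\<tau>. vserre (int m + 1) B1 \<tau> = (c2 * E4 \<tau>) *s B0 \<tau>"
    using weights_and_system by metis
  define \<zeta> where "\<zeta> = exp (\<i> * of_real pi / 3)"
  define W where "W \<tau> = cross2 (B0 \<tau>) (B1 \<tau>)" for \<tau>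
  note h0 = vvmfD(2)[OF vvmf_B0] and h1 = vvmfD(2)[OF vvmf_B1]
  \<comment> \<open>The off-diagonal terms of the system drop out of the derivative of a
    determinant; the half weights m and m + 1 add up.\<close>
  have W: "(W has_field_derivative of_nat (2 * m + 1) * eta4_logderiv \<tau> * W \<tau>) (at \<tau>)" if \<tau>: "\<tau> \<in> \<H>" for \<tau>
  proof -
    have d0: "((\<lambda>\<tau>. B0 \<tau> $ j) has_field_derivative c1 * B1 \<tau> $ j + of_int (int m) * eta4_logderiv \<tau> * B0 \<tau> $ j) (at \<tau>)" for j
      using uhp_deriv[OF h0[of j] \<tau>] unfolding vserre_components[OF \<tau>, of B0 j "int m"] sys by simp
    have d1: "((\<lambda>\<tau>. B1 \<tau> $ j) has_field_derivative c2 * E4 \<tau> * B0 \<tau> $ j + of_int (int m + 1) * eta4_logderiv \<tau> * B1 \<tau> $ j) (at \<tau>)" for j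
      using uhp_deriv[OF h1[of j] \<tau>] unfolding vserre_components[OF \<tau>, of B1 j "int m + 1"] sys by simp
    show ?thesis
      unfolding W_def[abs_def] cross2_def
      by (rule DERIV_cong, rule DERIV_diff, rule DERIV_mult[OF d0 d1], rule DERIV_mult[OF d0 d1]) (simp del: One_nat_def add: algebra_simps)
  qed
  have "((\<lambda>\<tau>. W \<tau> / eta4 \<tau> ^ (2 * m + 1)) has_field_derivative 0) (at \<tau>)" if \<tau>: "\<tau> \<in> \<H>" for \<tau>
  proof -
    have e: "((\<lambda>\<tau>. eta4 \<tau> ^ (2 * m + 1)) has_field_derivative of_nat (2 * m + 1) * eta4_logderiv \<tau> * eta4 \<tau> ^ (2 * m + 1)) (at \<tau>)"
      by (rule DERIV_cong, rule DERIV_power[OF eta4_has_deriv[OF \<tau>]]) (simp add: algebra_simps)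
    show ?thesis
      by (rule DERIV_cong, rule DERIV_divide[OF W[OF \<tau>] e]) (use eta4_nonzero[OF \<tau>] in \<open>simp_all add: algebra_simps\<close>)
  qed
  hence "\<exists>w. \<forall>\<tau>\<in>\<H>. W \<tau> / eta4 \<tau> ^ (2 * m + 1) = w" by (rule uhp_constant)
  then obtain w where w: "\<forall>\<tau>\<in>\<H>. W \<tau> / eta4 \<tau> ^ (2 * m + 1) = w" by (elim exE)
  have Ww: "W \<tau> = w * eta4 \<tau> ^ (2 * m + 1)" if "\<tau> \<in> \<H>" for \<tau>
    using bspec[OF w that] eta4_nonzero[OF that] by (auto simp: field_simps)
  obtain \<sigma> where \<sigma>: "\<sigma> \<in> \<H>" "B0 \<sigma> \<noteq> 0" using B0_nonzero by blast
  have W0: "W \<sigma> \<noteq> 0" unfolding W_def by (rule system_nondegenerate[OF sys \<sigma>])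
  have "W (\<sigma> + 1) = det (\<rho>0 T_mat) * W \<sigma>"
    unfolding W_def using vvmfD(3)[OF vvmf_B0 \<sigma>(1)] vvmfD(3)[OF vvmf_B1 \<sigma>(1)] by (simp only: cross2_matrix)
  moreover have "W (\<sigma> + 1) = \<zeta> ^ (2 * m + 1) * W \<sigma>"
    using Ww[OF \<sigma>(1)] Ww[of "\<sigma> + 1"] \<sigma>(1) eta4_translation[OF \<sigma>(1)] by (simp add: \<zeta>_def power_mult_distrib)
  ultimately have "det (\<rho>0 T_mat) = \<zeta> ^ (2 * m + 1)" using W0 by simp
  moreover have "\<zeta> ^ 3 = - 1" unfolding \<zeta>_def by (rule exp_pi_third_cube)
  \<comment> \<open>The minus sign in the determinant computed from the cocycle is absorbed as
    \<zeta>^3.\<close>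
  hence "det (\<rho>0 T_mat) = \<zeta> ^ (2 * a + 3)"
    by (simp add: det_\<rho>0_T X_T \<zeta>_def[symmetric] power_add power_mult[symmetric] mult.commute)
  ultimately have "\<zeta> ^ (2 * m + 1) = \<zeta> ^ (2 * a + 3)" by simp
  hence "exp (of_nat (2 * m + 1) * (\<i> * of_real pi / 3)) = exp (of_nat (2 * a + 3) * (\<i> * of_real pi / 3))"
    unfolding \<zeta>_def exp_of_nat_mult .
  then obtain n :: int where "of_nat (2 * m + 1) * (\<i> * of_real pi / 3) = of_nat (2 * a + 3) * (\<i> * of_real pi / 3) + of_real (real_of_int (2 * n) * pi) * \<i>"
    unfolding exp_eq by metis
  hence "Im (of_nat (2 * m + 1) * (\<i> * of_real pi / 3)) = Im (of_nat (2 * a + 3) * (\<i> * of_real pi / 3) + of_real (real_of_int (2 * n) * pi) * \<i>)" by simp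
  hence "real (2 * m + 1) * (pi / 3) = real (2 * a + 3) * (pi / 3) + real_of_int (2 * n) * pi" by simp
  hence "pi * (real (2 * m + 1)) = pi * (real (2 * a + 3) + 6 * real_of_int n)" by (simp add: field_simps)
  hence "real (2 * m + 1) = real (2 * a + 3) + 6 * real_of_int n" by simp
  hence "real_of_int (2 * int m + 1) = real_of_int (2 * int a + 3 + 6 * n)" by simp
  hence "2 * int m + 1 = 2 * int a + 3 + 6 * n" by (simp only: of_int_eq_iff)
  hence "int m = int a + 1 + 3 * n" by presburger
  thus ?thesis by blast
qed

text \<open>Eichler integral argument: dividing \<open>H\<close> by the power of \<open>eta4\<close> and integrating gives a
  cocycle in the plane of \<open>A\<close> and \<open>U\<close>, hence a multiple of the cocycle of the extension up to a
  coboundary. A nonzero multiple yields the lift. If the multiple is zero, the product with the power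
  of \<open>eta4\<close> is a form whose Serre derivative is \<open>H\<close>.\<close>

lemma lift_or_serre_primitive:
  assumes N: "N = a + 6 * r" and H: "vvmf \<rho>0 (2 * int N + 2) H"
    and noK: "\<And>K. vvmf \<rho>0 (2 * int N) K \<Longrightarrow> \<forall>\<tau>\<in>\<H>. vserre (int N) K \<tau> = H \<tau> \<Longrightarrow> False"
  shows "\<exists>F. vvmf \<rho> (2 * int N) F \<and> (\<forall>\<tau>\<in>\<H>. p *v F \<tau> = (eta4 \<tau> ^ N) *s axis 1 1)"
proof -
  \<comment> \<open>The cut-off matters for N = 0, where the power would be 1 outside \<H>.\<close>
  define e where "e \<tau> = (if \<tau> \<in> \<H> then eta4 \<tau> ^ N else 0)" for \<tau>
  have e_off: "e \<tau> = 0" if "\<tau> \<notin> \<H>" for \<tau> using that by (simp add: e_def)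
  have e_on: "e \<tau> = eta4 \<tau> ^ N" if "\<tau> \<in> \<H>" for \<tau> using that by (simp add: e_def)
  have e0: "e \<tau> \<noteq> 0" if "\<tau> \<in> \<H>" for \<tau> using that eta4_nonzero by (simp add: e_def)
  have \<zeta>6: "exp (\<i> * of_real pi / 3) ^ 6 = 1"
    using arg_cong[OF exp_pi_third_cube, of "\<lambda>z. z^2"] by (simp add: power_mult[symmetric])
  have \<zeta>N: "exp (\<i> * of_real pi / 3) ^ N = X T_mat"
    by (simp add: N power_add power_mult \<zeta>6 X_T)
  have eT: "e (\<tau> + 1) = X T_mat * e \<tau>" if "\<tau> \<in> \<H>" for \<tau>
    using that eta4_translation[OF that] by (simp add: e_def power_mult_distrib \<zeta>N)
  have XS: "X S_mat = (- 1) ^ N" by (simp add: X_S N power_add power_mult)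
  have eS: "e (- 1 / \<tau>) = X S_mat * \<tau> ^ (2 * N) * e \<tau>" if "\<tau> \<in> \<H>" for \<tau>
  proof -
    have "- 1 / \<tau> \<in> \<H>" using neg_inverse_in_uhp that by simp
    moreover have "(- (\<tau>^2) * eta4 \<tau>) ^ N = (- 1) ^ N * \<tau> ^ (2 * N) * eta4 \<tau> ^ N"
      by (simp only: power_mult_distrib power_mult) (metis mult_minus1 power_mult_distrib)
    ultimately show ?thesis using that by (simp only: e_on eta4_inversion XS)
  qed
  have e_deriv: "(e has_field_derivative of_nat N * eta4_logderiv \<tau> * e \<tau>) (at \<tau>)" if \<tau>: "\<tau> \<in> \<H>" for \<tau>
  proof -
    have "((\<lambda>\<tau>. eta4 \<tau> ^ N) has_field_derivative of_nat N * eta4_logderiv \<tau> * e \<tau>) (at \<tau>)"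
      by (rule DERIV_cong, rule DERIV_power[OF eta4_has_deriv[OF \<tau>]]) (cases N; simp add: e_on[OF \<tau>] algebra_simps)
    thus ?thesis
      by (rule has_field_derivative_transform_within_open[OF _ open_uhp \<tau>]) (simp add: e_def)
  qed
  have e_hol: "e holomorphic_on \<H>"
    using e_deriv open_uhp by (auto simp: holomorphic_on_open)
  note Hh = vvmfD(2)[OF H]
  have "\<exists>y. \<forall>\<tau>\<in>\<H>. (y has_field_derivative H \<tau> $ j / e \<tau>) (at \<tau>)" for j
  proof -
    have "(\<lambda>\<tau>. H \<tau> $ j / e \<tau>) holomorphic_on \<H>" using e0 by (intro holomorphic_intros Hh e_hol)
    from uhp_primitive[OF this] show ?thesis by metis
  qed
  then obtain y where y: "\<And>j \<tau>. \<tau> \<in> \<H> \<Longrightarrow> (y j has_field_derivative H \<tau> $ j / e \<tau>) (at \<tau>)" by metis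
  \<comment> \<open>The Eichler integral. Below, s, t and u are its period cocycle on S, T and
    ST.\<close>
  define Y :: "complex \<Rightarrow> complex^2" where "Y \<tau> = (\<chi> j. y j \<tau>)" for \<tau>
  have Y: "has_vec_deriv Y ((1 / e \<tau>) *s H \<tau>) \<tau>" if "\<tau> \<in> \<H>" for \<tau>
    using y[OF that] by (simp add: has_vec_deriv_def Y_def)
  have T: "\<tau> + 1 \<in> \<H>" and S: "- 1 / \<tau> \<in> \<H>" if "\<tau> \<in> \<H>" for \<tau>
    using that neg_inverse_in_uhp by simp_all
  have "has_vec_deriv (\<lambda>\<tau>. Y (- 1 / \<tau>) - A *v Y \<tau>) 0 \<tau>" if \<tau>: "\<tau> \<in> \<H>" for \<tau>
  proof -
    have nz: "\<tau> \<noteq> 0" using \<tau> by auto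
    \<comment> \<open>The weights balance: 2 N + 2 from H against 2 N from e and 2 from the
      differential of -1 / \<tau>.\<close>
    have "(1 / \<tau>^2) *s ((1 / e (- 1 / \<tau>)) *s H (- 1 / \<tau>)) = A *v ((1 / e \<tau>) *s H \<tau>)"
    proof -
      have "\<tau> powi (2 * int N + 2) = \<tau> ^ (2 * N) * \<tau>^2"
        using nz by (simp add: power_int_add) (simp add: power_int_def nat_mult_distrib)
      hence "1 / \<tau>^2 * (1 / (X S_mat * \<tau> ^ (2 * N) * e \<tau>) * \<tau> powi (2 * int N + 2)) = 1 / e \<tau> * (1 / X S_mat)"
        using nz e0[OF \<tau>] X_S_nonzero by (simp add: field_simps)
      moreover have "1 / X S_mat = X S_mat" using X_S_sq X_S_nonzero by (simp add: field_simps)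
      ultimately show ?thesis
        unfolding eS[OF \<tau>] vvmfD(4)[OF H \<tau>] mv_smult A_apply vector_smult_assoc by simp
    qed
    hence "has_vec_deriv (\<lambda>\<tau>. Y (- 1 / \<tau>)) (A *v ((1 / e \<tau>) *s H \<tau>)) \<tau>"
      using has_vec_deriv_inversion[OF \<tau> Y[OF S[OF \<tau>]]] by simp
    from has_vec_deriv_diff[OF this has_vec_deriv_matrix_vector[OF Y[OF \<tau>], of A]] show ?thesis by (simp only: diff_self)
  qed
  hence "\<exists>s. \<forall>\<tau>\<in>\<H>. Y (- 1 / \<tau>) - A *v Y \<tau> = s" by (rule vec_deriv_zero_constant)
  then obtain s where "\<forall>\<tau>\<in>\<H>. Y (- 1 / \<tau>) - A *v Y \<tau> = s" by (elim exE)
  hence s: "Y (- 1 / \<tau>) = A *v Y \<tau> + s" if "\<tau> \<in> \<H>" for \<tau> using that by (metis diff_add_cancel add.commute)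
  have "has_vec_deriv (\<lambda>\<tau>. Y (\<tau> + 1) - B *v Y \<tau>) 0 \<tau>" if \<tau>: "\<tau> \<in> \<H>" for \<tau>
  proof -
    have "(1 / e (\<tau> + 1)) *s H (\<tau> + 1) = B *v ((1 / e \<tau>) *s H \<tau>)"
      unfolding eT[OF \<tau>] vvmfD(3)[OF H \<tau>] mv_smult B_apply vector_smult_assoc by (simp add: mult.commute)
    hence "has_vec_deriv (\<lambda>\<tau>. Y (\<tau> + 1)) (B *v ((1 / e \<tau>) *s H \<tau>)) \<tau>"
      using has_vec_deriv_translation[OF Y[OF T[OF \<tau>]]] by simp
    from has_vec_deriv_diff[OF this has_vec_deriv_matrix_vector[OF Y[OF \<tau>], of B]] show ?thesis by (simp only: diff_self)
  qed
  hence "\<exists>t. \<forall>\<tau>\<in>\<H>. Y (\<tau> + 1) - B *v Y \<tau> = t" by (rule vec_deriv_zero_constant)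
  then obtain t where "\<forall>\<tau>\<in>\<H>. Y (\<tau> + 1) - B *v Y \<tau> = t" by (elim exE)
  hence t: "Y (\<tau> + 1) = B *v Y \<tau> + t" if "\<tau> \<in> \<H>" for \<tau> using that by (metis diff_add_cancel add.commute)
  define u where "u = A *v t + s"
  have su: "s + A *v s = 0"
  proof -
    \<comment> \<open>Evaluation at the fixed point of S gives the cocycle relation; for ST the cube
      root of unity \<sigma> is used in the same way.\<close>
    have "Y \<i> = A *v Y \<i> + s" using s[of \<i>] by simp
    hence s': "s = Y \<i> - A *v Y \<i>" by (metis add_diff_cancel_left')
    show ?thesis unfolding s' by (simp add: mv_diff plane.A2)
  qed
  have uu: "u + U *v u + U *v (U *v u) = 0"
  proof -
    define \<sigma> where "\<sigma> = Complex (- 1 / 2) (sqrt 3 / 2)"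
    have \<sigma>: "\<sigma> \<in> \<H>" by (simp add: \<sigma>_def)
    have "\<sigma> * (\<sigma> + 1) = - 1" by (simp add: \<sigma>_def complex_eq_iff)
    moreover have "\<sigma> + 1 \<noteq> 0" using \<sigma> by (auto simp: complex_eq_iff)
    ultimately have "- 1 / (\<sigma> + 1) = \<sigma>" by (simp add: field_simps)
    hence "Y \<sigma> = A *v Y (\<sigma> + 1) + s" using s[OF T[OF \<sigma>]] by simp
    hence "Y \<sigma> = U *v Y \<sigma> + u"
      unfolding t[OF \<sigma>] u_def U_apply mv_add by (metis add.assoc)
    hence u': "u = Y \<sigma> - U *v Y \<sigma>" by (metis add_diff_cancel_left')
    show ?thesis unfolding u' by (simp add: mv_diff plane.U3)
  qed
  from plane.cocycle_multiple[OF su uu cS_relation cU_relation not_coboundary]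
  obtain \<alpha> w where aw: "s = \<alpha> *s cS + (A *v w - w) \<and> u = \<alpha> *s cU + (U *v w - w)" by (elim exE)
  \<comment> \<open>Adding the constant of integration w makes the period cocycle exactly \<alpha>
    times that of the extension.\<close>
  define Z where "Z \<tau> = Y \<tau> + w" for \<tau>
  have ZS: "Z (- 1 / \<tau>) = A *v Z \<tau> + \<alpha> *s cS" if "\<tau> \<in> \<H>" for \<tau>
    using s[OF that] aw by (simp add: Z_def mv_add)
  \<comment> \<open>The value on T is recovered from the values on S and ST.\<close>
  have t': "t = \<alpha> *s cT + (B *v w - w)"
  proof -
    have AA: "A *v (A *v x + y) = x + A *v y" for x y by (simp add: mv_add plane.A2)
    have As: "A *v s = - s" using su by (simp add: eq_neg_iff_add_eq_0 add.commute)
    have "t = A *v u + s" unfolding u_def AA As by simp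
    also have "\<dots> = A *v (\<alpha> *s (A *v cT + cS) + (A *v (B *v w) - w)) + (\<alpha> *s cS + (A *v w - w))"
      using aw by (simp add: cU_def U_apply)
    also have "\<dots> = \<alpha> *s (cT + A *v cS) + (B *v w - A *v w) + (\<alpha> *s cS + (A *v w - w))"
      by (simp only: mv_add mv_smult mv_diff plane.A2)
    also have "A *v cS = - cS" using cS_relation by (simp add: eq_neg_iff_add_eq_0 add.commute)
    finally show ?thesis by (simp add: vec_eq_iff algebra_simps)
  qed
  have ZT: "Z (\<tau> + 1) = B *v Z \<tau> + \<alpha> *s cT" if "\<tau> \<in> \<H>" for \<tau>
    using t[OF that] t' by (simp add: Z_def mv_add)
  have Zd: "((\<lambda>\<tau>. Z \<tau> $ j) has_field_derivative H \<tau> $ j / e \<tau>) (at \<tau>)" if "\<tau> \<in> \<H>" for \<tau> j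
    unfolding Z_def Y_def by (rule DERIV_cong, simp, rule DERIV_add[OF y[OF that] DERIV_const]) simp
  have Zh: "(\<lambda>\<tau>. Z \<tau> $ j) holomorphic_on \<H>" for j
    using Zd open_uhp by (auto simp: holomorphic_on_open)
  obtain Ce where Ce: "\<forall>\<tau>\<in>cusp_strip. norm (e \<tau>) \<le> Ce * exp (- ((real N * (pi / 3)) * Im \<tau>))"
    and Cf: "\<exists>C. \<forall>\<tau>\<in>cusp_strip. \<forall>j. norm (H \<tau> $ j / e \<tau>) \<le> C * exp ((real N * (pi / 3)) * Im \<tau>)"
  proof -
    obtain c d where cd: "0 < c" "\<And>\<tau>. 1 \<le> Im \<tau> \<Longrightarrow> c * exp (- pi / 3 * Im \<tau>) \<le> norm (eta4 \<tau>)"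
      "\<And>\<tau>. 1 \<le> Im \<tau> \<Longrightarrow> norm (eta4 \<tau>) \<le> d * exp (- pi / 3 * Im \<tau>)"
      using eta4_bounds by metis
    obtain C where C: "\<And>\<tau>. \<tau> \<in> cusp_strip \<Longrightarrow> norm (H \<tau>) \<le> C"
      using basis_exists(2) vvmf_bounded H by metis
    have ex: "(x * exp (- pi / 3 * Im \<tau>)) ^ N = x ^ N * exp (- ((real N * (pi / 3)) * Im \<tau>))" for x \<tau>
      by (simp add: power_mult_distrib exp_of_nat_mult[symmetric])
    have st: "1 \<le> Im \<tau>" "\<tau> \<in> \<H>" if "\<tau> \<in> cusp_strip" for \<tau> using that by (auto simp: cusp_strip_def)
    have up: "norm (e \<tau>) \<le> d ^ N * exp (- ((real N * (pi / 3)) * Im \<tau>))" if "\<tau> \<in> cusp_strip" for \<tau>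
      unfolding e_on[OF st(2)[OF that]] norm_power ex[symmetric] by (intro power_mono cd(3) st that) simp
    have lo: "c ^ N * exp (- ((real N * (pi / 3)) * Im \<tau>)) \<le> norm (e \<tau>)" if "\<tau> \<in> cusp_strip" for \<tau>
      unfolding e_on[OF st(2)[OF that]] norm_power ex[symmetric] using cd(1) by (intro power_mono cd(2) st that) simp
    have "norm (H \<tau> $ j / e \<tau>) \<le> C / c ^ N * exp ((real N * (pi / 3)) * Im \<tau>)" if \<tau>: "\<tau> \<in> cusp_strip" for \<tau> j
    proof -
      have "norm (H \<tau> $ j) \<le> C" using C[OF \<tau>] Finite_Cartesian_Product.norm_nth_le[of "H \<tau>" j] by linarith
      hence "norm (H \<tau> $ j / e \<tau>) \<le> C / (c ^ N * exp (- ((real N * (pi / 3)) * Im \<tau>)))"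
        unfolding norm_divide using lo[OF \<tau>] cd(1) by (intro frac_le) (auto intro: order_trans[OF norm_ge_zero])
      thus ?thesis by (simp add: exp_minus field_simps)
    qed
    thus thesis using up by (intro that) blast+
  qed
  obtain Cf where Cf: "\<And>\<tau> j. \<tau> \<in> cusp_strip \<Longrightarrow> norm (H \<tau> $ j / e \<tau>) \<le> Cf * exp ((real N * (pi / 3)) * Im \<tau>)"
    using Cf by blast
  have "\<exists>C. \<forall>\<tau>\<in>cusp_strip. norm (e \<tau> * Z \<tau> $ j) \<le> C * (1 + Im \<tau>)" for j
    by (rule weighted_linear_growth[where f = "\<lambda>\<tau>. H \<tau> $ j / e \<tau>" and c = "real N * (pi / 3)", OF Zd _ Cf bspec[OF Ce]]) auto
  then obtain D where D: "\<And>j \<tau>. \<tau> \<in> cusp_strip \<Longrightarrow> norm (e \<tau> * Z \<tau> $ j) \<le> D j * (1 + Im \<tau>)" by metis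
  have eZ: "norm (e \<tau> *s Z \<tau>) \<le> (\<Sum>j\<in>UNIV. D j) * (1 + Im \<tau>)" if "\<tau> \<in> cusp_strip" for \<tau>
  proof -
    have "norm (e \<tau> *s Z \<tau>) \<le> (\<Sum>j\<in>UNIV. norm ((e \<tau> *s Z \<tau>) $ j))" by (rule norm_vec_le_sum)
    also have "\<dots> \<le> (\<Sum>j\<in>UNIV. D j * (1 + Im \<tau>))" using D[OF that] by (intro sum_mono) simp
    finally show ?thesis by (simp add: sum_distrib_right)
  qed
  have pw: "\<tau> powi (2 * int N) = \<tau> ^ (2 * N)" for \<tau> :: complex by (simp add: power_int_def nat_mult_distrib)
  have "\<alpha> \<noteq> 0"
  proof
    assume \<alpha>: "\<alpha> = 0"
    have "vvmf \<rho>0 (2 * int N) (\<lambda>\<tau>. e \<tau> *s Z \<tau>)"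
    proof (rule vvmfI[OF _ _ _ _ eZ])
      fix \<tau> assume \<tau>: "\<tau> \<in> \<H>"
      show "e (\<tau> + 1) *s Z (\<tau> + 1) = \<rho>0 T_mat *v (e \<tau> *s Z \<tau>)"
        using X_T_nonzero by (simp add: eT[OF \<tau>] ZT[OF \<tau>] \<alpha> B_apply mv_smult vector_smult_assoc)
      have "X S_mat * \<tau> ^ (2 * N) * e \<tau> * X S_mat = (X S_mat * X S_mat) * (\<tau> ^ (2 * N) * e \<tau>)" by (simp only: mult_ac)
      thus "e (- 1 / \<tau>) *s Z (- 1 / \<tau>) = \<tau> powi (2 * int N) *s (\<rho>0 S_mat *v (e \<tau> *s Z \<tau>))"
        unfolding pw eS[OF \<tau>] ZS[OF \<tau>] \<alpha> A_apply mv_smult vector_smult_assoc X_S_sq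
        by (simp add: vector_smult_assoc)
    qed (auto simp: e_off intro!: holomorphic_intros e_hol Zh)
    moreover have "vserre (int N) (\<lambda>\<tau>. e \<tau> *s Z \<tau>) \<tau> = H \<tau>" if \<tau>: "\<tau> \<in> \<H>" for \<tau>
    proof -
      have "deriv (\<lambda>\<tau>. e \<tau> * Z \<tau> $ j) \<tau> = of_nat N * eta4_logderiv \<tau> * e \<tau> * Z \<tau> $ j + H \<tau> $ j / e \<tau> * e \<tau>" for j
        by (rule DERIV_imp_deriv, rule DERIV_mult[OF e_deriv[OF \<tau>] Zd[OF \<tau>]])
      thus ?thesis using e0[OF \<tau>] \<tau>
        by (simp add: vec_eq_iff vserre_def serre_deriv_def)
    qed
    ultimately show False using noK by blast
  qed
  \<comment> \<open>The periods of Z / \<alpha>, carried over by \<iota>, match the failure of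
    \<open>v1\<close> to be fixed, so V transforms by \<open>RS\<close> and \<open>RT\<close>
    alone.\<close>
  define V where "V \<tau> = \<iota> *v ((1 / \<alpha>) *s Z \<tau>) + v1" for \<tau>
  have VT: "V (\<tau> + 1) = RT *v V \<tau>" if "\<tau> \<in> \<H>" for \<tau>
    unfolding V_def ZT[OF that] using \<open>\<alpha> \<noteq> 0\<close> by (simp add: vector_add_ldistrib vector_smult_assoc mv_add
        RT_v1 RT_\<iota> mv_smult add_ac)
  have VS: "V (- 1 / \<tau>) = RS *v V \<tau>" if "\<tau> \<in> \<H>" for \<tau>
    unfolding V_def ZS[OF that] using \<open>\<alpha> \<noteq> 0\<close> by (simp add: vector_add_ldistrib vector_smult_assoc mv_add
        RS_v1 RS_\<iota> mv_smult add_ac)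
  obtain K where K: "\<And>x. norm (\<iota> *v x) \<le> K * norm x" using matrix_vector_norm_bound by metis
  have "vvmf \<rho> (2 * int N) (\<lambda>\<tau>. e \<tau> *s V \<tau>)"
  proof (rule vvmfI[where C = "\<bar>K\<bar> * norm (1 / \<alpha>) * \<bar>\<Sum>j\<in>UNIV. D j\<bar> + \<bar>Ce\<bar> * norm v1"])
    fix \<tau> assume \<tau>: "\<tau> \<in> \<H>"
    show "e (\<tau> + 1) *s V (\<tau> + 1) = \<rho> T_mat *v (e \<tau> *s V \<tau>)"
      using X_T_nonzero by (simp add: eT[OF \<tau>] VT[OF \<tau>] RT_apply mv_smult vector_smult_assoc)
    have "X S_mat * \<tau> ^ (2 * N) * e \<tau> * X S_mat = (X S_mat * X S_mat) * (\<tau> ^ (2 * N) * e \<tau>)" by (simp only: mult_ac)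
    thus "e (- 1 / \<tau>) *s V (- 1 / \<tau>) = \<tau> powi (2 * int N) *s (\<rho> S_mat *v (e \<tau> *s V \<tau>))"
      unfolding pw eS[OF \<tau>] VS[OF \<tau>] RS_apply mv_smult vector_smult_assoc X_S_sq by simp
  next
    fix j
    have "(\<lambda>\<tau>. (1 / \<alpha>) * Z \<tau> $ i) holomorphic_on \<H>" for i by (intro holomorphic_intros Zh)
    hence "(\<lambda>\<tau>. (\<iota> *v ((1 / \<alpha>) *s Z \<tau>)) $ j) holomorphic_on \<H>" by (intro holomorphic_on_matrix_vector) simp
    thus "(\<lambda>\<tau>. (e \<tau> *s V \<tau>) $ j) holomorphic_on \<H>"
      by (auto simp: V_def intro!: holomorphic_intros e_hol)
  next
    fix \<tau> assume \<tau>: "\<tau> \<in> cusp_strip"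
    have y1: "1 \<le> 1 + Im \<tau>" using \<tau> by (simp add: cusp_strip_def)
    have "norm (\<iota> *v (e \<tau> *s Z \<tau>)) \<le> \<bar>K\<bar> * norm (e \<tau> *s Z \<tau>)"
      by (rule order_trans[OF K]) (simp add: mult_right_mono)
    also have "norm (e \<tau> *s Z \<tau>) \<le> \<bar>\<Sum>j\<in>UNIV. D j\<bar> * (1 + Im \<tau>)"
      using y1 by (intro order_trans[OF eZ[OF \<tau>]] mult_right_mono) auto
    finally have 1: "norm (1 / \<alpha>) * norm (\<iota> *v (e \<tau> *s Z \<tau>)) \<le> norm (1 / \<alpha>) * (\<bar>K\<bar> * (\<bar>\<Sum>j\<in>UNIV. D j\<bar> * (1 + Im \<tau>)))"
      by (intro mult_left_mono) (auto simp: mult_left_mono)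
    have "norm (e \<tau>) \<le> \<bar>Ce\<bar> * 1"
      by (rule order_trans[OF bspec[OF Ce \<tau>]], rule mult_mono) (use y1 in auto)
    hence "norm (e \<tau>) * norm v1 \<le> \<bar>Ce\<bar> * norm v1" by (intro mult_right_mono) auto
    also have "\<dots> \<le> \<bar>Ce\<bar> * norm v1 * (1 + Im \<tau>)" using mult_left_mono[OF y1, of "\<bar>Ce\<bar> * norm v1"] by simp
    finally have 2: "norm (e \<tau>) * norm v1 \<le> \<bar>Ce\<bar> * norm v1 * (1 + Im \<tau>)" .
    have "e \<tau> *s V \<tau> = (1 / \<alpha>) *s (\<iota> *v (e \<tau> *s Z \<tau>)) + e \<tau> *s v1"
      by (simp add: V_def vector_add_ldistrib mv_smult vector_smult_assoc mult.commute)
    hence "norm (e \<tau> *s V \<tau>) \<le> norm (1 / \<alpha>) * norm (\<iota> *v (e \<tau> *s Z \<tau>)) + norm (e \<tau>) * norm v1"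
      by (metis norm_triangle_ineq norm_vec_smult)
    thus "norm (e \<tau> *s V \<tau>) \<le> (\<bar>K\<bar> * norm (1 / \<alpha>) * \<bar>\<Sum>j\<in>UNIV. D j\<bar> + \<bar>Ce\<bar> * norm v1) * (1 + Im \<tau>)"
      using 1 2 by (simp add: algebra_simps)
  qed (simp add: e_off)
  moreover have "p *v (e \<tau> *s V \<tau>) = (eta4 \<tau> ^ N) *s axis 1 1" if "\<tau> \<in> \<H>" for \<tau>
    using that by (simp add: V_def mv_smult mv_add p_\<iota> p_v1 e_on)
  ultimately show ?thesis by blast
qed

end

lemma serre_deriv_cmult:
  assumes "f holomorphic_on \<H>" shows "serre_deriv n (\<lambda>\<tau>. c * f \<tau>) \<tau> = c * serre_deriv n f \<tau>"
proof (cases "\<tau> \<in> \<H>")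
  case True
  have "deriv (\<lambda>\<tau>. c * f \<tau>) \<tau> = c * deriv f \<tau>"
    by (rule DERIV_imp_deriv, rule DERIV_cmult, rule uhp_deriv[OF assms True])
  thus ?thesis using True by (simp add: serre_deriv_def algebra_simps)
qed (auto simp: serre_deriv_def)

lemma serre_deriv_zero [simp]: "serre_deriv n (\<lambda>_. 0) \<tau> = 0"
  by (simp add: serre_deriv_def)

lemma E6_nonzero: "E6 \<noteq> (\<lambda>_. 0)"
proof
  assume "E6 = (\<lambda>_. 0)"
  hence "cusp_value E6 = 0" by (intro cusp_valueI) simp
  thus False by (simp add: cusp_value_E6)
qed

section \<open>Lifts of eta powers, by the position of the weights\<close>

context extension
begin

lemma generator_combination_zero:
  assumes "sform k f" "sform l g" "\<And>\<tau>. \<tau> \<in> \<H> \<Longrightarrow> f \<tau> *s B0 \<tau> + g \<tau> *s B1 \<tau> = 0"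
  shows "f = (\<lambda>_. 0)" "g = (\<lambda>_. 0)"
proof -
  have "f \<tau> *s B0 \<tau> + g \<tau> *s B1 \<tau> = 0" for \<tau>
    using assms(3) sformD(1)[OF assms(1)] sformD(1)[OF assms(2)] by (cases "\<tau> \<in> \<H>") auto
  thus "f = (\<lambda>_. 0)" "g = (\<lambda>_. 0)" using gens_unique[OF assms(1,2)[THEN sform_in_ring]] by blast+
qed

text \<open>Leibniz rule together with the system for B0 and B1. The half weights n + 1 of f and n
  of g give both products the half weight m + 1 + n.\<close>

lemma serre_deriv_combination:
  assumes f: "sform k f" and g: "sform l g" and c: "\<And>\<tau>. vserre (int m) B0 \<tau> = c1 *s B1 \<tau>"
    "\<And>\<tau>. vserre (int m + 1) B1 \<tau> = (c2 * E4 \<tau>) *s B0 \<tau>"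
  shows "vserre (int m + 1 + n) (\<lambda>\<tau>. f \<tau> *s B0 \<tau> + g \<tau> *s B1 \<tau>) \<tau> =
    (serre_deriv (n + 1) f \<tau> + c2 * E4 \<tau> * g \<tau>) *s B0 \<tau> + (c1 * f \<tau> + serre_deriv n g \<tau>) *s B1 \<tau>"
proof -
  note h0 = vvmfD(2)[OF vvmf_B0] and h1 = vvmfD(2)[OF vvmf_B1]
  have "vserre ((n + 1) + int m) (\<lambda>\<tau>. f \<tau> *s B0 \<tau>) \<tau> = serre_deriv (n + 1) f \<tau> *s B0 \<tau> + f \<tau> *s (c1 *s B1 \<tau>)"
    unfolding vserre_smult[OF sformD(2)[OF f] h0] c ..
  moreover have "vserre (n + (int m + 1)) (\<lambda>\<tau>. g \<tau> *s B1 \<tau>) \<tau> = serre_deriv n g \<tau> *s B1 \<tau> + g \<tau> *s ((c2 * E4 \<tau>) *s B0 \<tau>)"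
    unfolding vserre_smult[OF sformD(2)[OF g] h1] c ..
  moreover have "vserre (int m + 1 + n) (\<lambda>\<tau>. f \<tau> *s B0 \<tau> + g \<tau> *s B1 \<tau>) \<tau> =
      vserre (int m + 1 + n) (\<lambda>\<tau>. f \<tau> *s B0 \<tau>) \<tau> + vserre (int m + 1 + n) (\<lambda>\<tau>. g \<tau> *s B1 \<tau>) \<tau>"
    by (rule vserre_add) (use h0 h1 sformD(2)[OF f] sformD(2)[OF g] in \<open>auto simp del: One_nat_def intro!: holomorphic_intros\<close>)
  moreover have "(n + 1) + int m = int m + 1 + n" "n + (int m + 1) = int m + 1 + n" by simp_all
  ultimately have "vserre (int m + 1 + n) (\<lambda>\<tau>. f \<tau> *s B0 \<tau> + g \<tau> *s B1 \<tau>) \<tau> =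
      (serre_deriv (n + 1) f \<tau> *s B0 \<tau> + f \<tau> *s (c1 *s B1 \<tau>)) + (serre_deriv n g \<tau> *s B1 \<tau> + g \<tau> *s ((c2 * E4 \<tau>) *s B0 \<tau>))"
    by (simp only:)
  thus ?thesis by (simp only: vec_eq_iff) (simp del: One_nat_def add: algebra_simps)
qed

text \<open>Here B0 itself has weight 2 N + 2; a Serre primitive would have weight 2 N, below the
  least weight k1, where only 0 exists.\<close>

lemma lift_weight_below:
  assumes N: "N = a + 6 * r" and m: "int m = int N + 1"
  shows "\<exists>F. vvmf \<rho> (2 * int N) F \<and> (\<forall>\<tau>\<in>\<H>. p *v F \<tau> = (eta4 \<tau> ^ N) *s axis 1 1)"
proof (rule lift_or_serre_primitive[OF N, of B0])
  have "2 * int N + 2 = k1" using m k1_eq by simp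
  thus "vvmf \<rho>0 (2 * int N + 2) B0" using vvmf_B0 by simp
  fix K assume K: "vvmf \<rho>0 (2 * int N) K" and D: "\<forall>\<tau>\<in>\<H>. vserre (int N) K \<tau> = B0 \<tau>"
  from gens_exist[OF K] obtain f g where fg: "sform (2 * int N - k1) f \<and> sform (2 * int N - k2) g \<and>
    K = (\<lambda>\<tau>. f \<tau> *s B0 \<tau> + g \<tau> *s B1 \<tau>)" by (elim exE)
  have "2 * int N - k1 < 0" "2 * int N - k2 < 0" using m k1_eq k12(1) by simp_all
  hence "f \<tau> = 0" "g \<tau> = 0" for \<tau> using fg sform_negative_weight by blast+
  hence "K = (\<lambda>_. 0)" using fg by simp
  hence "B0 \<tau> = 0" if "\<tau> \<in> \<H>" for \<tau>
    using D that by (simp add: vserre_def vec_eq_iff)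
  thus False using B0_nonzero by blast
qed

text \<open>A primitive of E6 B0 has the form f B0 with f of weight 4, since the coefficient of B1
  has weight 2. The B1 component c1 f of its derivative must vanish, so f = 0 and then E6 = 0.
  Besides n = -1 this gives the lift of the discriminant in the exceptional case.\<close>

lemma lift_weight_above:
  assumes N: "N = a + 6 * r" and m: "int N = int m + 2"
  shows "\<exists>F. vvmf \<rho> (2 * int N) F \<and> (\<forall>\<tau>\<in>\<H>. p *v F \<tau> = (eta4 \<tau> ^ N) *s axis 1 1)"
proof (rule lift_or_serre_primitive[OF N, of "\<lambda>\<tau>. E6 \<tau> *s B0 \<tau>"])
  have "2 * int N + 2 = 6 + k1" using m k1_eq by simp
  thus "vvmf \<rho>0 (2 * int N + 2) (\<lambda>\<tau>. E6 \<tau> *s B0 \<tau>)" using vvmf_smult[OF sform_E6 vvmf_B0] by simp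
  obtain c1 c2 where c1: "c1 \<noteq> 0" and k2: "k2 = 2 * int m + 2" and
    sys: "\<And>\<tau>. vserre (int m) B0 \<tau> = c1 *s B1 \<tau>"
    "\<And>\<tau>. vserre (int m + 1) B1 \<tau> = (c2 * E4 \<tau>) *s B0 \<tau>"
    using weights_and_system by metis
  fix K assume K: "vvmf \<rho>0 (2 * int N) K" and D: "\<forall>\<tau>\<in>\<H>. vserre (int N) K \<tau> = E6 \<tau> *s B0 \<tau>"
  from gens_exist[OF K] obtain f g where fg: "sform (2 * int N - k1) f \<and> sform (2 * int N - k2) g \<and>
    K = (\<lambda>\<tau>. f \<tau> *s B0 \<tau> + g \<tau> *s B1 \<tau>)" by (elim exE)
  have k: "2 * int N - k1 = 4" "2 * int N - k2 = 2" using m k1_eq k2 by simp_all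
  hence f: "sform 4 f" and g: "sform 2 g" using fg by simp_all
  have g0: "g = (\<lambda>_. 0)" using sform_weight_2[OF g] by blast
  have N': "int N = int m + 1 + 1" using m by simp
  have "sform 6 (serre_deriv 2 f)" using sform_serre_deriv[of 2 f] f by simp
  hence 1: "sform 6 (\<lambda>\<tau>. serre_deriv 2 f \<tau> - E6 \<tau>)" using sform_E6 by (rule sform_diff)
  have 2: "sform 4 (\<lambda>\<tau>. c1 * f \<tau>)" using f by (rule sform_cmult)
  have "(serre_deriv 2 f \<tau> - E6 \<tau>) *s B0 \<tau> + (c1 * f \<tau>) *s B1 \<tau> = 0" if \<tau>: "\<tau> \<in> \<H>" for \<tau>
  proof -
    have "E6 \<tau> *s B0 \<tau> = serre_deriv 2 f \<tau> *s B0 \<tau> + (c1 * f \<tau>) *s B1 \<tau>"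
      using bspec[OF D \<tau>] serre_deriv_combination[OF f g sys, of 1 \<tau>] fg unfolding N' by (simp add: g0)
    thus ?thesis by (simp add: vec_eq_iff algebra_simps)
  qed
  note z = generator_combination_zero[OF 1 2 this]
  have "f \<tau> = 0" for \<tau> using fun_cong[OF z(2), of \<tau>] c1 by simp
  hence "f = (\<lambda>_. 0)" by blast
  hence "E6 \<tau> = 0" for \<tau> using fun_cong[OF z(1), of \<tau>] by simp
  thus False using E6_nonzero by blast
qed

text \<open>Here H = h B0 with h of weight 12. A primitive f B0 + g B1 has g = x E4^2, and the
  vanishing B1 component determines f from x. So the h for which a primitive exists lie on one line,
  which cannot contain both E4^3 and E6^2.\<close>

lemma lift_weight_far_above:
  assumes m: "m = 0" and a: "a = 5"
  shows "\<exists>F. vvmf \<rho> (2 * int a) F \<and> (\<forall>\<tau>\<in>\<H>. p *v F \<tau> = (eta4 \<tau> ^ a) *s axis 1 1)"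
proof (rule ccontr)
  assume no: "\<not> ?thesis"
  obtain c1 c2 where c1: "c1 \<noteq> 0" and k2: "k2 = 2 * int m + 2" and
    sys: "\<And>\<tau>. vserre (int m) B0 \<tau> = c1 *s B1 \<tau>"
    "\<And>\<tau>. vserre (int m + 1) B1 \<tau> = (c2 * E4 \<tau>) *s B0 \<tau>"
    using weights_and_system by metis
  have k1: "k1 = 0" using k1_eq m by simp
  \<comment> \<open>\<open>h0\<close> is the coefficient at B0 of the derivative when g = E4^2 and f
    is chosen to cancel the B1 component.\<close>
  define G where "G = serre_deriv 4 (\<lambda>\<tau>. E4 \<tau> ^ 2)"
  define h0 where "h0 \<tau> = - (1 / c1) * serre_deriv 5 G \<tau> + c2 * E4 \<tau> * E4 \<tau> ^ 2" for \<tau>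
  have E42: "sform 8 (\<lambda>\<tau>. E4 \<tau> ^ 2)" using sform_power[OF sform_E4, of 2] by simp
  have G: "sform 10 G" unfolding G_def using sform_serre_deriv[of 4] E42 by simp
  have multiple: "\<exists>x. \<forall>\<tau>. h \<tau> = x * h0 \<tau>" if h: "sform 12 h" for h
  proof -
    have H: "vvmf \<rho>0 (2 * int a + 2) (\<lambda>\<tau>. h \<tau> *s B0 \<tau>)" using vvmf_smult[OF h vvmf_B0] by (simp add: k1 a)
    have "\<exists>K. vvmf \<rho>0 (2 * int a) K \<and> (\<forall>\<tau>\<in>\<H>. vserre (int a) K \<tau> = h \<tau> *s B0 \<tau>)"
      using lift_or_serre_primitive[of a 0, OF _ H] no by auto
    then obtain K where K: "vvmf \<rho>0 (2 * int a) K" and D: "\<forall>\<tau>\<in>\<H>. vserre (int a) K \<tau> = h \<tau> *s B0 \<tau>" by blast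
    from gens_exist[OF K] obtain f g where fg: "sform (2 * int a - k1) f \<and> sform (2 * int a - k2) g \<and>
      K = (\<lambda>\<tau>. f \<tau> *s B0 \<tau> + g \<tau> *s B1 \<tau>)" by (elim exE)
    have "int a = 5" "int m = 0" using a m by (simp_all only: of_nat_numeral of_nat_0)
    hence "2 * int a - k1 = 10" "2 * int a - k2 = 8" using k1 k2 by linarith+
    hence f: "sform 10 f" and g: "sform 8 g" using fg by metis+
    define x where "x = cusp_value g"
    have g': "g = (\<lambda>\<tau>. x * E4 \<tau> ^ 2)"
    proof
      fix \<tau> show "g \<tau> = x * E4 \<tau> ^ 2"
        using sform_small_weight[OF g, of 2 0 \<tau>] sformD(1)[OF g, of \<tau>] sformD(1)[OF sform_E4, of \<tau>]
        by (cases "\<tau> \<in> \<H>") (simp_all add: mono46_def x_def)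
    qed
    have a': "int a = int m + 1 + 4" by (simp add: a m)
    have Dg: "serre_deriv 4 g \<tau> = x * G \<tau>" for \<tau>
      unfolding g' G_def by (rule serre_deriv_cmult[OF sformD(2)[OF E42]])
    have "sform 12 (serre_deriv 5 f)" using sform_serre_deriv[of 5 f] f by simp
    moreover have "sform 12 (\<lambda>\<tau>. E4 \<tau> * g \<tau>)" using sform_mult[OF sform_E4 g] by simp
    hence "sform 12 (\<lambda>\<tau>. c2 * (E4 \<tau> * g \<tau>))" by (rule sform_cmult)
    ultimately have "sform 12 (\<lambda>\<tau>. serre_deriv 5 f \<tau> + c2 * (E4 \<tau> * g \<tau>))" by (rule sform_add)
    hence 1: "sform 12 (\<lambda>\<tau>. serre_deriv 5 f \<tau> + c2 * (E4 \<tau> * g \<tau>) - h \<tau>)" using h by (rule sform_diff)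
    have "sform 10 (serre_deriv 4 g)" using sform_serre_deriv[of 4 g] g by simp
    hence 2: "sform 10 (\<lambda>\<tau>. c1 * f \<tau> + serre_deriv 4 g \<tau>)" using sform_cmult[OF f] by (intro sform_add)
    have "(serre_deriv 5 f \<tau> + c2 * (E4 \<tau> * g \<tau>) - h \<tau>) *s B0 \<tau> + (c1 * f \<tau> + serre_deriv 4 g \<tau>) *s B1 \<tau> = 0" if \<tau>: "\<tau> \<in> \<H>" for \<tau>
    proof -
      have "h \<tau> *s B0 \<tau> = (serre_deriv (4 + 1) f \<tau> + c2 * E4 \<tau> * g \<tau>) *s B0 \<tau> + (c1 * f \<tau> + serre_deriv 4 g \<tau>) *s B1 \<tau>"
        using bspec[OF D \<tau>] serre_deriv_combination[OF f g sys, of 4 \<tau>] fg unfolding a' by simp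
      thus ?thesis by (simp add: vec_eq_iff algebra_simps)
    qed
    note z = generator_combination_zero[OF 1 2 this]
    have f': "f = (\<lambda>\<tau>. - (x / c1) * G \<tau>)"
    proof
      fix \<tau>
      have "c1 * f \<tau> + x * G \<tau> = 0" using fun_cong[OF z(2), of \<tau>] by (simp add: Dg)
      hence "c1 * f \<tau> = - (x * G \<tau>)" by (simp add: eq_neg_iff_add_eq_0)
      thus "f \<tau> = - (x / c1) * G \<tau>" using c1 by (simp add: field_simps)
    qed
    have "h \<tau> = x * h0 \<tau>" for \<tau>
    proof -
      have "h \<tau> = serre_deriv 5 f \<tau> + c2 * (E4 \<tau> * g \<tau>)" using fun_cong[OF z(1), of \<tau>] by simp
      moreover have "serre_deriv 5 f \<tau> = - (x / c1) * serre_deriv 5 G \<tau>"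
        unfolding f' by (rule serre_deriv_cmult[OF sformD(2)[OF G]])
      ultimately show ?thesis by (simp add: g' h0_def algebra_simps)
    qed
    thus ?thesis by blast
  qed
  have E43: "sform 12 (\<lambda>\<tau>. E4 \<tau> ^ 3)" and E62: "sform 12 (\<lambda>\<tau>. E6 \<tau> ^ 2)"
    using sform_power[OF sform_E4, of 3] sform_power[OF sform_E6, of 2] by simp_all
  obtain x where x: "\<And>\<tau>. E4 \<tau> ^ 3 = x * h0 \<tau>" using multiple[OF E43] by blast
  obtain y where y: "\<And>\<tau>. E6 \<tau> ^ 2 = y * h0 \<tau>" using multiple[OF E62] by blast
  have c: "cusp_value (\<lambda>\<tau>. E4 \<tau> ^ 3) = 1" "cusp_value (\<lambda>\<tau>. E6 \<tau> ^ 2) = 1"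
    using cusp_value_power[OF sform_E4, of 3] cusp_value_power[OF sform_E6, of 2] by (simp_all add: cusp_value_E4 cusp_value_E6)
  \<comment> \<open>Both constant terms are 1, so x = y and the excluded identity E4^3 = E6^2
    follows.\<close>
  have "(\<lambda>\<tau>. y * E4 \<tau> ^ 3) = (\<lambda>\<tau>. x * E6 \<tau> ^ 2)" by (simp add: x y mult.left_commute)
  from arg_cong[OF this, of cusp_value] have xy: "x = y"
    by (simp add: cusp_value_cmult[OF E43] cusp_value_cmult[OF E62] c)
  have "E4 \<tau> ^ 3 = E6 \<tau> ^ 2" for \<tau> by (simp add: x y xy)
  thus False using E4_cubed_ne_E6_squared by blast
qed

text \<open>k2 \<le> 11 gives m \<le> 4, hence n \<le> 1 with equality only for (8, 10) and a = 0; m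
  \<ge> 0 and a \<le> 5 give n \<ge> -2 with equality only for m = 0 and a = 5.\<close>

lemma lift_exists:
  assumes a: "a \<le> 5" and k: "(k1, k2) \<noteq> (8, 10) \<or> a = 3"
  shows "\<exists>F. vvmf \<rho> (2 * int a) F \<and> (\<forall>\<tau>\<in>\<H>. p *v F \<tau> = (eta4 \<tau> ^ a) *s axis 1 1)"
proof -
  have k2: "k2 = 2 * int m + 2" using weights_and_system by metis
  have m4: "int m \<le> 4" using k2 k12(3) by simp
  obtain n where n: "int m = int a + 1 + 3 * n" using weight_congruence by (elim exE)
  have "n \<le> 0"
  proof (rule ccontr)
    assume "\<not> n \<le> 0"
    hence "int m = 4 \<and> a = 0" using n m4 by presburger
    thus False using k k1_eq k2 by simp
  qed
  hence "n = 0 \<or> n = - 1 \<or> (n = - 2 \<and> m = 0 \<and> a = 5)" using n m4 a by presburger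
  thus ?thesis
  proof (elim disjE conjE)
    assume "n = 0" thus ?thesis using n by (intro lift_weight_below[of a 0]) simp_all
  next
    assume "n = - 1" thus ?thesis using n by (intro lift_weight_above[of a 0]) simp_all
  next
    assume "m = 0" "a = 5" thus ?thesis by (rule lift_weight_far_above)
  qed
qed

text \<open>For a \<le> 5 the exponent of the character is a / 6 < 1, so every form carries the
  factor q to the power a / 6, the exact order of the divisor \<open>eta4 ^ a\<close>.\<close>

lemma quotient_form:
  assumes a: "a \<le> 5" and f: "vvmf \<xi> k f"
  shows "sform (k - 2 * int a) (\<lambda>\<tau>. f \<tau> $ 1 / eta4 \<tau> ^ a)"
proof -
  let ?g = "\<lambda>\<tau>. f \<tau> $ 1 / eta4 \<tau> ^ a"
  have eT: "eta4 (\<tau> + 1) ^ a = X T_mat * eta4 \<tau> ^ a" if "\<tau> \<in> \<H>" for \<tau>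
    unfolding eta4_translation[OF that] X_T power_mult_distrib ..
  have eS: "eta4 (- 1 / \<tau>) ^ a = X S_mat * \<tau> ^ (2 * a) * eta4 \<tau> ^ a" if "\<tau> \<in> \<H>" for \<tau>
    unfolding eta4_inversion[OF that] X_S
    by (simp only: power_mult_distrib power_mult) (metis mult_minus1 power_mult_distrib)
  have basis: "T_eigenbasis \<xi> (mat 1) (mat 1) (\<lambda>_. of_real (real a / 6))"
  proof -
    have "q_exp (of_real (real a / 6)) = X T_mat"
      unfolding X_T exp_of_nat_mult[symmetric] by (rule arg_cong[where f = exp]) simp
    hence "\<xi> T_mat = mat 1 ** diag_mat (\<lambda>j. q_exp (of_real (real a / 6))) ** mat 1"
      by (intro matrix_eq_on_axes) (simp add: chi_apply diag_mat_axis)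
    thus ?thesis using a by (simp add: T_eigenbasis_def)
  qed
  obtain G where G: "\<And>j. G j holomorphic_on ball 0 1"
    "\<And>j \<tau>. \<tau> \<in> \<H> \<Longrightarrow> (mat 1 *v f \<tau>) $ j = q_pow (of_real (real a / 6)) \<tau> * G j (q_exp \<tau>)"
    using vvmf_expansion[OF basis f] by blast
  obtain C where C: "\<And>\<tau>. 1 \<le> Im \<tau> \<Longrightarrow> norm (G 1 (q_exp \<tau>)) \<le> C"
    using bounded_on_cusp_strip_exp[OF G(1)] by metis
  obtain c where c: "0 < c" "\<And>\<tau>. 1 \<le> Im \<tau> \<Longrightarrow> c * exp (- pi / 3 * Im \<tau>) \<le> norm (eta4 \<tau>)"
    using eta4_bounds by metis
  show ?thesis
  proof (rule sformI[where C = "C / c ^ a"])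
    fix \<tau> assume \<tau>: "\<tau> \<in> \<H>"
    have nz: "\<tau> \<noteq> 0" using \<tau> by auto
    show "?g (\<tau> + 1) = ?g \<tau>"
      unfolding eT[OF \<tau>] vvmfD(3)[OF f \<tau>] chi_apply using X_T_nonzero by simp
    have "\<tau> powi (k - 2 * int a) = \<tau> powi k / \<tau> ^ (2 * a)"
      using nz by (simp add: power_int_diff) (simp add: power_int_def nat_mult_distrib)
    thus "?g (- 1 / \<tau>) = \<tau> powi (k - 2 * int a) * ?g \<tau>"
      unfolding eS[OF \<tau>] vvmfD(4)[OF f \<tau>] chi_apply using X_S_nonzero by simp
  next
    fix \<tau> assume "\<tau> \<notin> \<H>" thus "?g \<tau> = 0" using vvmfD(1)[OF f] by simp
  next
    have "eta4 holomorphic_on \<H>" by (rule eta4_holomorphic)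
    thus "?g holomorphic_on \<H>" using eta4_nonzero vvmfD(2)[OF f] by (intro holomorphic_intros) auto
  next
    fix \<tau> assume "\<tau> \<in> cusp_strip"
    hence \<tau>: "\<tau> \<in> \<H>" "1 \<le> Im \<tau>" by (auto simp: cusp_strip_def)
    have "norm (f \<tau> $ 1) = exp (real a * (- pi / 3 * Im \<tau>)) * norm (G 1 (q_exp \<tau>))"
      using G(2)[OF \<tau>(1), of 1] by (simp only: matrix_vector_mul_lid norm_mult norm_exp_2pi_i) (simp add: mult_ac)
    also have "\<dots> \<le> exp (- pi / 3 * Im \<tau>) ^ a * C"
      unfolding exp_of_nat_mult using C[OF \<tau>(2)] by (intro mult_left_mono) simp_all
    finally have 1: "norm (f \<tau> $ 1) \<le> exp (- pi / 3 * Im \<tau>) ^ a * C" .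
    have 2: "(c * exp (- pi / 3 * Im \<tau>)) ^ a \<le> norm (eta4 \<tau> ^ a)"
      unfolding norm_power using c(1) by (intro power_mono c(2) \<tau>) simp
    have "norm (?g \<tau>) \<le> (exp (- pi / 3 * Im \<tau>) ^ a * C) / (c * exp (- pi / 3 * Im \<tau>)) ^ a"
      unfolding norm_divide using 1 2 c(1) by (intro frac_le) (auto intro: order_trans[OF norm_ge_zero])
    thus "norm (?g \<tau>) \<le> C / c ^ a" by (simp add: power_mult_distrib)
  qed
qed

lemma M_split_of_lift:
  assumes a: "a \<le> 5" and \<Phi>: "vvmf \<rho> (2 * int a) \<Phi>" "\<forall>\<tau>\<in>\<H>. p *v \<Phi> \<tau> = (eta4 \<tau> ^ a) *s axis 1 1"
  shows "M_split \<rho> p \<xi>"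
  unfolding M_split_def
proof (intro equalityI subsetI)
  fix f assume "f \<in> (\<lambda>F \<tau>. p *v F \<tau>) ` modular_form_module \<rho>"
  then obtain K F where F: "f = (\<lambda>\<tau>. p *v (\<Sum>k\<in>K. F k \<tau>))" "finite K" "\<And>k. k \<in> K \<Longrightarrow> F k \<in> modular_forms \<rho> k"
    by (auto simp: modular_form_module_def)
  have "(\<lambda>\<tau>. p *v F k \<tau>) \<in> modular_forms \<xi> k" if "k \<in> K" for k
    using F(3)[OF that] vvmf_matrix_apply[OF p_intertwines] by (simp add: forms formsc)
  thus "f \<in> modular_form_module \<xi>"
    unfolding modular_form_module_def F(1) using F(2)
    by (intro CollectI exI[of _ K] exI[of _ "\<lambda>k \<tau>. p *v F k \<tau>"]) (simp add: matrix_vector_sum)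
next
  fix f assume "f \<in> modular_form_module \<xi>"
  then obtain K F where F: "f = (\<lambda>\<tau>. \<Sum>k\<in>K. F k \<tau>)" "finite K" "\<And>k. k \<in> K \<Longrightarrow> F k \<in> modular_forms \<xi> k"
    by (auto simp: modular_form_module_def)
  have lift: "\<exists>L. L \<in> modular_forms \<rho> k \<and> (\<forall>\<tau>. p *v L \<tau> = F k \<tau>)" if k: "k \<in> K" for k
  proof -
    have v: "vvmf \<xi> k (F k)" using F(3)[OF k] by (simp add: formsc)
    let ?L = "\<lambda>\<tau>. (F k \<tau> $ 1 / eta4 \<tau> ^ a) *s \<Phi> \<tau>"
    have "vvmf \<rho> (k - 2 * int a + 2 * int a) ?L" by (rule vvmf_smult[OF quotient_form[OF a v] \<Phi>(1)])
    moreover have "p *v ?L \<tau> = F k \<tau>" for \<tau>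
    proof (cases "\<tau> \<in> \<H>")
      case True
      thus ?thesis using \<Phi>(2) eta4_nonzero[OF True] vec_1_axis[of "F k \<tau>"]
        by (simp add: mv_smult vector_smult_assoc)
    qed (use vvmfD(1)[OF v] in simp)
    ultimately show ?thesis by (intro exI[of _ ?L]) (simp add: forms)
  qed
  have "\<forall>k\<in>K. \<exists>L. L \<in> modular_forms \<rho> k \<and> (\<forall>\<tau>. p *v L \<tau> = F k \<tau>)" using lift by blast
  from bchoice[OF this] obtain L where L: "\<forall>k\<in>K. L k \<in> modular_forms \<rho> k \<and> (\<forall>\<tau>. p *v L k \<tau> = F k \<tau>)" by (elim exE)
  have "(\<lambda>\<tau>. \<Sum>k\<in>K. L k \<tau>) \<in> modular_form_module \<rho>"
    using L F(2) unfolding modular_form_module_def by blast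
  moreover have "f = (\<lambda>\<tau>. p *v (\<Sum>k\<in>K. L k \<tau>))" using L by (simp add: F(1) matrix_vector_sum)
  ultimately show "f \<in> (\<lambda>F \<tau>. p *v F \<tau>) ` modular_form_module \<rho>" by (intro image_eqI[where x = "\<lambda>\<tau>. \<Sum>k\<in>K. L k \<tau>"])
qed

end

subsection \<open>The exceptional case\<close>

abbreviation lead_term ::
    "complex^'n^'n \<Rightarrow> ('n \<Rightarrow> complex) \<Rightarrow> (complex \<Rightarrow> complex^'n) \<Rightarrow> 'n \<Rightarrow> real \<Rightarrow> complex" where
  "lead_term Q l F j y \<equiv> exp (- (2 * of_real pi * \<i> * l j * (\<i> * of_real y))) * (Q *v F (\<i> * of_real y)) $ j"

text \<open>c is the vector of constant terms g_j(0), where the components of Q F are q to the power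
  l_j times g_j(q), read off along the imaginary axis.\<close>

definition has_lead ::
    "complex^'n^'n \<Rightarrow> ('n \<Rightarrow> complex) \<Rightarrow> (complex \<Rightarrow> complex^'n) \<Rightarrow> complex^'n \<Rightarrow> bool" where
  "has_lead Q l F c \<longleftrightarrow> (\<forall>j. ((\<lambda>y. lead_term Q l F j y)
     \<longlongrightarrow> c $ j) at_top)"

lemma eventually_imag_axis: "eventually (\<lambda>y. \<i> * of_real y \<in> \<H>) at_top"
  using eventually_gt_at_top[of "0::real"] by eventually_elim simp

lemma has_lead_expansion:
  assumes "\<And>j. g j holomorphic_on ball 0 1"
    "\<And>j \<tau>. \<tau> \<in> \<H> \<Longrightarrow> (Q *v F \<tau>) $ j = q_pow (l j) \<tau> * g j (q_exp \<tau>)"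
  shows "has_lead Q l F (\<chi> j. g j 0)"
  unfolding has_lead_def vec_lambda_beta
proof
  fix j
  have "eventually (\<lambda>y. g j (q_exp (\<i> * of_real y)) =
      lead_term Q l F j y) at_top"
    using eventually_imag_axis
  proof eventually_elim
    case (elim y)
    have "exp (- z) * (exp z * x) = x" for z x :: complex by (simp add: exp_minus)
    thus ?case unfolding assms(2)[OF elim] by simp
  qed
  thus "((\<lambda>y. lead_term Q l F j y) \<longlongrightarrow> g j 0) at_top"
    by (rule Lim_transform_eventually[OF q_expansion_imag_axis[OF assms(1)]])
qed

lemma has_lead_exists:
  assumes "T_eigenbasis \<rho> P Q l" "vvmf \<rho> k F" shows "\<exists>c. has_lead Q l F c"
  using vvmf_expansion[OF assms] has_lead_expansion by metis

lemma has_lead_unique: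
  assumes "has_lead Q l F c" "has_lead Q l F d" shows "c = d"
proof -
  have "c $ j = d $ j" for j
    by (rule tendsto_unique[OF trivial_limit_at_top_linorder assms(1)[unfolded has_lead_def, rule_format, of j]
          assms(2)[unfolded has_lead_def, rule_format, of j]])
  thus ?thesis by (simp add: vec_eq_iff)
qed

lemma has_lead_add:
  assumes "has_lead Q l F c" "has_lead Q l G d" shows "has_lead Q l (\<lambda>\<tau>. F \<tau> + G \<tau>) (c + d)"
  unfolding has_lead_def
proof
  fix j
  from tendsto_add[OF assms(1)[unfolded has_lead_def, rule_format, of j] assms(2)[unfolded has_lead_def, rule_format, of j]]
  show "((\<lambda>y. exp (- (2 * of_real pi * \<i> * l j * (\<i> * of_real y))) * (Q *v (F (\<i> * of_real y) + G (\<i> * of_real y))) $ j)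
      \<longlongrightarrow> (c + d) $ j) at_top" by (simp add: mv_add distrib_left)
qed

lemma has_lead_smult:
  assumes "sform k f" "has_lead Q l F c" shows "has_lead Q l (\<lambda>\<tau>. f \<tau> *s F \<tau>) (cusp_value f *s c)"
  unfolding has_lead_def
proof
  fix j
  from tendsto_mult[OF cusp_value_limit[OF assms(1)] assms(2)[unfolded has_lead_def, rule_format, of j]]
  show "((\<lambda>y. exp (- (2 * of_real pi * \<i> * l j * (\<i> * of_real y))) * (Q *v (f (\<i> * of_real y) *s F (\<i> * of_real y))) $ j)
      \<longlongrightarrow> (cusp_value f *s c) $ j) at_top" by (simp add: mv_smult mult_ac)
qed

text \<open>If all constant terms vanish, every component gains a factor q, which is the order of
  the discriminant.\<close>

lemma vvmf_div_Delta:
  assumes basis: "T_eigenbasis \<rho> P Q l" and F: "vvmf \<rho> k F" and 0: "has_lead Q l F 0"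
  shows "vvmf \<rho> (k - 12) (\<lambda>\<tau>. (1 / Delta \<tau>) *s F \<tau>)"
proof -
  obtain g where g: "\<And>j. g j holomorphic_on ball 0 1"
    "\<And>j \<tau>. \<tau> \<in> \<H> \<Longrightarrow> (Q *v F \<tau>) $ j = q_pow (l j) \<tau> * g j (q_exp \<tau>)"
    using vvmf_expansion[OF basis F] by blast
  have "(\<chi> j. g j 0) = 0" by (rule has_lead_unique[OF has_lead_expansion[OF g] 0])
  hence g0: "g j 0 = 0" for j by (simp add: vec_eq_iff)
  have "\<exists>h. h holomorphic_on ball 0 1 \<and> (\<forall>q\<in>ball 0 1. g j q = q * h q)" for j
    by (rule expansion_vanishing_at_cusp[OF g(1) g0]) blast
  then obtain h where h: "\<And>j. h j holomorphic_on ball 0 1" "\<And>j q. q \<in> ball 0 1 \<Longrightarrow> g j q = q * h j q" by metis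
  define F' where "F' \<tau> = exp (- (2 * of_real pi * \<i> * \<tau>)) *s F \<tau>" for \<tau>
  have "\<exists>C. \<forall>\<tau>\<in>cusp_strip. norm (F' \<tau>) \<le> C"
  proof (rule bounded_from_expansion[where g = h])
    show "P ** Q = mat 1" "\<And>j. 0 \<le> Re (l j)" using basis by (auto simp: T_eigenbasis_def)
    fix \<tau> j assume \<tau>: "\<tau> \<in> \<H>"
    have q: "q_exp \<tau> \<in> ball 0 1" using \<tau> by (simp add: pi_gt_zero)
    have "exp (- z) * (w * (exp z * x)) = w * x" for z w x :: complex by (simp add: exp_minus)
    thus "(Q *v F' \<tau>) $ j = q_pow (l j) \<tau> * h j (q_exp \<tau>)"
      unfolding F'_def mv_smult by (simp only: vector_smult_component g(2)[OF \<tau>] h(2)[OF q])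
  qed (rule h(1))
  then obtain C where C: "\<And>\<tau>. \<tau> \<in> cusp_strip \<Longrightarrow> norm (F' \<tau>) \<le> C" by blast
  obtain a where a: "0 < a" "\<And>\<tau>. 1 \<le> Im \<tau> \<Longrightarrow> a * exp (- 2 * pi * Im \<tau>) \<le> norm (Delta \<tau>)"
    using Delta_bounds by metis
  have bound: "norm ((1 / Delta \<tau>) *s F \<tau>) \<le> C / a" if \<tau>: "\<tau> \<in> cusp_strip" for \<tau>
  proof -
    have y: "1 \<le> Im \<tau>" using \<tau> by (simp add: cusp_strip_def)
    have "F \<tau> = q_exp \<tau> *s F' \<tau>"
      unfolding F'_def vector_smult_assoc exp_minus by simp
    hence "norm (F \<tau>) = exp (- 2 * pi * Im \<tau>) * norm (F' \<tau>)" by (simp add: norm_vec_smult)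
    also have "\<dots> \<le> exp (- 2 * pi * Im \<tau>) * C" using C[OF \<tau>] by simp
    finally have "norm (F \<tau>) \<le> exp (- 2 * pi * Im \<tau>) * C" .
    hence "norm (F \<tau>) / norm (Delta \<tau>) \<le> (exp (- 2 * pi * Im \<tau>) * C) / (a * exp (- 2 * pi * Im \<tau>))"
      using a(1) a(2)[OF y] by (intro frac_le) (auto intro: order_trans[OF norm_ge_zero])
    thus ?thesis by (simp add: norm_vec_smult norm_divide)
  qed
  obtain D where D: "\<And>\<tau>. \<tau> \<in> cusp_strip \<Longrightarrow> norm ((1 / Delta \<tau>) *s F \<tau>) \<le> D * (1 + Im \<tau>)"
    using bounded_imp_linear_growth[of "\<lambda>\<tau>. (1 / Delta \<tau>) *s F \<tau>", OF bound] by blast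
  show ?thesis
  proof (rule vvmfI[OF _ _ _ _ D])
    fix \<tau> assume \<tau>: "\<tau> \<in> \<H>"
    have nz: "\<tau> \<noteq> 0" using \<tau> by auto
    have "\<tau> powi k = \<tau> powi (k - 12) * \<tau> ^ 12"
      using power_int_add[of \<tau> "k - 12" 12] nz by simp
    hence "1 / (\<tau> ^ 12 * Delta \<tau>) * \<tau> powi k = \<tau> powi (k - 12) * (1 / Delta \<tau>)"
      using nz Delta_nonzero[OF \<tau>] by (simp add: field_simps)
    thus "(1 / Delta (- 1 / \<tau>)) *s F (- 1 / \<tau>) = \<tau> powi (k - 12) *s (\<rho> S_mat *v ((1 / Delta \<tau>) *s F \<tau>))"
      unfolding Delta_inversion[OF \<tau>] vvmfD(4)[OF F \<tau>] mv_smult vector_smult_assoc by simp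
    show "(1 / Delta (\<tau> + 1)) *s F (\<tau> + 1) = \<rho> T_mat *v ((1 / Delta \<tau>) *s F \<tau>)"
      unfolding Delta_translation[OF \<tau>] vvmfD(3)[OF F \<tau>] mv_smult ..
  qed (use vvmfD(1,2)[OF F] Delta_holomorphic Delta_nonzero in \<open>auto intro!: holomorphic_intros\<close>)
qed

text \<open>The ideal of E4 and E6 contains every nontrivial monomial, and also the discriminant, a
  multiple of E4^3 - E6^2. In the exceptional case this ideal turns out to be the image of the
  projection.\<close>

lemma sform_E4_E6_combination:
  assumes f: "sform k f" and k: "k \<noteq> 0"
  shows "\<exists>g h. sform (k - 4) g \<and> sform (k - 6) h \<and> f = (\<lambda>\<tau>. E4 \<tau> * g \<tau> + E6 \<tau> * h \<tau>)"
proof (cases "even k \<and> k \<noteq> 2 \<and> 0 < k")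
  case False
  have "f \<tau> = 0" for \<tau>
    using False k sform_odd_weight[OF f] sform_negative_weight[OF f] sform_weight_2[of f] f
    by (metis linorder_neqE)
  hence "f = (\<lambda>\<tau>. E4 \<tau> * 0 + E6 \<tau> * 0)" by auto
  thus ?thesis using sform_zero by blast
next
  case True
  then obtain a b where ab: "k = 4 * int a + 6 * int b"
    using even_weight_decomposition[of "nat k"] by (auto simp: even_nat_iff nat_eq_iff)
  obtain g where g: "sform (k - 12) g" "f = (\<lambda>\<tau>. cusp_value f * mono46 a b \<tau> + Delta \<tau> * g \<tau>)"
    using sform_decompose[OF f ab] by metis
  obtain c where c: "c \<noteq> 0" "\<And>\<tau>. E4 \<tau> ^ 3 - E6 \<tau> ^ 2 = c * Delta \<tau>"
    using E4_cubed_minus_E6_squared by metis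
  have \<Delta>: "Delta \<tau> = E4 \<tau> * ((1 / c) * E4 \<tau> ^ 2) + E6 \<tau> * (- (1 / c) * E6 \<tau>)" for \<tau>
  proof -
    have "c * Delta \<tau> = E4 \<tau> * E4 \<tau> ^ 2 - E6 \<tau> * E6 \<tau>"
      unfolding c(2)[symmetric] by (simp add: power2_eq_square power3_eq_cube mult.assoc)
    hence "Delta \<tau> = (E4 \<tau> * E4 \<tau> ^ 2 - E6 \<tau> * E6 \<tau>) / c" using c(1) by (simp add: field_simps)
    thus ?thesis by (simp add: diff_divide_distrib)
  qed
  have "\<exists>u v. sform (k - 4) u \<and> sform (k - 6) v \<and> (\<forall>\<tau>. mono46 a b \<tau> = E4 \<tau> * u \<tau> + E6 \<tau> * v \<tau>)"
  proof (cases a)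
    case (Suc a')
    have "sform (k - 4) (mono46 a' b)" using sform_mono46[of a' b] by (simp add: ab Suc)
    moreover have "mono46 a b \<tau> = E4 \<tau> * mono46 a' b \<tau> + E6 \<tau> * 0" for \<tau> by (simp add: mono46_def Suc)
    ultimately show ?thesis using sform_zero by blast
  next
    case 0
    then obtain b' where b: "b = Suc b'" using ab k by (cases b) auto
    have "sform (k - 6) (mono46 a b')" using sform_mono46[of a b'] by (simp add: ab b)
    moreover have "mono46 a b \<tau> = E4 \<tau> * 0 + E6 \<tau> * mono46 a b' \<tau>" for \<tau> by (simp add: mono46_def b)
    ultimately show ?thesis using sform_zero by blast
  qed
  then obtain u v where uv: "sform (k - 4) u" "sform (k - 6) v" "\<And>\<tau>. mono46 a b \<tau> = E4 \<tau> * u \<tau> + E6 \<tau> * v \<tau>" by blast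
  let ?G = "\<lambda>\<tau>. cusp_value f * u \<tau> + (1 / c) * E4 \<tau> ^ 2 * g \<tau>"
  let ?H = "\<lambda>\<tau>. cusp_value f * v \<tau> + - (1 / c) * E6 \<tau> * g \<tau>"
  have "sform (8 + (k - 12)) (\<lambda>\<tau>. (1 / c) * E4 \<tau> ^ 2 * g \<tau>)"
    using sform_power[OF sform_E4, of 2] by (intro sform_mult[OF sform_cmult g(1)]) simp
  hence G: "sform (k - 4) ?G" by (intro sform_add sform_cmult uv(1)) simp
  have "sform (6 + (k - 12)) (\<lambda>\<tau>. - (1 / c) * E6 \<tau> * g \<tau>)" by (intro sform_mult[OF sform_cmult[OF sform_E6] g(1)])
  hence H: "sform (k - 6) ?H" by (intro sform_add sform_cmult uv(2)) simp
  have "f \<tau> = E4 \<tau> * ?G \<tau> + E6 \<tau> * ?H \<tau>" for \<tau>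
  proof -
    have "f \<tau> = cusp_value f * (E4 \<tau> * u \<tau> + E6 \<tau> * v \<tau>) + (E4 \<tau> * ((1 / c) * E4 \<tau> ^ 2) + E6 \<tau> * (- (1 / c) * E6 \<tau>)) * g \<tau>"
      unfolding uv(3)[symmetric] \<Delta>[symmetric] using fun_cong[OF g(2), of \<tau>] .
    thus ?thesis by (simp only: algebra_simps)
  qed
  hence "f = (\<lambda>\<tau>. E4 \<tau> * ?G \<tau> + E6 \<tau> * ?H \<tau>)" by (rule ext)
  thus ?thesis using G H by blast
qed

lemma eisenstein_ring_holomorphic: "f \<in> eisenstein_ring \<Longrightarrow> f holomorphic_on \<H>"
proof (induction rule: eisenstein_ring.induct)
  case (const c)
  show ?case using sformD(2)[OF sform_const[of c]] by simp
qed (auto intro!: holomorphic_intros sformD(2)[OF sform_E4] sformD(2)[OF sform_E6])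

lemma eisenstein_ring_off: "f \<in> eisenstein_ring \<Longrightarrow> \<tau> \<notin> \<H> \<Longrightarrow> f \<tau> = 0"
  by (induction rule: eisenstein_ring.induct) (auto simp: eisenstein_def)

text \<open>Identity theorem, starting from the nonempty open set where E6 does not vanish.\<close>

lemma mult_E6_eq_zero:
  assumes f: "f \<in> eisenstein_ring" and 0: "\<And>\<tau>. f \<tau> * E6 \<tau> = 0" shows "f = (\<lambda>_. 0)"
proof
  fix \<tau>
  show "f \<tau> = 0"
  proof (cases "\<tau> \<in> \<H>")
    case True
    note h6 = sformD(2)[OF sform_E6]
    obtain \<sigma> where \<sigma>: "E6 \<sigma> \<noteq> 0" using E6_nonzero by blast
    show ?thesis
    proof (rule analytic_continuation_open[of "\<H> \<inter> E6 -` (- {0})" \<H> f "\<lambda>_. 0" \<tau>])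
      show "open (\<H> \<inter> E6 -` (- {0}))"
        by (rule continuous_open_preimage[OF holomorphic_on_imp_continuous_on[OF h6] open_uhp]) auto
      show "\<H> \<inter> E6 -` (- {0}) \<noteq> {}" using \<sigma> sformD(1)[OF sform_E6, of \<sigma>] by blast
      show "connected \<H>" using convex_connected[OF convex_uhp] .
      show "f z = 0" if "z \<in> \<H> \<inter> E6 -` (- {0})" for z using 0[of z] that by auto
    qed (use True eisenstein_ring_holomorphic[OF f] open_uhp in auto)
  qed (rule eisenstein_ring_off[OF f])
qed

lemma eisenstein_ring_diff: "f \<in> eisenstein_ring \<Longrightarrow> g \<in> eisenstein_ring \<Longrightarrow> (\<lambda>\<tau>. f \<tau> - g \<tau>) \<in> eisenstein_ring"
  using eisenstein_ring.add[of f "\<lambda>\<tau>. - 1 * g \<tau>"] eisenstein_ring_cmult[of g "- 1"] by simp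

locale exceptional_extension = extension +
  assumes a0: "a = 0" and k8: "k1 = 8" and k10: "k2 = 10"
begin

lemma X_trivial: "X S_mat = 1" "X T_mat = 1"
  by (simp_all add: X_S X_T a0)

lemma forms0_exist:
  assumes "vvmf \<rho>0 k H"
  shows "\<exists>f g. sform (k - 8) f \<and> sform (k - 10) g \<and> H = (\<lambda>\<tau>. f \<tau> *s B0 \<tau> + g \<tau> *s B1 \<tau>)"
  using gens_exist[OF assms] unfolding k8 k10 .

lemma forms0_small_weight:
  assumes H: "vvmf \<rho>0 k H" and k: "k < 8" shows "H \<tau> = 0"
proof -
  from forms0_exist[OF H] obtain f g where fg: "sform (k - 8) f \<and> sform (k - 10) g \<and> H = (\<lambda>\<tau>. f \<tau> *s B0 \<tau> + g \<tau> *s B1 \<tau>)"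
    by (elim exE)
  have "k - 8 < 0" "k - 10 < 0" using k by simp_all
  hence "f \<tau> = 0" "g \<tau> = 0" using fg sform_negative_weight by blast+
  thus ?thesis using fg by simp
qed

text \<open>Left exactness on the level of forms; a linear left inverse N of \<iota> provides the
  preimage.\<close>

lemma kernel_form:
  assumes V: "vvmf \<rho> k V" and 0: "\<And>\<tau>. \<tau> \<in> \<H> \<Longrightarrow> p *v V \<tau> = 0"
  shows "\<exists>H. vvmf \<rho>0 k H \<and> V = (\<lambda>\<tau>. \<iota> *v H \<tau>)"
proof -
  obtain N where N: "N ** \<iota> = mat 1"
    using matrix_left_invertible_injective[of \<iota>] \<iota>_inj by (auto simp: inj_def)
  have "V \<tau> = \<iota> *v (N *v V \<tau>)" for \<tau>
  proof -
    have "p *v V \<tau> = 0" using 0 vvmfD(1)[OF V, of \<tau>] by (cases "\<tau> \<in> \<H>") auto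
    then obtain x where "V \<tau> = \<iota> *v x" using ker_p by blast
    moreover have "N *v (\<iota> *v x) = x" by (simp add: mv_assoc N)
    ultimately show ?thesis by simp
  qed
  hence eq: "V = (\<lambda>\<tau>. \<iota> *v (N *v V \<tau>))" by (rule ext)
  hence "vvmf \<rho> k (\<lambda>\<tau>. \<iota> *v (N *v V \<tau>))" using V by metis
  from vvmf_pullback[OF \<iota>_intertwines N this] show ?thesis using eq by blast
qed

lemma vvmf_\<iota>: "vvmf \<rho>0 k H \<Longrightarrow> vvmf \<rho> k (\<lambda>\<tau>. \<iota> *v H \<tau>)"
  by (rule vvmf_matrix_apply[OF \<iota>_intertwines])

text \<open>The derivative of a lift of the constant 1 would be a form of weight 2 in \<open>\<rho>0\<close>, hence zero,
  so that the lift would be constant and split the extension.\<close>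

lemma no_lift_of_one:
  assumes \<Phi>: "vvmf \<rho> 0 \<Phi>" and p\<Phi>: "\<And>\<tau>. \<tau> \<in> \<H> \<Longrightarrow> p *v \<Phi> \<tau> = axis 1 1"
  shows False
proof -
  obtain P Q l where basis: "T_eigenbasis \<rho> P Q l" using basis_exists(1) by (elim exE)
  have "vvmf \<rho> (2 * 0) \<Phi>" using \<Phi> by simp
  hence V: "vvmf \<rho> 2 (vserre 0 \<Phi>)" using vvmf_serre_deriv[OF basis, of 0 \<Phi>] by simp
  have "p *v vserre 0 \<Phi> \<tau> = 0" if \<tau>: "\<tau> \<in> \<H>" for \<tau>
  proof -
    have "((\<lambda>\<tau>. (p *v \<Phi> \<tau>) $ i) has_field_derivative 0) (at \<tau>)" for i
      by (rule has_field_derivative_transform_within_open[OF DERIV_const open_uhp \<tau>, of "axis 1 1 $ i"]) (simp add: p\<Phi>)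
    hence "deriv (\<lambda>\<tau>. (p *v \<Phi> \<tau>) $ i) \<tau> = 0" for i by (rule DERIV_imp_deriv)
    hence "vserre 0 (\<lambda>\<tau>. p *v \<Phi> \<tau>) \<tau> = 0" by (simp add: vserre_def serre_deriv_def vec_eq_iff)
    thus ?thesis using vserre_matrix_vector[OF vvmfD(2)[OF \<Phi>], of 0 p \<tau>] by simp
  qed
  from kernel_form[OF V this] obtain H where H: "vvmf \<rho>0 2 H" "vserre 0 \<Phi> = (\<lambda>\<tau>. \<iota> *v H \<tau>)" by blast
  have D0: "vserre 0 \<Phi> \<tau> = 0" for \<tau> using forms0_small_weight[OF H(1)] H(2) by simp
  have "has_vec_deriv \<Phi> 0 \<tau>" if \<tau>: "\<tau> \<in> \<H>" for \<tau>
    unfolding has_vec_deriv_def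
  proof
    fix j
    have "deriv (\<lambda>\<tau>. \<Phi> \<tau> $ j) \<tau> = 0" using vserre_components[OF \<tau>, of \<Phi> j 0] by (simp add: D0)
    thus "((\<lambda>\<tau>. \<Phi> \<tau> $ j) has_field_derivative 0 $ j) (at \<tau>)"
      using uhp_deriv[OF vvmfD(2)[OF \<Phi>, of j] \<tau>] by simp
  qed
  hence "\<exists>v. \<forall>\<tau>\<in>\<H>. \<Phi> \<tau> = v" by (rule vec_deriv_zero_constant)
  then obtain v where v: "\<And>\<tau>. \<tau> \<in> \<H> \<Longrightarrow> \<Phi> \<tau> = v" by blast
  have i: "\<i> \<in> \<H>" "\<i> + 1 \<in> \<H>" "- 1 / \<i> \<in> \<H>" by simp_all
  have "\<rho> T_mat *v v = 1 *s v" using vvmfD(3)[OF \<Phi> i(1)] v[OF i(1)] v[OF i(2)] by simp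
  moreover have "\<rho> S_mat *v v = 1 *s v" using vvmfD(4)[OF \<Phi> i(1)] v[OF i(1)] v[OF i(3)] by simp
  moreover have "p *v v = axis 1 1" using p\<Phi>[OF i(1)] v[OF i(1)] by simp
  ultimately show False using no_invariant_complement by blast
qed

text \<open>A preimage of the constant 1 in the module may mix weights, but by independence of
  weights its part of weight 0 is again a preimage.\<close>

lemma not_M_split: "\<not> M_split \<rho> p \<xi>"
proof
  assume split: "M_split \<rho> p \<xi>"
  define u :: "complex \<Rightarrow> complex^1" where "u \<tau> = (if \<tau> \<in> \<H> then axis 1 1 else 0)" for \<tau>
  have u: "vvmf \<xi> 0 u"
  proof (rule vvmfI[where C = 1])
    fix \<tau> assume \<tau>: "\<tau> \<in> \<H>"
    show "u (\<tau> + 1) = \<xi> T_mat *v u \<tau>" using \<tau> by (simp add: u_def chi_apply X_trivial)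
    show "u (- 1 / \<tau>) = \<tau> powi 0 *s (\<xi> S_mat *v u \<tau>)"
      using \<tau> neg_inverse_in_uhp[of \<tau>] by (simp add: u_def chi_apply X_trivial)
  next
    fix j
    show "(\<lambda>\<tau>. u \<tau> $ j) holomorphic_on \<H>"
      by (rule holomorphic_transform[of "\<lambda>_. axis 1 1 $ j"]) (auto simp: u_def)
  next
    fix \<tau> assume "\<tau> \<in> cusp_strip" thus "norm (u \<tau>) \<le> 1 * (1 + Im \<tau>)"
      by (auto simp: u_def cusp_strip_def)
  qed (simp add: u_def)
  hence "u \<in> modular_form_module \<xi>" using formsc in_module by blast
  hence "u \<in> (\<lambda>F \<tau>. p *v F \<tau>) ` modular_form_module \<rho>" using split by (simp add: M_split_def)
  then obtain K F where F: "u = (\<lambda>\<tau>. p *v (\<Sum>k\<in>K. F k \<tau>))" "finite K" "\<And>k. k \<in> K \<Longrightarrow> F k \<in> modular_forms \<rho> k"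
    by (auto simp: modular_form_module_def)
  define F' where "F' k = (if k \<in> K then F k else (\<lambda>_. 0))" for k
  have F': "vvmf \<rho> k (F' k)" for k using F(3) by (simp add: F'_def forms)
  define G where "G k = (\<lambda>\<tau>. p *v F' k \<tau> - (if k = 0 then u \<tau> else 0))" for k
  have G: "vvmf \<xi> k (G k)" for k
  proof -
    have "vvmf \<xi> k (\<lambda>\<tau>. if k = 0 then u \<tau> else 0)" using u by (cases "k = 0") auto
    thus ?thesis unfolding G_def by (intro vvmf_diff vvmf_matrix_apply[OF p_intertwines F'])
  qed
  have "(\<Sum>k\<in>insert 0 K. G k \<tau>) = 0" for \<tau>
  proof -
    have "(\<Sum>k\<in>insert 0 K. p *v F' k \<tau>) = (\<Sum>k\<in>K. p *v F k \<tau>)"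
      using F(2) by (intro sum.mono_neutral_cong_right) (auto simp: F'_def)
    also have "\<dots> = u \<tau>" by (simp add: F(1) matrix_vector_sum)
    finally have "(\<Sum>k\<in>insert 0 K. p *v F' k \<tau>) = u \<tau>" .
    moreover have "(\<Sum>k\<in>insert 0 K. if k = 0 then u \<tau> else 0) = u \<tau>"
      using F(2) by (subst sum.delta) auto
    ultimately show ?thesis by (simp only: G_def sum_subtractf diff_self)
  qed
  from vvmf_weights_independent[OF slc _ G this, of 0]
  have "G 0 \<tau> = 0" for \<tau> using F(2) by simp
  hence "p *v F' 0 \<tau> = axis 1 1" if "\<tau> \<in> \<H>" for \<tau> using that by (simp add: G_def u_def)
  thus False using no_lift_of_one[OF F'[of 0]] by blast
qed

text \<open>Since the character is trivial, p kills every T-eigenvector of the basis with exponent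
  other than 0. On the remaining coordinates no power of q is split off, so the limit of p F is p
  applied to the constant terms.\<close>

lemma lead_projection:
  assumes basis: "T_eigenbasis \<rho> P Q l" and c: "has_lead Q l F c"
  shows "((\<lambda>y. (p *v F (\<i> * of_real y)) $ 1) \<longlongrightarrow> (p *v (P *v c)) $ 1) at_top"
proof -
  have PQ: "P ** Q = mat 1" "Q ** P = mat 1" and T: "\<rho> T_mat = P ** diag_mat (\<lambda>j. q_exp (l j)) ** Q"
    and l: "\<And>j. 0 \<le> Re (l j) \<and> Re (l j) < 1" using basis by (auto simp: T_eigenbasis_def)
  define r where "r j = (p *v (P *v axis j 1)) $ 1" for j
  have sum: "(p *v (P *v x)) $ 1 = (\<Sum>j\<in>UNIV. r j * x $ j)" for x
  proof -
    have "x = (\<Sum>j\<in>UNIV. x $ j *s axis j 1)" by (simp add: vec_eq_iff axis_def if_distrib sum.delta cong: if_cong)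
    hence "p *v (P *v x) = p *v (P *v (\<Sum>j\<in>UNIV. x $ j *s axis j 1))" by (rule arg_cong)
    also have "\<dots> = (\<Sum>j\<in>UNIV. x $ j *s (p *v (P *v axis j 1)))"
      by (simp only: matrix_vector_sum mv_smult)
    finally show ?thesis by (simp add: r_def mult.commute)
  qed
  have r0: "r j = 0 \<or> l j = 0" for j
  proof -
    have "\<rho> T_mat *v (P *v axis j 1) = P *v (diag_mat (\<lambda>j. q_exp (l j)) *v ((Q ** P) *v axis j 1))"
      unfolding T by (simp only: mv_assoc matrix_mul_assoc)
    hence "\<rho> T_mat *v (P *v axis j 1) = q_exp (l j) *s (P *v axis j 1)"
      by (simp add: PQ(2) diag_mat_axis mv_smult)
    hence "p *v (\<rho> T_mat *v (P *v axis j 1)) = q_exp (l j) *s (p *v (P *v axis j 1))"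
      by (simp add: mv_smult)
    moreover have "p *v (\<rho> T_mat *v (P *v axis j 1)) = p *v (P *v axis j 1)"
      by (simp add: p_comm chi_apply X_trivial)
    ultimately have "(p *v (P *v axis j 1)) $ 1 = (q_exp (l j) *s (p *v (P *v axis j 1))) $ 1" by simp
    hence "r j = q_exp (l j) * r j" by (simp add: r_def)
    hence "r j = 0 \<or> q_exp (l j) = q_exp 0" by simp
    thus ?thesis using exp_2pi_i_inj[of "l j" 0] l[of j] by auto
  qed
  have "((\<lambda>y. \<Sum>j\<in>UNIV. r j * (lead_term Q l F j y))
      \<longlongrightarrow> (\<Sum>j\<in>UNIV. r j * c $ j)) at_top"
    using c unfolding has_lead_def by (intro tendsto_sum tendsto_mult tendsto_const) blast
  also have "(\<lambda>y. \<Sum>j\<in>UNIV. r j * (lead_term Q l F j y)) =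
      (\<lambda>y. (p *v (P *v (Q *v F (\<i> * of_real y)))) $ 1)"
  proof
    fix y
    have "r j * (exp (- (2 * of_real pi * \<i> * l j * (\<i> * of_real y))) * z) = r j * z" for j z
      using r0[of j] by auto
    thus "(\<Sum>j\<in>UNIV. r j * (lead_term Q l F j y)) =
        (p *v (P *v (Q *v F (\<i> * of_real y)))) $ 1" by (simp only: sum)
  qed
  also have "(\<lambda>y. (p *v (P *v (Q *v F (\<i> * of_real y)))) $ 1) = (\<lambda>y. (p *v F (\<i> * of_real y)) $ 1)"
    by (simp add: mv_assoc PQ(1) matrix_mul_assoc)
  also have "(\<Sum>j\<in>UNIV. r j * c $ j) = (p *v (P *v c)) $ 1" by (rule sum[symmetric])
  finally show ?thesis .
qed

lemma lead_in_image:
  assumes basis: "T_eigenbasis \<rho> P Q l" and c: "has_lead Q l F c"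
    and 0: "((\<lambda>y. (p *v F (\<i> * of_real y)) $ 1) \<longlongrightarrow> 0) at_top"
  shows "\<exists>x. P *v c = \<iota> *v x"
proof -
  have "(p *v (P *v c)) $ 1 = 0"
    by (rule tendsto_unique[OF trivial_limit_at_top_linorder lead_projection[OF basis c] 0])
  hence "p *v (P *v c) = 0" by (simp add: vec_eq_iff forall_1)
  thus ?thesis by (rule ker_p)
qed

text \<open>The leading vector of a lift F of the discriminant is killed by p, hence is a
  combination of those of B0 and B1. Cancelling the B1 part in weight 12 would take a scalar form of
  weight 2, so F is first multiplied by E4 or E6. In weights 16 and 18 all coefficients exist with
  constant term 1, and division by the discriminant leaves weights 4 and 6.\<close>

lemma low_weight_forms:
  "\<exists>F4 F6 c. vvmf \<rho> 4 F4 \<and> vvmf \<rho> 6 F6 \<and> c \<noteq> 0 \<and>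
    (\<forall>\<tau>\<in>\<H>. p *v F4 \<tau> = E4 \<tau> *s axis 1 1) \<and> (\<forall>\<tau>\<in>\<H>. p *v F6 \<tau> = E6 \<tau> *s axis 1 1) \<and>
    (\<forall>\<tau>. E4 \<tau> *s F6 \<tau> - E6 \<tau> *s F4 \<tau> = c *s (\<iota> *v B1 \<tau>))"
proof -
  obtain P Q l where basis: "T_eigenbasis \<rho> P Q l" using basis_exists(1) by (elim exE)
  have QP: "Q ** P = mat 1" using basis by (simp add: T_eigenbasis_def)
  have m4: "int m = 4" using k1_eq k8 by linarith
  have "\<exists>F. vvmf \<rho> (2 * int 6) F \<and> (\<forall>\<tau>\<in>\<H>. p *v F \<tau> = (eta4 \<tau> ^ 6) *s axis 1 1)"
    by (rule lift_weight_above[of 6 1]) (use a0 m4 in simp_all)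
  then obtain F where F: "vvmf \<rho> 12 F" "\<And>\<tau>. \<tau> \<in> \<H> \<Longrightarrow> p *v F \<tau> = Delta \<tau> *s axis 1 1"
    by (auto simp: Delta_def)
  define I0 where "I0 = (\<lambda>\<tau>. \<iota> *v B0 \<tau>)"
  define I1 where "I1 = (\<lambda>\<tau>. \<iota> *v B1 \<tau>)"
  have vB0: "vvmf \<rho>0 8 B0" and vB1: "vvmf \<rho>0 10 B1" using vvmf_B0 vvmf_B1 k8 k10 by metis+
  have I0: "vvmf \<rho> 8 I0" and I1: "vvmf \<rho> 10 I1" unfolding I0_def I1_def by (intro vvmf_\<iota> vB0 vB1)+
  have pI: "p *v I0 \<tau> = 0" "p *v I1 \<tau> = 0" for \<tau> by (simp_all add: I0_def I1_def p_\<iota>)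
  obtain cF where cF: "has_lead Q l F cF" using has_lead_exists[OF basis F(1)] by blast
  obtain c0 where c0: "has_lead Q l I0 c0" using has_lead_exists[OF basis I0] by blast
  obtain c1 where c1: "has_lead Q l I1 c1" using has_lead_exists[OF basis I1] by blast
  obtain xF where xF: "P *v cF = \<iota> *v xF"
  proof (rule exE[OF lead_in_image[OF basis cF]])
    have "((\<lambda>y. Delta (\<i> * of_real y)) \<longlongrightarrow> 0) at_top"
      using cusp_value_limit[OF sform_Delta] by (simp add: cusp_value_Delta)
    thus "((\<lambda>y. (p *v F (\<i> * of_real y)) $ 1) \<longlongrightarrow> 0) at_top"
      by (rule Lim_transform_eventually) (use eventually_imag_axis in eventually_elim; simp add: F(2))
  qed
  obtain x0 where x0: "P *v c0 = \<iota> *v x0" using lead_in_image[OF basis c0] by (auto simp: pI)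
  obtain x1 where x1: "P *v c1 = \<iota> *v x1" using lead_in_image[OF basis c1] by (auto simp: pI)
  have zero_lead: "z *s cF + x *s c0 + y *s c1 = 0" if "z *s xF + x *s x0 + y *s x1 = 0" for x y z
  proof -
    have "P *v (z *s cF + x *s c0 + y *s c1) = \<iota> *v (z *s xF + x *s x0 + y *s x1)"
      by (simp only: mv_add mv_smult xF x0 x1)
    hence "Q *v (P *v (z *s cF + x *s c0 + y *s c1)) = 0" by (simp add: that)
    thus ?thesis by (simp add: mv_assoc QP)
  qed
  have cE4: "cusp_value (\<lambda>\<tau>. x * E4 \<tau>) = x" and cE6: "cusp_value (\<lambda>\<tau>. x * E6 \<tau>) = x" for x
    using cusp_value_cmult[OF sform_E4, of x] cusp_value_cmult[OF sform_E6, of x] by (simp_all add: cusp_value_E4 cusp_value_E6)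
  have E44: "sform 8 (\<lambda>\<tau>. E4 \<tau> * E4 \<tau>)" and E46: "sform 10 (\<lambda>\<tau>. E4 \<tau> * E6 \<tau>)"
    using sform_mult[OF sform_E4 sform_E4] sform_mult[OF sform_E4 sform_E6] by simp_all
  have cE44: "cusp_value (\<lambda>\<tau>. x * (E4 \<tau> * E4 \<tau>)) = x" and cE46: "cusp_value (\<lambda>\<tau>. x * (E4 \<tau> * E6 \<tau>)) = x" for x
    using cusp_value_cmult[OF E44, of x] cusp_value_cmult[OF E46, of x]
      cusp_value_mult[OF sform_E4 sform_E4] cusp_value_mult[OF sform_E4 sform_E6] by (simp_all add: cusp_value_E4 cusp_value_E6)
  note sE4 = sform_cmult[OF sform_E4] and sE6 = sform_cmult[OF sform_E6]
    and sE44 = sform_cmult[OF E44] and sE46 = sform_cmult[OF E46]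
  \<comment> \<open>A dependence would make a nontrivial combination of E6 B0 and E4 B1, of weight
    14, divisible by the discriminant; the quotient would be a nonzero form of weight 2 for
    \<open>\<rho>0\<close>.\<close>
  have indep: "cross2 x0 x1 \<noteq> 0"
  proof
    assume "cross2 x0 x1 = 0"
    have "\<exists>x y. (x \<noteq> 0 \<or> y \<noteq> 0) \<and> x *s x0 + y *s x1 = 0"
    proof (cases "x0 = 0")
      case True thus ?thesis by (intro exI[of _ 1] exI[of _ 0]) simp
    next
      case False
      then obtain d where "x1 = d *s x0" using cross2_parallel[OF \<open>cross2 x0 x1 = 0\<close>] by blast
      thus ?thesis by (intro exI[of _ d] exI[of _ "- 1"]) simp
    qed
    then obtain x y where xy: "x \<noteq> 0 \<or> y \<noteq> 0" "x *s x0 + y *s x1 = 0" by blast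
    define V where "V = (\<lambda>\<tau>. (x * E6 \<tau>) *s I0 \<tau> + (y * E4 \<tau>) *s I1 \<tau>)"
    have V: "vvmf \<rho> 14 V"
      unfolding V_def using vvmf_smult[OF sE6 I0] vvmf_smult[OF sE4 I1] by (intro vvmf_add) simp_all
    have "has_lead Q l V (x *s c0 + y *s c1)"
      unfolding V_def using has_lead_add[OF has_lead_smult[OF sE6 c0] has_lead_smult[OF sE4 c1], of x y] by (simp only: cE4 cE6)
    hence "has_lead Q l V 0" using zero_lead[of 0 x y] xy(2) by simp
    from vvmf_div_Delta[OF basis V this] have W: "vvmf \<rho> 2 (\<lambda>\<tau>. (1 / Delta \<tau>) *s V \<tau>)" by simp
    have "p *v ((1 / Delta \<tau>) *s V \<tau>) = 0" for \<tau>
      by (simp add: V_def mv_smult mv_add pI)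
    from kernel_form[OF W this] obtain H where H: "vvmf \<rho>0 2 H" "(\<lambda>\<tau>. (1 / Delta \<tau>) *s V \<tau>) = (\<lambda>\<tau>. \<iota> *v H \<tau>)" by blast
    have "(x * E6 \<tau>) *s B0 \<tau> + (y * E4 \<tau>) *s B1 \<tau> = 0" if \<tau>: "\<tau> \<in> \<H>" for \<tau>
    proof -
      have "(1 / Delta \<tau>) *s V \<tau> = \<iota> *v H \<tau>" using fun_cong[OF H(2)] .
      hence "(1 / Delta \<tau>) *s V \<tau> = 0" using forms0_small_weight[OF H(1)] by simp
      hence "V \<tau> = 0" using Delta_nonzero[OF \<tau>] vector_mul_eq_0 by fastforce
      hence "\<iota> *v ((x * E6 \<tau>) *s B0 \<tau> + (y * E4 \<tau>) *s B1 \<tau>) = \<iota> *v 0"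
        by (simp add: V_def I0_def I1_def mv_add mv_smult)
      thus ?thesis by (rule \<iota>_cancel)
    qed
    note z = generator_combination_zero[OF sE6 sE4 this]
    have "cusp_value (\<lambda>_. 0) = 0" by (intro cusp_valueI) simp
    hence "x = 0" "y = 0" using arg_cong[OF z(1), of cusp_value] arg_cong[OF z(2), of cusp_value] by (simp_all only: cE4 cE6)
    thus False using xy(1) by blast
  qed
  obtain x y where xy: "1 *s xF + x *s x0 + y *s x1 = 0"
  proof -
    obtain x y where "xF = x *s x0 + y *s x1" using cross2_span[OF indep] by blast
    hence "1 *s xF + (- x) *s x0 + (- y) *s x1 = 0" by (simp add: vec_eq_iff)
    thus thesis by (rule that)
  qed
  have lead0: "1 *s cF + x *s c0 + y *s c1 = 0" by (rule zero_lead[OF xy])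
  \<comment> \<open>With y = 0 the correction would already work in weight 12, and the quotient
    would lift the constant 1.\<close>
  have y0: "y \<noteq> 0"
  proof
    assume "y = 0"
    define V where "V = (\<lambda>\<tau>. F \<tau> + (x * E4 \<tau>) *s I0 \<tau>)"
    have V: "vvmf \<rho> 12 V" unfolding V_def using vvmf_smult[OF sE4 I0] by (intro vvmf_add F(1)) simp
    have "has_lead Q l V (cF + x *s c0)"
      unfolding V_def using has_lead_add[OF cF has_lead_smult[OF sE4 c0], of x] by (simp only: cE4)
    hence "has_lead Q l V 0" using lead0 \<open>y = 0\<close> by simp
    from vvmf_div_Delta[OF basis V this] have "vvmf \<rho> 0 (\<lambda>\<tau>. (1 / Delta \<tau>) *s V \<tau>)" by simp
    moreover have "p *v ((1 / Delta \<tau>) *s V \<tau>) = axis 1 1" if "\<tau> \<in> \<H>" for \<tau>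
      using that Delta_nonzero[OF that]
      by (simp add: V_def mv_smult mv_add pI F(2) vector_smult_assoc)
    ultimately show False by (rule no_lift_of_one)
  qed
  define V4 where "V4 = (\<lambda>\<tau>. E4 \<tau> *s F \<tau> + (x * (E4 \<tau> * E4 \<tau>)) *s I0 \<tau> + (y * E6 \<tau>) *s I1 \<tau>)"
  define V6 where "V6 = (\<lambda>\<tau>. E6 \<tau> *s F \<tau> + (x * (E4 \<tau> * E6 \<tau>)) *s I0 \<tau> + (y * (E4 \<tau> * E4 \<tau>)) *s I1 \<tau>)"
  have V4: "vvmf \<rho> 16 V4"
    unfolding V4_def using vvmf_smult[OF sform_E4 F(1)] vvmf_smult[OF sE44 I0] vvmf_smult[OF sE6 I1] by (intro vvmf_add) simp_all
  have V6: "vvmf \<rho> 18 V6"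
    unfolding V6_def using vvmf_smult[OF sform_E6 F(1)] vvmf_smult[OF sE46 I0] vvmf_smult[OF sE44 I1] by (intro vvmf_add) simp_all
  have "has_lead Q l V4 (1 *s cF + x *s c0 + y *s c1)"
    unfolding V4_def
    using has_lead_add[OF has_lead_add[OF has_lead_smult[OF sform_E4 cF] has_lead_smult[OF sE44 c0, of x]] has_lead_smult[OF sE6 c1, of y]]
    by (simp only: cE44 cE6 cusp_value_E4)
  hence L4: "has_lead Q l V4 0" by (simp only: lead0)
  have "has_lead Q l V6 (1 *s cF + x *s c0 + y *s c1)"
    unfolding V6_def
    using has_lead_add[OF has_lead_add[OF has_lead_smult[OF sform_E6 cF] has_lead_smult[OF sE46 c0, of x]] has_lead_smult[OF sE44 c1, of y]]
    by (simp only: cE44 cE46 cusp_value_E6)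
  hence L6: "has_lead Q l V6 0" by (simp only: lead0)
  define F4 where "F4 = (\<lambda>\<tau>. (1 / Delta \<tau>) *s V4 \<tau>)"
  define F6 where "F6 = (\<lambda>\<tau>. (1 / Delta \<tau>) *s V6 \<tau>)"
  have F4: "vvmf \<rho> 4 F4" and F6: "vvmf \<rho> 6 F6"
    using vvmf_div_Delta[OF basis V4 L4] vvmf_div_Delta[OF basis V6 L6] by (simp_all add: F4_def F6_def)
  have p4: "p *v F4 \<tau> = E4 \<tau> *s axis 1 1" and p6: "p *v F6 \<tau> = E6 \<tau> *s axis 1 1" if "\<tau> \<in> \<H>" for \<tau>
    using that Delta_nonzero[OF that]
    by (simp_all add: F4_def F6_def V4_def V6_def mv_smult mv_add pI F(2) vector_smult_assoc)
  obtain d where d: "d \<noteq> 0" "\<And>\<tau>. E4 \<tau> ^ 3 - E6 \<tau> ^ 2 = d * Delta \<tau>" using E4_cubed_minus_E6_squared by metis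
  have rel: "E4 \<tau> *s F6 \<tau> - E6 \<tau> *s F4 \<tau> = (y * d) *s (\<iota> *v B1 \<tau>)" for \<tau>
  proof (cases "\<tau> \<in> \<H>")
    case True
    \<comment> \<open>The terms with F and B0 cancel, and at B1 there remains E4^3 - E6^2, a
      multiple of the discriminant.\<close>
    have "E4 \<tau> *s V6 \<tau> - E6 \<tau> *s V4 \<tau> = (y * (E4 \<tau> ^ 3 - E6 \<tau> ^ 2)) *s I1 \<tau>"
      unfolding V4_def V6_def by (simp add: vec_eq_iff algebra_simps power2_eq_square power3_eq_cube)
    also have "\<dots> = Delta \<tau> *s ((y * d) *s I1 \<tau>)" unfolding d(2) by (simp add: vector_smult_assoc mult_ac)
    finally have "(1 / Delta \<tau>) *s (E4 \<tau> *s V6 \<tau> - E6 \<tau> *s V4 \<tau>) = (y * d) *s I1 \<tau>"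
      using Delta_nonzero[OF True] by (simp add: vector_smult_assoc)
    thus ?thesis unfolding F4_def F6_def I1_def by (simp add: vec_eq_iff algebra_simps)
  next
    case False
    thus ?thesis using vvmfD(1)[OF F4] vvmfD(1)[OF F6] vvmfD(1)[OF vB1] by simp
  qed
  have "y * d \<noteq> 0" using y0 d(1) by simp
  thus ?thesis using F4 F6 p4 p6 rel by blast
qed

end

section \<open>The basis in weights 4, 6 and 8\<close>

context exceptional_extension
begin

text \<open>The projection of a form lies in the ideal of E4 and E6: in weight 0 because the
  constant 1 has no lift, in other weights because all scalar forms do. Subtracting multiples of F4
  and F6 leaves a form of \<open>\<rho>0\<close>.\<close>

lemma form_components:
  assumes p4: "\<And>\<tau>. \<tau> \<in> \<H> \<Longrightarrow> p *v F4 \<tau> = E4 \<tau> *s axis 1 1" and p6: "\<And>\<tau>. \<tau> \<in> \<H> \<Longrightarrow> p *v F6 \<tau> = E6 \<tau> *s axis 1 1"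
    and F4: "vvmf \<rho> 4 F4" and F6: "vvmf \<rho> 6 F6" and V: "vvmf \<rho> k V"
  shows "\<exists>g h u w. g \<in> eisenstein_ring \<and> h \<in> eisenstein_ring \<and> u \<in> eisenstein_ring \<and> w \<in> eisenstein_ring \<and>
    V = (\<lambda>\<tau>. g \<tau> *s F4 \<tau> + h \<tau> *s F6 \<tau> + (u \<tau> *s (\<iota> *v B0 \<tau>) + w \<tau> *s (\<iota> *v B1 \<tau>)))"
proof -
  define f where "f \<tau> = (p *v V \<tau>) $ 1" for \<tau>
  have f: "sform k f"
    using quotient_form[OF _ vvmf_matrix_apply[OF p_intertwines V]] by (simp add: a0 f_def[abs_def])
  have pV: "p *v V \<tau> = f \<tau> *s axis 1 1" for \<tau> unfolding f_def by (rule vec_1_axis)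
  have "\<exists>g h. sform (k - 4) g \<and> sform (k - 6) h \<and> f = (\<lambda>\<tau>. E4 \<tau> * g \<tau> + E6 \<tau> * h \<tau>)"
  proof (cases "k = 0")
    case True
    have f0: "f \<tau> = cusp_value f" if "\<tau> \<in> \<H>" for \<tau> using sform_weight_0[of f \<tau>] f True that by simp
    have "cusp_value f = 0"
    proof (rule ccontr)
      assume c: "cusp_value f \<noteq> 0"
      have "vvmf \<rho> 0 (\<lambda>\<tau>. (1 / cusp_value f) *s V \<tau>)" using vvmf_cmult[OF V] True by simp
      moreover have "p *v ((1 / cusp_value f) *s V \<tau>) = axis 1 1" if "\<tau> \<in> \<H>" for \<tau>
        using c by (simp add: mv_smult pV f0[OF that] vector_smult_assoc)
      ultimately show False by (rule no_lift_of_one)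
    qed
    hence "f \<tau> = 0" for \<tau> using f0 sformD(1)[OF f] by (cases "\<tau> \<in> \<H>") auto
    hence "f = (\<lambda>\<tau>. E4 \<tau> * 0 + E6 \<tau> * 0)" by auto
    thus ?thesis using sform_zero by blast
  qed (rule sform_E4_E6_combination[OF f])
  then obtain g h where gh: "sform (k - 4) g" "sform (k - 6) h" "f = (\<lambda>\<tau>. E4 \<tau> * g \<tau> + E6 \<tau> * h \<tau>)" by blast
  define W where "W = (\<lambda>\<tau>. V \<tau> - (g \<tau> *s F4 \<tau> + h \<tau> *s F6 \<tau>))"
  have W: "vvmf \<rho> k W"
    unfolding W_def using vvmf_smult[OF gh(1) F4] vvmf_smult[OF gh(2) F6] by (intro vvmf_diff V vvmf_add) simp_all
  have "p *v W \<tau> = 0" if "\<tau> \<in> \<H>" for \<tau>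
    unfolding W_def mv_diff mv_add mv_smult pV p4[OF that] p6[OF that] gh(3)
    by (simp add: vec_eq_iff algebra_simps)
  from kernel_form[OF W this] obtain H where H: "vvmf \<rho>0 k H" "W = (\<lambda>\<tau>. \<iota> *v H \<tau>)" by blast
  from forms0_exist[OF H(1)] obtain u w where uw: "sform (k - 8) u \<and> sform (k - 10) w \<and> H = (\<lambda>\<tau>. u \<tau> *s B0 \<tau> + w \<tau> *s B1 \<tau>)"
    by (elim exE)
  have "V \<tau> = g \<tau> *s F4 \<tau> + h \<tau> *s F6 \<tau> + (u \<tau> *s (\<iota> *v B0 \<tau>) + w \<tau> *s (\<iota> *v B1 \<tau>))" for \<tau>
  proof -
    have "W \<tau> = \<iota> *v (u \<tau> *s B0 \<tau> + w \<tau> *s B1 \<tau>)" using H(2) uw by metis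
    also have "\<dots> = u \<tau> *s (\<iota> *v B0 \<tau>) + w \<tau> *s (\<iota> *v B1 \<tau>)"
      by (simp only: mv_add mv_smult)
    finally show ?thesis unfolding W_def by (metis diff_add_cancel add.commute)
  qed
  hence "V = (\<lambda>\<tau>. g \<tau> *s F4 \<tau> + h \<tau> *s F6 \<tau> + (u \<tau> *s (\<iota> *v B0 \<tau>) + w \<tau> *s (\<iota> *v B1 \<tau>)))" by (rule ext)
  thus ?thesis using gh(1,2) uw sform_in_ring by blast
qed

lemma generating_weights: "has_generating_weights \<rho> [4, 6, 8]"
proof -
  obtain F4 F6 c where "vvmf \<rho> 4 F4 \<and> vvmf \<rho> 6 F6 \<and> c \<noteq> 0 \<and>
    (\<forall>\<tau>\<in>\<H>. p *v F4 \<tau> = E4 \<tau> *s axis 1 1) \<and> (\<forall>\<tau>\<in>\<H>. p *v F6 \<tau> = E6 \<tau> *s axis 1 1) \<and>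
    (\<forall>\<tau>. E4 \<tau> *s F6 \<tau> - E6 \<tau> *s F4 \<tau> = c *s (\<iota> *v B1 \<tau>))"
    using low_weight_forms by (elim exE)
  hence F4: "vvmf \<rho> 4 F4" and F6: "vvmf \<rho> 6 F6" and c: "c \<noteq> 0"
    and p4: "\<And>\<tau>. \<tau> \<in> \<H> \<Longrightarrow> p *v F4 \<tau> = E4 \<tau> *s axis 1 1" and p6: "\<And>\<tau>. \<tau> \<in> \<H> \<Longrightarrow> p *v F6 \<tau> = E6 \<tau> *s axis 1 1"
    and rel: "\<And>\<tau>. E4 \<tau> *s F6 \<tau> - E6 \<tau> *s F4 \<tau> = c *s (\<iota> *v B1 \<tau>)" by blast+
  have I0: "vvmf \<rho> 8 (\<lambda>\<tau>. \<iota> *v B0 \<tau>)" using vvmf_\<iota>[OF vvmf_B0] k8 by metis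
  have E4r: "E4 \<in> eisenstein_ring" and E6r: "E6 \<in> eisenstein_ring" by (rule eisenstein_ring.E4 eisenstein_ring.E6)+
  define S where "S = {V. \<exists>g h u. g \<in> eisenstein_ring \<and> h \<in> eisenstein_ring \<and> u \<in> eisenstein_ring \<and>
    V = (\<lambda>\<tau>. g \<tau> *s F4 \<tau> + h \<tau> *s F6 \<tau> + u \<tau> *s (\<iota> *v B0 \<tau>))}"
  have S_form: "V \<in> S" if V: "vvmf \<rho> k V" for V k
  proof -
    from form_components[OF p4 p6 F4 F6 V] obtain g h u w where r: "g \<in> eisenstein_ring" "h \<in> eisenstein_ring" "u \<in> eisenstein_ring" "w \<in> eisenstein_ring"
      and eq: "V = (\<lambda>\<tau>. g \<tau> *s F4 \<tau> + h \<tau> *s F6 \<tau> + (u \<tau> *s (\<iota> *v B0 \<tau>) + w \<tau> *s (\<iota> *v B1 \<tau>)))" by blast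
    \<comment> \<open>B1 is eliminated by the relation between F4 and F6.\<close>
    have "V \<tau> = (g \<tau> - (1 / c) * (w \<tau> * E6 \<tau>)) *s F4 \<tau> + (h \<tau> + (1 / c) * (w \<tau> * E4 \<tau>)) *s F6 \<tau> + u \<tau> *s (\<iota> *v B0 \<tau>)" for \<tau>
    proof -
      have "\<iota> *v B1 \<tau> = (1 / c) *s (c *s (\<iota> *v B1 \<tau>))" using c by (simp add: vector_smult_assoc)
      also have "\<dots> = (1 / c) *s (E4 \<tau> *s F6 \<tau> - E6 \<tau> *s F4 \<tau>)" by (simp only: rel)
      finally have i: "\<iota> *v B1 \<tau> = (1 / c) *s (E4 \<tau> *s F6 \<tau> - E6 \<tau> *s F4 \<tau>)" .
      show ?thesis unfolding fun_cong[OF eq] i by (simp add: vec_eq_iff algebra_simps)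
    qed
    hence "V = (\<lambda>\<tau>. (g \<tau> - (1 / c) * (w \<tau> * E6 \<tau>)) *s F4 \<tau> + (h \<tau> + (1 / c) * (w \<tau> * E4 \<tau>)) *s F6 \<tau> + u \<tau> *s (\<iota> *v B0 \<tau>))"
      by (rule ext)
    moreover have "(\<lambda>\<tau>. g \<tau> - (1 / c) * (w \<tau> * E6 \<tau>)) \<in> eisenstein_ring" "(\<lambda>\<tau>. h \<tau> + (1 / c) * (w \<tau> * E4 \<tau>)) \<in> eisenstein_ring"
      by (rule eisenstein_ring_diff[OF r(1) eisenstein_ring_cmult[OF eisenstein_ring.mult[OF r(4) E6r]]]
          eisenstein_ring.add[OF r(2) eisenstein_ring_cmult[OF eisenstein_ring.mult[OF r(4) E4r]]])+
    ultimately show ?thesis unfolding S_def using r(3) by blast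
  qed
  have S_zero: "(\<lambda>_. 0) \<in> S" by (rule S_form[OF vvmf_zero])
  have S_add: "(\<lambda>\<tau>. V \<tau> + W \<tau>) \<in> S" if "V \<in> S" "W \<in> S" for V W
  proof -
    obtain g h u where 1: "g \<in> eisenstein_ring" "h \<in> eisenstein_ring" "u \<in> eisenstein_ring"
      "V = (\<lambda>\<tau>. g \<tau> *s F4 \<tau> + h \<tau> *s F6 \<tau> + u \<tau> *s (\<iota> *v B0 \<tau>))" using \<open>V \<in> S\<close> unfolding S_def by blast
    obtain g' h' u' where 2: "g' \<in> eisenstein_ring" "h' \<in> eisenstein_ring" "u' \<in> eisenstein_ring"
      "W = (\<lambda>\<tau>. g' \<tau> *s F4 \<tau> + h' \<tau> *s F6 \<tau> + u' \<tau> *s (\<iota> *v B0 \<tau>))" using \<open>W \<in> S\<close> unfolding S_def by blast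
    have "(\<lambda>\<tau>. V \<tau> + W \<tau>) = (\<lambda>\<tau>. (g \<tau> + g' \<tau>) *s F4 \<tau> + (h \<tau> + h' \<tau>) *s F6 \<tau> + (u \<tau> + u' \<tau>) *s (\<iota> *v B0 \<tau>))"
      unfolding 1(4) 2(4) by (simp add: fun_eq_iff vec_eq_iff algebra_simps)
    thus ?thesis unfolding S_def using eisenstein_ring.add[OF 1(1) 2(1)] eisenstein_ring.add[OF 1(2) 2(2)] eisenstein_ring.add[OF 1(3) 2(3)]
      by blast
  qed
  have S_module: "V \<in> S" if V: "V \<in> modular_form_module \<rho>" for V
  proof -
    obtain K F where F: "V = (\<lambda>\<tau>. \<Sum>k\<in>K. F k \<tau>)" "finite K" "\<And>k. k \<in> K \<Longrightarrow> F k \<in> modular_forms \<rho> k"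
      using V by (auto simp: modular_form_module_def)
    have "(\<lambda>\<tau>. \<Sum>k\<in>K. F k \<tau>) \<in> S" using F(2,3)
    proof (induction K rule: finite_induct)
      case empty
      show ?case using S_zero by simp
    next
      case (insert k K)
      have "F k \<in> S" using insert.prems[of k] by (intro S_form[of k]) (simp add: forms)
      moreover have "(\<lambda>\<tau>. \<Sum>k\<in>K. F k \<tau>) \<in> S" using insert by blast
      ultimately have "(\<lambda>\<tau>. F k \<tau> + (\<Sum>k\<in>K. F k \<tau>)) \<in> S" by (rule S_add)
      thus ?case using insert.hyps by simp
    qed
    thus ?thesis by (simp add: F(1))
  qed
  have unique: "g = (\<lambda>_. 0) \<and> h = (\<lambda>_. 0) \<and> u = (\<lambda>_. 0)"
    if r: "g \<in> eisenstein_ring" "h \<in> eisenstein_ring" "u \<in> eisenstein_ring"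
      and 0: "\<And>\<tau>. g \<tau> *s F4 \<tau> + h \<tau> *s F6 \<tau> + u \<tau> *s (\<iota> *v B0 \<tau>) = 0" for g h u
  proof -
    have e: "E4 \<tau> * g \<tau> + E6 \<tau> * h \<tau> = 0" for \<tau>
    proof (cases "\<tau> \<in> \<H>")
      case True
      have "p *v (g \<tau> *s F4 \<tau> + h \<tau> *s F6 \<tau> + u \<tau> *s (\<iota> *v B0 \<tau>)) = 0" by (simp add: 0)
      hence "(p *v (g \<tau> *s F4 \<tau> + h \<tau> *s F6 \<tau> + u \<tau> *s (\<iota> *v B0 \<tau>))) $ 1 = 0" by simp
      thus ?thesis by (simp add: mv_add mv_smult p4[OF True] p6[OF True] p_\<iota> mult.commute)
    qed (simp add: eisenstein_ring_off[OF r(1)] eisenstein_ring_off[OF r(2)])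
    \<comment> \<open>Multiplying the relation by E6 and replacing E6 h by -E4 g turns its F4 and F6
      part into a multiple of B1, so independence of B0 and B1 applies.\<close>
    have "(u \<tau> * E6 \<tau>) *s B0 \<tau> + (- c * g \<tau>) *s B1 \<tau> = 0" for \<tau>
    proof -
      have h: "E6 \<tau> * h \<tau> = - (E4 \<tau> * g \<tau>)" using e[of \<tau>] by (simp add: eq_neg_iff_add_eq_0 add.commute)
      have "E6 \<tau> *s (g \<tau> *s F4 \<tau> + h \<tau> *s F6 \<tau> + u \<tau> *s (\<iota> *v B0 \<tau>)) =
          (E6 \<tau> * h \<tau>) *s F6 \<tau> + (E6 \<tau> * g \<tau>) *s F4 \<tau> + (u \<tau> * E6 \<tau>) *s (\<iota> *v B0 \<tau>)"
        by (simp add: vec_eq_iff algebra_simps)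
      also have "\<dots> = (u \<tau> * E6 \<tau>) *s (\<iota> *v B0 \<tau>) - g \<tau> *s (E4 \<tau> *s F6 \<tau> - E6 \<tau> *s F4 \<tau>)"
        unfolding h by (simp add: vec_eq_iff algebra_simps)
      also have "\<dots> = \<iota> *v ((u \<tau> * E6 \<tau>) *s B0 \<tau> + (- c * g \<tau>) *s B1 \<tau>)"
        unfolding rel mv_add mv_smult by (simp only: vec_eq_iff) (simp del: One_nat_def add: algebra_simps)
      finally have "\<iota> *v ((u \<tau> * E6 \<tau>) *s B0 \<tau> + (- c * g \<tau>) *s B1 \<tau>) = \<iota> *v 0" by (simp del: One_nat_def add: 0)
      thus ?thesis by (rule \<iota>_cancel)
    qed
    note z = gens_unique[OF eisenstein_ring.mult[OF r(3) E6r] eisenstein_ring_cmult[OF r(1), of "- c"] this]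
    have g0: "g = (\<lambda>_. 0)" using z(2) c by (auto simp: fun_eq_iff)
    have u0: "u = (\<lambda>_. 0)" by (rule mult_E6_eq_zero[OF r(3)]) (use z(1) in metis)
    have "h = (\<lambda>_. 0)" by (rule mult_E6_eq_zero[OF r(2)]) (use e g0 in \<open>simp add: mult.commute\<close>)
    thus ?thesis using g0 u0 by blast
  qed
  define Bw where "Bw i = (if i = 0 then F4 else if i = 1 then F6 else (\<lambda>\<tau>. \<iota> *v B0 \<tau>))" for i :: nat
  have sum3: "(\<Sum>i<length [4, 6, 8 :: int]. f i) = f 0 + f 1 + f 2" for f :: "nat \<Rightarrow> complex^3"
    by (simp add: numeral_2_eq_2)
  have len: "{..<length [4, 6, 8 :: int]} = {0, 1, 2}" by auto
  have sumB: "(\<Sum>i<length [4, 6, 8 :: int]. f i \<tau> *s Bw i \<tau>) = f 0 \<tau> *s F4 \<tau> + f 1 \<tau> *s F6 \<tau> + f 2 \<tau> *s (\<iota> *v B0 \<tau>)" for f \<tau>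
    unfolding sum3 by (simp add: Bw_def)
  let ?rep = "\<lambda>V f. f \<in> {..<length [4, 6, 8 :: int]} \<rightarrow>\<^sub>E eisenstein_ring \<and> V = (\<lambda>\<tau>. \<Sum>i<length [4, 6, 8 :: int]. f i \<tau> *s Bw i \<tau>)"
  have "\<exists>!f. ?rep V f"
    if V: "V \<in> modular_form_module \<rho>" for V
  proof (rule ex_ex1I)
    obtain g h u where 1: "g \<in> eisenstein_ring" "h \<in> eisenstein_ring" "u \<in> eisenstein_ring"
      "V = (\<lambda>\<tau>. g \<tau> *s F4 \<tau> + h \<tau> *s F6 \<tau> + u \<tau> *s (\<iota> *v B0 \<tau>))" using S_module[OF V] unfolding S_def by blast
    define f where "f = (\<lambda>i\<in>{..<length [4, 6, 8 :: int]}. if i = 0 then g else if i = 1 then h else u)"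
    have "f \<in> {..<length [4, 6, 8 :: int]} \<rightarrow>\<^sub>E eisenstein_ring" using 1(1-3) by (auto simp: f_def)
    moreover have "V = (\<lambda>\<tau>. \<Sum>i<length [4, 6, 8 :: int]. f i \<tau> *s Bw i \<tau>)"
      unfolding sumB 1(4) by (simp add: f_def)
    ultimately show "\<exists>f. ?rep V f"
      by blast
  next
    fix f f'
    assume f: "?rep V f"
      and f': "?rep V f'"
    have mem: "f i \<in> eisenstein_ring" "f' i \<in> eisenstein_ring" if "i \<in> {0, 1, 2}" for i
      using PiE_mem[OF conjunct1[OF f], of i] PiE_mem[OF conjunct1[OF f'], of i] that unfolding len by simp_all
    have "(\<lambda>\<tau>. \<Sum>i<length [4, 6, 8 :: int]. f i \<tau> *s Bw i \<tau>) = (\<lambda>\<tau>. \<Sum>i<length [4, 6, 8 :: int]. f' i \<tau> *s Bw i \<tau>)"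
      by (rule trans[OF conjunct2[OF f, symmetric] conjunct2[OF f']])
    hence "(\<Sum>i<length [4, 6, 8 :: int]. f i \<tau> *s Bw i \<tau>) = (\<Sum>i<length [4, 6, 8 :: int]. f' i \<tau> *s Bw i \<tau>)" for \<tau>
      by (rule fun_cong)
    hence "(f 0 \<tau> - f' 0 \<tau>) *s F4 \<tau> + (f 1 \<tau> - f' 1 \<tau>) *s F6 \<tau> + (f 2 \<tau> - f' 2 \<tau>) *s (\<iota> *v B0 \<tau>) = 0" for \<tau>
      unfolding sumB by (simp del: One_nat_def add: vec_eq_iff algebra_simps)
    note z = unique[OF eisenstein_ring_diff eisenstein_ring_diff eisenstein_ring_diff this]
    have "(\<lambda>\<tau>. f 0 \<tau> - f' 0 \<tau>) = (\<lambda>_. 0) \<and> (\<lambda>\<tau>. f 1 \<tau> - f' 1 \<tau>) = (\<lambda>_. 0) \<and> (\<lambda>\<tau>. f 2 \<tau> - f' 2 \<tau>) = (\<lambda>_. 0)"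
      by (rule z) (rule mem; simp)+
    hence "f 0 = f' 0 \<and> f 1 = f' 1 \<and> f 2 = f' 2" by (simp del: One_nat_def add: fun_eq_iff)
    hence "f i = f' i" if "i \<in> {..<length [4, 6, 8 :: int]}" for i using that unfolding len by auto
    thus "f = f'" by (rule PiE_ext[OF conjunct1[OF f] conjunct1[OF f']])
  qed
  moreover have "\<forall>i<length [4, 6, 8 :: int]. Bw i \<in> modular_forms \<rho> ([4, 6, 8] ! i)"
    using F4 F6 I0 by (auto simp: less_Suc_eq Bw_def forms)
  ultimately show ?thesis unfolding has_generating_weights_def by blast
qed

end

theorem theorem4p2:
  fixes \<rho>\<^sub>0 :: "int^2^2 \<Rightarrow> complex^2^2"
    and \<rho> :: "int^2^2 \<Rightarrow> complex^3^3"
    and \<chi>2a :: "int^2^2 \<Rightarrow> complex^1^1"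
    and \<iota> :: "complex^2^3" and p :: "complex^3^1"
    and k\<^sub>1 k\<^sub>2 :: int and a :: nat
  assumes "psl2_rep \<rho>\<^sub>0" and "irreducible_rep \<rho>\<^sub>0"
    and "has_generating_weights \<rho>\<^sub>0 [k\<^sub>1, k\<^sub>2]"
    and "k\<^sub>1 \<le> k\<^sub>2" and "k\<^sub>1 \<in> {0..11}" and "k\<^sub>2 \<in> {0..11}"
    and "psl2_rep \<rho>" and "indecomposable_rep \<rho>"
    and "diagonalizable_matrix (\<rho> T_mat)"
    and "a \<in> {0..5}" and "is_chi_power (2 * a) \<chi>2a"
    and "short_exact_reps \<rho>\<^sub>0 \<iota> \<rho> p \<chi>2a"
  shows "((k\<^sub>1, k\<^sub>2) \<noteq> (8, 10) \<or> ((k\<^sub>1, k\<^sub>2) = (8, 10) \<and> a = 3) \<longrightarrow> M_split \<rho> p \<chi>2a) \<and>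
         ((k\<^sub>1, k\<^sub>2) = (8, 10) \<and> a = 0 \<longrightarrow>
            \<not> M_split \<rho> p \<chi>2a \<and> has_generating_weights \<rho> [4, 6, 8])"
proof -
  have ext: "extension \<rho>\<^sub>0 \<rho> \<chi>2a \<iota> p k\<^sub>1 k\<^sub>2 a"
    using assms by (intro extension.intro)
  then interpret extension \<rho>\<^sub>0 \<rho> \<chi>2a \<iota> p k\<^sub>1 k\<^sub>2 a .
  have a5: "a \<le> 5" using assms(10) by simp
  show ?thesis
  proof (intro conjI impI)
    assume "(k\<^sub>1, k\<^sub>2) \<noteq> (8, 10) \<or> (k\<^sub>1, k\<^sub>2) = (8, 10) \<and> a = 3"
    hence "(k\<^sub>1, k\<^sub>2) \<noteq> (8, 10) \<or> a = 3" by blast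
    thus "M_split \<rho> p \<chi>2a" using lift_exists[OF a5] M_split_of_lift[OF a5] by blast
  next
    assume e: "(k\<^sub>1, k\<^sub>2) = (8, 10) \<and> a = 0"
    have ex: "exceptional_extension \<rho>\<^sub>0 \<rho> \<chi>2a \<iota> p k\<^sub>1 k\<^sub>2 a"
      by (rule exceptional_extension.intro[OF ext]) (rule exceptional_extension_axioms.intro; use e in simp)
    show "\<not> M_split \<rho> p \<chi>2a" by (rule exceptional_extension.not_M_split[OF ex])
    show "has_generating_weights \<rho> [4, 6, 8]" by (rule exceptional_extension.generating_weights[OF ex])
  qed
qed

end
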